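(* Let $\alpha\in(0,\pi/2)$ be a constant, $a=\sin\alpha$, $b=\cos\alpha$, and let $\gamma_T(s)=(\cos(s-\alpha),\sin(s-\alpha))$ and $\gamma_R(s)=(\cos(s+\alpha),\sin(s+\alpha))$, $s\in[0,2\pi]$, be the trajectories of the emitter and the receiver respectively. Let $\mathrm{D}_b=\{x\in\mathbb{R}^2: |x|<b\}$ and let $\mathcal{E}'(\mathrm{D}_b)$ be the space of compactly supported distributions supported in $\mathrm{D}_b$. Let $\mathcal{R}$ be the elliptical Radon transform, restricted to the domain $\mathcal{E}'(\mathrm{D}_b)$. Then: (1) $\mathcal{R}$ satisfies the microlocal (double fibration) conditions (i)--(v) listed in the context, with $X=\mathrm{D}_b$, $Y=\{(s,L): s\in[0,2\pi],\ L>2a\}$ and $Z=\{(s,L,x)\in Y\times \mathrm{D}_b : x\in E(s,L)\}$. (2) $\mathcal{R}$ is an elliptic Fourier integral operator of order $-1/2$. (3) The canonical relation $\mathcal{C}\subset T^*(Y)\times T^*(\mathrm{D}_b)$ associated to $\mathcal{R}$ satisfies the Bolker Assumption, i.e. the natural projection $\Pi_Y:\mathcal{C}\to T^*(Y)$ is an injective immersion.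
   Context: Parameter set: $Y=\{(s,L): s\in[0,2\pi],\ L>2a\}$, where $[0,2\pi]$ is viewed as the unit circle (the endpoints $0$ and $2\pi$ are identified). Ellipses: for $(s,L)\in Y$, $E(s,L)=\{x\in\mathbb{R}^2 : |x-\gamma_T(s)|+|x-\gamma_R(s)|=L\}$. Elliptical Radon transform: for a locally integrable function $f$, $\mathcal{R}f(s,L)=\int_{x\in E(s,L)}f(x)\,dl(x)$, where $dl$ is the arc length measure on $E(s,L)$; it is extended to distributions in $\mathcal{E}'(\mathrm{D}_b)$. Its dual (backprojection) transform is $\mathcal{R}^*g(x)=\int_{s\in[0,2\pi]}g(s,|x-\gamma_R(s)|+|x-\gamma_T(s)|)\,ds$, where the positive smooth measure $ds$ is chosen so that $\mathcal{R}^*$ is the $L^2$ adjoint of $\mathcal{R}$. Double fibration conditions: let $\pi_L:Z\to Y$ and $\pi_R:Z\to X$ be the natural projections. (i) $X$ and $Y$ are smooth connected manifolds of the same dimension, and $Z\subset Y\times X$ is a smooth connected submanifold of codimension $k<\dim(X)$. (ii) $\pi_L:Z\to Y$ and $\pi_R:Z\to X$ are both fiber maps (fibrations). (iii) $\pi_R$ is a proper map, that is, its fibers are compact. (iv) For $y_1,y_2\in Y$, $\pi_R(\pi_L^{-1}(\{y_1\}))=\pi_R(\pi_L^{-1}(\{y_2\}))$ if and only if $y_1=y_2$; and for $x_1,x_2\in X$, $\pi_L(\pi_R^{-1}(\{x_1\}))=\pi_L(\pi_R^{-1}(\{x_2\}))$ if and only if $x_1=x_2$. (v) The transform integrates over the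 sets $\pi_R(\pi_L^{-1}(\{y\}))$, $y\in Y$, and the dual transform integrates over the sets $\pi_L(\pi_R^{-1}(\{x\}))$, $x\in X$, with respect to smooth nowhere zero measures (arising from smooth nowhere zero measures on $Z$, $X$ and $Y$). Canonical relation: $\mathcal{C}=(N^*(Z)\setminus\{0\})'$, where $N^*(Z)\subset T^*(Y)\times T^*(\mathrm{D}_b)$ is the conormal bundle of $Z$, $N^*(Z)\setminus\{0\}$ is the conormal bundle with its zero section removed, and for $\mathcal{A}\subset T^*(Y)\times T^*(X)$, $\mathcal{A}'=\{(y,\eta,x,\xi) : (y,\eta,x,-\xi)\in\mathcal{A}\}$. $\Pi_Y$ is the natural projection from $\mathcal{C}$ to the $T^*(Y)$ factor.
   Formalization: In (1), the fibration condition on π_L and the first half of (iv) are stated only for those (s,L) in Y whose ellipse E(s,L) meets D_b, since for large L the ellipse misses D_b and both fail on all of Y; (i), (v), (2) and (3) are also proved for the full Y. *)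

theory Defs
  imports "HOL-Analysis.Analysis"
begin

section \<open>Smooth maps, submanifolds and bundles in Euclidean spaces\<close>

text \<open>Manifolds are embedded submanifolds of Euclidean spaces, presented as locally diffeomorphic
  to open subsets of a coordinate subspace; a map on an arbitrary subset of a Euclidean space is
  smooth if locally it is the restriction of a smooth map on an open set.\<close>

primrec Ck_on :: "nat \<Rightarrow> 'a::real_normed_vector set \<Rightarrow> ('a \<Rightarrow> 'b::real_normed_vector) \<Rightarrow> bool" where
  "Ck_on 0 S f \<longleftrightarrow> continuous_on S f"
| "Ck_on (Suc k) S f \<longleftrightarrow> (\<forall>x\<in>S. f differentiable (at x)) \<and>
     (\<forall>v. Ck_on k S (\<lambda>x. frechet_derivative f (at x) v))"

text \<open>Meant for open \<open>S\<close> only.\<close>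

definition smooth_open :: "'a::real_normed_vector set \<Rightarrow> ('a \<Rightarrow> 'b::real_normed_vector) \<Rightarrow> bool" where
  "smooth_open S f \<longleftrightarrow> (\<forall>k. Ck_on k S f)"

primrec dir_derivs :: "'a list \<Rightarrow> ('a::real_normed_vector \<Rightarrow> 'b::real_normed_vector) \<Rightarrow> 'a \<Rightarrow> 'b" where
  "dir_derivs [] f = f"
| "dir_derivs (v # vs) f = (\<lambda>x. frechet_derivative (dir_derivs vs f) (at x) v)"

definition smooth_map_on :: "'a::real_normed_vector set \<Rightarrow> ('a \<Rightarrow> 'b::real_normed_vector) \<Rightarrow> bool" where
  "smooth_map_on A f \<longleftrightarrow>
     (\<forall>p\<in>A. \<exists>U F. open U \<and> p \<in> U \<and> smooth_open U F \<and> (\<forall>q\<in>A \<inter> U. F q = f q))"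

definition diffeo ::
  "'a::real_normed_vector set \<Rightarrow> 'b::real_normed_vector set \<Rightarrow> ('a \<Rightarrow> 'b) \<Rightarrow> ('b \<Rightarrow> 'a) \<Rightarrow> bool" where
  "diffeo A B f g \<longleftrightarrow>
     smooth_map_on A f \<and> smooth_map_on B g \<and> f ` A = B \<and> (\<forall>x\<in>A. g (f x) = x)"

text \<open>For \<open>I \<subseteq> Basis\<close>, the subspace \<open>span I\<close> serves as a copy of the \<open>card I\<close>-dimensional
  coordinate space.\<close>

definition local_param ::
  "'a::euclidean_space set \<Rightarrow> 'a set \<Rightarrow> ('a \<Rightarrow> 'a) \<Rightarrow> 'a set \<Rightarrow> 'a \<Rightarrow> bool" where
  "local_param I A \<psi> M p \<longleftrightarrow> I \<subseteq> Basis \<and> openin (top_of_set (span I)) A \<and>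
     openin (top_of_set M) (\<psi> ` A) \<and> p \<in> \<psi> ` A \<and> (\<exists>h. diffeo A (\<psi> ` A) \<psi> h)"

definition smooth_submanifold :: "nat \<Rightarrow> 'a::euclidean_space set \<Rightarrow> bool" where
  "smooth_submanifold d M \<longleftrightarrow> (\<forall>p\<in>M. \<exists>I A \<psi>. card I = d \<and> local_param I A \<psi> M p)"

definition smooth_curve_at :: "'a::euclidean_space set \<Rightarrow> 'a \<Rightarrow> (real \<Rightarrow> 'a) \<Rightarrow> bool" where
  "smooth_curve_at M p c \<longleftrightarrow>
     (\<exists>\<epsilon>>0. smooth_open {-\<epsilon><..<\<epsilon>} c \<and> c ` {-\<epsilon><..<\<epsilon>} \<subseteq> M) \<and> c 0 = p"

definition tangent_space :: "'a::euclidean_space set \<Rightarrow> 'a \<Rightarrow> 'a set" where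
  "tangent_space M p = {v. \<exists>c. smooth_curve_at M p c \<and> (c has_vector_derivative v) (at 0)}"

text \<open>Covectors at \<open>p \<in> M\<close> are identified with elements of \<open>tangent_space M p\<close> through the inner
  product of the ambient space. Under this identification the canonical one-form of the cotangent
  bundle of \<open>M\<close> is the restriction of the one of the ambient space.\<close>

definition cotangent_bundle :: "'a::euclidean_space set \<Rightarrow> ('a \<times> 'a) set" where
  "cotangent_bundle M = {(p, \<zeta>). p \<in> M \<and> \<zeta> \<in> tangent_space M p}"

definition conormal_bundle :: "'a::euclidean_space set \<Rightarrow> 'a set \<Rightarrow> ('a \<times> 'a) set" where
  "conormal_bundle M Z =
     {(p, \<zeta>). p \<in> Z \<and> \<zeta> \<in> tangent_space M p \<and> (\<forall>v\<in>tangent_space Z p. \<zeta> \<bullet> v = 0)}"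

definition immersion_on ::
  "'a::euclidean_space set \<Rightarrow> ('a \<Rightarrow> 'b::euclidean_space) \<Rightarrow> bool" where
  "immersion_on M f \<longleftrightarrow> smooth_map_on M f \<and>
     (\<forall>p\<in>M. \<forall>c. smooth_curve_at M p c \<and> ((f \<circ> c) has_vector_derivative 0) (at 0) \<longrightarrow>
        (c has_vector_derivative 0) (at 0))"

definition injective_immersion ::
  "'a::euclidean_space set \<Rightarrow> 'b::euclidean_space set \<Rightarrow> ('a \<Rightarrow> 'b) \<Rightarrow> bool" where
  "injective_immersion M N f \<longleftrightarrow> (\<exists>d. smooth_submanifold d M) \<and> (\<exists>d. smooth_submanifold d N) \<and>
     f ` M \<subseteq> N \<and> inj_on f M \<and> immersion_on M f"

text \<open>Smooth locally trivial fibre bundle projection of \<open>Z\<close> onto \<open>B\<close>.\<close>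

definition fiber_map ::
  "('a::euclidean_space \<Rightarrow> 'b::euclidean_space) \<Rightarrow> 'a set \<Rightarrow> 'b set \<Rightarrow> bool" where
  "fiber_map \<pi> Z B \<longleftrightarrow> \<pi> ` Z = B \<and> smooth_map_on Z \<pi> \<and>
     (\<forall>b\<in>B. \<exists>U h k. openin (top_of_set B) U \<and> b \<in> U \<and>
        diffeo (Z \<inter> \<pi> -` U) (U \<times> (Z \<inter> \<pi> -` {b})) h k \<and>
        (\<forall>z \<in> Z \<inter> \<pi> -` U. fst (h z) = \<pi> z))"

text \<open>Lebesgue measure on \<open>span I\<close>, normalized as \<^const>\<open>lborel\<close> is on the whole space.\<close>

definition coord_lborel :: "'a::euclidean_space set \<Rightarrow> 'a measure" where
  "coord_lborel I = distr (Pi\<^sub>M I (\<lambda>_. lborel)) borel (\<lambda>c. \<Sum>b\<in>I. c b *\<^sub>R b)"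

definition smooth_measure :: "'a::euclidean_space set \<Rightarrow> 'a measure \<Rightarrow> bool" where
  "smooth_measure M \<mu> \<longleftrightarrow> M \<in> sets borel \<and> sets \<mu> = sets borel \<and> emeasure \<mu> (- M) = 0 \<and>
     (\<forall>p\<in>M. \<exists>I A \<psi> (\<rho> :: 'a \<Rightarrow> real).
        local_param I A \<psi> M p \<and> smooth_map_on A \<rho> \<and> (\<forall>u\<in>A. \<rho> u > 0) \<and>
        (\<forall>B\<in>sets borel. B \<subseteq> A \<longrightarrow>
           emeasure \<mu> (\<psi> ` B) = (\<integral>\<^sup>+u\<in>B. ennreal (\<rho> u) \<partial>coord_lborel I)))"


section \<open>Double fibration conditions\<close>

text \<open>The projections of \<open>Z \<subseteq> Y \<times> X\<close> are \<^const>\<open>fst\<close> (to \<open>Y\<close>) and \<^const>\<open>snd\<close> (to \<open>X\<close>).\<close>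

definition Y_fiber :: "('y \<times> 'x) set \<Rightarrow> 'y \<Rightarrow> 'x set" where
  "Y_fiber Z y = snd ` (Z \<inter> fst -` {y})"

definition X_fiber :: "('y \<times> 'x) set \<Rightarrow> 'x \<Rightarrow> 'y set" where
  "X_fiber Z x = fst ` (Z \<inter> snd -` {x})"

definition df_manifolds ::
  "'x::euclidean_space set \<Rightarrow> 'y::euclidean_space set \<Rightarrow> ('y \<times> 'x) set \<Rightarrow> bool" where
  "df_manifolds X Y Z \<longleftrightarrow> (\<exists>n k. k < n \<and>
     smooth_submanifold n X \<and> connected X \<and> smooth_submanifold n Y \<and> connected Y \<and>
     Z \<subseteq> Y \<times> X \<and> smooth_submanifold (2 * n - k) Z \<and> connected Z)"

definition df_fibrations ::
  "'x::euclidean_space set \<Rightarrow> 'y::euclidean_space set \<Rightarrow> ('y \<times> 'x) set \<Rightarrow> bool" where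
  "df_fibrations X Y Z \<longleftrightarrow> fiber_map fst Z Y \<and> fiber_map snd Z X"

definition df_proper ::
  "'x::euclidean_space set \<Rightarrow> ('y::euclidean_space \<times> 'x) set \<Rightarrow> bool" where
  "df_proper X Z \<longleftrightarrow> proper_map (top_of_set Z) (top_of_set X) snd"

definition df_points :: "'x set \<Rightarrow> 'y set \<Rightarrow> ('y \<times> 'x) set \<Rightarrow> bool" where
  "df_points X Y Z \<longleftrightarrow>
     (\<forall>y1\<in>Y. \<forall>y2\<in>Y. Y_fiber Z y1 = Y_fiber Z y2 \<longleftrightarrow> y1 = y2) \<and>
     (\<forall>x1\<in>X. \<forall>x2\<in>X. X_fiber Z x1 = X_fiber Z x2 \<longleftrightarrow> x1 = x2)"

definition Cc_functions :: "'a::topological_space set \<Rightarrow> ('a \<Rightarrow> 'b::real_normed_vector) set" where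
  "Cc_functions M = {f. continuous_on M f \<and> (\<exists>K. compact K \<and> K \<subseteq> M \<and> (\<forall>p. p \<notin> K \<longrightarrow> f p = 0))}"

text \<open>The last two conjuncts say how the measures on the fibres arise: they disintegrate the
  measure on \<open>Z\<close> with respect to the measures on \<open>Y\<close> and on \<open>X\<close>.\<close>

definition df_measures ::
  "'x::euclidean_space set \<Rightarrow> 'y::euclidean_space set \<Rightarrow> ('y \<times> 'x) set \<Rightarrow>
   (('x \<Rightarrow> complex) \<Rightarrow> 'y \<Rightarrow> complex) \<Rightarrow> (('y \<Rightarrow> complex) \<Rightarrow> 'x \<Rightarrow> complex) \<Rightarrow> bool" where
  "df_measures X Y Z R Rdual \<longleftrightarrow> (\<exists>\<mu>X \<mu>Y \<mu>Z m_y m_x.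
     smooth_measure X \<mu>X \<and> smooth_measure Y \<mu>Y \<and> smooth_measure Z \<mu>Z \<and>
     (\<forall>y\<in>Y. smooth_measure (Y_fiber Z y) (m_y y)) \<and>
     (\<forall>x\<in>X. smooth_measure (X_fiber Z x) (m_x x)) \<and>
     (\<forall>f\<in>Cc_functions X. \<forall>y\<in>Y. integrable (m_y y) f \<and> R f y = (\<integral>x. f x \<partial>m_y y)) \<and>
     (\<forall>g\<in>Cc_functions Y. \<forall>x\<in>X. integrable (m_x x) g \<and> Rdual g x = (\<integral>y. g y \<partial>m_x x)) \<and>
     (\<forall>h\<in>Cc_functions Z. (\<integral>z. h z \<partial>\<mu>Z) = (\<integral>y. (\<integral>x. (h (y, x) :: real) \<partial>m_y y) \<partial>\<mu>Y)) \<and>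
     (\<forall>h\<in>Cc_functions Z. (\<integral>z. h z \<partial>\<mu>Z) = (\<integral>x. (\<integral>y. (h (y, x) :: real) \<partial>m_x x) \<partial>\<mu>X)))"

definition double_fibration ::
  "'x::euclidean_space set \<Rightarrow> 'y::euclidean_space set \<Rightarrow> ('y \<times> 'x) set \<Rightarrow>
   (('x \<Rightarrow> complex) \<Rightarrow> 'y \<Rightarrow> complex) \<Rightarrow> (('y \<Rightarrow> complex) \<Rightarrow> 'x \<Rightarrow> complex) \<Rightarrow> bool" where
  "double_fibration X Y Z R Rdual \<longleftrightarrow> df_manifolds X Y Z \<and> df_fibrations X Y Z \<and>
     df_proper X Z \<and> df_points X Y Z \<and> df_measures X Y Z R Rdual"


section \<open>Distributions\<close>

text \<open>A manifold is given here by a smooth covering-like parametrization \<open>\<kappa>\<close> of it, defined on an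
  open set \<open>V\<close> of coordinates (for an open set \<open>X\<close> of a Euclidean space: the identity on \<open>X\<close>).\<close>

definition etale_param ::
  "('a::euclidean_space \<Rightarrow> 'm::euclidean_space) \<Rightarrow> 'a set \<Rightarrow> 'm set \<Rightarrow> bool" where
  "etale_param \<kappa> V Y \<longleftrightarrow> open V \<and> \<kappa> ` V = Y \<and>
     (\<forall>y\<in>V. \<exists>B h. open B \<and> y \<in> B \<and> B \<subseteq> V \<and> openin (top_of_set Y) (\<kappa> ` B) \<and> diffeo B (\<kappa> ` B) \<kappa> h)"

definition test_functions ::
  "('a::euclidean_space \<Rightarrow> 'm::euclidean_space) \<Rightarrow> 'a set \<Rightarrow> ('m \<Rightarrow> complex) set" where
  "test_functions \<kappa> V = {g. smooth_open V (g \<circ> \<kappa>) \<and>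
     (\<exists>K. compact K \<and> K \<subseteq> \<kappa> ` V \<and> (\<forall>p. p \<notin> K \<longrightarrow> g p = 0))}"

definition linear_functional :: "('m \<Rightarrow> complex) set \<Rightarrow> (('m \<Rightarrow> complex) \<Rightarrow> complex) \<Rightarrow> bool" where
  "linear_functional S u \<longleftrightarrow>
     (\<forall>f\<in>S. \<forall>g\<in>S. \<forall>c d. u (\<lambda>p. c * f p + d * g p) = c * u f + d * u g)"

definition distributions ::
  "('a::euclidean_space \<Rightarrow> 'm::euclidean_space) \<Rightarrow> 'a set \<Rightarrow> (('m \<Rightarrow> complex) \<Rightarrow> complex) set" where
  "distributions \<kappa> V = {u. linear_functional (test_functions \<kappa> V) u \<and>
     (\<forall>K. compact K \<and> K \<subseteq> \<kappa> ` V \<longrightarrow> (\<exists>k C. \<forall>g\<in>test_functions \<kappa> V. (\<forall>p. p \<notin> K \<longrightarrow> g p = 0) \<longrightarrow>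
        (\<forall>b. (\<forall>vs. set vs \<subseteq> Basis \<and> length vs \<le> k \<longrightarrow> (\<forall>z\<in>V. norm (dir_derivs vs (g \<circ> \<kappa>) z) \<le> b))
           \<longrightarrow> norm (u g) \<le> C * b)))}"

text \<open>Compactly supported distributions on the open set \<open>X\<close>, as continuous linear functionals on
  the smooth functions on \<open>X\<close>.\<close>

definition compact_distributions ::
  "'a::euclidean_space set \<Rightarrow> (('a \<Rightarrow> complex) \<Rightarrow> complex) set" where
  "compact_distributions X = {u. linear_functional {f. smooth_open X f} u \<and>
     (\<exists>K k C. compact K \<and> K \<subseteq> X \<and> (\<forall>f. smooth_open X f \<longrightarrow>
        (\<forall>b. (\<forall>vs. set vs \<subseteq> Basis \<and> length vs \<le> k \<longrightarrow> (\<forall>x\<in>K. norm (dir_derivs vs f x) \<le> b))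
           \<longrightarrow> norm (u f) \<le> C * b)))}"

definition dist_of_fun :: "('a::euclidean_space \<Rightarrow> complex) \<Rightarrow> ('a \<Rightarrow> complex) \<Rightarrow> complex" where
  "dist_of_fun f = (\<lambda>h. \<integral>x. f x * h x \<partial>lborel)"


section \<open>Oscillatory integrals\<close>

text \<open>The number \<open>N\<close> of phase variables is existentially quantified below, so a phase variable is a
  function \<open>\<theta> :: nat \<Rightarrow> real\<close> that is extensional on \<open>{..<N}\<close>. A direction of differentiation is
  \<open>Inl v\<close> (a vector \<open>v\<close> in the base variable \<open>z\<close>) or \<open>Inr j\<close> (the phase variable \<open>\<theta> j\<close>).\<close>

definition phase_space :: "nat \<Rightarrow> (nat \<Rightarrow> real) set" where
  "phase_space N = PiE {..<N} (\<lambda>_. UNIV)"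

definition phase_norm :: "nat \<Rightarrow> (nat \<Rightarrow> real) \<Rightarrow> real" where
  "phase_norm N \<theta> = L2_set \<theta> {..<N}"

definition phase_scale :: "nat \<Rightarrow> real \<Rightarrow> (nat \<Rightarrow> real) \<Rightarrow> nat \<Rightarrow> real" where
  "phase_scale N t \<theta> = (\<lambda>i\<in>{..<N}. t * \<theta> i)"

definition phase_space0 :: "nat \<Rightarrow> (nat \<Rightarrow> real) set" where
  "phase_space0 N = {\<theta>\<in>phase_space N. phase_norm N \<theta> \<noteq> 0}"

definition conic :: "nat \<Rightarrow> ('z \<times> (nat \<Rightarrow> real)) set \<Rightarrow> bool" where
  "conic N G \<longleftrightarrow> (\<forall>z \<theta> t. (z, \<theta>) \<in> G \<and> t > 0 \<longrightarrow> (z, phase_scale N t \<theta>) \<in> G)"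

definition open_cone :: "nat \<Rightarrow> 'z::euclidean_space set \<Rightarrow> ('z \<times> (nat \<Rightarrow> real)) set \<Rightarrow> bool" where
  "open_cone N U G \<longleftrightarrow> G \<subseteq> U \<times> phase_space0 N \<and> conic N G \<and>
     openin (top_of_set (UNIV \<times> phase_space N)) G"

definition along ::
  "'z::real_vector + nat \<Rightarrow> ('z \<Rightarrow> (nat \<Rightarrow> real) \<Rightarrow> 'c) \<Rightarrow> 'z \<Rightarrow> (nat \<Rightarrow> real) \<Rightarrow> real \<Rightarrow> 'c" where
  "along d F z \<theta> = (\<lambda>t. case d of Inl v \<Rightarrow> F (z + t *\<^sub>R v) \<theta> | Inr j \<Rightarrow> F z (\<theta>(j := \<theta> j + t)))"

definition pderiv_dir ::
  "'z::real_vector + nat \<Rightarrow> ('z \<Rightarrow> (nat \<Rightarrow> real) \<Rightarrow> 'c::real_normed_vector) \<Rightarrow>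
   'z \<Rightarrow> (nat \<Rightarrow> real) \<Rightarrow> 'c" where
  "pderiv_dir d F z \<theta> = vector_derivative (along d F z \<theta>) (at 0)"

definition pderivs ::
  "('z::real_vector + nat) list \<Rightarrow> ('z \<Rightarrow> (nat \<Rightarrow> real) \<Rightarrow> 'c::real_normed_vector) \<Rightarrow>
   'z \<Rightarrow> (nat \<Rightarrow> real) \<Rightarrow> 'c" where
  "pderivs ds F = foldr pderiv_dir ds F"

definition directions :: "nat \<Rightarrow> ('z::euclidean_space + nat) set" where
  "directions N = Inl ` Basis \<union> Inr ` {..<N}"

text \<open>All iterated partial derivatives exist and are continuous; \<open>G\<close> is open in \<open>z\<close> and \<open>\<theta>\<close>.\<close>

definition smooth_phase_on ::
  "nat \<Rightarrow> ('z::euclidean_space \<times> (nat \<Rightarrow> real)) set \<Rightarrow>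
   ('z \<Rightarrow> (nat \<Rightarrow> real) \<Rightarrow> 'c::real_normed_vector) \<Rightarrow> bool" where
  "smooth_phase_on N G F \<longleftrightarrow> (\<forall>ds. set ds \<subseteq> directions N \<longrightarrow>
     continuous_on G (\<lambda>(z, \<theta>). pderivs ds F z \<theta>) \<and>
     (\<forall>d\<in>directions N. \<forall>(z, \<theta>)\<in>G. along d (pderivs ds F) z \<theta> differentiable (at 0)))"

definition phase_function ::
  "nat \<Rightarrow> (('y::euclidean_space \<times> 'x::euclidean_space) \<times> (nat \<Rightarrow> real)) set \<Rightarrow>
   ('y \<times> 'x \<Rightarrow> (nat \<Rightarrow> real) \<Rightarrow> real) \<Rightarrow> bool" where
  "phase_function N G \<phi> \<longleftrightarrow> smooth_phase_on N G \<phi> \<and>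
     (\<forall>(z, \<theta>)\<in>G. (\<forall>t>0. \<phi> z (phase_scale N t \<theta>) = t * \<phi> z \<theta>) \<and>
        ((\<exists>v\<in>Basis. pderiv_dir (Inl (v, 0)) \<phi> z \<theta> \<noteq> 0) \<or> (\<exists>j<N. pderiv_dir (Inr j) \<phi> z \<theta> \<noteq> 0)) \<and>
        ((\<exists>v\<in>Basis. pderiv_dir (Inl (0, v)) \<phi> z \<theta> \<noteq> 0) \<or> (\<exists>j<N. pderiv_dir (Inr j) \<phi> z \<theta> \<noteq> 0)))"

definition nondegenerate ::
  "nat \<Rightarrow> ('z::euclidean_space \<times> (nat \<Rightarrow> real)) set \<Rightarrow> ('z \<Rightarrow> (nat \<Rightarrow> real) \<Rightarrow> real) \<Rightarrow> bool" where
  "nondegenerate N G \<phi> \<longleftrightarrow> (\<forall>(z, \<theta>)\<in>G. (\<forall>j<N. pderiv_dir (Inr j) \<phi> z \<theta> = 0) \<longrightarrow>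
     (\<forall>c. (\<forall>d\<in>directions N. (\<Sum>j<N. c j * pderivs [d, Inr j] \<phi> z \<theta>) = 0) \<longrightarrow> (\<forall>j<N. c j = 0)))"

definition symbol_class ::
  "'z::euclidean_space set \<Rightarrow> nat \<Rightarrow> real \<Rightarrow> ('z \<Rightarrow> (nat \<Rightarrow> real) \<Rightarrow> complex) \<Rightarrow> bool" where
  "symbol_class U N \<mu> p \<longleftrightarrow> smooth_phase_on N (U \<times> phase_space N) p \<and>
     (\<forall>K ds. compact K \<and> K \<subseteq> U \<and> set ds \<subseteq> directions N \<longrightarrow>
        (\<exists>C. \<forall>z\<in>K. \<forall>\<theta>\<in>phase_space N. norm (pderivs ds p z \<theta>) \<le>
           C * (1 + phase_norm N \<theta>) powr (\<mu> - real (length (filter (\<lambda>d. \<not> isl d) ds)))))"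

definition has_osc_integral ::
  "nat \<Rightarrow> ('z::euclidean_space \<Rightarrow> (nat \<Rightarrow> real) \<Rightarrow> real) \<Rightarrow> ('z \<Rightarrow> (nat \<Rightarrow> real) \<Rightarrow> complex) \<Rightarrow>
   ('z \<Rightarrow> complex) \<Rightarrow> complex \<Rightarrow> bool" where
  "has_osc_integral N \<phi> p u J \<longleftrightarrow> (\<forall>cut :: real \<Rightarrow> real.
     smooth_open UNIV cut \<and> (\<exists>\<delta>>0. \<forall>t. \<bar>t\<bar> < \<delta> \<longrightarrow> cut t = 1) \<and> (\<exists>b. \<forall>t. \<bar>t\<bar> > b \<longrightarrow> cut t = 0) \<longrightarrow>
     ((\<lambda>\<epsilon>. \<integral>(z, \<theta>). complex_of_real (cut (\<epsilon> * phase_norm N \<theta>)) * exp (\<i> * complex_of_real (\<phi> z \<theta>)) * p z \<theta> * u z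
        \<partial>(lborel \<Otimes>\<^sub>M Pi\<^sub>M {..<N} (\<lambda>_. lborel))) \<longlongrightarrow> J) (at_right 0))"


section \<open>Fourier integral operators\<close>

text \<open>The open set \<open>X\<close> lies in \<open>'x\<close>; the manifold \<open>Y\<close> lies in \<open>'m\<close> and is parametrized by \<open>\<kappa>\<close> on
  \<open>V\<close> in \<open>'y\<close>. Elements of a canonical relation have the form \<open>((y, \<eta>), (x, \<xi>))\<close>.

  In \<open>canonical_relation\<close> the last condition is the vanishing of the difference of the two
  symplectic forms. Together with the dimension this says that the twisted relation is Lagrangian.\<close>

definition canonical_relation ::
  "nat \<Rightarrow> 'm::euclidean_space set \<Rightarrow> 'x::euclidean_space set \<Rightarrow> (('m \<times> 'm) \<times> ('x \<times> 'x)) set \<Rightarrow> bool" where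
  "canonical_relation n Y X C \<longleftrightarrow>
     C \<subseteq> {((y, \<eta>), (x, \<xi>)). (y, \<eta>) \<in> cotangent_bundle Y \<and> \<eta> \<noteq> 0 \<and> (x, \<xi>) \<in> cotangent_bundle X \<and> \<xi> \<noteq> 0} \<and>
     closedin (top_of_set {((y, \<eta>), (x, \<xi>)). (y, \<eta>) \<in> cotangent_bundle Y \<and>
        (x, \<xi>) \<in> cotangent_bundle X \<and> (\<eta>, \<xi>) \<noteq> 0}) C \<and>
     (\<forall>y \<eta> x \<xi> t. ((y, \<eta>), (x, \<xi>)) \<in> C \<and> t > 0 \<longrightarrow> ((y, t *\<^sub>R \<eta>), (x, t *\<^sub>R \<xi>)) \<in> C) \<and>
     smooth_submanifold n C \<and>
     (\<forall>c\<in>C. \<forall>((y1, \<eta>1), (x1, \<xi>1)) \<in> tangent_space C c. \<forall>((y2, \<eta>2), (x2, \<xi>2)) \<in> tangent_space C c.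
        (\<eta>1 \<bullet> y2 - \<eta>2 \<bullet> y1) - (\<xi>1 \<bullet> x2 - \<xi>2 \<bullet> x1) = 0)"

text \<open>\<open>(y, x, \<theta>)\<close> is a critical point of \<open>\<phi>\<close> in \<open>\<theta>\<close>, and \<open>(\<eta>, \<xi>)\<close> is the covector
  \<open>(d\<^sub>y \<phi>, - d\<^sub>x \<phi>)\<close> there, with \<open>\<eta>\<close> transported from the coordinates to \<open>Y\<close>.\<close>

definition phase_crit ::
  "('y::euclidean_space \<Rightarrow> 'm::euclidean_space) \<Rightarrow> nat \<Rightarrow>
   (('y \<times> 'x::euclidean_space) \<times> (nat \<Rightarrow> real)) set \<Rightarrow> ('y \<times> 'x \<Rightarrow> (nat \<Rightarrow> real) \<Rightarrow> real) \<Rightarrow>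
   'y \<Rightarrow> 'x \<Rightarrow> (nat \<Rightarrow> real) \<Rightarrow> 'm \<Rightarrow> 'x \<Rightarrow> bool" where
  "phase_crit \<kappa> N G \<phi> y x \<theta> \<eta> \<xi> \<longleftrightarrow> ((y, x), \<theta>) \<in> G \<and>
     (\<forall>j<N. pderiv_dir (Inr j) \<phi> (y, x) \<theta> = 0) \<and>
     \<eta> \<in> range (frechet_derivative \<kappa> (at y)) \<and>
     (\<forall>v\<in>Basis. \<eta> \<bullet> frechet_derivative \<kappa> (at y) v = pderiv_dir (Inl (v, 0)) \<phi> (y, x) \<theta>) \<and>
     (\<forall>v\<in>Basis. \<xi> \<bullet> v = - pderiv_dir (Inl (0, v)) \<phi> (y, x) \<theta>)"

type_synonym ('y, 'x) osc_term =
  "nat \<times> (('y \<times> 'x) \<times> (nat \<Rightarrow> real)) set \<times> ('y \<times> 'x \<Rightarrow> (nat \<Rightarrow> real) \<Rightarrow> real) \<times>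
   ('y \<times> 'x \<Rightarrow> (nat \<Rightarrow> real) \<Rightarrow> complex)"

text \<open>Order of the amplitude in an operator of order \<open>m\<close> (Hoermander's normalization).\<close>

definition amplitude_order :: "nat \<Rightarrow> real \<Rightarrow> nat \<Rightarrow> real" where
  "amplitude_order n m N = m + (real n - 2 * real N) / 4"

text \<open>The phase is only given on the cone \<open>G\<close>; the amplitude is supported in a closed subcone.\<close>

definition fio_term ::
  "('y::euclidean_space \<Rightarrow> 'm::euclidean_space) \<Rightarrow> (('m \<times> 'm) \<times> ('x::euclidean_space \<times> 'x)) set \<Rightarrow>
   real \<Rightarrow> ('y \<times> 'x) set \<Rightarrow> ('y, 'x) osc_term \<Rightarrow> bool" where
  "fio_term \<kappa> C m U = (\<lambda>(N, G, \<phi>, p). N \<ge> 1 \<and> open_cone N U G \<and>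
     phase_function N G \<phi> \<and> nondegenerate N G \<phi> \<and>
     (\<forall>y x \<theta> \<eta> \<xi>. phase_crit \<kappa> N G \<phi> y x \<theta> \<eta> \<xi> \<longrightarrow> ((\<kappa> y, \<eta>), (x, \<xi>)) \<in> C) \<and>
     symbol_class U N (amplitude_order (DIM('y) + DIM('x)) m N) p \<and>
     (\<exists>S. S \<subseteq> G \<and> conic N S \<and> closedin (top_of_set (U \<times> phase_space0 N)) S \<and>
        (\<forall>(z, \<theta>) \<in> U \<times> phase_space0 N - S. p z \<theta> = 0)))"

text \<open>On \<open>B \<times> W\<close> the Schwartz kernel of \<open>T\<close> (tested on tensor products \<open>g(y) f(x)\<close>) is the sum of
  the oscillatory integrals in \<open>ts\<close> and of a smooth function. The kernel is taken with respect to
  Lebesgue measure in the coordinates of \<open>Y\<close>. As \<open>\<kappa>\<close> need not be injective on \<open>V\<close>, \<open>g \<circ> \<kappa>\<close> has to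
  be cut off to \<open>B\<close>.\<close>

definition local_kernel ::
  "('y::euclidean_space \<Rightarrow> 'm::euclidean_space) \<Rightarrow>
   ((('x::euclidean_space \<Rightarrow> complex) \<Rightarrow> complex) \<Rightarrow> ('m \<Rightarrow> complex) \<Rightarrow> complex) \<Rightarrow>
   'y set \<Rightarrow> 'x set \<Rightarrow> ('y, 'x) osc_term list \<Rightarrow> bool" where
  "local_kernel \<kappa> T B W ts \<longleftrightarrow> (\<exists>r. smooth_open (B \<times> W) r \<and>
     (\<forall>f\<in>test_functions (\<lambda>x. x) W. \<forall>g\<in>test_functions \<kappa> B. \<exists>J.
        (\<forall>i<length ts. case ts ! i of (N, G, \<phi>, p) \<Rightarrow>
           has_osc_integral N \<phi> p (\<lambda>(y, x). if y \<in> B then g (\<kappa> y) * f x else 0) (J i)) \<and>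
        T (dist_of_fun f) g = (\<Sum>i<length ts. J i) +
           (LINT z:B \<times> W|lborel. r z * g (\<kappa> (fst z)) * f (snd z))))"

definition local_representation ::
  "('y::euclidean_space \<Rightarrow> 'm::euclidean_space) \<Rightarrow> 'y set \<Rightarrow> 'x::euclidean_space set \<Rightarrow>
   (('m \<times> 'm) \<times> ('x \<times> 'x)) set \<Rightarrow> real \<Rightarrow>
   ((('x \<Rightarrow> complex) \<Rightarrow> complex) \<Rightarrow> ('m \<Rightarrow> complex) \<Rightarrow> complex) \<Rightarrow>
   'y \<Rightarrow> 'x \<Rightarrow> 'y set \<Rightarrow> 'x set \<Rightarrow> ('y, 'x) osc_term list \<Rightarrow> bool" where
  "local_representation \<kappa> V X C m T y x B W ts \<longleftrightarrow>
     open B \<and> y \<in> B \<and> B \<subseteq> V \<and> inj_on \<kappa> B \<and> open W \<and> x \<in> W \<and> W \<subseteq> X \<and>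
     (\<forall>t\<in>set ts. fio_term \<kappa> C m (B \<times> W) t) \<and> local_kernel \<kappa> T B W ts"

definition fourier_integral_operator ::
  "('y::euclidean_space \<Rightarrow> 'm::euclidean_space) \<Rightarrow> 'y set \<Rightarrow> 'm set \<Rightarrow> 'x::euclidean_space set \<Rightarrow>
   (('m \<times> 'm) \<times> ('x \<times> 'x)) set \<Rightarrow> real \<Rightarrow>
   ((('x \<Rightarrow> complex) \<Rightarrow> complex) \<Rightarrow> ('m \<Rightarrow> complex) \<Rightarrow> complex) \<Rightarrow> bool" where
  "fourier_integral_operator \<kappa> V Y X C m T \<longleftrightarrow>
     open X \<and> etale_param \<kappa> V Y \<and> canonical_relation (DIM('y) + DIM('x)) Y X C \<and>
     (\<forall>u\<in>compact_distributions X. T u \<in> distributions \<kappa> V) \<and>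
     (\<forall>u1\<in>compact_distributions X. \<forall>u2\<in>compact_distributions X. \<forall>c d. \<forall>g\<in>test_functions \<kappa> V.
        T (\<lambda>f. c * u1 f + d * u2 f) g = c * T u1 g + d * T u2 g) \<and>
     (\<forall>U u. (\<forall>n::nat. U n \<in> compact_distributions X) \<and> u \<in> compact_distributions X \<and>
        (\<forall>f. smooth_open X f \<longrightarrow> (\<lambda>n. U n f) \<longlonglongrightarrow> u f) \<longrightarrow>
        (\<forall>g\<in>test_functions \<kappa> V. (\<lambda>n. T (U n) g) \<longlonglongrightarrow> T u g)) \<and>
     (\<forall>y\<in>V. \<forall>x\<in>X. \<exists>B W ts. local_representation \<kappa> V X C m T y x B W ts)"

text \<open>Non-vanishing of the principal symbol at every point of \<open>C\<close>: there is a local representation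
  in which exactly one term contributes near that point, with an amplitude that is elliptic there.\<close>

definition elliptic_fourier_integral_operator ::
  "('y::euclidean_space \<Rightarrow> 'm::euclidean_space) \<Rightarrow> 'y set \<Rightarrow> 'm set \<Rightarrow> 'x::euclidean_space set \<Rightarrow>
   (('m \<times> 'm) \<times> ('x \<times> 'x)) set \<Rightarrow> real \<Rightarrow>
   ((('x \<Rightarrow> complex) \<Rightarrow> complex) \<Rightarrow> ('m \<Rightarrow> complex) \<Rightarrow> complex) \<Rightarrow> bool" where
  "elliptic_fourier_integral_operator \<kappa> V Y X C m T \<longleftrightarrow>
     fourier_integral_operator \<kappa> V Y X C m T \<and>
     (\<forall>y\<in>V. \<forall>\<eta> x \<xi>. ((\<kappa> y, \<eta>), (x, \<xi>)) \<in> C \<longrightarrow>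
        (\<exists>B W ts i \<theta>0. local_representation \<kappa> V X C m T y x B W ts \<and> i < length ts \<and>
           (case ts ! i of (N, G, \<phi>, p) \<Rightarrow> phase_crit \<kappa> N G \<phi> y x \<theta>0 \<eta> \<xi> \<and>
              (\<exists>H c r. open_cone N (B \<times> W) H \<and> ((y, x), \<theta>0) \<in> H \<and> c > 0 \<and>
                 (\<forall>(z, \<theta>) \<in> H. phase_norm N \<theta> \<ge> r \<longrightarrow>
                    norm (p z \<theta>) \<ge> c * (1 + phase_norm N \<theta>) powr amplitude_order (DIM('y) + DIM('x)) m N))) \<and>
           (\<forall>j<length ts. case ts ! j of (N, G, \<phi>, p) \<Rightarrow>
              (\<forall>\<theta>1. phase_crit \<kappa> N G \<phi> y x \<theta>1 \<eta> \<xi> \<and> (j, \<theta>1) \<noteq> (i, \<theta>0) \<longrightarrow>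
                 (\<exists>H. open_cone N (B \<times> W) H \<and> ((y, x), \<theta>1) \<in> H \<and> (\<forall>(z, \<theta>) \<in> H. p z \<theta> = 0))))))"


section \<open>The elliptical Radon transform\<close>

definition circ :: "real \<Rightarrow> (real^2)" where
  "circ s = vector [cos s, sin s]"

definition gamma_T :: "real \<Rightarrow> real \<Rightarrow> (real^2)" where
  "gamma_T \<alpha> s = circ (s - \<alpha>)"

definition gamma_R :: "real \<Rightarrow> real \<Rightarrow> (real^2)" where
  "gamma_R \<alpha> s = circ (s + \<alpha>)"

definition focal_sum :: "real \<Rightarrow> real \<Rightarrow> (real^2) \<Rightarrow> real" where
  "focal_sum \<alpha> s x = norm (x - gamma_T \<alpha> s) + norm (x - gamma_R \<alpha> s)"

definition ellipse :: "real \<Rightarrow> real \<Rightarrow> real \<Rightarrow> (real^2) set" where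
  "ellipse \<alpha> s L = {x. focal_sum \<alpha> s x = L}"

definition disc :: "real \<Rightarrow> (real^2) set" where
  "disc \<alpha> = ball 0 (cos \<alpha>)"

text \<open>The parameter manifold \<open>Y\<close> is realized in \<open>(real^2) \<times> real\<close> as the product of the unit circle
  and a half-line, with coordinates \<open>(s, L)\<close> that are \<open>2\<pi>\<close>-periodic in \<open>s\<close>.\<close>

definition Y_coord :: "real \<times> real \<Rightarrow> (real^2) \<times> real" where
  "Y_coord = (\<lambda>(s, L). (circ s, L))"

definition coord_domain :: "real \<Rightarrow> (real \<times> real) set" where
  "coord_domain \<alpha> = UNIV \<times> {2 * sin \<alpha> <..}"

definition Yset :: "real \<Rightarrow> ((real^2) \<times> real) set" where
  "Yset \<alpha> = Y_coord ` ({0..2*pi} \<times> {2 * sin \<alpha> <..})"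

definition Zset :: "real \<Rightarrow> (((real^2) \<times> real) \<times> (real^2)) set" where
  "Zset \<alpha> = {(Y_coord (s, L), x) | s L x.
     s \<in> {0..2*pi} \<and> L > 2 * sin \<alpha> \<and> x \<in> disc \<alpha> \<and> x \<in> ellipse \<alpha> s L}"

text \<open>The ellipses that meet the disc. This is a proper subset of \<open>Yset \<alpha>\<close>, since
  \<open>ellipse \<alpha> s L\<close> misses the disc for large \<open>L\<close>. Hence \<^const>\<open>fst\<close> does not
  map \<open>Zset \<alpha>\<close> onto \<open>Yset \<alpha>\<close>, and distinct points of \<open>Yset \<alpha>\<close> can have the same (empty) fibre
  (\<open>df_points_Yset_fails\<close> below); the fibration condition on \<^const>\<open>fst\<close> and the separation of points
  of \<open>Y\<close> can only hold over this set, which is \<open>fst ` Zset \<alpha>\<close>.\<close>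

definition Y_meeting :: "real \<Rightarrow> ((real^2) \<times> real) set" where
  "Y_meeting \<alpha> = {Y_coord (s, L) | s L.
     s \<in> {0..2*pi} \<and> L > 2 * sin \<alpha> \<and> disc \<alpha> \<inter> ellipse \<alpha> s L \<noteq> {}}"

text \<open>The ellipse has centre \<open>cos \<alpha> \<cdot> circ s\<close>, major axis in the direction \<open>circ (s + \<pi>/2)\<close>, and
  semi-axes \<open>L/2\<close> and \<open>sqrt (L\<^sup>2/4 - sin\<^sup>2 \<alpha>)\<close>. Arc length is the image of speed times Lebesgue
  measure on a period.\<close>

definition ellipse_param :: "real \<Rightarrow> real \<Rightarrow> real \<Rightarrow> real \<Rightarrow> (real^2)" where
  "ellipse_param \<alpha> s L t =
     cos \<alpha> *\<^sub>R circ s + (L / 2 * cos t) *\<^sub>R circ (s + pi / 2) +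
     (sqrt ((L / 2)\<^sup>2 - (sin \<alpha>)\<^sup>2) * sin t) *\<^sub>R circ s"

definition ellipse_arc_length :: "real \<Rightarrow> real \<Rightarrow> real \<Rightarrow> (real^2) measure" where
  "ellipse_arc_length \<alpha> s L =
     distr (density lborel (\<lambda>t. indicator {0..<2*pi} t *
         ennreal (norm (vector_derivative (ellipse_param \<alpha> s L) (at t)))))
       borel (ellipse_param \<alpha> s L)"

definition angle :: "(real^2) \<Rightarrow> real" where
  "angle q = (THE s. 0 \<le> s \<and> s < 2 * pi \<and> circ s = q)"

definition radon :: "real \<Rightarrow> ((real^2) \<Rightarrow> complex) \<Rightarrow> (real^2) \<times> real \<Rightarrow> complex" where
  "radon \<alpha> f y = (\<integral>x. f x \<partial>ellipse_arc_length \<alpha> (angle (fst y)) (snd y))"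

text \<open>The measure in the backprojection is \<open>w s x ds\<close>; \<open>L2_adjoint_weight\<close> says that it is positive
  and smooth and makes the backprojection the adjoint of \<^const>\<open>radon\<close> with respect to \<open>dx\<close> and
  \<open>ds dL\<close>. This determines \<open>w\<close> on the disc.\<close>

definition backprojection ::
  "real \<Rightarrow> (real \<Rightarrow> (real^2) \<Rightarrow> real) \<Rightarrow> ((real^2) \<times> real \<Rightarrow> complex) \<Rightarrow> (real^2) \<Rightarrow> complex" where
  "backprojection \<alpha> w g x =
     (LINT s:{0..2*pi}|lborel. w s x *\<^sub>R g (Y_coord (s, focal_sum \<alpha> s x)))"

definition L2_adjoint_weight :: "real \<Rightarrow> (real \<Rightarrow> (real^2) \<Rightarrow> real) \<Rightarrow> bool" where
  "L2_adjoint_weight \<alpha> w \<longleftrightarrow>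
     smooth_open (UNIV \<times> disc \<alpha>) (\<lambda>(s, x). w s x) \<and>
     (\<forall>s. \<forall>x\<in>disc \<alpha>. w s x > 0 \<and> w (s + 2 * pi) x = w s x) \<and>
     (\<forall>f\<in>test_functions (\<lambda>x. x) (disc \<alpha>). \<forall>g\<in>test_functions Y_coord (coord_domain \<alpha>).
        (LINT q:{0..2*pi} \<times> {2 * sin \<alpha> <..}|lborel. radon \<alpha> f (Y_coord q) * cnj (g (Y_coord q))) =
        (LINT x:disc \<alpha>|lborel. f x * cnj (backprojection \<alpha> w g x)))"

text \<open>Extension of the Radon transform to compactly supported distributions by duality.\<close>

definition radon_dist ::
  "real \<Rightarrow> (real \<Rightarrow> (real^2) \<Rightarrow> real) \<Rightarrow> (((real^2) \<Rightarrow> complex) \<Rightarrow> complex) \<Rightarrow>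
   ((real^2) \<times> real \<Rightarrow> complex) \<Rightarrow> complex" where
  "radon_dist \<alpha> w u g = u (backprojection \<alpha> w g)"

definition radon_canonical_relation ::
  "real \<Rightarrow> ((((real^2) \<times> real) \<times> ((real^2) \<times> real)) \<times> ((real^2) \<times> (real^2))) set" where
  "radon_canonical_relation \<alpha> = {((y, \<eta>), (x, \<xi>)).
     ((y, x), (\<eta>, - \<xi>)) \<in> conormal_bundle (Yset \<alpha> \<times> disc \<alpha>) (Zset \<alpha>) \<and> (\<eta>, \<xi>) \<noteq> (0, 0)}"

definition bolker_assumption ::
  "'m::euclidean_space set \<Rightarrow> (('m \<times> 'm) \<times> ('x::euclidean_space \<times> 'x)) set \<Rightarrow> bool" where
  "bolker_assumption Y C \<longleftrightarrow> injective_immersion C (cotangent_bundle Y) fst"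


subsection \<open>Consistency checks\<close>

lemma norm_circ [simp]: "norm (circ s) = 1"
  by (simp add: circ_def norm_vec_def L2_set_def UNIV_2)

lemma df_points_Yset_fails: "\<not> df_points (disc \<alpha>) (Yset \<alpha>) (Zset \<alpha>)"
proof
  assume *: "df_points (disc \<alpha>) (Yset \<alpha>) (Zset \<alpha>)"
  have empty: "Y_fiber (Zset \<alpha>) (Y_coord (0, L)) = {}" if "L \<ge> 4" for L
  proof -
    have lt: "focal_sum \<alpha> s x < 4" if "x \<in> disc \<alpha>" for s x
    proof -
      have "norm x < 1" using that cos_le_one[of \<alpha>] by (auto simp: disc_def intro: less_le_trans)
      moreover have "norm (x - gamma_T \<alpha> s) \<le> norm x + 1" "norm (x - gamma_R \<alpha> s) \<le> norm x + 1"
        using norm_triangle_ineq4[of x "gamma_T \<alpha> s"] norm_triangle_ineq4[of x "gamma_R \<alpha> s"]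
        by (auto simp: gamma_T_def gamma_R_def)
      ultimately show ?thesis by (simp add: focal_sum_def)
    qed
    have "\<not> (x \<in> disc \<alpha> \<and> x \<in> ellipse \<alpha> s L)" for s x
      using that lt[of x s] by (auto simp: ellipse_def)
    then show ?thesis
      by (auto simp: Y_fiber_def Zset_def Y_coord_def)
  qed
  have Y: "Y_coord (0, L) \<in> Yset \<alpha>" if "L \<ge> 4" for L
  proof -
    have "2 * sin \<alpha> < L" using that sin_le_one[of \<alpha>] by linarith
    then show ?thesis by (auto simp: Yset_def intro!: imageI)
  qed
  have "Y_coord (0, 4) = Y_coord (0, 5)"
  proof -
    have "Y_fiber (Zset \<alpha>) (Y_coord (0, 4)) = Y_fiber (Zset \<alpha>) (Y_coord (0, 5))"
      using empty[of 4] empty[of 5] by simp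
    then show ?thesis using * Y[of 4] Y[of 5] unfolding df_points_def by auto
  qed
  then show False by (simp add: Y_coord_def)
qed

lemma Y_meeting_eq: "Y_meeting \<alpha> = fst ` Zset \<alpha>"
  by (force simp: Y_meeting_def Zset_def)

lemma focal_equation:
  fixes a A u v :: real
  assumes "0 < a" "a < A"
  shows "sqrt ((u + a)\<^sup>2 + v\<^sup>2) + sqrt ((u - a)\<^sup>2 + v\<^sup>2) = 2 * A \<longleftrightarrow>
    (u / A)\<^sup>2 + v\<^sup>2 / (A\<^sup>2 - a\<^sup>2) = 1"
proof -
  define p q where "p = sqrt ((u + a)\<^sup>2 + v\<^sup>2)" and "q = sqrt ((u - a)\<^sup>2 + v\<^sup>2)"
  have pq: "p\<^sup>2 = (u + a)\<^sup>2 + v\<^sup>2" "q\<^sup>2 = (u - a)\<^sup>2 + v\<^sup>2" "p \<ge> 0" "q \<ge> 0"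
    by (simp_all add: p_def q_def)
  have B: "A\<^sup>2 - a\<^sup>2 > 0"
    using assms power_strict_mono[of a A 2] by simp
  define k where "k = u / A"
  have u: "u = k * A" "a * u / A = a * k" using assms by (simp_all add: k_def)
  have key: "(A + a * u / A)\<^sup>2 = (u + a)\<^sup>2 + v\<^sup>2 \<longleftrightarrow> (u / A)\<^sup>2 + v\<^sup>2 / (A\<^sup>2 - a\<^sup>2) = 1"
  proof -
    have "(u / A)\<^sup>2 + v\<^sup>2 / (A\<^sup>2 - a\<^sup>2) = 1 \<longleftrightarrow> k\<^sup>2 * (A\<^sup>2 - a\<^sup>2) + v\<^sup>2 = A\<^sup>2 - a\<^sup>2"
      using B by (simp add: k_def[symmetric] divide_eq_eq eq_divide_eq add_divide_eq_iff)
    also have "\<dots> \<longleftrightarrow> (A + a * k)\<^sup>2 = (k * A + a)\<^sup>2 + v\<^sup>2"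
      by (simp add: power2_eq_square algebra_simps) linarith
    finally show ?thesis using u by simp
  qed
  have "p + q = 2 * A \<longleftrightarrow> p = A + a * u / A \<and> q = A - a * u / A"
  proof
    assume h: "p + q = 2 * A"
    have "(p + q) * (p - q) = 4 * (a * u)"
      using pq(1,2) by (simp add: power2_eq_square algebra_simps)
    then have "p - q = 2 * (a * u / A)" using h assms by (simp add: field_simps)
    with h show "p = A + a * u / A \<and> q = A - a * u / A" by simp
  qed auto
  moreover have "p = A + a * u / A \<and> q = A - a * u / A \<longleftrightarrow> (A + a * u / A)\<^sup>2 = (u + a)\<^sup>2 + v\<^sup>2"
  proof
    assume "p = A + a * u / A \<and> q = A - a * u / A"
    then show "(A + a * u / A)\<^sup>2 = (u + a)\<^sup>2 + v\<^sup>2" using pq by metis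
  next
    assume h: "(A + a * u / A)\<^sup>2 = (u + a)\<^sup>2 + v\<^sup>2"
    have "v\<^sup>2 / (A\<^sup>2 - a\<^sup>2) \<ge> 0" using B by simp
    then have "(u / A)\<^sup>2 \<le> 1" using key h by linarith
    then have "\<bar>u / A\<bar> \<le> 1" by (simp add: abs_square_le_1)
    then have "\<bar>a * (u / A)\<bar> \<le> a" using assms using mult_left_mono[of "\<bar>u / A\<bar>" 1 a] by (simp add: abs_mult)
    then have "\<bar>a * k\<bar> \<le> a" by (simp only: k_def)
    then have pos: "A + a * u / A \<ge> 0" "A - a * u / A \<ge> 0" using assms unfolding u(2) by linarith+
    have "(A - a * u / A)\<^sup>2 = (A + a * u / A)\<^sup>2 - 4 * (a * u)"
      using assms by (simp add: power2_eq_square field_simps)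
    also have "\<dots> = (u - a)\<^sup>2 + v\<^sup>2"
      by (subst h) (simp add: power2_eq_square algebra_simps)
    finally have "(A - a * u / A)\<^sup>2 = (u - a)\<^sup>2 + v\<^sup>2" .
    with h pos show "p = A + a * u / A \<and> q = A - a * u / A"
      unfolding p_def q_def by (metis real_sqrt_unique)
  qed
  ultimately show ?thesis using key p_def q_def by simp
qed

lemma focal_sum_frame:
  "focal_sum \<alpha> s (cos \<alpha> *\<^sub>R circ s + u *\<^sub>R circ (s + pi / 2) + v *\<^sub>R circ s) =
   sqrt ((u + sin \<alpha>)\<^sup>2 + v\<^sup>2) + sqrt ((u - sin \<alpha>)\<^sup>2 + v\<^sup>2)"
proof -
  have frame: "norm (p *\<^sub>R circ (s + pi / 2) + q *\<^sub>R circ s) = sqrt (p\<^sup>2 + q\<^sup>2)" for p q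
  proof -
    have "(q * cos s - p * sin s)\<^sup>2 + (p * cos s + q * sin s)\<^sup>2 =
        (p\<^sup>2 + q\<^sup>2) * ((sin s)\<^sup>2 + (cos s)\<^sup>2)"
      by algebra
    then show ?thesis
      by (simp add: circ_def norm_vec_def L2_set_def UNIV_2 cos_add sin_add)
  qed
  have "cos \<alpha> *\<^sub>R circ s + u *\<^sub>R circ (s + pi / 2) + v *\<^sub>R circ s - gamma_T \<alpha> s =
      (u + sin \<alpha>) *\<^sub>R circ (s + pi / 2) + v *\<^sub>R circ s"
    by (simp add: vec_eq_iff forall_2 circ_def gamma_T_def cos_add sin_add cos_diff sin_diff algebra_simps)
  moreover have "cos \<alpha> *\<^sub>R circ s + u *\<^sub>R circ (s + pi / 2) + v *\<^sub>R circ s - gamma_R \<alpha> s =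
      (u - sin \<alpha>) *\<^sub>R circ (s + pi / 2) + v *\<^sub>R circ s"
    by (simp add: vec_eq_iff forall_2 circ_def gamma_R_def cos_add sin_add algebra_simps)
  ultimately show ?thesis unfolding focal_sum_def by (simp only: frame)
qed

lemma circ_frame:
  obtains u v where "x = cos \<alpha> *\<^sub>R circ s + u *\<^sub>R circ (s + pi / 2) + v *\<^sub>R circ s"
proof
  define y where "y = x - cos \<alpha> *\<^sub>R circ s"
  have "y $ 1 * ((sin s)\<^sup>2 + (cos s)\<^sup>2) = y $ 1" "y $ 2 * ((sin s)\<^sup>2 + (cos s)\<^sup>2) = y $ 2"
    by simp_all
  then have "y = (y $ 2 * cos s - y $ 1 * sin s) *\<^sub>R circ (s + pi / 2) + (y $ 1 * cos s + y $ 2 * sin s) *\<^sub>R circ s"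
    by (simp add: vec_eq_iff forall_2 circ_def cos_add sin_add power2_eq_square algebra_simps
        del: sin_cos_squared_add sin_cos_squared_add2 sin_cos_squared_add3)
  then show "x = cos \<alpha> *\<^sub>R circ s + (y $ 2 * cos s - y $ 1 * sin s) *\<^sub>R circ (s + pi / 2) +
      (y $ 1 * cos s + y $ 2 * sin s) *\<^sub>R circ s"
    by (simp add: y_def algebra_simps)
qed

lemma ellipse_param_image:
  assumes "0 < \<alpha>" "\<alpha> < pi / 2" "2 * sin \<alpha> < L"
  shows "ellipse_param \<alpha> s L ` {0..<2*pi} = ellipse \<alpha> s L"
proof -
  define A B where "A = L / 2" and "B = sqrt (A\<^sup>2 - (sin \<alpha>)\<^sup>2)"
  have a: "0 < sin \<alpha>" using assms by (intro sin_gt_zero) auto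
  have A: "sin \<alpha> < A" using assms by (simp add: A_def)
  have "A\<^sup>2 - (sin \<alpha>)\<^sup>2 > 0" using a A power_strict_mono[of "sin \<alpha>" A 2] by simp
  then have B: "B > 0" "B\<^sup>2 = A\<^sup>2 - (sin \<alpha>)\<^sup>2" by (simp_all add: B_def)
  have mem: "cos \<alpha> *\<^sub>R circ s + u *\<^sub>R circ (s + pi / 2) + v *\<^sub>R circ s \<in> ellipse \<alpha> s L \<longleftrightarrow>
      (u / A)\<^sup>2 + (v / B)\<^sup>2 = 1" for u v
    using focal_equation[OF a A, of u v] B(2)
    by (simp add: ellipse_def focal_sum_frame A_def power_divide)
  have par: "ellipse_param \<alpha> s L t =
      cos \<alpha> *\<^sub>R circ s + (A * cos t) *\<^sub>R circ (s + pi / 2) + (B * sin t) *\<^sub>R circ s" for t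
    by (simp add: ellipse_param_def A_def B_def)
  show ?thesis
  proof (intro equalityI subsetI)
    fix x assume "x \<in> ellipse_param \<alpha> s L ` {0..<2*pi}"
    then show "x \<in> ellipse \<alpha> s L" using a A B(1) by (auto simp: par mem)
  next
    fix x assume x: "x \<in> ellipse \<alpha> s L"
    obtain u v where uv: "x = cos \<alpha> *\<^sub>R circ s + u *\<^sub>R circ (s + pi / 2) + v *\<^sub>R circ s"
      by (rule circ_frame)
    have "(u / A)\<^sup>2 + (v / B)\<^sup>2 = 1" using x mem uv by simp
    then obtain t where t: "0 \<le> t" "t < 2 * pi" "u / A = cos t" "v / B = sin t"
      by (rule sincos_total_2pi)
    then have "u = A * cos t" "v = B * sin t" using a A B(1) by (auto simp: field_simps)
    then show "x \<in> ellipse_param \<alpha> s L ` {0..<2*pi}" using t uv par by auto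
  qed
qed

lemma ellipse_param_inj:
  assumes "0 < \<alpha>" "\<alpha> < pi / 2" "2 * sin \<alpha> < L"
  shows "inj_on (ellipse_param \<alpha> s L) {0..<2*pi}"
proof (rule inj_onI)
  fix t t' assume t: "t \<in> {0..<2*pi}" "t' \<in> {0..<2*pi}" "ellipse_param \<alpha> s L t = ellipse_param \<alpha> s L t'"
  define A B where "A = L / 2" and "B = sqrt (A\<^sup>2 - (sin \<alpha>)\<^sup>2)"
  have a: "0 < sin \<alpha>" using assms by (intro sin_gt_zero) auto
  have A: "sin \<alpha> < A" using assms by (simp add: A_def)
  have "A\<^sup>2 - (sin \<alpha>)\<^sup>2 > 0" using a A power_strict_mono[of "sin \<alpha>" A 2] by simp
  then have B: "B > 0" by (simp add: B_def)
  define p q where "p = A * (cos t - cos t')" and "q = B * (sin t - sin t')"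
  have "p *\<^sub>R circ (s + pi / 2) + q *\<^sub>R circ s = 0"
  proof -
    have "ellipse_param \<alpha> s L t - ellipse_param \<alpha> s L t' = p *\<^sub>R circ (s + pi / 2) + q *\<^sub>R circ s"
      unfolding ellipse_param_def p_def q_def A_def B_def
      by (simp add: vec_eq_iff field_simps)
    then show ?thesis using t(3) by simp
  qed
  then have "q * cos s - p * sin s = 0" "p * cos s + q * sin s = 0"
    by (simp_all add: vec_eq_iff forall_2 circ_def cos_add sin_add algebra_simps)
  then have "p = 0" "q = 0"
    using sin_cos_squared_add[of s] by algebra+
  then have cs: "cos t = cos t'" "sin t = sin t'" using a A B by (auto simp: p_def q_def)
  then obtain n :: int where n: "t = t' + 2 * pi * n"
    using sin_cos_eq_iff[of t t'] by auto
  have "\<bar>t - t'\<bar> < 2 * pi" using t(1,2) by auto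
  then have "\<bar>2 * pi * real_of_int n\<bar> < 2 * pi * 1" using n by simp
  then have "\<bar>real_of_int n\<bar> < 1" by (simp add: abs_mult)
  then have "n = 0" by linarith
  then show "t = t'" using n by simp
qed

end

theory Submission imports Defs "HOL-Probability.Probability"
begin

text \<open>Writing \<open>\<phi>(s, x)\<close> for the focal sum, \<open>Z\<close> is the graph of \<open>L = \<phi>(s, x)\<close>, so it has the global
  coordinates \<open>(s, x)\<close>, and the coarea formula gives the adjoint weight \<open>\<bar>\<nabla>\<^sub>x \<phi>\<bar>\<close>. The Schwartz kernel of
  the transform is \<open>\<bar>\<nabla>\<^sub>x \<phi>\<bar> \<delta>(L - \<phi>(s, x))\<close>, that is, the oscillatory integral with the phase
  \<open>\<theta> (L - \<phi>(s, x))\<close> and the amplitude \<open>\<bar>\<nabla>\<^sub>x \<phi>\<bar> / (2\<pi>)\<close>, which is positive and of order \<open>0\<close>; with one phase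
  variable and \<open>2 + 2\<close> base variables the operator has order \<open>-1/2\<close>.

  The points of the canonical relation are \<open>(s, L, - l \<partial>\<^sub>s \<phi>, l; x, l \<nabla>\<^sub>x \<phi>)\<close> with \<open>L = \<phi>(s, x)\<close> and
  \<open>l \<noteq> 0\<close>, so the Bolker condition says that \<open>x\<close> is determined, also infinitesimally, by \<open>s\<close>, \<open>\<phi>\<close> and
  \<open>\<partial>\<^sub>s \<phi>\<close>. It holds because \<open>D\<^sub>b\<close> lies on one side of the line through the two foci: on the half of
  the ellipse on that side \<open>\<partial>\<^sub>s \<phi>\<close> is strictly monotone.\<close>

section \<open>Smooth maps\<close>

text \<open>Two facts about the disc carry the geometry. Since |x| < b, the unit vectors pointing
  from both foci to x have negative component along q = circ s, so the gradient cannot vanish. Since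
  |x| < 1 while the foci run on the unit circle, x - focus has negative inner product with the
  focus; these signs make the two contributions to the x-derivative of \<open>phis\<close> along the
  ellipse add up instead of cancelling.

  The circle has no global chart. Manifolds that contain it are therefore images of maps that are
  2\<pi>-periodic in one coordinate, treated in the single locale \<open>circle_param\<close>; their
  measures integrate over one period.

  The oscillatory integral has to converge to the same value for every cutoff. Two derivatives of
  the test function in L make the inner Fourier integral decay like 1/(1 + \<theta>^2), so limits
  pass under the integral by dominated convergence and Fourier inversion identifies them. For this
  the test function, which lives on the circle, is unrolled to the line over an interval in s
  shorter than a period.\<close>

lemma Ck_on_cong:
  assumes "open S" "\<And>x. x \<in> S \<Longrightarrow> f x = g x" "Ck_on k S f"
  shows "Ck_on k S g"
  using assms(2,3)
proof (induction k arbitrary: f g)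
  case 0
  then show ?case by (simp cong: continuous_on_cong)
next
  case (Suc k)
  have d: "(g has_derivative frechet_derivative f (at x)) (at x)" if "x \<in> S" for x
  proof (rule has_derivative_transform_within_open[OF _ assms(1) that])
    show "(f has_derivative frechet_derivative f (at x)) (at x)"
      using Suc.prems(2) that by (simp add: frechet_derivative_works[symmetric])
  qed (use Suc.prems(1) in auto)
  have e: "frechet_derivative f (at x) = frechet_derivative g (at x)" if "x \<in> S" for x
    using frechet_derivative_at[OF d[OF that]] .
  show ?case
    unfolding Ck_on.simps
  proof (intro conjI ballI allI)
    show "g differentiable at x" if "x \<in> S" for x using d[OF that] by (auto simp: differentiable_def)
    show "Ck_on k S (\<lambda>x. frechet_derivative g (at x) v)" for v
      by (rule Suc.IH[of "\<lambda>x. frechet_derivative f (at x) v"]) (use e Suc.prems(2) in auto)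
  qed
qed

text \<open>\<open>Ck_on\<close> is defined through the chosen \<open>frechet_derivative\<close>; on
  an open set any explicit derivative may take its place, so the induction steps below can work with
  the formulas of the product and chain rules.\<close>

lemma Ck_on_SucI:
  assumes "open S" "\<And>x. x \<in> S \<Longrightarrow> (f has_derivative f' x) (at x)" "\<And>v. Ck_on k S (\<lambda>x. f' x v)"
  shows "Ck_on (Suc k) S f"
  unfolding Ck_on.simps
proof (intro conjI ballI allI)
  show "f differentiable at x" if "x \<in> S" for x using assms(2)[OF that] by (auto simp: differentiable_def)
  show "Ck_on k S (\<lambda>x. frechet_derivative f (at x) v)" for v
    by (rule Ck_on_cong[OF assms(1) _ assms(3)[of v]]) (use frechet_derivative_at[OF assms(2)] in auto)
qed

lemma Ck_on_SucD:
  assumes "Ck_on (Suc k) S f" "x \<in> S"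
  shows "(f has_derivative frechet_derivative f (at x)) (at x)" "Ck_on k S (\<lambda>x. frechet_derivative f (at x) v)"
  using assms by (auto simp: frechet_derivative_works[symmetric])

lemma Ck_on_mono: "Ck_on k S f \<Longrightarrow> T \<subseteq> S \<Longrightarrow> Ck_on k T f"
  by (induction k arbitrary: f) (auto intro: continuous_on_subset)

lemma Ck_on_Suc_lower: "Ck_on (Suc k) S f \<Longrightarrow> Ck_on k S f"
proof (induction k arbitrary: f)
  case 0
  then show ?case
    by (auto intro!: continuous_at_imp_continuous_on differentiable_imp_continuous_within)
qed auto

lemma Ck_on_const: "Ck_on k S (\<lambda>x. c)"
  by (induction k arbitrary: c) auto

lemma Ck_on_bounded_linear:
  assumes "bounded_linear f" shows "Ck_on k S f"
proof (cases k)
  case 0 then show ?thesis by (simp add: assms linear_continuous_on)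
next
  case (Suc m)
  have e: "frechet_derivative f (at x) = f" for x
    using frechet_derivative_at[OF bounded_linear_imp_has_derivative[OF assms]] by metis
  show ?thesis
    unfolding Suc Ck_on.simps e using assms
    by (auto intro!: Ck_on_const bounded_linear_imp_differentiable)
qed

lemma Ck_on_add:
  assumes "open S" "Ck_on k S f" "Ck_on k S g" shows "Ck_on k S (\<lambda>x. f x + g x)"
  using assms(2,3)
proof (induction k arbitrary: f g)
  case 0 then show ?case by (auto intro: continuous_on_add)
next
  case (Suc k)
  show ?case
  proof (rule Ck_on_SucI[OF assms(1)])
    show "((\<lambda>x. f x + g x) has_derivative (\<lambda>v. frechet_derivative f (at x) v + frechet_derivative g (at x) v)) (at x)"
      if "x \<in> S" for x
      by (intro has_derivative_add Ck_on_SucD[OF Suc.prems(1) that] Ck_on_SucD[OF Suc.prems(2) that])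
  qed (use Suc in auto)
qed

lemma Ck_on_sum:
  assumes "open S" "finite I" "\<And>i. i \<in> I \<Longrightarrow> Ck_on k S (f i)" shows "Ck_on k S (\<lambda>x. \<Sum>i\<in>I. f i x)"
  using assms(2,3) by (induction I rule: finite_induct) (auto intro!: Ck_on_const Ck_on_add[OF assms(1)])

lemma Ck_on_bilinear:
  assumes "open S" "bounded_bilinear p" "Ck_on k S f" "Ck_on k S g" shows "Ck_on k S (\<lambda>x. p (f x) (g x))"
  using assms(3,4)
proof (induction k arbitrary: f g)
  case 0 then show ?case using assms(2) by (auto intro: bounded_bilinear.continuous_on)
next
  case (Suc k)
  show ?case
  proof (rule Ck_on_SucI[OF assms(1)])
    show "((\<lambda>x. p (f x) (g x)) has_derivative (\<lambda>v. p (f x) (frechet_derivative g (at x) v) + p (frechet_derivative f (at x) v) (g x))) (at x)"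
      if "x \<in> S" for x
      by (intro bounded_bilinear.FDERIV[OF assms(2)] Ck_on_SucD[OF Suc.prems(1) that] Ck_on_SucD[OF Suc.prems(2) that])
    show "Ck_on k S (\<lambda>x. p (f x) (frechet_derivative g (at x) v) + p (frechet_derivative f (at x) v) (g x))" for v
      by (intro Ck_on_add[OF assms(1)] Suc.IH Ck_on_Suc_lower[OF Suc.prems(1)] Ck_on_Suc_lower[OF Suc.prems(2)])
        (use Suc.prems in auto)
  qed
qed

text \<open>In the chain rule the derivative of \<open>g\<close> is applied to a direction that
  varies with \<open>x\<close>, while \<open>Ck_on\<close> controls it only for fixed directions.
  Expanding the direction in \<open>Basis\<close> turns the derivative into a finite sum of
  products, which is why the middle space is Euclidean.\<close>

lemma Ck_on_compose:
  fixes f :: "'a::real_normed_vector \<Rightarrow> 'b::euclidean_space" and g :: "'b \<Rightarrow> 'c::real_normed_vector"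
  assumes "open S" "open T" "f ` S \<subseteq> T" "Ck_on k S f" "Ck_on k T g" shows "Ck_on k S (\<lambda>x. g (f x))"
  using assms(4,5)
proof (induction k arbitrary: g)
  case 0 then show ?case using assms(3) by (auto intro: continuous_on_compose2)
next
  case (Suc k)
  show ?case
  proof (rule Ck_on_SucI[OF assms(1)])
    fix x assume x: "x \<in> S"
    let ?g = "frechet_derivative g (at (f x))" and ?f = "frechet_derivative f (at x)"
    have g: "(g has_derivative ?g) (at (f x))" using Ck_on_SucD[OF Suc.prems(2)] assms(3) x by blast
    have d: "((\<lambda>x. g (f x)) has_derivative (\<lambda>v. ?g (?f v))) (at x)"
      by (rule has_derivative_compose[OF Ck_on_SucD(1)[OF Suc.prems(1) x] g])
    have e: "?g y = (\<Sum>b\<in>Basis. (y \<bullet> b) *\<^sub>R ?g b)" for y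
    proof -
      interpret bounded_linear ?g using g by (rule has_derivative_bounded_linear)
      have "?g y = ?g (\<Sum>b\<in>Basis. (y \<bullet> b) *\<^sub>R b)" by (simp add: euclidean_representation)
      then show ?thesis by (simp add: sum scale)
    qed
    show "((\<lambda>x. g (f x)) has_derivative (\<lambda>v. \<Sum>b\<in>Basis. (?f v \<bullet> b) *\<^sub>R ?g b)) (at x)"
      using d by (simp only: e[symmetric])
  next
    fix v
    show "Ck_on k S (\<lambda>x. \<Sum>b\<in>Basis. (frechet_derivative f (at x) v \<bullet> b) *\<^sub>R frechet_derivative g (at (f x)) b)"
    proof (intro Ck_on_sum[OF assms(1)] finite_Basis Ck_on_bilinear[OF assms(1) bounded_bilinear_scaleR] Ck_on_bilinear[OF assms(1) bounded_bilinear_inner] Ck_on_const)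
      show "Ck_on k S (\<lambda>x. frechet_derivative f (at x) v)" using Suc.prems by auto
      show "Ck_on k S (\<lambda>x. frechet_derivative g (at (f x)) b)" for b
        by (rule Suc.IH[OF Ck_on_Suc_lower[OF Suc.prems(1)]]) (use Suc.prems in auto)
    qed
  qed
qed

lemma smooth_open_cong:
  assumes "open S" "\<And>x. x \<in> S \<Longrightarrow> f x = g x" "smooth_open S f" shows "smooth_open S g"
  using assms unfolding smooth_open_def by (auto intro: Ck_on_cong)

lemma smooth_open_mono: "smooth_open S f \<Longrightarrow> T \<subseteq> S \<Longrightarrow> smooth_open T f"
  unfolding smooth_open_def by (auto intro: Ck_on_mono)

lemma smooth_open_has_derivative:
  "smooth_open S f \<Longrightarrow> x \<in> S \<Longrightarrow> (f has_derivative frechet_derivative f (at x)) (at x)"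
  unfolding smooth_open_def using Ck_on_SucD(1)[of 0 S f x] by blast

lemma smooth_open_deriv: "smooth_open S f \<Longrightarrow> smooth_open S (\<lambda>x. frechet_derivative f (at x) v)"
  unfolding smooth_open_def
proof
  fix k assume "\<forall>k. Ck_on k S f"
  then have "Ck_on (Suc k) S f" by blast
  then show "Ck_on k S (\<lambda>x. frechet_derivative f (at x) v)" by simp
qed

lemma smooth_open_continuous_on: "smooth_open S f \<Longrightarrow> continuous_on S f"
  unfolding smooth_open_def by (metis Ck_on.simps(1))

text \<open>The local criterion behind gluing: it lets an extension by zero be checked separately
  inside a box and off the support.\<close>

lemma smooth_open_locally:
  assumes "\<And>x. x \<in> S \<Longrightarrow> \<exists>U. open U \<and> x \<in> U \<and> smooth_open U f"
  shows "smooth_open S f"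
proof -
  have "Ck_on k S f" if "\<And>x. x \<in> S \<Longrightarrow> \<exists>U. open U \<and> x \<in> U \<and> Ck_on k U f" for k
    using that
  proof (induction k arbitrary: f)
    case 0
    then show ?case
      by (metis Ck_on.simps(1) continuous_at_imp_continuous_on continuous_on_eq_continuous_at)
  next
    case (Suc k)
    show ?case unfolding Ck_on.simps
    proof (intro conjI ballI allI)
      show "f differentiable at x" if "x \<in> S" for x
        using Suc.prems[OF that] by auto
      show "Ck_on k S (\<lambda>x. frechet_derivative f (at x) v)" for v
        by (rule Suc.IH) (use Suc.prems in force)
    qed
  qed
  then show ?thesis using assms unfolding smooth_open_def by blast
qed

lemma smooth_open_const [intro, simp]: "smooth_open S (\<lambda>x. c)"
  by (simp add: smooth_open_def Ck_on_const)

lemma smooth_open_bounded_linear: "bounded_linear f \<Longrightarrow> smooth_open S f"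
  by (simp add: smooth_open_def Ck_on_bounded_linear)

lemma smooth_open_id [intro, simp]: "smooth_open S (\<lambda>x. x)"
  by (intro smooth_open_bounded_linear bounded_linear_ident)

lemma smooth_open_bilinear:
  "open S \<Longrightarrow> bounded_bilinear p \<Longrightarrow> smooth_open S f \<Longrightarrow> smooth_open S g \<Longrightarrow> smooth_open S (\<lambda>x. p (f x) (g x))"
  by (simp add: smooth_open_def Ck_on_bilinear)

lemma smooth_open_add: "open S \<Longrightarrow> smooth_open S f \<Longrightarrow> smooth_open S g \<Longrightarrow> smooth_open S (\<lambda>x. f x + g x)"
  by (simp add: smooth_open_def Ck_on_add)

lemmas smooth_open_scaleR = smooth_open_bilinear[OF _ bounded_bilinear_scaleR]
lemmas smooth_open_mult = smooth_open_bilinear[OF _ bounded_bilinear_mult]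
lemmas smooth_open_inner = smooth_open_bilinear[OF _ bounded_bilinear_inner]

lemma smooth_open_compose:
  fixes f :: "'a::real_normed_vector \<Rightarrow> 'b::euclidean_space" and g :: "'b \<Rightarrow> 'c::real_normed_vector"
  assumes "smooth_open T g" "open T" "open S" "smooth_open S f" "\<And>x. x \<in> S \<Longrightarrow> f x \<in> T"
  shows "smooth_open S (\<lambda>x. g (f x))"
  unfolding smooth_open_def
proof
  fix k show "Ck_on k S (\<lambda>x. g (f x))"
    by (rule Ck_on_compose[OF assms(3,2)]) (use assms in \<open>auto simp: smooth_open_def\<close>)
qed

lemma smooth_open_linear_compose:
  assumes "bounded_linear L" "open S" "smooth_open S f" shows "smooth_open S (\<lambda>x. L (f x))"
proof -
  interpret L: bounded_linear L by fact
  \<comment> \<open>Writing \<open>L (f x)\<close> as a product of the constant 1 with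
    \<open>f x\<close> avoids \<open>smooth_open_compose\<close>, whose middle space would have to
    be Euclidean.\<close>
  have "bounded_bilinear (\<lambda>(r::real) y. r *\<^sub>R L y)"
    by (intro bounded_bilinear.comp[OF bounded_bilinear_scaleR] bounded_linear_ident assms)
  from smooth_open_bilinear[OF assms(2) this, of "\<lambda>_. 1" f] assms(3) show ?thesis by simp
qed

lemma smooth_open_minus: "open S \<Longrightarrow> smooth_open S f \<Longrightarrow> smooth_open S (\<lambda>x. - f x)"
  by (rule smooth_open_linear_compose[OF bounded_linear_minus[OF bounded_linear_ident]])

lemma smooth_open_diff: "open S \<Longrightarrow> smooth_open S f \<Longrightarrow> smooth_open S g \<Longrightarrow> smooth_open S (\<lambda>x. f x - g x)"
  using smooth_open_add[of S f "\<lambda>x. - g x"] smooth_open_minus[of S g] by simp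

lemma smooth_open_Pair:
  fixes f :: "'a::real_normed_vector \<Rightarrow> 'b::real_normed_vector" and g :: "'a \<Rightarrow> 'c::real_normed_vector"
  assumes "open S" "smooth_open S f" "smooth_open S g" shows "smooth_open S (\<lambda>x. (f x, g x))"
proof -
  have l: "bounded_linear (\<lambda>x::'b. (x, 0::'c))" "bounded_linear (\<lambda>x::'c. (0::'b, x))"
    by (intro bounded_linear_Pair bounded_linear_ident bounded_linear_zero)+
  from smooth_open_add[OF assms(1) smooth_open_linear_compose[OF l(1) assms(1,2)] smooth_open_linear_compose[OF l(2) assms(1,3)]]
  show ?thesis by simp
qed

lemmas smooth_open_fst = smooth_open_linear_compose[OF bounded_linear_fst]
lemmas smooth_open_snd = smooth_open_linear_compose[OF bounded_linear_snd]
lemmas smooth_open_vec_nth = smooth_open_linear_compose[OF bounded_linear_vec_nth]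
lemmas smooth_open_of_real = smooth_open_linear_compose[OF bounded_linear_of_real]

lemmas smooth_open_arith = smooth_open_const smooth_open_id smooth_open_add smooth_open_diff smooth_open_minus
  smooth_open_scaleR smooth_open_mult smooth_open_inner smooth_open_Pair smooth_open_fst smooth_open_snd smooth_open_vec_nth smooth_open_of_real

lemma Ck_on_Suc_real:
  fixes f :: "real \<Rightarrow> real"
  assumes "open S" "\<And>x. x \<in> S \<Longrightarrow> (f has_real_derivative f' x) (at x)" "Ck_on k S f'"
  shows "Ck_on (Suc k) S f"
proof (rule Ck_on_SucI[OF assms(1)])
  show "(f has_derivative (\<lambda>v. f' x * v)) (at x)" if "x \<in> S" for x
    using assms(2)[OF that] by (simp add: has_field_derivative_def)
  show "Ck_on k S (\<lambda>x. f' x * v)" for v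
    by (intro Ck_on_bilinear[OF assms(1) bounded_bilinear_mult] assms Ck_on_const)
qed

lemma smooth_open_real_deriv:
  fixes f :: "real \<Rightarrow> real"
  assumes "open S" "\<And>x. x \<in> S \<Longrightarrow> (f has_real_derivative f' x) (at x)" "smooth_open S f'"
  shows "smooth_open S f"
  unfolding smooth_open_def
proof
  fix k show "Ck_on k S f"
    using Ck_on_Suc_lower[OF Ck_on_Suc_real[OF assms(1,2), of k]] assms(3) by (auto simp: smooth_open_def)
qed

text \<open>The derivative is a polynomial in the function itself, so C^k passes to C^(k+1). The
  same device serves \<open>sqrt\<close>, whose derivative is half of
  \<open>inverse (sqrt x)\<close>.\<close>

lemma smooth_open_inverse_real: "smooth_open (- {0}) (inverse :: real \<Rightarrow> real)"
proof -
  have "Ck_on k (- {0}) (inverse :: real \<Rightarrow> real)" for k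
  proof (induction k)
    case 0 show ?case by (auto intro!: continuous_intros)
  next
    case (Suc k)
    have "Ck_on k (- {0}) (\<lambda>x::real. - 1 * (inverse x * inverse x))"
      by (intro Ck_on_bilinear[OF _ bounded_bilinear_mult] Ck_on_const Suc) auto
    then show ?case
      by (rule Ck_on_Suc_real[rotated -1]) (auto intro!: derivative_eq_intros simp: power2_eq_square)
  qed
  then show ?thesis by (simp add: smooth_open_def)
qed

lemma smooth_open_sqrt_real: "smooth_open {0<..} sqrt"
proof -
  have "Ck_on k {0<..} sqrt" for k
  proof (induction k)
    case 0 show ?case by (auto intro!: continuous_intros)
  next
    case (Suc k)
    have i: "Ck_on k {0<..} (\<lambda>x. inverse (sqrt x))"
      by (rule Ck_on_compose[of _ "- {0}"]) (use Suc smooth_open_inverse_real in \<open>auto simp: smooth_open_def\<close>)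
    show ?case
    proof (rule Ck_on_Suc_real[where f' = "\<lambda>x. inverse (sqrt x) * (1/2)"])
      show "Ck_on k {0<..} (\<lambda>x. inverse (sqrt x) * (1/2))"
        by (intro Ck_on_bilinear[OF _ bounded_bilinear_mult] i Ck_on_const) auto
    qed (auto intro!: derivative_eq_intros)
  qed
  then show ?thesis by (simp add: smooth_open_def)
qed

text \<open>The induction runs over \<open>sin\<close>, its negative and \<open>cos\<close> together
  because this system is closed under differentiation; \<open>- 1 * sin x\<close> is the shape to
  which the product rule applies.\<close>

lemma smooth_open_sin_cos_real: "smooth_open UNIV (sin :: real \<Rightarrow> real)" "smooth_open UNIV (cos :: real \<Rightarrow> real)"
proof -
  have "Ck_on k UNIV (sin :: real \<Rightarrow> real) \<and> Ck_on k UNIV (\<lambda>x::real. - 1 * sin x) \<and> Ck_on k UNIV (cos :: real \<Rightarrow> real)" for k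
  proof (induction k)
    case 0 show ?case by (auto intro!: continuous_intros)
  next
    case (Suc k)
    show ?case
    proof (intro conjI)
      show s: "Ck_on (Suc k) UNIV (sin :: real \<Rightarrow> real)"
        by (rule Ck_on_Suc_real[where f' = cos]) (use Suc in \<open>auto intro!: derivative_eq_intros\<close>)
      show "Ck_on (Suc k) UNIV (\<lambda>x::real. - 1 * sin x)"
        by (intro Ck_on_bilinear[OF _ bounded_bilinear_mult] s Ck_on_const) auto
      show "Ck_on (Suc k) UNIV (cos :: real \<Rightarrow> real)"
        by (rule Ck_on_Suc_real[where f' = "\<lambda>x. - 1 * sin x"]) (use Suc in \<open>auto intro!: derivative_eq_intros\<close>)
    qed
  qed
  then show "smooth_open UNIV (sin :: real \<Rightarrow> real)" "smooth_open UNIV (cos :: real \<Rightarrow> real)"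
    by (simp_all add: smooth_open_def)
qed

lemma smooth_open_inverse:
  fixes f :: "'a::real_normed_vector \<Rightarrow> real"
  assumes "open S" "smooth_open S f" "\<And>x. x \<in> S \<Longrightarrow> f x \<noteq> 0"
  shows "smooth_open S (\<lambda>x. inverse (f x))"
  by (rule smooth_open_compose[OF smooth_open_inverse_real]) (use assms in auto)

lemma smooth_open_divide:
  fixes f g :: "'a::real_normed_vector \<Rightarrow> real"
  assumes "open S" "smooth_open S f" "smooth_open S g" "\<And>x. x \<in> S \<Longrightarrow> g x \<noteq> 0"
  shows "smooth_open S (\<lambda>x. f x / g x)"
  unfolding divide_inverse by (intro smooth_open_mult smooth_open_inverse assms)

lemma smooth_open_sqrt:
  fixes f :: "'a::real_normed_vector \<Rightarrow> real"
  assumes "open S" "smooth_open S f" "\<And>x. x \<in> S \<Longrightarrow> f x > 0"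
  shows "smooth_open S (\<lambda>x. sqrt (f x))"
  by (rule smooth_open_compose[OF smooth_open_sqrt_real]) (use assms in auto)

lemma smooth_open_sin: "open S \<Longrightarrow> smooth_open S f \<Longrightarrow> smooth_open S (\<lambda>x. sin (f x :: real))"
  by (rule smooth_open_compose[OF smooth_open_sin_cos_real(1)]) auto

lemma smooth_open_cos: "open S \<Longrightarrow> smooth_open S f \<Longrightarrow> smooth_open S (\<lambda>x. cos (f x :: real))"
  by (rule smooth_open_compose[OF smooth_open_sin_cos_real(2)]) auto

lemma smooth_open_power:
  fixes f :: "'a::real_normed_vector \<Rightarrow> real"
  shows "open S \<Longrightarrow> smooth_open S f \<Longrightarrow> smooth_open S (\<lambda>x. f x ^ n)"
  by (induction n) (auto intro: smooth_open_mult)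

lemma smooth_open_norm:
  fixes f :: "'a::real_normed_vector \<Rightarrow> 'b::real_inner"
  assumes "open S" "smooth_open S f" "\<And>x. x \<in> S \<Longrightarrow> f x \<noteq> 0"
  shows "smooth_open S (\<lambda>x. norm (f x))"
  unfolding norm_eq_sqrt_inner by (intro smooth_open_sqrt smooth_open_inner assms) (use assms(3) in auto)

lemma smooth_open_arcsin_real: "smooth_open {-1<..<1} arcsin"
proof (rule smooth_open_real_deriv)
  show "(arcsin has_real_derivative inverse (sqrt (1 - x\<^sup>2))) (at x)" if "x \<in> {-1<..<1}" for x
    using that by (intro DERIV_arcsin) auto
  have *: "x\<^sup>2 < 1" if "x \<in> {-1<..<1}" for x::real using that by (simp add: abs_square_less_1 abs_less_iff)
  have "smooth_open {-1<..<1} (\<lambda>x::real. sqrt (1 - x\<^sup>2))"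
    by (rule smooth_open_sqrt) (use * in \<open>auto intro!: smooth_open_diff smooth_open_power\<close>)
  then show "smooth_open {-1<..<1} (\<lambda>x::real. inverse (sqrt (1 - x\<^sup>2)))"
    by (rule smooth_open_inverse[rotated]) (use * in fastforce)+
qed auto

lemma smooth_open_arcsin:
  fixes f :: "'a::real_normed_vector \<Rightarrow> real"
  assumes "open S" "smooth_open S f" "\<And>x. x \<in> S \<Longrightarrow> \<bar>f x\<bar> < 1"
  shows "smooth_open S (\<lambda>x. arcsin (f x))"
proof (rule smooth_open_compose[OF smooth_open_arcsin_real])
  show "f x \<in> {-1<..<1}" if "x \<in> S" for x using assms(3)[OF that] by auto
qed (use assms in auto)

section \<open>Smooth maps on arbitrary sets, by local extension\<close>

lemma smooth_map_onE:
  assumes "smooth_map_on A f" "p \<in> A"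
  obtains U F where "open U" "p \<in> U" "smooth_open U F" "\<forall>q\<in>A \<inter> U. F q = f q"
proof -
  obtain U F where "open U \<and> p \<in> U \<and> smooth_open U F \<and> (\<forall>q\<in>A \<inter> U. F q = f q)"
    using bspec[OF assms(1)[unfolded smooth_map_on_def] assms(2)] by (elim exE)
  then show ?thesis by (intro that[of U F]) simp_all
qed

lemma smooth_map_on_pointwiseI:
  assumes "\<And>p. p \<in> A \<Longrightarrow> \<exists>U F. open U \<and> p \<in> U \<and> smooth_open U F \<and> (\<forall>q\<in>A \<inter> U. F q = f q)"
  shows "smooth_map_on A f"
  unfolding smooth_map_on_def using assms by (intro ballI)

lemma smooth_map_onI:
  assumes "smooth_open U F" "open U" "A \<subseteq> U" "\<And>q. q \<in> A \<Longrightarrow> F q = f q" shows "smooth_map_on A f"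
proof (rule smooth_map_on_pointwiseI)
  fix p assume "p \<in> A"
  then show "\<exists>U F. open U \<and> p \<in> U \<and> smooth_open U F \<and> (\<forall>q\<in>A \<inter> U. F q = f q)"
    using assms by (intro exI[of _ U] exI[of _ F]) auto
qed

lemma smooth_map_on_subset: 
  assumes "smooth_map_on A f" "B \<subseteq> A" shows "smooth_map_on B f"
proof (rule smooth_map_on_pointwiseI)
  fix p assume "p \<in> B"
  then have p: "p \<in> A" using assms(2) by auto
  obtain U F where "open U" "p \<in> U" "smooth_open U F" "\<forall>q\<in>A \<inter> U. F q = f q"
    by (rule smooth_map_onE[OF assms(1) p])
  then show "\<exists>U F. open U \<and> p \<in> U \<and> smooth_open U F \<and> (\<forall>q\<in>B \<inter> U. F q = f q)"
    using assms(2) by (intro exI[of _ U] exI[of _ F]) auto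
qed

lemma smooth_map_on_continuous_on: assumes "smooth_map_on A f" shows "continuous_on A f"
  unfolding continuous_on_eq_continuous_within
proof
  fix p assume p: "p \<in> A"
  obtain U F where U: "open U" "p \<in> U" "smooth_open U F" "\<forall>q\<in>A \<inter> U. F q = f q"
    by (rule smooth_map_onE[OF assms p])
  have "continuous (at p) F"
    using smooth_open_continuous_on[OF U(3)] U by (simp add: continuous_on_eq_continuous_at)
  then have "(F \<longlongrightarrow> F p) (at p within A)"
    using continuous_at_imp_continuous_within continuous_within by blast
  then have "(f \<longlongrightarrow> F p) (at p within A)"
    by (rule Lim_transform_eventually) (use U in \<open>auto simp: eventually_at_topological\<close>)
  then show "continuous (at p within A) f"
    using U(2) U(4) p by (simp add: continuous_within)
qed

lemma smooth_map_on_open_iff: assumes "open S" shows "smooth_map_on S f \<longleftrightarrow> smooth_open S f"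
proof
  assume f: "smooth_map_on S f"
  show "smooth_open S f"
  proof (rule smooth_open_locally)
    fix x assume x: "x \<in> S"
    obtain U F where U: "open U" "x \<in> U" "smooth_open U F" "\<forall>q\<in>S \<inter> U. F q = f q"
      by (rule smooth_map_onE[OF f x])
    have o: "open (S \<inter> U)" using assms U(1) by auto
    have "smooth_open (S \<inter> U) f"
      by (rule smooth_open_cong[OF o _ smooth_open_mono[OF U(3)]]) (use U(4) in auto)
    then show "\<exists>U. open U \<and> x \<in> U \<and> smooth_open U f"
      using U(2) o x by (intro exI[of _ "S \<inter> U"]) simp
  qed
next
  assume "smooth_open S f"
  then show "smooth_map_on S f" by (rule smooth_map_onI) (use assms in auto)
qed

lemma smooth_map_on_compose:
  fixes f :: "'a::real_normed_vector \<Rightarrow> 'b::euclidean_space" and g :: "'b \<Rightarrow> 'c::real_normed_vector"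
  assumes "smooth_map_on B g" "smooth_map_on A f" "f ` A \<subseteq> B" shows "smooth_map_on A (\<lambda>x. g (f x))"
proof (rule smooth_map_on_pointwiseI)
  fix p assume p: "p \<in> A"
  obtain U F where U: "open U" "p \<in> U" "smooth_open U F" "\<forall>q\<in>A \<inter> U. F q = f q"
    by (rule smooth_map_onE[OF assms(2) p])
  have q: "f p \<in> B" using p assms(3) by auto
  obtain V G where V: "open V" "f p \<in> V" "smooth_open V G" "\<forall>q\<in>B \<inter> V. G q = g q"
    by (rule smooth_map_onE[OF assms(1) q])
  \<comment> \<open>The local extension \<open>F\<close> may leave \<open>V\<close> at points off
    \<open>A\<close>, so its domain is cut down before composing with \<open>G\<close>.\<close>
  let ?W = "U \<inter> F -` V"
  have W: "open ?W" using continuous_open_preimage[OF smooth_open_continuous_on[OF U(3)] U(1) V(1)] .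
  have "smooth_open ?W (\<lambda>x. G (F x))"
    by (rule smooth_open_compose[OF V(3,1) W smooth_open_mono[OF U(3)]]) auto
  moreover have "G (F q) = g (f q)" if "q \<in> A \<inter> ?W" for q
  proof -
    have "F q = f q" "f q \<in> B" using that U(4) assms(3) by auto
    then show ?thesis using that V(4) by auto
  qed
  moreover have "p \<in> ?W" using U p V by auto
  ultimately show "\<exists>W H. open W \<and> p \<in> W \<and> smooth_open W H \<and> (\<forall>q\<in>A \<inter> W. H q = g (f q))"
    using W by (intro exI[of _ ?W] exI[of _ "\<lambda>x. G (F x)"]) simp
qed

section \<open>Charts\<close>

text \<open>Submanifolds are defined with coordinates in a subspace \<open>span I\<close> of the
  ambient space itself. For an injection \<open>j\<close> of bases, \<open>coord_emb j\<close> and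
  \<open>coord_proj j\<close> identify a Euclidean space of another type with such a subspace, so
  that charts can be given on open sets of a space of the right dimension.\<close>

definition coord_emb :: "('b::euclidean_space \<Rightarrow> 'a::euclidean_space) \<Rightarrow> 'b \<Rightarrow> 'a" where
  "coord_emb j z = (\<Sum>b\<in>Basis. (z \<bullet> b) *\<^sub>R j b)"

definition coord_proj :: "('b::euclidean_space \<Rightarrow> 'a::euclidean_space) \<Rightarrow> 'a \<Rightarrow> 'b" where
  "coord_proj j y = (\<Sum>b\<in>Basis. (y \<bullet> j b) *\<^sub>R b)"

lemma bounded_linear_coord_emb: "bounded_linear (coord_emb j)"
  unfolding coord_emb_def
  by (intro bounded_linear_sum bounded_linear_compose[OF bounded_linear_scaleR_left bounded_linear_inner_left])

lemma bounded_linear_coord_proj: "bounded_linear (coord_proj j)"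
  unfolding coord_proj_def
  by (intro bounded_linear_sum bounded_linear_compose[OF bounded_linear_scaleR_left bounded_linear_inner_left])

locale coord_inj =
  fixes j :: "'b::euclidean_space \<Rightarrow> 'a::euclidean_space"
  assumes inj: "inj_on j Basis" and sub: "j ` Basis \<subseteq> Basis"
begin

lemma inner_j: "b \<in> Basis \<Longrightarrow> b' \<in> Basis \<Longrightarrow> j b \<bullet> j b' = (if b = b' then 1 else 0)"
  using inj sub by (subst inner_Basis) (auto dest: inj_onD)

lemma emb_inner: assumes "b \<in> Basis" shows "coord_emb j z \<bullet> j b = z \<bullet> b"
proof -
  have "coord_emb j z \<bullet> j b = (\<Sum>b'\<in>Basis. if b' = b then z \<bullet> b' else 0)"
    unfolding coord_emb_def inner_sum_left inner_scaleR_left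
    by (intro sum.cong refl) (use assms inner_j in auto)
  then show ?thesis using assms by simp
qed

lemma proj_emb [simp]: "coord_proj j (coord_emb j z) = z"
proof -
  have "coord_proj j (coord_emb j z) = (\<Sum>b\<in>Basis. (z \<bullet> b) *\<^sub>R b)"
    unfolding coord_proj_def by (intro sum.cong refl) (simp add: emb_inner)
  then show ?thesis by (simp add: euclidean_representation)
qed

lemma emb_in_span: "coord_emb j z \<in> span (j ` Basis)"
  unfolding coord_emb_def by (intro span_sum span_scale span_base) auto

lemma emb_proj: assumes "y \<in> span (j ` Basis)" shows "coord_emb j (coord_proj j y) = y"
proof -
  have "coord_proj j (j b) = b" if "b \<in> Basis" for b
  proof -
    have "coord_proj j (j b) = (\<Sum>b'\<in>Basis. (if b' = b then 1 else 0) *\<^sub>R b')"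
      unfolding coord_proj_def by (intro sum.cong refl) (use that inner_j in auto)
    also have "\<dots> = (\<Sum>b'\<in>Basis. if b' = b then b else 0)" by (intro sum.cong) auto
    finally show ?thesis using that by simp
  qed
  moreover have "coord_emb j b = j b" if "b \<in> Basis" for b
  proof -
    have "coord_emb j b = (\<Sum>b'\<in>Basis. if b' = b then j b else 0)"
      unfolding coord_emb_def by (intro sum.cong refl) (use that in \<open>auto simp: inner_Basis\<close>)
    then show ?thesis using that by simp
  qed
  ultimately have b: "coord_emb j (coord_proj j x) = x" if "x \<in> j ` Basis" for x using that by auto
  interpret e: bounded_linear "coord_emb j" by (rule bounded_linear_coord_emb)
  interpret p: bounded_linear "coord_proj j" by (rule bounded_linear_coord_proj)
  show ?thesis using assms
  proof (induction rule: span_induct_alt)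
    case base show ?case by (simp add: e.zero p.zero)
  next
    case (step c x y) then show ?case using b[of x] by (simp add: e.add e.scale p.add p.scale)
  qed
qed

lemma openin_emb: assumes "open V" shows "openin (top_of_set (span (j ` Basis))) (coord_emb j ` V)"
proof -
  have "coord_emb j ` V = span (j ` Basis) \<inter> coord_proj j -` V"
    using emb_in_span emb_proj by (auto simp: image_iff) metis
  moreover have "open (coord_proj j -` V)"
    using assms by (intro open_vimage linear_continuous_on bounded_linear_coord_proj)
  ultimately show ?thesis by (auto simp: openin_open)
qed

text \<open>Both sides are images of product measures, one indexed by the image of
  \<open>Basis\<close> and one by \<open>Basis\<close>; reindexing along \<open>j\<close> matches
  them factor by factor.\<close>

lemma coord_lborel_eq: "coord_lborel (j ` Basis) = distr lborel borel (coord_emb j)"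
proof -
  let ?I = "j ` Basis"
  let ?r = "\<lambda>c::'b \<Rightarrow> real. \<lambda>i\<in>?I. c (the_inv_into Basis j i)"
  interpret I: product_sigma_finite "\<lambda>_::'a. lborel :: real measure" ..
  interpret B: product_sigma_finite "\<lambda>_::'b. lborel :: real measure" ..
  have inv: "the_inv_into Basis j (j b) = b" if "b \<in> Basis" for b using that inj by (simp add: the_inv_into_f_f)
  have ml: "(\<lambda>c. c (the_inv_into Basis j i)) \<in> borel_measurable (Pi\<^sub>M Basis (\<lambda>_. lborel))" if "i \<in> ?I" for i
    using that inv by (auto intro!: measurable_component_singleton)
  have m: "?r \<in> measurable (Pi\<^sub>M Basis (\<lambda>_. lborel)) (Pi\<^sub>M ?I (\<lambda>_. lborel))"
    by (intro measurable_restrict) (use ml in auto)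
  \<comment> \<open>Uniqueness of product measures: it is enough that the reindexed measure has the
    right value on boxes.\<close>
  have P: "Pi\<^sub>M ?I (\<lambda>_. lborel) = distr (Pi\<^sub>M Basis (\<lambda>_. lborel)) (Pi\<^sub>M ?I (\<lambda>_. lborel)) ?r"
  proof (rule I.PiM_eqI[symmetric])
    fix A :: "'a \<Rightarrow> real set" assume A: "\<And>i. i \<in> ?I \<Longrightarrow> A i \<in> sets lborel"
    have s: "Pi\<^sub>E ?I A \<in> sets (Pi\<^sub>M ?I (\<lambda>_. lborel))" by (intro sets_PiM_I_finite) (use A in auto)
    have "?r -` Pi\<^sub>E ?I A \<inter> space (Pi\<^sub>M Basis (\<lambda>_. lborel)) = Pi\<^sub>E Basis (\<lambda>b. A (j b))"
      using inv by (auto simp: space_PiM PiE_iff)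
    then have "emeasure (distr (Pi\<^sub>M Basis (\<lambda>_. lborel)) (Pi\<^sub>M ?I (\<lambda>_. lborel)) ?r) (Pi\<^sub>E ?I A) =
        emeasure (Pi\<^sub>M Basis (\<lambda>_. lborel)) (Pi\<^sub>E Basis (\<lambda>b. A (j b)))"
      by (simp add: emeasure_distr[OF m s])
    also have "\<dots> = (\<Prod>b\<in>Basis. emeasure lborel (A (j b)))"
      by (intro B.emeasure_PiM) (use A in auto)
    also have "\<dots> = (\<Prod>i\<in>?I. emeasure lborel (A i))"
      by (simp add: prod.reindex[OF inj])
    finally show "emeasure (distr (Pi\<^sub>M Basis (\<lambda>_. lborel)) (Pi\<^sub>M ?I (\<lambda>_. lborel)) ?r) (Pi\<^sub>E ?I A) = (\<Prod>i\<in>?I. emeasure lborel (A i))" .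
  qed auto
  have ms: "(\<lambda>c. \<Sum>b\<in>?I. c b *\<^sub>R b) \<in> borel_measurable (Pi\<^sub>M ?I (\<lambda>_. lborel :: real measure))"
  proof (intro borel_measurable_sum borel_measurable_scaleR borel_measurable_const)
    show "(\<lambda>c. c i) \<in> borel_measurable (Pi\<^sub>M ?I (\<lambda>_. lborel :: real measure))" if "i \<in> ?I" for i
      using measurable_component_singleton[OF that, of "\<lambda>_. lborel :: real measure"] by simp
  qed
  have mb: "(\<lambda>c. \<Sum>b\<in>Basis. c b *\<^sub>R b) \<in> borel_measurable (Pi\<^sub>M (Basis :: 'b set) (\<lambda>_. lborel :: real measure))"
    by measurable
  have L: "(lborel :: 'b measure) = distr (Pi\<^sub>M Basis (\<lambda>_. lborel)) borel (\<lambda>c. \<Sum>b\<in>Basis. c b *\<^sub>R b)"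
    by (subst lborel_def) (simp add: lborel_eq_real)
  have "coord_lborel ?I = distr (Pi\<^sub>M Basis (\<lambda>_. lborel)) borel ((\<lambda>c. \<Sum>b\<in>?I. c b *\<^sub>R b) \<circ> ?r)"
    unfolding coord_lborel_def by (subst P) (rule distr_distr[OF ms m])
  also have "(\<lambda>c. \<Sum>b\<in>?I. c b *\<^sub>R b) \<circ> ?r = coord_emb j \<circ> (\<lambda>c. \<Sum>b\<in>Basis. c b *\<^sub>R b)"
  proof
    fix c :: "'b \<Rightarrow> real"
    have "((\<lambda>c. \<Sum>b\<in>?I. c b *\<^sub>R b) \<circ> ?r) c = (\<Sum>b\<in>Basis. c b *\<^sub>R j b)"
      by (simp add: sum.reindex[OF inj] inv)
    also have "\<dots> = (coord_emb j \<circ> (\<lambda>c. \<Sum>b\<in>Basis. c b *\<^sub>R b)) c"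
      by (simp add: coord_emb_def inner_sum_left inner_Basis if_distrib cong: if_cong)
    finally show "((\<lambda>c. \<Sum>b\<in>?I. c b *\<^sub>R b) \<circ> ?r) c = \<dots>" .
  qed
  also have "distr (Pi\<^sub>M Basis (\<lambda>_. lborel)) borel (coord_emb j \<circ> (\<lambda>c. \<Sum>b\<in>Basis. c b *\<^sub>R b)) = distr lborel borel (coord_emb j)"
    by (subst L, rule distr_distr[symmetric])
      (auto intro!: mb borel_measurable_continuous_onI linear_continuous_on bounded_linear_coord_emb)
  finally show ?thesis .
qed

end

lemma coord_inj_exists:
  assumes "DIM('b::euclidean_space) \<le> DIM('a::euclidean_space)"
  shows "\<exists>j :: 'b \<Rightarrow> 'a. coord_inj j"
  using card_le_inj[OF finite_Basis finite_Basis assms] by (auto simp: coord_inj_def)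

text \<open>A variant of \<open>local_param\<close> whose domain is open in a space of its own type;
  \<open>coord_inj.chart_local_param\<close> converts it back.\<close>

definition chart :: "'b::euclidean_space set \<Rightarrow> ('b \<Rightarrow> 'a::euclidean_space) \<Rightarrow> 'a set \<Rightarrow> bool" where
  "chart V \<psi> M \<longleftrightarrow> open V \<and> openin (top_of_set M) (\<psi> ` V) \<and> (\<exists>h. diffeo V (\<psi> ` V) \<psi> h)"

lemma chartI:
  assumes "open V" "openin (top_of_set M) (\<psi> ` V)" "smooth_open V \<psi>" "smooth_map_on (\<psi> ` V) h"
    "\<And>z. z \<in> V \<Longrightarrow> h (\<psi> z) = z"
  shows "chart V \<psi> M"
  unfolding chart_def diffeo_def using assms smooth_map_on_open_iff by blast

lemma (in coord_inj) chart_local_param: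
  assumes "chart V \<psi> M" "p \<in> \<psi> ` V"
  shows "local_param (j ` Basis) (coord_emb j ` V) (\<lambda>y. \<psi> (coord_proj j y)) M p"
proof -
  obtain h where h: "open V" "openin (top_of_set M) (\<psi> ` V)" "smooth_map_on V \<psi>" "smooth_map_on (\<psi> ` V) h"
    "\<forall>x\<in>V. h (\<psi> x) = x"
    using assms(1) by (auto simp: chart_def diffeo_def)
  have im: "(\<lambda>y. \<psi> (coord_proj j y)) ` coord_emb j ` V = \<psi> ` V" by (simp add: image_image)
  have "smooth_map_on (coord_emb j ` V) (coord_proj j)" "smooth_map_on V (coord_emb j)"
    by (rule smooth_map_onI[OF smooth_open_bounded_linear[of _ UNIV]]; simp add: bounded_linear_coord_proj bounded_linear_coord_emb)+
  then have "smooth_map_on (coord_emb j ` V) (\<lambda>y. \<psi> (coord_proj j y))" "smooth_map_on (\<psi> ` V) (\<lambda>m. coord_emb j (h m))"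
    using h by (auto intro!: smooth_map_on_compose[OF h(3)] smooth_map_on_compose[OF _ h(4)])
  then have "diffeo (coord_emb j ` V) (\<psi> ` V) (\<lambda>y. \<psi> (coord_proj j y)) (\<lambda>m. coord_emb j (h m))"
    using h im by (auto simp: diffeo_def)
  then show ?thesis
    unfolding local_param_def using sub h im assms(2) by (auto simp: openin_emb)
qed

lemma smooth_submanifoldI:
  fixes M :: "'a::euclidean_space set"
  assumes "\<And>p. p \<in> M \<Longrightarrow> \<exists>V \<psi>. chart V (\<psi> :: 'b::euclidean_space \<Rightarrow> 'a) M \<and> p \<in> \<psi> ` V" "DIM('b) \<le> DIM('a)"
    "d = DIM('b)"
  shows "smooth_submanifold d M"
  unfolding smooth_submanifold_def
proof
  fix p assume "p \<in> M"
  then obtain V and \<psi> :: "'b \<Rightarrow> 'a" where c: "chart V \<psi> M" "p \<in> \<psi> ` V" using assms(1) by blast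
  obtain j :: "'b \<Rightarrow> 'a" where "coord_inj j" using coord_inj_exists[OF assms(2)] by blast
  then interpret coord_inj j .
  have "card (j ` Basis) = d" using assms(3) card_image[OF inj] by simp
  then show "\<exists>I A \<psi>. card I = d \<and> local_param I A \<psi> M p"
    using chart_local_param[OF c] by blast
qed

lemma smooth_measureI:
  fixes M :: "'a::euclidean_space set"
  assumes M: "M \<in> sets borel" "sets \<mu> = sets borel" "emeasure \<mu> (- M) = 0" and dim: "DIM('b) \<le> DIM('a)"
  and ch: "\<And>p. p \<in> M \<Longrightarrow> \<exists>V \<psi> \<rho>. chart V (\<psi> :: 'b::euclidean_space \<Rightarrow> 'a) M \<and> p \<in> \<psi> ` V \<and>
     smooth_open V \<rho> \<and> (\<forall>z\<in>V. \<rho> z > 0) \<and>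
     (\<forall>B\<in>sets borel. B \<subseteq> V \<longrightarrow> emeasure \<mu> (\<psi> ` B) = (\<integral>\<^sup>+z\<in>B. ennreal (\<rho> z) \<partial>lborel))"
  shows "smooth_measure M \<mu>"
  unfolding smooth_measure_def
proof (intro conjI ballI M)
  fix p assume "p \<in> M"
  then obtain V \<rho> and \<psi> :: "'b \<Rightarrow> 'a" where c: "chart V \<psi> M" "p \<in> \<psi> ` V" and
    r: "smooth_open V \<rho>" "\<forall>z\<in>V. \<rho> z > 0" and
    e: "\<forall>B\<in>sets borel. B \<subseteq> V \<longrightarrow> emeasure \<mu> (\<psi> ` B) = (\<integral>\<^sup>+z\<in>B. ennreal (\<rho> z) \<partial>lborel)"
    using ch by blast
  obtain j :: "'b \<Rightarrow> 'a" where "coord_inj j" using coord_inj_exists[OF dim] by blast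
  then interpret coord_inj j .
  let ?A = "coord_emb j ` V" and ?\<rho> = "\<lambda>y. \<rho> (coord_proj j y)" and ?\<psi> = "\<lambda>y. \<psi> (coord_proj j y)"
  have V: "open V" using c(1) by (simp add: chart_def)
  have me: "coord_emb j \<in> borel_measurable borel" and mp: "coord_proj j \<in> borel_measurable borel"
    by (auto intro!: borel_measurable_continuous_onI linear_continuous_on bounded_linear_coord_emb bounded_linear_coord_proj)
  have sp: "smooth_map_on ?A (coord_proj j)"
    by (rule smooth_map_onI[OF smooth_open_bounded_linear[of _ UNIV]]) (auto simp: bounded_linear_coord_proj)
  have s: "smooth_map_on ?A ?\<rho>"
    by (rule smooth_map_on_compose[OF _ sp, of V]) (auto simp: smooth_map_on_open_iff[OF V] r)
  have cont: "continuous_on V \<rho>" using r(1) by (rule smooth_open_continuous_on)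
  \<comment> \<open>\<open>\<rho>\<close> is controlled on \<open>V\<close> only. Its extension by 0
    is Borel everywhere, as the transport of the integral along \<open>coord_emb j\<close>
    requires.\<close>
  have mr: "(\<lambda>z. if z \<in> V then \<rho> z else 0) \<in> borel_measurable borel"
    by (rule borel_measurable_continuous_on_if) (use V cont in auto)
  have meas: "emeasure \<mu> (?\<psi> ` B) = (\<integral>\<^sup>+u\<in>B. ennreal (?\<rho> u) \<partial>coord_lborel (j ` Basis))"
    if B: "B \<in> sets borel" "B \<subseteq> ?A" for B
  proof -
    define B' where "B' = coord_emb j -` B"
    have B': "B' \<in> sets borel" using me B(1) unfolding B'_def by (simp add: measurable_sets_borel)
    have BV: "B' \<subseteq> V" "coord_proj j ` B = B'"
    proof -
      show "B' \<subseteq> V"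
      proof
        fix z assume "z \<in> B'"
        then obtain z' where "z' \<in> V" "coord_emb j z = coord_emb j z'" using B(2) by (auto simp: B'_def)
        then show "z \<in> V" using proj_emb by metis
      qed
      show "coord_proj j ` B = B'"
      proof (intro equalityI subsetI)
        fix z assume "z \<in> coord_proj j ` B"
        then obtain z' where "coord_emb j z' \<in> B" "z = coord_proj j (coord_emb j z')" using B(2) by blast
        then show "z \<in> B'" by (simp add: B'_def)
      next
        fix z assume "z \<in> B'"
        then show "z \<in> coord_proj j ` B" by (intro image_eqI[of _ _ "coord_emb j z"]) (auto simp: B'_def)
      qed
    qed
    have mB: "(\<lambda>y. ennreal (if coord_proj j y \<in> V then ?\<rho> y else 0) * indicator B y) \<in> borel_measurable borel"
      using measurable_compose[OF mp mr] B(1) by auto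
    have "(\<integral>\<^sup>+u\<in>B. ennreal (?\<rho> u) \<partial>coord_lborel (j ` Basis)) =
      (\<integral>\<^sup>+u\<in>B. ennreal (if coord_proj j u \<in> V then ?\<rho> u else 0) \<partial>coord_lborel (j ` Basis))"
      using BV by (intro nn_integral_cong) (auto simp: indicator_def)
    also have "\<dots> = (\<integral>\<^sup>+z. ennreal (if z \<in> V then \<rho> z else 0) * indicator B' z \<partial>lborel)"
      unfolding coord_lborel_eq
      by (subst nn_integral_distr) (use me mB in \<open>auto simp: B'_def indicator_def intro!: nn_integral_cong\<close>)
    also have "\<dots> = (\<integral>\<^sup>+z\<in>B'. ennreal (\<rho> z) \<partial>lborel)"
      using BV by (intro nn_integral_cong) (auto simp: indicator_def)
    also have "\<dots> = emeasure \<mu> (\<psi> ` B')" using e B' BV by simp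
    also have "\<psi> ` B' = ?\<psi> ` B" unfolding BV(2)[symmetric] by (simp add: image_image)
    finally show ?thesis by simp
  qed
  have pos: "\<forall>u\<in>?A. ?\<rho> u > 0" using r by auto
  show "\<exists>I A \<psi> (\<rho> :: 'a \<Rightarrow> real). local_param I A \<psi> M p \<and> smooth_map_on A \<rho> \<and> (\<forall>u\<in>A. \<rho> u > 0) \<and>
        (\<forall>B\<in>sets borel. B \<subseteq> A \<longrightarrow> emeasure \<mu> (\<psi> ` B) = (\<integral>\<^sup>+u\<in>B. ennreal (\<rho> u) \<partial>coord_lborel I))"
    by (intro exI[of _ "j ` Basis"] exI[of _ ?A] exI[of _ ?\<psi>] exI[of _ ?\<rho>] conjI ballI impI
        chart_local_param[OF c] s meas bspec[OF pos])
qed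

text \<open>A curve in \<open>M\<close> stays in the chart for small times and there equals
  \<open>\<psi>\<close> after a smooth ambient extension \<open>H\<close> of the inverse, so its
  velocity is a value of \<open>D\<close>. Conversely every value of \<open>D\<close> is the
  velocity of the image of a straight line.\<close>

lemma chart_tangent_space:
  assumes "chart V \<psi> M" "z \<in> V" "(\<psi> has_derivative D) (at z)"
  shows "tangent_space M (\<psi> z) = range D"
proof (intro equalityI subsetI)
  obtain h where h0: "open V" "openin (top_of_set M) (\<psi> ` V)" "diffeo V (\<psi> ` V) \<psi> h"
    using assms(1) unfolding chart_def by blast
  have h: "open V" "openin (top_of_set M) (\<psi> ` V)" "smooth_map_on V \<psi>" "smooth_map_on (\<psi> ` V) h"
    "\<And>x. x \<in> V \<Longrightarrow> h (\<psi> x) = x"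
    using h0 by (auto simp: diffeo_def)
  {
    fix v assume "v \<in> tangent_space M (\<psi> z)"
    then obtain c \<epsilon> where c: "c 0 = \<psi> z" "\<epsilon> > 0" "smooth_open {-\<epsilon><..<\<epsilon>} c" "c ` {-\<epsilon><..<\<epsilon>} \<subseteq> M"
      and v: "(c has_vector_derivative v) (at 0)"
      by (auto simp: tangent_space_def smooth_curve_at_def)
    have pz: "\<psi> z \<in> \<psi> ` V" using assms(2) by auto
    obtain U H where H: "open U" "\<psi> z \<in> U" "smooth_open U H" "\<forall>q\<in>\<psi> ` V \<inter> U. H q = h q"
      by (rule smooth_map_onE[OF h(4) pz])
    obtain W where W: "open W" "\<psi> ` V = M \<inter> W" using h(2) by (auto simp: openin_open)
    have Hz: "H (\<psi> z) = z" using H(2,4) assms(2) h(5) by auto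
    have dH: "(H has_derivative frechet_derivative H (at (\<psi> z))) (at (c 0))"
      using smooth_open_has_derivative[OF H(3,2)] c(1) by simp
    have dc: "(c has_derivative (\<lambda>t. t *\<^sub>R v)) (at 0)" using v by (simp add: has_vector_derivative_def)
    have dHc: "((\<lambda>t. H (c t)) has_derivative (\<lambda>t. frechet_derivative H (at (\<psi> z)) (t *\<^sub>R v))) (at 0)"
      by (rule has_derivative_compose[OF dc dH])
    have dA: "((\<lambda>t. \<psi> (H (c t))) has_derivative (\<lambda>t. D (frechet_derivative H (at (\<psi> z)) (t *\<^sub>R v)))) (at 0)"
      by (rule has_derivative_compose[OF dHc]) (use assms(3) Hz c(1) in simp)
    have "continuous (at 0) c" using dc has_derivative_continuous by blast
    then have "\<forall>\<^sub>F t in at 0. c t \<in> U \<inter> W"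
      using topological_tendstoD[of c "c 0" "at 0" "U \<inter> W"] H(1,2) W pz c(1) by (auto simp: isCont_def)
    moreover have "\<forall>\<^sub>F t in at 0. t \<in> {-\<epsilon><..<\<epsilon>}" by (rule eventually_at_in_open') (use c(2) in auto)
    then have "\<forall>\<^sub>F t in at 0. c t \<in> M" by (rule eventually_mono) (use c(4) in auto)
    ultimately have "\<forall>\<^sub>F t in at 0. \<psi> (H (c t)) = c t"
      by eventually_elim (use W H(4) h(5) in force)
    then have "(c has_derivative (\<lambda>t. D (frechet_derivative H (at (\<psi> z)) (t *\<^sub>R v)))) (at 0)"
      by (rule has_derivative_transform_eventually[rotated]) (use dA Hz c(1) in auto)
    from has_derivative_unique[OF dc this] have "v = D (frechet_derivative H (at (\<psi> z)) v)"
      by (metis scaleR_one)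
    then show "v \<in> range D" by auto
  }
  fix v assume "v \<in> range D"
  then obtain d where d: "v = D d" by auto
  define g where "g = (\<lambda>t::real. z + t *\<^sub>R d)"
  have g: "continuous_on UNIV g" by (auto simp: g_def intro!: continuous_intros)
  have "open (g -` V)" using h(1) g by (rule open_vimage)
  moreover have "0 \<in> g -` V" using assms(2) by (simp add: g_def)
  ultimately obtain \<epsilon> where "\<epsilon> > 0" "ball 0 \<epsilon> \<subseteq> g -` V"
    by (rule openE)
  moreover have "ball (0::real) \<epsilon> = {-\<epsilon><..<\<epsilon>}" by (auto simp: dist_real_def)
  ultimately have e: "\<epsilon> > 0" "{-\<epsilon><..<\<epsilon>} \<subseteq> g -` V" by simp_all
  have sg: "smooth_open {-\<epsilon><..<\<epsilon>} g" unfolding g_def by (intro smooth_open_arith) auto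
  have "smooth_open {-\<epsilon><..<\<epsilon>} (\<lambda>t. \<psi> (g t))"
    by (rule smooth_open_compose[of V]) (use h smooth_map_on_open_iff[of V] sg e in auto)
  moreover have "(\<lambda>t. \<psi> (g t)) ` {-\<epsilon><..<\<epsilon>} \<subseteq> M" using e openin_imp_subset[OF h(2)] by auto
  ultimately have "smooth_curve_at M (\<psi> z) (\<lambda>t. \<psi> (g t))"
    using e by (auto simp: smooth_curve_at_def g_def)
  moreover have "((\<lambda>t. \<psi> (g t)) has_derivative (\<lambda>t. D (t *\<^sub>R d))) (at 0)"
  proof (rule has_derivative_compose[of g])
    show "(g has_derivative (\<lambda>t. t *\<^sub>R d)) (at 0)" unfolding g_def by (auto intro!: derivative_eq_intros)
    show "(\<psi> has_derivative D) (at (g 0))" using assms(3) by (simp add: g_def)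
  qed
  then have "((\<lambda>t. \<psi> (g t)) has_vector_derivative v) (at 0)"
    using d linear_scale[OF has_derivative_linear[OF assms(3)]] by (simp add: has_vector_derivative_def)
  ultimately show "v \<in> tangent_space M (\<psi> z)" unfolding tangent_space_def by blast
qed

lemma open_chart: "open V \<Longrightarrow> V \<subseteq> M \<Longrightarrow> chart V (\<lambda>x. x) M"
  by (rule chartI[where h = "\<lambda>x. x"])
    (auto simp: openin_open intro!: smooth_map_onI[of UNIV])

lemma tangent_space_open: assumes "open M" "p \<in> M" shows "tangent_space M p = UNIV"
  using chart_tangent_space[OF open_chart[OF assms(1) subset_refl] assms(2) has_derivative_ident] by simp

lemma smooth_submanifold_open:
  fixes M :: "'a::euclidean_space set"
  assumes "open M" "d = DIM('a)" shows "smooth_submanifold d M"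
  using assms open_chart[OF assms(1) subset_refl]
  by (intro smooth_submanifoldI[where 'b = 'a]) (auto intro!: exI[of _ M] exI[of _ "\<lambda>x. x"])

section \<open>Manifolds parametrized by an angle\<close>

definition rot :: "real^2 \<Rightarrow> real^2" where
  "rot v = vector [- v $ 2, v $ 1]"

lemma rot_nth [simp]: "rot v $ 1 = - v $ 2" "rot v $ 2 = v $ 1"
  by (simp_all add: rot_def)

lemma circ_nth [simp]: "circ s $ 1 = cos s" "circ s $ 2 = sin s"
  by (simp_all add: circ_def)

lemma vec2_eq_iff: "(x :: real^2) = y \<longleftrightarrow> x $ 1 = y $ 1 \<and> x $ 2 = y $ 2"
  by (simp add: vec_eq_iff forall_2)

lemma inner_vec2: "(x :: real^2) \<bullet> y = x $ 1 * y $ 1 + x $ 2 * y $ 2"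
  by (simp add: inner_vec_def sum_2)

lemma bounded_linear_rot: "bounded_linear rot"
  by (rule linear_conv_bounded_linear[THEN iffD1], unfold_locales) (simp_all add: vec2_eq_iff)

lemma rot_arith [simp]: "rot (x + y) = rot x + rot y" "rot (x - y) = rot x - rot y" "rot (- x) = - rot x"
    "rot (c *\<^sub>R x) = c *\<^sub>R rot x" "rot (rot x) = - x" "rot 0 = 0"
  by (simp_all add: vec2_eq_iff)

lemma inner_rot [simp]: "x \<bullet> rot x = 0" "rot x \<bullet> x = 0" "rot x \<bullet> rot y = x \<bullet> y"
  by (simp_all add: inner_vec2)

lemma norm_rot [simp]: "norm (rot x) = norm x"
  by (simp add: norm_eq_sqrt_inner)

lemma rot_eq_0_iff [simp]: "rot x = 0 \<longleftrightarrow> x = 0"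
  by (auto simp: vec2_eq_iff)

lemma inner_frame:
  assumes "norm (q::real^2) = 1" shows "x \<bullet> y = (x \<bullet> q) * (y \<bullet> q) + (x \<bullet> rot q) * (y \<bullet> rot q)"
proof -
  have "q \<bullet> q = 1" using assms by (simp add: norm_eq_1)
  then have h: "q $ 1 * q $ 1 + q $ 2 * q $ 2 = 1" by (simp add: inner_vec2)
  have "(x \<bullet> q) * (y \<bullet> q) + (x \<bullet> rot q) * (y \<bullet> rot q) =
    (x $ 1 * y $ 1 + x $ 2 * y $ 2) * (q $ 1 * q $ 1 + q $ 2 * q $ 2)"
    unfolding inner_vec2 rot_nth by algebra
  then show ?thesis using h by (simp add: inner_vec2)
qed

lemma vec_frame:
  assumes "norm (q::real^2) = 1" shows "x = (x \<bullet> q) *\<^sub>R q + (x \<bullet> rot q) *\<^sub>R rot q"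
proof (rule vector_eq_ldot[THEN iffD1], rule allI)
  fix y show "y \<bullet> x = y \<bullet> ((x \<bullet> q) *\<^sub>R q + (x \<bullet> rot q) *\<^sub>R rot q)"
    using inner_frame[OF assms, of y x] by (simp add: inner_add_right algebra_simps)
qed

lemma circ_shift: "circ (s + pi / 2) = rot (circ s)"
  by (simp add: vec2_eq_iff cos_add sin_add)

lemma circ_add: "circ (s + t) = cos t *\<^sub>R circ s + sin t *\<^sub>R rot (circ s)"
  by (simp add: vec2_eq_iff cos_add sin_add algebra_simps)

lemma circ_diff: "circ (s - t) = cos t *\<^sub>R circ s - sin t *\<^sub>R rot (circ s)"
  by (simp add: vec2_eq_iff cos_diff sin_diff algebra_simps)

lemma circ_eq_iff: "circ s = circ t \<longleftrightarrow> (\<exists>n::int. s = t + 2 * pi * n)"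
  using sin_cos_eq_iff[of s t] by (auto simp: vec2_eq_iff)

lemma circ_surj: assumes "norm q = 1" obtains s where "0 \<le> s" "s < 2 * pi" "q = circ s"
proof -
  have "q \<bullet> q = 1" using assms by (simp add: norm_eq_1)
  then have "(q $ 1)\<^sup>2 + (q $ 2)\<^sup>2 = 1" by (simp add: inner_vec2 power2_eq_square)
  then obtain t where "0 \<le> t" "t < 2 * pi" "q $ 1 = cos t" "q $ 2 = sin t" by (rule sincos_total_2pi)
  then show ?thesis by (intro that[of t]) (auto simp: vec2_eq_iff)
qed

lemma circ_eq_close: assumes "circ s = circ t" "\<bar>s - t\<bar> < 2 * pi" shows "s = t"
proof -
  obtain n :: int where n: "s = t + 2 * pi * n" using assms(1) circ_eq_iff by blast
  then have "2 * pi * \<bar>real_of_int n\<bar> < 2 * pi * 1" using assms(2) by (simp add: abs_mult)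
  then have "\<bar>real_of_int n\<bar> < 1" by (simp only: mult_less_cancel_left_pos pi_gt_zero zero_less_mult_iff zero_less_numeral simp_thms)
  then have "n = 0" by linarith
  then show ?thesis using n by simp
qed

lemma smooth_open_rot: "open S \<Longrightarrow> smooth_open S f \<Longrightarrow> smooth_open S (\<lambda>x. rot (f x))"
  by (rule smooth_open_linear_compose[OF bounded_linear_rot])

lemma smooth_open_circ: "open S \<Longrightarrow> smooth_open S f \<Longrightarrow> smooth_open S (\<lambda>x. circ (f x))"
proof -
  assume "open S" "smooth_open S f"
  moreover have "circ (f x) = cos (f x) *\<^sub>R axis 1 1 + sin (f x) *\<^sub>R axis 2 1" for x
    by (simp add: vec2_eq_iff axis_def)
  ultimately show ?thesis by (simp add: smooth_open_arith smooth_open_sin smooth_open_cos)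
qed

lemma circ_has_derivative [derivative_intros]:
  assumes "(f has_derivative f') F" "F = at x within S"
  shows "((\<lambda>y. circ (f y)) has_derivative (\<lambda>v. f' v *\<^sub>R rot (circ (f x)))) F"
proof -
  have e: "circ t = cos t *\<^sub>R axis 1 1 + sin t *\<^sub>R axis 2 1" "rot (circ t) = - sin t *\<^sub>R axis 1 1 + cos t *\<^sub>R axis 2 1" for t
    by (simp_all add: vec2_eq_iff axis_def)
  show ?thesis unfolding e(2) assms(2) unfolding e(1) using assms(1)[unfolded assms(2)]
    by (auto intro!: derivative_eq_intros simp: algebra_simps)
qed

lemma continuous_on_circ [continuous_intros]: "continuous_on S f \<Longrightarrow> continuous_on S (\<lambda>x. circ (f x))"
  by (rule continuous_on_compose2[OF smooth_open_continuous_on[OF smooth_open_circ[OF open_UNIV smooth_open_id]]]) auto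

lemma continuous_on_rot [continuous_intros]: "continuous_on S f \<Longrightarrow> continuous_on S (\<lambda>x. rot (f x))"
  by (rule bounded_linear.continuous_on[OF bounded_linear_rot])

lemma circ_measurable [measurable]: "circ \<in> borel_measurable borel"
  by (intro borel_measurable_continuous_onI continuous_intros)

section \<open>Integration over a period\<close>

lemma nn_integral_translate:
  fixes f :: "'a::euclidean_space \<Rightarrow> ennreal"
  assumes "f \<in> borel_measurable borel"
  shows "(\<integral>\<^sup>+z. f (z + c) \<partial>lborel) = (\<integral>\<^sup>+z. f z \<partial>lborel)"
proof -
  have "(\<integral>\<^sup>+z. f z \<partial>lborel) = (\<integral>\<^sup>+z. f z \<partial>distr lborel borel ((+) c))" by (simp add: lborel_distr_plus)
  also have "\<dots> = (\<integral>\<^sup>+z. f (z + c) \<partial>lborel)"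
    using assms by (subst nn_integral_distr) (auto simp: add.commute)
  finally show ?thesis by simp
qed

text \<open>For starting points at most a period apart, the piece cut off at one end is translated
  by a period to the other end. Whole periods are translated away beforehand.\<close>

lemma nn_integral_period:
  fixes F :: "'a::euclidean_space \<Rightarrow> ennreal"
  assumes F: "F \<in> borel_measurable borel" and e: "e \<bullet> e = 1" and per: "\<And>z. F (z + (2 * pi) *\<^sub>R e) = F z"
  shows "(\<integral>\<^sup>+z. indicator {c..<c + 2 * pi} (z \<bullet> e) * F z \<partial>lborel) =
    (\<integral>\<^sup>+z. indicator {d..<d + 2 * pi} (z \<bullet> e) * F z \<partial>lborel)"
proof -
  define P where "P c = (\<integral>\<^sup>+z. indicator {c..<c + 2 * pi} (z \<bullet> e) * F z \<partial>lborel)" for c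
  have m [measurable]: "F \<in> borel_measurable borel" by fact
  have shift: "(\<integral>\<^sup>+z. indicator {a + 2 * pi..<b + 2 * pi} (z \<bullet> e) * F z \<partial>lborel) =
      (\<integral>\<^sup>+z. indicator {a..<b} (z \<bullet> e) * F z \<partial>lborel)" for a b
  proof -
    have "(\<integral>\<^sup>+z. indicator {a + 2 * pi..<b + 2 * pi} (z \<bullet> e) * F z \<partial>lborel) =
      (\<integral>\<^sup>+z. indicator {a + 2 * pi..<b + 2 * pi} ((z + (2 * pi) *\<^sub>R e) \<bullet> e) * F (z + (2 * pi) *\<^sub>R e) \<partial>lborel)"
      by (rule nn_integral_translate[symmetric]) measurable
    also have "\<dots> = (\<integral>\<^sup>+z. indicator {a..<b} (z \<bullet> e) * F z \<partial>lborel)"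
      by (intro nn_integral_cong) (auto simp: per inner_add_left e indicator_def)
    finally show ?thesis .
  qed
  have P_shift: "P (c + 2 * pi) = P c" for c using shift[of c "c + 2 * pi"] by (simp add: P_def)
  have P_nat: "P (c + 2 * pi * real n) = P c" for c n
  proof (induction n)
    case (Suc n)
    then show ?case using P_shift[of "c + 2 * pi * real n"] by (simp add: algebra_simps)
  qed simp
  have P_int: "P (c + 2 * pi * of_int k) = P c" for c and k :: int
  proof (cases "k \<ge> 0")
    case True then show ?thesis using P_nat[of c "nat k"] by simp
  next
    case False then show ?thesis using P_nat[of "c + 2 * pi * of_int k" "nat (- k)"] by simp
  qed
  have close: "P c = P d" if "c \<le> d" "d \<le> c + 2 * pi" for c d
  proof -
    have "P c = (\<integral>\<^sup>+z. indicator {c..<d} (z \<bullet> e) * F z + indicator {d..<c + 2 * pi} (z \<bullet> e) * F z \<partial>lborel)"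
      unfolding P_def by (intro nn_integral_cong) (use that in \<open>auto simp: indicator_def\<close>)
    also have "\<dots> = (\<integral>\<^sup>+z. indicator {c..<d} (z \<bullet> e) * F z \<partial>lborel) + (\<integral>\<^sup>+z. indicator {d..<c + 2 * pi} (z \<bullet> e) * F z \<partial>lborel)"
      by (rule nn_integral_add) measurable
    also have "\<dots> = (\<integral>\<^sup>+z. indicator {c + 2 * pi..<d + 2 * pi} (z \<bullet> e) * F z \<partial>lborel) + (\<integral>\<^sup>+z. indicator {d..<c + 2 * pi} (z \<bullet> e) * F z \<partial>lborel)"
      by (simp only: shift)
    also have "\<dots> = (\<integral>\<^sup>+z. indicator {c + 2 * pi..<d + 2 * pi} (z \<bullet> e) * F z + indicator {d..<c + 2 * pi} (z \<bullet> e) * F z \<partial>lborel)"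
      by (rule nn_integral_add[symmetric]) measurable
    also have "\<dots> = P d"
      unfolding P_def by (intro nn_integral_cong) (use that in \<open>auto simp: indicator_def\<close>)
    finally show ?thesis .
  qed
  \<comment> \<open>The number of whole periods from \<open>c\<close> to \<open>d\<close>; the
    remainder lies in [0, 2\<pi>) and is handled by \<open>close\<close>.\<close>
  define k where "k = \<lfloor>(d - c) / (2 * pi)\<rfloor>"
  have "of_int k \<le> (d - c) / (2 * pi)" "(d - c) / (2 * pi) < of_int k + 1" by (simp_all add: k_def)
  then have "2 * pi * of_int k \<le> d - c" "d - c < 2 * pi * of_int k + 2 * pi"
    by (simp_all add: field_simps)
  then have "P (c + 2 * pi * of_int k) = P d" by (intro close) auto
  then show ?thesis using P_int by (simp add: P_def)
qed

text \<open>A parametrization that is \<open>2\<pi>\<close>-periodic in the coordinate \<open>e\<close>: \<open>Q\<close> reads off the point of the circle,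
  and \<open>K\<close> recovers all coordinates from the angle and the image point.\<close>

locale circle_param =
  fixes \<Psi> :: "'b::euclidean_space \<Rightarrow> 'a::euclidean_space" and V0 :: "'b set" and e :: 'b
    and U :: "'a set" and Q :: "'a \<Rightarrow> real^2" and K :: "real \<times> 'a \<Rightarrow> 'b"
  assumes e: "e \<in> Basis" and V0: "open V0" and V0_shift: "\<And>z t. z \<in> V0 \<Longrightarrow> z + t *\<^sub>R e \<in> V0"
    and \<Psi>_shift: "\<And>z t. z \<in> V0 \<Longrightarrow> circ (z \<bullet> e + t) = circ (z \<bullet> e) \<Longrightarrow> \<Psi> (z + t *\<^sub>R e) = \<Psi> z"
    and \<Psi>_smooth: "smooth_open V0 \<Psi>" and U: "open U" "\<Psi> ` V0 \<subseteq> U"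
    and Q: "smooth_open U Q" "\<And>z. z \<in> V0 \<Longrightarrow> Q (\<Psi> z) = circ (z \<bullet> e)"
    and K: "smooth_open (UNIV \<times> U) K" "\<And>z. z \<in> V0 \<Longrightarrow> K (z \<bullet> e, \<Psi> z) = z"
begin

text \<open>Half-width \<pi>/2 makes the window visible on the image, as the set where the point of
  the circle has positive inner product with the centre, and keeps the angle within the range of
  \<open>arcsin\<close>.\<close>

definition window :: "'b \<Rightarrow> 'b set" where "window z0 = {z \<in> V0. \<bar>z \<bullet> e - z0 \<bullet> e\<bar> < pi / 2}"

lemma open_window: "open (window z0)"
proof -
  have "window z0 = V0 \<inter> {z. \<bar>z \<bullet> e - z0 \<bullet> e\<bar> < pi / 2}" by (auto simp: window_def)
  moreover have "open {z. \<bar>z \<bullet> e - z0 \<bullet> e\<bar> < pi / 2}"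
    by (intro open_Collect_less continuous_intros)
  ultimately show ?thesis using V0 by auto
qed

lemma inj_window: assumes "z \<in> V0" "z' \<in> V0" "\<Psi> z = \<Psi> z'" "\<bar>z \<bullet> e - z' \<bullet> e\<bar> < 2 * pi" shows "z = z'"
proof -
  have "circ (z \<bullet> e) = circ (z' \<bullet> e)" using Q(2) assms by metis
  then have "z \<bullet> e = z' \<bullet> e" using assms(4) circ_eq_close by blast
  then show ?thesis using K(2) assms by metis
qed

text \<open>This exhibits the image of a window as relatively open. For the inclusion from right to
  left, the parameter \<open>z\<close> may be many turns away from \<open>z0\<close>; it is moved
  back along \<open>e\<close> by a multiple of 2\<pi>, which leaves its image unchanged.\<close>

lemma image_window: "\<Psi> ` window z0 = \<Psi> ` V0 \<inter> {m \<in> U. 0 < Q m \<bullet> circ (z0 \<bullet> e)}"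
proof (intro equalityI subsetI)
  fix m assume "m \<in> \<Psi> ` window z0"
  then obtain z where z: "z \<in> V0" "\<bar>z \<bullet> e - z0 \<bullet> e\<bar> < pi / 2" "m = \<Psi> z" by (auto simp: window_def)
  have "0 < cos (z \<bullet> e - z0 \<bullet> e)" by (rule cos_gt_zero_pi) (use z(2) in linarith)+
  then show "m \<in> \<Psi> ` V0 \<inter> {m \<in> U. 0 < Q m \<bullet> circ (z0 \<bullet> e)}"
    using z U(2) Q(2) by (auto simp: inner_vec2 cos_diff)
next
  fix m assume "m \<in> \<Psi> ` V0 \<inter> {m \<in> U. 0 < Q m \<bullet> circ (z0 \<bullet> e)}"
  then obtain z where z: "z \<in> V0" "m = \<Psi> z" "0 < Q m \<bullet> circ (z0 \<bullet> e)" by auto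
  define d where "d = z \<bullet> e - z0 \<bullet> e"
  have c: "0 < cos d" using z Q(2) by (simp add: d_def inner_vec2 cos_diff)
  \<comment> \<open>The representative of \<open>d\<close> modulo 2\<pi> in (-\<pi>/2, \<pi>/2): it
    has the same sine by construction and the same cosine because \<open>cos d\<close> is
    positive.\<close>
  define a where "a = arcsin (sin d)"
  have ab: "\<bar>a\<bar> < pi / 2" "sin a = sin d" "cos a = cos d"
  proof -
    show "sin a = sin d" by (simp add: a_def)
    have "cos a = sqrt (1 - (sin d)\<^sup>2)" unfolding a_def by (rule cos_arcsin) auto
    also have "\<dots> = cos d" using c by (simp add: cos_squared_eq[symmetric])
    finally show "cos a = cos d" .
    have "(sin d)\<^sup>2 < 1" using c sin_cos_squared_add[of d] zero_less_power[OF c, of 2] by linarith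
    then have "\<bar>sin d\<bar> < 1" by (simp add: abs_square_less_1)
    then show "\<bar>a\<bar> < pi / 2" unfolding a_def using arcsin_lt_bounded[of "sin d"] by (auto simp: abs_less_iff)
  qed
  define t where "t = a - d"
  have "circ (z \<bullet> e + t) = circ (z0 \<bullet> e + a)" by (simp add: t_def d_def add.commute)
  also have "\<dots> = circ (z0 \<bullet> e + d)" using ab by (simp add: circ_add)
  finally have ct: "circ (z \<bullet> e + t) = circ (z \<bullet> e)" by (simp add: d_def)
  have "(z + t *\<^sub>R e) \<bullet> e - z0 \<bullet> e = a" using e by (simp add: inner_add_left t_def d_def)
  then have "z + t *\<^sub>R e \<in> window z0" using V0_shift[OF z(1)] ab(1) by (simp add: window_def)
  then show "m \<in> \<Psi> ` window z0" using \<Psi>_shift[OF z(1) ct] z(2) by (metis imageI)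
qed

lemma chart_window: "chart (window z0) \<Psi> (\<Psi> ` V0)"
proof -
  let ?U = "{m \<in> U. 0 < Q m \<bullet> circ (z0 \<bullet> e)}"
  let ?W = "{m \<in> U. \<bar>Q m \<bullet> rot (circ (z0 \<bullet> e))\<bar> < 1}"
  have cQ: "continuous_on U Q" using Q(1) by (rule smooth_open_continuous_on)
  have "open (U \<inter> (\<lambda>m. Q m \<bullet> circ (z0 \<bullet> e)) -` {0<..})"
    by (rule continuous_open_preimage) (auto intro!: continuous_intros cQ U)
  then have oU: "open ?U" by (simp add: vimage_def Int_def)
  have "open (U \<inter> (\<lambda>m. \<bar>Q m \<bullet> rot (circ (z0 \<bullet> e))\<bar>) -` {..<1})"
    by (rule continuous_open_preimage) (auto intro!: continuous_intros cQ U)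
  then have oW: "open ?W" by (simp add: vimage_def Int_def)
  \<comment> \<open>On the window the inner product of \<open>Q m\<close> with the rotated centre is
    \<open>sin (z \<bullet> e - z0 \<bullet> e)\<close>; \<open>arcsin\<close> recovers the angle
    from it and \<open>K\<close> the remaining coordinates.\<close>
  let ?h = "\<lambda>m. K (z0 \<bullet> e + arcsin (Q m \<bullet> rot (circ (z0 \<bullet> e))), m)"
  show ?thesis
  proof (rule chartI[OF open_window, where h = ?h])
    show "openin (top_of_set (\<Psi> ` V0)) (\<Psi> ` window z0)"
      unfolding image_window using oU by (auto simp: openin_open)
    show "smooth_open (window z0) \<Psi>" by (rule smooth_open_mono[OF \<Psi>_smooth]) (auto simp: window_def)
    have "smooth_open ?W Q" by (rule smooth_open_mono[OF Q(1)]) auto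
    then have a: "smooth_open ?W (\<lambda>m. arcsin (Q m \<bullet> rot (circ (z0 \<bullet> e))))"
      by (intro smooth_open_arcsin oW smooth_open_arith) auto
    have "smooth_open ?W ?h"
      by (rule smooth_open_compose[OF K(1)]) (auto intro!: smooth_open_arith a oW open_Times U)
    moreover have lt: "\<bar>sin (z \<bullet> e - z0 \<bullet> e)\<bar> < 1" if "z \<in> window z0" for z
    proof -
      have "\<bar>z \<bullet> e - z0 \<bullet> e\<bar> < pi / 2" using that by (simp add: window_def)
      then have "0 < cos (z \<bullet> e - z0 \<bullet> e)" by (intro cos_gt_zero_pi) linarith+
      then have "(sin (z \<bullet> e - z0 \<bullet> e))\<^sup>2 < 1"
        using sin_cos_squared_add[of "z \<bullet> e - z0 \<bullet> e"] zero_less_power[of "cos (z \<bullet> e - z0 \<bullet> e)" 2] by linarith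
      then show ?thesis by (simp add: abs_square_less_1)
    qed
    have Qr: "Q (\<Psi> z) \<bullet> rot (circ (z0 \<bullet> e)) = sin (z \<bullet> e - z0 \<bullet> e)" if "z \<in> window z0" for z
      using that Q(2)[of z] by (simp add: window_def inner_vec2 sin_diff)
    have "\<Psi> ` window z0 \<subseteq> ?W" using lt Qr U(2) by (auto simp: window_def)
    ultimately show "smooth_map_on (\<Psi> ` window z0) ?h" by (intro smooth_map_onI[OF _ oW]) auto
    show "?h (\<Psi> z) = z" if "z \<in> window z0" for z
    proof -
      have "arcsin (Q (\<Psi> z) \<bullet> rot (circ (z0 \<bullet> e))) = z \<bullet> e - z0 \<bullet> e"
        unfolding Qr[OF that] by (rule arcsin_sin) (use that in \<open>unfold window_def mem_Collect_eq, linarith\<close>)+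
      then show ?thesis using K(2)[of z] that by (simp add: window_def)
    qed
  qed
qed

lemma window_mem: "z \<in> V0 \<Longrightarrow> z \<in> window z" by (simp add: window_def)

lemma submanifold: "DIM('b) \<le> DIM('a) \<Longrightarrow> d = DIM('b) \<Longrightarrow> smooth_submanifold d (\<Psi> ` V0)"
  using chart_window window_mem by (intro smooth_submanifoldI[where 'b = 'b]) blast+

lemma tangent:
  assumes "z \<in> V0" "(\<Psi> has_derivative D) (at z)" shows "tangent_space (\<Psi> ` V0) (\<Psi> z) = range D"
  by (rule chart_tangent_space[OF chart_window window_mem assms(2)]) fact

text \<open>\<open>\<Psi>\<close> covers its image once per period, so the density is restricted to
  one half-open period, which counts every point of the image exactly once.\<close>

definition push :: "('b \<Rightarrow> real) \<Rightarrow> 'a measure" where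
  "push \<rho> = distr (density lborel (\<lambda>z. indicator V0 z * indicator {0..<2*pi} (z \<bullet> e) * ennreal (\<rho> z))) borel \<Psi>"

text \<open>A window may straddle the cut of the period at 0. By periodicity the period of
  integration is replaced by the one centred at the window, where \<open>\<Psi>\<close> takes each
  value once and \<open>B\<close> lies inside.\<close>

lemma smooth_measure_push:
  assumes dim: "DIM('b) \<le> DIM('a)" and M: "\<Psi> ` V0 \<in> sets borel"
    and \<Psi>m: "\<Psi> \<in> borel_measurable borel" and \<rho>m: "\<rho> \<in> borel_measurable borel"
    and \<rho>: "smooth_open V0 \<rho>" "\<And>z. z \<in> V0 \<Longrightarrow> \<rho> z > 0"
    and \<rho>s: "\<And>z t. z \<in> V0 \<Longrightarrow> circ (z \<bullet> e + t) = circ (z \<bullet> e) \<Longrightarrow> \<rho> (z + t *\<^sub>R e) = \<rho> z"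
  shows "smooth_measure (\<Psi> ` V0) (push \<rho>)"
proof (rule smooth_measureI[OF M _ _ dim])
  have [measurable]: "\<Psi> \<in> borel_measurable borel" "\<rho> \<in> borel_measurable borel" "V0 \<in> sets borel"
    using assms V0 by auto
  have d [measurable]: "(\<lambda>z. indicator V0 z * indicator {0..<2*pi} (z \<bullet> e) * ennreal (\<rho> z)) \<in> borel_measurable lborel" by measurable
  show "sets (push \<rho>) = sets borel" by (simp add: push_def)
  have em: "emeasure (push \<rho>) A = (\<integral>\<^sup>+z. indicator {0..<2*pi} (z \<bullet> e) * (indicator V0 z * ennreal (\<rho> z) * indicator A (\<Psi> z)) \<partial>lborel)"
    if [measurable]: "A \<in> sets borel" for A
  proof -
    have "\<Psi> -` A \<in> sets borel" using measurable_sets_borel[of \<Psi> borel A] by simp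
    then show ?thesis
      unfolding push_def
      by (subst emeasure_distr) (auto simp: emeasure_density indicator_def intro!: nn_integral_cong)
  qed
  show "emeasure (push \<rho>) (- \<Psi> ` V0) = 0"
  proof -
    have "emeasure (push \<rho>) (- \<Psi> ` V0) = (\<integral>\<^sup>+z. 0 \<partial>(lborel :: 'b measure))"
      using M by (subst em) (auto intro!: nn_integral_cong simp: indicator_def simp del: nn_integral_const)
    then show ?thesis by simp
  qed
  fix p assume "p \<in> \<Psi> ` V0"
  then obtain z0 where z0: "z0 \<in> V0" "p = \<Psi> z0" by auto
  let ?V = "window z0"
  have VV: "?V \<subseteq> V0" by (auto simp: window_def)
  have "emeasure (push \<rho>) (\<Psi> ` B) = (\<integral>\<^sup>+z\<in>B. ennreal (\<rho> z) \<partial>lborel)" if B: "B \<in> sets borel" "B \<subseteq> ?V" for B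
  proof -
    have "chart ?V \<Psi> (\<Psi> ` V0)" by (rule chart_window)
    then obtain h where h: "openin (top_of_set (\<Psi> ` V0)) (\<Psi> ` ?V)" "diffeo ?V (\<Psi> ` ?V) \<Psi> h"
      unfolding chart_def by blast
    then have phis_deriv: "smooth_map_on (\<Psi> ` ?V) h" "\<And>z. z \<in> ?V \<Longrightarrow> h (\<Psi> z) = z" by (auto simp: diffeo_def)
    have mV: "\<Psi> ` ?V \<in> sets borel" using h(1) M by (auto simp: openin_open)
    have mh: "(\<lambda>m. if m \<in> \<Psi> ` ?V then h m else 0) \<in> borel_measurable borel"
      by (rule borel_measurable_continuous_on_if[OF mV smooth_map_on_continuous_on[OF phis_deriv(1)]]) auto
    have "\<Psi> ` B = \<Psi> ` ?V \<inter> (\<lambda>m. if m \<in> \<Psi> ` ?V then h m else 0) -` B"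
      using phis_deriv(2) B(2) by (auto intro!: image_eqI)
    then have mB [measurable]: "\<Psi> ` B \<in> sets borel" using mV measurable_sets_borel[OF mh B(1)] by auto
    let ?F = "\<lambda>z. indicator V0 z * ennreal (\<rho> z) * indicator (\<Psi> ` B) (\<Psi> z)"
    have e1: "e \<bullet> e = 1" using e by simp
    have per: "?F (z + (2 * pi) *\<^sub>R e) = ?F z" for z
    proof -
      have c: "circ (z \<bullet> e + 2 * pi) = circ (z \<bullet> e)" by (simp add: vec2_eq_iff)
      have "z \<in> V0 \<longleftrightarrow> z + (2 * pi) *\<^sub>R e \<in> V0"
        using V0_shift[of z "2 * pi"] V0_shift[of "z + (2 * pi) *\<^sub>R e" "- 2 * pi"] by auto
      then show ?thesis using \<Psi>_shift[OF _ c] \<rho>s[OF _ c] by (auto simp: indicator_def)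
    qed
    have Fm: "?F \<in> borel_measurable borel" by measurable
    have "emeasure (push \<rho>) (\<Psi> ` B) = (\<integral>\<^sup>+z. indicator {0..<0 + 2*pi} (z \<bullet> e) * ?F z \<partial>lborel)"
      by (subst em) (auto simp: mB)
    also have "\<dots> = (\<integral>\<^sup>+z. indicator {z0 \<bullet> e - pi..<z0 \<bullet> e - pi + 2*pi} (z \<bullet> e) * ?F z \<partial>lborel)"
      by (rule nn_integral_period[OF Fm e1 per])
    also have "\<dots> = (\<integral>\<^sup>+z\<in>B. ennreal (\<rho> z) \<partial>lborel)"
    proof (rule nn_integral_cong)
      fix z
      have "z \<in> B" if zz: "z \<in> V0" "z0 \<bullet> e - pi \<le> z \<bullet> e" "z \<bullet> e < z0 \<bullet> e + pi" "\<Psi> z \<in> \<Psi> ` B"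
      proof -
        obtain b where b: "b \<in> B" "\<Psi> z = \<Psi> b" using zz(4) by auto
        have bw: "b \<in> V0" "\<bar>b \<bullet> e - z0 \<bullet> e\<bar> < pi / 2" using b B(2) by (auto simp: window_def)
        have "z = b" by (rule inj_window[OF zz(1) bw(1) b(2)]) (use zz(2,3) bw(2) in linarith)
        then show ?thesis using b by simp
      qed
      moreover have "z \<in> V0 \<and> z0 \<bullet> e - pi \<le> z \<bullet> e \<and> z \<bullet> e < z0 \<bullet> e + pi" if "z \<in> B"
      proof -
        have "z \<in> V0" "\<bar>z \<bullet> e - z0 \<bullet> e\<bar> < pi / 2" using that B(2) by (auto simp: window_def)
        then show ?thesis using pi_gt_zero by (intro conjI) linarith+
      qed
      ultimately show "indicator {z0 \<bullet> e - pi..<z0 \<bullet> e - pi + 2*pi} (z \<bullet> e) * ?F z = ennreal (\<rho> z) * indicator B z"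
        by (auto simp: indicator_def)
    qed
    finally show ?thesis .
  qed
  then show "\<exists>V \<psi> \<rho>'. chart V (\<psi> :: 'b \<Rightarrow> 'a) (\<Psi> ` V0) \<and> p \<in> \<psi> ` V \<and>
     smooth_open V \<rho>' \<and> (\<forall>z\<in>V. \<rho>' z > 0) \<and>
     (\<forall>B\<in>sets borel. B \<subseteq> V \<longrightarrow> emeasure (push \<rho>) (\<psi> ` B) = (\<integral>\<^sup>+z\<in>B. ennreal (\<rho>' z) \<partial>lborel))"
    using chart_window[of z0] z0 window_mem[OF z0(1)] smooth_open_mono[OF \<rho>(1) VV] \<rho>(2) VV
    by (intro exI[of _ ?V] exI[of _ \<Psi>] exI[of _ \<rho>]) blast
qed

lemma push_integral:
  fixes f :: "'a \<Rightarrow> 'c::{banach, second_countable_topology}"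
  assumes [measurable]: "\<Psi> \<in> borel_measurable borel" "\<rho> \<in> borel_measurable borel" "f \<in> borel_measurable borel"
    and pos: "\<And>z. z \<in> V0 \<Longrightarrow> \<rho> z \<ge> 0"
  shows "(\<integral>m. f m \<partial>push \<rho>) = (\<integral>z. (indicator V0 z * indicator {0..<2*pi} (z \<bullet> e) * \<rho> z) *\<^sub>R f (\<Psi> z) \<partial>lborel)"
    "integrable (push \<rho>) f \<longleftrightarrow> integrable lborel (\<lambda>z. (indicator V0 z * indicator {0..<2*pi} (z \<bullet> e) * \<rho> z) *\<^sub>R f (\<Psi> z))"
proof -
  have [measurable]: "V0 \<in> sets borel" using V0 by auto
  have "(\<lambda>z. indicator V0 z * indicator {0..<2*pi} (z \<bullet> e) * ennreal (\<rho> z)) =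
    (\<lambda>z. ennreal (indicator V0 z * indicator {0..<2*pi} (z \<bullet> e) * \<rho> z))"
    by (auto simp: indicator_def)
  then have p: "push \<rho> = distr (density lborel (\<lambda>z. ennreal (indicator V0 z * indicator {0..<2*pi} (z \<bullet> e) * \<rho> z))) borel \<Psi>"
    by (simp add: push_def)
  have nn: "0 \<le> indicator V0 z * indicator {0..<2*pi} (z \<bullet> e) * \<rho> z" for z
    using pos by (auto simp: indicator_def)
  show "(\<integral>m. f m \<partial>push \<rho>) = (\<integral>z. (indicator V0 z * indicator {0..<2*pi} (z \<bullet> e) * \<rho> z) *\<^sub>R f (\<Psi> z) \<partial>lborel)"
    unfolding p by (subst integral_distr, measurable, subst integral_density, auto simp: nn)
  show "integrable (push \<rho>) f \<longleftrightarrow> integrable lborel (\<lambda>z. (indicator V0 z * indicator {0..<2*pi} (z \<bullet> e) * \<rho> z) *\<^sub>R f (\<Psi> z))"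
    unfolding p by (subst integrable_distr_eq, measurable, subst integrable_density, auto simp: nn)
qed

end

text \<open>Only the part of \<open>f'\<close> orthogonal to the unit vector turns it, at the rate
  one over the norm.\<close>

lemma sgn_has_derivative:
  fixes f :: "'a::real_normed_vector \<Rightarrow> 'b::real_inner"
  assumes "(f has_derivative f') (at x within S)" "f x \<noteq> 0"
  shows "((\<lambda>y. sgn (f y)) has_derivative
    (\<lambda>v. inverse (norm (f x)) *\<^sub>R (f' v - (f' v \<bullet> sgn (f x)) *\<^sub>R sgn (f x)))) (at x within S)"
proof -
  have n: "((\<lambda>y. norm (f y)) has_derivative (\<lambda>v. f' v \<bullet> sgn (f x))) (at x within S)"
    using has_derivative_compose[OF assms(1) has_derivative_norm[OF assms(2)]] by (simp add: inner_commute)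
  have "((\<lambda>y. inverse (norm (f y))) has_derivative (\<lambda>v. - (inverse (norm (f x)) * (f' v \<bullet> sgn (f x)) * inverse (norm (f x))))) (at x within S)"
    by (rule Deriv.has_derivative_inverse[OF _ n]) (use assms(2) in auto)
  from has_derivative_scaleR[OF this assms(1)] assms(2)
  show ?thesis unfolding sgn_div_norm by (simp add: algebra_simps divide_inverse)
qed

lemma smooth_open_sgn:
  fixes f :: "'a::real_normed_vector \<Rightarrow> 'b::real_inner"
  assumes "open S" "smooth_open S f" "\<And>x. x \<in> S \<Longrightarrow> f x \<noteq> 0"
  shows "smooth_open S (\<lambda>x. sgn (f x))"
  unfolding sgn_div_norm by (intro smooth_open_scaleR smooth_open_inverse smooth_open_norm assms) (use assms(3) in auto)

lemma vec2_orthogonal: assumes "(v :: real^2) \<bullet> w = 0" "w \<noteq> 0" obtains c where "v = c *\<^sub>R rot w"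
proof -
  have q: "norm (sgn w) = 1" using assms(2) by (simp add: norm_sgn)
  have "v \<bullet> sgn w = 0" using assms(1) by (simp add: sgn_div_norm)
  then have "v = (v \<bullet> rot (sgn w)) *\<^sub>R rot (sgn w)" using vec_frame[OF q, of v] by simp
  then show ?thesis by (intro that[of "(v \<bullet> rot (sgn w)) * inverse (norm w)"]) (simp add: sgn_div_norm)
qed

section \<open>Geometry of the ellipses\<close>

locale elliptic_radon =
  fixes \<alpha> :: real
  assumes \<alpha>: "0 < \<alpha>" "\<alpha> < pi / 2"
begin

definition a where "a = sin \<alpha>"
definition b where "b = cos \<alpha>"

lemma ab: "0 < a" "0 < b" "a < 1" "b < 1" "a\<^sup>2 + b\<^sup>2 = 1"
proof -
  show p: "0 < a" "0 < b" unfolding a_def b_def using \<alpha> by (auto intro!: sin_gt_zero cos_gt_zero)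
  show s: "a\<^sup>2 + b\<^sup>2 = 1" by (simp add: a_def b_def)
  have "a\<^sup>2 < 1\<^sup>2" "b\<^sup>2 < 1\<^sup>2" using s zero_less_power[OF p(1), of 2] zero_less_power[OF p(2), of 2] by (simp_all, linarith+)
  then show "a < 1" "b < 1" using power_less_imp_less_base[of a 2 1] power_less_imp_less_base[of b 2 1] by auto
qed

text \<open>Everything is expressed through the unit vector \<open>q = circ s\<close>, which makes periodicity in \<open>s\<close>
  automatic: \<open>phi q x\<close> is the focal sum, \<open>grad\<close> its gradient in \<open>x\<close> and \<open>phis\<close> its derivative in \<open>s\<close>.\<close>

definition gam1 where "gam1 q = b *\<^sub>R q - a *\<^sub>R rot q"
definition gam2 where "gam2 q = b *\<^sub>R q + a *\<^sub>R rot q"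

definition phi where "phi q x = norm (x - gam1 q) + norm (x - gam2 q)"
definition grad where "grad q x = sgn (x - gam1 q) + sgn (x - gam2 q)"
definition phis where "phis q x = - (sgn (x - gam1 q) \<bullet> rot (gam1 q)) - sgn (x - gam2 q) \<bullet> rot (gam2 q)"

definition Reg where "Reg = {p :: (real^2) \<times> (real^2). snd p \<noteq> gam1 (fst p) \<and> snd p \<noteq> gam2 (fst p)}"

lemma gamma_T_eq: "gamma_T \<alpha> s = gam1 (circ s)" and gamma_R_eq: "gamma_R \<alpha> s = gam2 (circ s)"
  by (simp_all add: gamma_T_def gamma_R_def gam1_def gam2_def circ_add circ_diff a_def b_def)

lemma focal_sum_eq: "focal_sum \<alpha> s x = phi (circ s) x"
  by (simp add: focal_sum_def phi_def gamma_T_eq gamma_R_eq)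

lemma disc_eq: "disc \<alpha> = ball 0 b" by (simp add: disc_def b_def)

lemma norm_gam [simp]: "norm (gam1 q) = norm q" "norm (gam2 q) = norm q"
proof -
  have "gam1 q \<bullet> gam1 q = (a\<^sup>2 + b\<^sup>2) * (q \<bullet> q)" "gam2 q \<bullet> gam2 q = (a\<^sup>2 + b\<^sup>2) * (q \<bullet> q)"
    by (simp_all add: gam1_def gam2_def inner_diff_left inner_diff_right inner_add_left inner_add_right power2_eq_square algebra_simps)
  then show "norm (gam1 q) = norm q" "norm (gam2 q) = norm q" using ab(5) by (simp_all add: norm_eq_sqrt_inner)
qed

lemma bounded_linear_gam: "bounded_linear gam1" "bounded_linear gam2"
  unfolding gam1_def gam2_def
  by (intro bounded_linear_sub bounded_linear_add bounded_linear_scaleR_const[OF bounded_linear_ident, unfolded id_def]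
      bounded_linear_compose[OF bounded_linear_scaleR_right] bounded_linear_ident bounded_linear_rot)+

lemma smooth_open_gam:
  "open S \<Longrightarrow> smooth_open S f \<Longrightarrow> smooth_open S (\<lambda>x. gam1 (f x))"
  "open S \<Longrightarrow> smooth_open S f \<Longrightarrow> smooth_open S (\<lambda>x. gam2 (f x))"
  by (rule smooth_open_linear_compose[OF bounded_linear_gam(1)] smooth_open_linear_compose[OF bounded_linear_gam(2)]; assumption)+

lemma continuous_on_gam [continuous_intros]:
  "continuous_on S f \<Longrightarrow> continuous_on S (\<lambda>x. gam1 (f x))"
  "continuous_on S f \<Longrightarrow> continuous_on S (\<lambda>x. gam2 (f x))"
  by (rule bounded_linear.continuous_on[OF bounded_linear_gam(1)] bounded_linear.continuous_on[OF bounded_linear_gam(2)]; assumption)+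

lemma continuous_on_phi [continuous_intros]:
  "continuous_on S f \<Longrightarrow> continuous_on S g \<Longrightarrow> continuous_on S (\<lambda>x. phi (f x) (g x))"
  unfolding phi_def by (intro continuous_intros)

lemma open_Reg: "open Reg"
proof -
  have "Reg = {p. snd p \<noteq> gam1 (fst p)} \<inter> {p. snd p \<noteq> gam2 (fst p)}" by (auto simp: Reg_def)
  moreover have "open {p :: (real^2) \<times> (real^2). snd p \<noteq> gam1 (fst p)}" "open {p :: (real^2) \<times> (real^2). snd p \<noteq> gam2 (fst p)}"
    by (intro open_Collect_neq continuous_intros)+
  ultimately show ?thesis by auto
qed

lemma smooth_geom:
  assumes "open S" "smooth_open S f" "smooth_open S g" "\<And>x. x \<in> S \<Longrightarrow> (f x, g x) \<in> Reg"
  shows "smooth_open S (\<lambda>x. phi (f x) (g x))" "smooth_open S (\<lambda>x. grad (f x) (g x))" "smooth_open S (\<lambda>x. phis (f x) (g x))"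
  unfolding phi_def grad_def phis_def
  by (intro smooth_open_add smooth_open_diff smooth_open_minus smooth_open_inner smooth_open_rot smooth_open_gam
      smooth_open_norm smooth_open_sgn assms(1-3); use assms(4) in \<open>auto simp: Reg_def\<close>)+

lemma disc_Reg: assumes "norm q = 1" "x \<in> disc \<alpha>" shows "(q, x) \<in> Reg"
proof -
  have "norm x < 1" using assms(2) ab by (auto simp: disc_eq)
  moreover have "norm (gam1 q) = 1" "norm (gam2 q) = 1" using assms(1) by simp_all
  ultimately have "x \<noteq> gam1 q" "x \<noteq> gam2 q" by auto
  then show ?thesis by (simp add: Reg_def)
qed

lemma phi_has_derivative:
  assumes "(f has_derivative f') (at z within S)" "(g has_derivative g') (at z within S)" "(f z, g z) \<in> Reg"
  shows "((\<lambda>z. phi (f z) (g z)) has_derivative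
    (\<lambda>v. sgn (g z - gam1 (f z)) \<bullet> (g' v - gam1 (f' v)) + sgn (g z - gam2 (f z)) \<bullet> (g' v - gam2 (f' v)))) (at z within S)"
proof -
  have d: "((\<lambda>z. g z - gam1 (f z)) has_derivative (\<lambda>v. g' v - gam1 (f' v))) (at z within S)"
    "((\<lambda>z. g z - gam2 (f z)) has_derivative (\<lambda>v. g' v - gam2 (f' v))) (at z within S)"
    by (intro has_derivative_diff assms bounded_linear.has_derivative[OF bounded_linear_gam(1)] bounded_linear.has_derivative[OF bounded_linear_gam(2)])+
  have "g z - gam1 (f z) \<noteq> 0" "g z - gam2 (f z) \<noteq> 0" using assms(3) by (auto simp: Reg_def)
  then show ?thesis unfolding phi_def
    using has_derivative_add[OF has_derivative_compose[OF d(1) has_derivative_norm] has_derivative_compose[OF d(2) has_derivative_norm]]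
    by (simp add: inner_commute)
qed

lemma grad_has_derivative:
  assumes "(f has_derivative f') (at z within S)" "(g has_derivative g') (at z within S)" "(f z, g z) \<in> Reg"
  defines "P e r v \<equiv> inverse r *\<^sub>R (v - (v \<bullet> e) *\<^sub>R (e :: real^2))"
  shows "((\<lambda>z. grad (f z) (g z)) has_derivative
    (\<lambda>v. P (sgn (g z - gam1 (f z))) (norm (g z - gam1 (f z))) (g' v - gam1 (f' v)) +
         P (sgn (g z - gam2 (f z))) (norm (g z - gam2 (f z))) (g' v - gam2 (f' v)))) (at z within S)"
proof -
  have d: "((\<lambda>z. g z - gam1 (f z)) has_derivative (\<lambda>v. g' v - gam1 (f' v))) (at z within S)"
    "((\<lambda>z. g z - gam2 (f z)) has_derivative (\<lambda>v. g' v - gam2 (f' v))) (at z within S)"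
    by (intro has_derivative_diff assms bounded_linear.has_derivative[OF bounded_linear_gam(1)] bounded_linear.has_derivative[OF bounded_linear_gam(2)])+
  have "g z - gam1 (f z) \<noteq> 0" "g z - gam2 (f z) \<noteq> 0" using assms(3) by (auto simp: Reg_def)
  then show ?thesis unfolding grad_def P_def
    by (intro has_derivative_add sgn_has_derivative d)
qed

lemma phis_has_derivative:
  assumes "(f has_derivative f') (at z within S)" "(g has_derivative g') (at z within S)" "(f z, g z) \<in> Reg"
  defines "P e r v \<equiv> inverse r *\<^sub>R (v - (v \<bullet> e) *\<^sub>R (e :: real^2))"
  shows "((\<lambda>z. phis (f z) (g z)) has_derivative
    (\<lambda>v. - (sgn (g z - gam1 (f z)) \<bullet> rot (gam1 (f' v)) + P (sgn (g z - gam1 (f z))) (norm (g z - gam1 (f z))) (g' v - gam1 (f' v)) \<bullet> rot (gam1 (f z)))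
       - (sgn (g z - gam2 (f z)) \<bullet> rot (gam2 (f' v)) + P (sgn (g z - gam2 (f z))) (norm (g z - gam2 (f z))) (g' v - gam2 (f' v)) \<bullet> rot (gam2 (f z))))) (at z within S)"
proof -
  have g: "((\<lambda>z. gam1 (f z)) has_derivative (\<lambda>v. gam1 (f' v))) (at z within S)" "((\<lambda>z. gam2 (f z)) has_derivative (\<lambda>v. gam2 (f' v))) (at z within S)"
    by (intro assms bounded_linear.has_derivative[OF bounded_linear_gam(1)] bounded_linear.has_derivative[OF bounded_linear_gam(2)])+
  have d: "((\<lambda>z. g z - gam1 (f z)) has_derivative (\<lambda>v. g' v - gam1 (f' v))) (at z within S)"
    "((\<lambda>z. g z - gam2 (f z)) has_derivative (\<lambda>v. g' v - gam2 (f' v))) (at z within S)"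
    by (intro has_derivative_diff assms g)+
  have "g z - gam1 (f z) \<noteq> 0" "g z - gam2 (f z) \<noteq> 0" using assms(3) by (auto simp: Reg_def)
  then show ?thesis unfolding phis_def P_def
    by (intro has_derivative_diff has_derivative_minus has_derivative_inner sgn_has_derivative d bounded_linear.has_derivative[OF bounded_linear_rot] g)
qed

lemma gam_rot [simp]: "gam1 (rot q) = rot (gam1 q)" "gam2 (rot q) = rot (gam2 q)" "gam1 (c *\<^sub>R q) = c *\<^sub>R gam1 q" "gam2 (c *\<^sub>R q) = c *\<^sub>R gam2 q"
   "gam1 0 = 0" "gam2 0 = 0"
  by (simp_all add: gam1_def gam2_def algebra_simps)

lemma phi_circ_has_derivative:
  assumes "(f has_derivative f') (at z within S)" "(g has_derivative g') (at z within S)" "(circ (f z), g z) \<in> Reg"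
  shows "((\<lambda>z. phi (circ (f z)) (g z)) has_derivative
    (\<lambda>v. phis (circ (f z)) (g z) * f' v + grad (circ (f z)) (g z) \<bullet> g' v)) (at z within S)"
  by (rule has_derivative_eq_rhs[OF phi_has_derivative[OF circ_has_derivative[OF assms(1) refl] assms(2,3)]])
    (simp add: phis_def grad_def fun_eq_iff inner_diff_right inner_add_left algebra_simps)

text \<open>Coordinates of \<open>x\<close> along the axes of the ellipse, with origin at its centre. On the disc \<open>vv < 0\<close>,
  since the disc lies on one side of the line through the foci.\<close>

definition uu where "uu q x = x \<bullet> rot q"
definition vv where "vv q x = x \<bullet> q - b"

lemma vv_neg: assumes "norm q = 1" "x \<in> disc \<alpha>" shows "vv q x < 0"
proof -
  have "x \<bullet> q \<le> norm x * norm q" by (rule norm_cauchy_schwarz)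
  then show ?thesis using assms by (simp add: vv_def disc_eq)
qed

lemma gam_frame:
  assumes "norm q = 1"
  shows "x - gam1 q = vv q x *\<^sub>R q + (uu q x + a) *\<^sub>R rot q" "x - gam2 q = vv q x *\<^sub>R q + (uu q x - a) *\<^sub>R rot q"
proof -
  have "x = (x \<bullet> q) *\<^sub>R q + (x \<bullet> rot q) *\<^sub>R rot q" by (rule vec_frame[OF assms])
  then have "x - (b *\<^sub>R q + c *\<^sub>R rot q) = vv q x *\<^sub>R q + (uu q x - c) *\<^sub>R rot q" for c
    unfolding uu_def vv_def scaleR_diff_left by (metis add_diff_add)
  from this[of "- a"] this[of a]
  show "x - gam1 q = vv q x *\<^sub>R q + (uu q x + a) *\<^sub>R rot q" "x - gam2 q = vv q x *\<^sub>R q + (uu q x - a) *\<^sub>R rot q"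
    by (simp_all add: gam1_def gam2_def)
qed

lemma norm_frame: assumes "norm q = 1" shows "norm (v *\<^sub>R q + u *\<^sub>R rot q) = sqrt (u\<^sup>2 + v\<^sup>2)"
proof -
  have "q \<bullet> q = 1" using assms by (simp add: norm_eq_1)
  then show ?thesis
    by (simp add: norm_eq_sqrt_inner inner_add_left inner_add_right power2_eq_square add.commute)
qed

lemma norm_frame2: assumes "norm q = 1" shows "norm x = sqrt ((x \<bullet> rot q)\<^sup>2 + (x \<bullet> q)\<^sup>2)"
  by (subst vec_frame[OF assms, of x], rule norm_frame[OF assms])

lemma phi_uv:
  assumes "norm q = 1" shows "phi q x = sqrt ((uu q x + a)\<^sup>2 + (vv q x)\<^sup>2) + sqrt ((uu q x - a)\<^sup>2 + (vv q x)\<^sup>2)"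
  unfolding phi_def gam_frame[OF assms] norm_frame[OF assms] ..

text \<open>\<open>vv\<close> is nonzero on the disc, so each distance to a focus strictly exceeds
  the absolute value of its component along the line of the foci, and these two components,
  \<open>uu q x + a\<close> and \<open>uu q x - a\<close>, differ by \<open>2 * a\<close>.\<close>

lemma phi_gt: assumes "norm q = 1" "x \<in> disc \<alpha>" shows "2 * a < phi q x"
proof -
  have v: "0 < (vv q x)\<^sup>2" using vv_neg[OF assms] by simp
  have "\<bar>w\<bar> < sqrt (w\<^sup>2 + (vv q x)\<^sup>2)" for w :: real using v by (intro real_less_rsqrt) auto
  from this[of "uu q x + a"] this[of "uu q x - a"] show ?thesis unfolding phi_uv[OF assms(1)] by linarith
qed

lemma sgn_gam_q: assumes "norm q = 1" "x \<in> disc \<alpha>" shows "sgn (x - gam1 q) \<bullet> q < 0" "sgn (x - gam2 q) \<bullet> q < 0"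
proof -
  have qq: "q \<bullet> q = 1" using assms(1) by (simp add: norm_eq_1)
  have "(x - gam1 q) \<bullet> q = vv q x" "(x - gam2 q) \<bullet> q = vv q x"
    unfolding gam_frame[OF assms(1)] by (simp_all add: inner_add_left qq)
  moreover have "x - gam1 q \<noteq> 0" "x - gam2 q \<noteq> 0" using disc_Reg[OF assms] by (auto simp: Reg_def)
  ultimately show "sgn (x - gam1 q) \<bullet> q < 0" "sgn (x - gam2 q) \<bullet> q < 0"
    using vv_neg[OF assms] by (simp_all add: sgn_div_norm mult_pos_neg)
qed

text \<open>The point lies on the same side of both foci, so both unit vectors have negative
  component along \<open>q\<close> and cannot cancel.\<close>

lemma grad_nz: assumes "norm q = 1" "x \<in> disc \<alpha>" shows "grad q x \<noteq> 0"
proof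
  assume "grad q x = 0" then have "grad q x \<bullet> q = 0" by simp
  then show False using sgn_gam_q[OF assms] by (simp add: grad_def inner_add_left)
qed

lemma norm_grad_le: "norm (grad q x) \<le> 2"
  using norm_triangle_ineq[of "sgn (x - gam1 q)" "sgn (x - gam2 q)"] by (simp add: grad_def norm_sgn split: if_splits)

text \<open>The derivative of \<open>phis\<close> in \<open>x\<close>. That it does not vanish on the kernel of \<open>grad\<close> is the immersion
  part of the Bolker condition.\<close>

definition phis_deriv_x where
  "phis_deriv_x q x v = - (sgn (x - gam1 q) \<bullet> gam1 q) / norm (x - gam1 q) * (v \<bullet> rot (sgn (x - gam1 q)))
     - (sgn (x - gam2 q) \<bullet> gam2 q) / norm (x - gam2 q) * (v \<bullet> rot (sgn (x - gam2 q)))"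

lemma phis_x_has_derivative:
  assumes "norm q = 1" "g z \<in> disc \<alpha>" "(g has_derivative g') (at z within S)"
  shows "((\<lambda>z. phis q (g z)) has_derivative (\<lambda>v. phis_deriv_x q (g z) (g' v))) (at z within S)"
proof -
  let ?x = "g z"
  let ?e1 = "sgn (?x - gam1 q)" and ?e2 = "sgn (?x - gam2 q)"
  have nz: "?x - gam1 q \<noteq> 0" "?x - gam2 q \<noteq> 0" using disc_Reg[OF assms(1,2)] by (auto simp: Reg_def)
  then have e: "norm ?e1 = 1" "norm ?e2 = 1" by (simp_all add: norm_sgn)
  \<comment> \<open>In the plane, removing the component along the unit vector \<open>e\<close>
    leaves a multiple of \<open>rot e\<close>; the derivative of each \<open>sgn\<close> thereby
    collapses to a scalar.\<close>
  have P: "(inverse r *\<^sub>R (v - (v \<bullet> e) *\<^sub>R e)) \<bullet> rot g = (e \<bullet> g) / r * (v \<bullet> rot e)" if "norm e = 1" for e v g :: "real^2" and r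
  proof -
    have "v \<bullet> rot g - (v \<bullet> e) * (e \<bullet> rot g) = (e \<bullet> g) * (v \<bullet> rot e)"
      using inner_frame[OF that, of v "rot g"] by (simp add: inner_commute[of "rot g" e] inner_commute[of g e])
    then show ?thesis by (simp add: inner_diff_left divide_inverse)
  qed
  show ?thesis
    by (rule has_derivative_eq_rhs[OF phis_has_derivative[OF has_derivative_const assms(3) disc_Reg[OF assms(1,2)]]])
      (simp add: P e phis_deriv_x_def fun_eq_iff del: inner_scaleR_left)
qed

text \<open>The kernel of \<open>grad\<close> is spanned by \<open>rot (grad q x)\<close>. This
  direction has the same component along \<open>rot ?e1\<close> and \<open>rot ?e2\<close>, namely
  \<open>1 + ?e1 \<bullet> ?e2\<close>, half the squared norm of \<open>grad q x\<close>. Along it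
  \<open>phis_deriv_x\<close> is therefore a nonzero multiple of a sum of two positive coefficients,
  and no cancellation is possible.\<close>

lemma phis_deriv_x_eq_0:
  assumes "norm q = 1" "x \<in> disc \<alpha>" and v: "grad q x \<bullet> v = 0" "phis_deriv_x q x v = 0"
  shows "v = 0"
proof -
  let ?e1 = "sgn (x - gam1 q)" and ?e2 = "sgn (x - gam2 q)" and ?r1 = "norm (x - gam1 q)" and ?r2 = "norm (x - gam2 q)"
  have nz: "x - gam1 q \<noteq> 0" "x - gam2 q \<noteq> 0" using disc_Reg[OF assms(1,2)] by (auto simp: Reg_def)
  then have e: "norm ?e1 = 1" "norm ?e2 = 1" by (simp_all add: norm_sgn)
  define k1 k2 where "k1 = - (?e1 \<bullet> gam1 q) / ?r1" and "k2 = - (?e2 \<bullet> gam2 q) / ?r2"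
  have x1: "norm x < 1" using assms(2) ab by (auto simp: disc_eq)
  \<comment> \<open>The foci run on the unit circle and the point stays strictly inside it; this
    fixes the signs of both coefficients \<open>k1\<close> and \<open>k2\<close>.\<close>
  have "x \<bullet> g < 1" if "norm g = 1" for g using norm_cauchy_schwarz[of x g] that x1 by simp
  then have lt: "x \<bullet> gam1 q < 1" "x \<bullet> gam2 q < 1" using assms(1) by simp_all
  have gg: "gam1 q \<bullet> gam1 q = 1" "gam2 q \<bullet> gam2 q = 1" using norm_gam[of q] assms(1) by (simp_all only: norm_eq_1)
  have "(x - gam1 q) \<bullet> gam1 q < 0" "(x - gam2 q) \<bullet> gam2 q < 0" using lt gg by (simp_all add: inner_diff_left)
  then have "?e1 \<bullet> gam1 q < 0" "?e2 \<bullet> gam2 q < 0"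
    unfolding sgn_div_norm inner_scaleR_left using nz by (simp_all add: mult_pos_neg)
  then have k: "k1 > 0" "k2 > 0" unfolding k1_def k2_def using nz by (simp_all add: divide_neg_pos)
  obtain c where c: "v = c *\<^sub>R rot (grad q x)"
    using vec2_orthogonal[OF _ grad_nz[OF assms(1,2)]] v(1) by (metis inner_commute)
  have ee: "?e1 \<bullet> ?e1 = 1" "?e2 \<bullet> ?e2 = 1" using e by (simp_all only: norm_eq_1)
  have vr: "v \<bullet> rot ?e1 = c * (1 + ?e1 \<bullet> ?e2)" "v \<bullet> rot ?e2 = c * (1 + ?e1 \<bullet> ?e2)"
    unfolding c inner_scaleR_left inner_rot(3) by (simp_all add: grad_def inner_add_left ee inner_commute[of ?e2 ?e1])
  have "k1 * (v \<bullet> rot ?e1) + k2 * (v \<bullet> rot ?e2) = 0" using v(2) by (simp add: phis_deriv_x_def k1_def k2_def)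
  then have "c * ((1 + ?e1 \<bullet> ?e2) * (k1 + k2)) = 0" unfolding vr by (simp add: algebra_simps)
  moreover have "grad q x \<bullet> grad q x = 2 * (1 + ?e1 \<bullet> ?e2)"
    by (simp add: grad_def inner_add_left inner_add_right ee inner_commute[of ?e2 ?e1])
  then have "1 + ?e1 \<bullet> ?e2 > 0" using grad_nz[OF assms(1,2)] inner_gt_zero_iff[of "grad q x"] by simp
  ultimately have "c = 0" using k by simp
  then show "v = 0" using c by simp
qed

text \<open>\<open>BB L\<close> is the semi-minor axis, and \<open>EE q L u\<close>, with \<open>u\<close> the cosine of the eccentric anomaly, runs through
  the half of the ellipse on the side of the disc. The equation \<open>norm (EE q L u) = b\<close> is quadratic in
  \<open>sqrt (1 - u\<^sup>2)\<close>, with positive root \<open>tau0 L\<close>.\<close>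

definition BB where "BB L = sqrt ((L / 2)\<^sup>2 - a\<^sup>2)"
definition tau0 where "tau0 L = (sqrt (b\<^sup>2 * (BB L)\<^sup>2 + a\<^sup>2 * (L / 2)\<^sup>2) - b * BB L) / a\<^sup>2"
definition EE where "EE q L u = (L / 2 * u) *\<^sub>R rot q + (b - BB L * sqrt (1 - u\<^sup>2)) *\<^sub>R q"

lemma BB: assumes "2 * a < L" shows "0 < BB L" "(BB L)\<^sup>2 = (L / 2)\<^sup>2 - a\<^sup>2" "0 < (L / 2)\<^sup>2 - a\<^sup>2" "0 < L"
proof -
  show "0 < (L / 2)\<^sup>2 - a\<^sup>2" using assms ab power_strict_mono[of a "L / 2" 2] by simp
  then show "0 < BB L" "(BB L)\<^sup>2 = (L / 2)\<^sup>2 - a\<^sup>2" by (simp_all add: BB_def)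
  show "0 < L" using assms ab by simp
qed

lemma EE_uv: assumes "norm q = 1" shows "EE q L u \<bullet> rot q = L / 2 * u" "EE q L u \<bullet> q = b - BB L * sqrt (1 - u\<^sup>2)"
  using assms by (simp_all add: EE_def inner_add_left norm_eq_1)

lemma phi_EE: assumes "norm q = 1" "2 * a < L" "\<bar>u\<bar> \<le> 1" shows "phi q (EE q L u) = L"
proof -
  have u: "u\<^sup>2 \<le> 1" using assms(3) by (simp add: abs_square_le_1)
  have "(L / 2 * u / (L / 2))\<^sup>2 + (- (BB L * sqrt (1 - u\<^sup>2)))\<^sup>2 / ((L / 2)\<^sup>2 - a\<^sup>2) = 1"
    using BB[OF assms(2)] u by (simp add: power_mult_distrib)
  then have "sqrt ((L / 2 * u + a)\<^sup>2 + (- (BB L * sqrt (1 - u\<^sup>2)))\<^sup>2) + sqrt ((L / 2 * u - a)\<^sup>2 + (- (BB L * sqrt (1 - u\<^sup>2)))\<^sup>2) = 2 * (L / 2)"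
    using focal_equation[of a "L / 2" "L / 2 * u" "- (BB L * sqrt (1 - u\<^sup>2))"] ab assms(2) by auto
  then show ?thesis unfolding phi_uv[OF assms(1)] uu_def vv_def EE_uv[OF assms(1)] by simp
qed

text \<open>The equation of the ellipse determines \<open>vv\<close> up to sign, and the disc
  selects the negative root, which is the half of the ellipse that \<open>EE\<close> runs
  through.\<close>

lemma EE_of_phi:
  assumes "norm q = 1" "2 * a < L" "x \<in> disc \<alpha>" "phi q x = L"
  shows "\<bar>x \<bullet> rot q / (L / 2)\<bar> < 1" "x = EE q L (x \<bullet> rot q / (L / 2))"
proof -
  define u where "u = x \<bullet> rot q / (L / 2)"
  have "u\<^sup>2 + (vv q x)\<^sup>2 / (BB L)\<^sup>2 = 1"
    using focal_equation[of a "L / 2" "uu q x" "vv q x"] phi_uv[OF assms(1), of x] assms(2,4) ab BB[OF assms(2)]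
    by (simp add: uu_def u_def)
  then have v: "(vv q x / BB L)\<^sup>2 = 1 - u\<^sup>2" by (simp add: power_divide)
  moreover have "0 < (vv q x / BB L)\<^sup>2" using vv_neg[OF assms(1,3)] BB(1)[OF assms(2)] by simp
  ultimately have "u\<^sup>2 < 1" by linarith
  then show "\<bar>x \<bullet> rot q / (L / 2)\<bar> < 1" by (simp add: abs_square_less_1 u_def)
  have "sqrt (1 - u\<^sup>2) = - (vv q x / BB L)"
    unfolding v[symmetric] real_sqrt_abs using vv_neg[OF assms(1,3)] BB(1)[OF assms(2)] by (simp add: divide_neg_pos)
  then have "b - BB L * sqrt (1 - u\<^sup>2) = x \<bullet> q" using BB(1)[OF assms(2)] by (simp add: vv_def)
  moreover have "L / 2 * u = x \<bullet> rot q" using BB(4)[OF assms(2)] by (simp add: u_def)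
  ultimately have "EE q L u = (x \<bullet> rot q) *\<^sub>R rot q + (x \<bullet> q) *\<^sub>R q" by (simp only: EE_def)
  then show "x = EE q L (x \<bullet> rot q / (L / 2))"
    using vec_frame[OF assms(1), of x] unfolding u_def[symmetric] by (metis add.commute)
qed

lemma norm_EE: assumes "norm q = 1" "2 * a < L" "\<bar>u\<bar> \<le> 1"
  shows "(norm (EE q L u))\<^sup>2 = b\<^sup>2 + (L / 2)\<^sup>2 - a\<^sup>2 * (sqrt (1 - u\<^sup>2))\<^sup>2 - 2 * b * BB L * sqrt (1 - u\<^sup>2)"
proof -
  have u: "u\<^sup>2 \<le> 1" using assms(3) by (simp add: abs_square_le_1)
  define t where "t = sqrt (1 - u\<^sup>2)"
  have t: "u\<^sup>2 = 1 - t\<^sup>2" using u by (simp add: t_def)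
  have "(norm (EE q L u))\<^sup>2 = (L / 2)\<^sup>2 * u\<^sup>2 + (b - BB L * t)\<^sup>2"
    unfolding norm_frame2[OF assms(1), of "EE q L u"] EE_uv[OF assms(1)] by (simp add: t_def power_mult_distrib del: power_divide times_divide_eq_left)
  also have "\<dots> = (L / 2)\<^sup>2 * (1 - t\<^sup>2) + b\<^sup>2 - 2 * b * BB L * t + (BB L)\<^sup>2 * t\<^sup>2"
    unfolding t by (simp add: power2_diff power_mult_distrib)
  also have "\<dots> = b\<^sup>2 + (L / 2)\<^sup>2 - a\<^sup>2 * t\<^sup>2 - 2 * b * BB L * t"
    unfolding BB(2)[OF assms(2)] by algebra
  finally show ?thesis by (simp add: t_def)
qed

lemma tau0_pos: assumes "2 * a < L" shows "0 < tau0 L"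
proof -
  have "0 < a\<^sup>2 * (L / 2)\<^sup>2" using ab BB(4)[OF assms] by simp
  then have "b * BB L < sqrt (b\<^sup>2 * (BB L)\<^sup>2 + a\<^sup>2 * (L / 2)\<^sup>2)"
    by (intro real_less_rsqrt) (simp add: power_mult_distrib)
  then show ?thesis using ab by (simp add: tau0_def)
qed

lemma EE_disc: assumes "norm q = 1" "2 * a < L" "\<bar>u\<bar> \<le> 1"
  shows "EE q L u \<in> disc \<alpha> \<longleftrightarrow> u\<^sup>2 < 1 - (tau0 L)\<^sup>2"
proof -
  have u: "u\<^sup>2 \<le> 1" using assms(3) by (simp add: abs_square_le_1)
  define t where "t = sqrt (1 - u\<^sup>2)"
  have t: "t \<ge> 0" "t\<^sup>2 = 1 - u\<^sup>2" using u by (simp_all add: t_def)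
  have B: "0 < BB L" using BB[OF assms(2)] by simp
  let ?D = "b\<^sup>2 * (BB L)\<^sup>2 + a\<^sup>2 * (L / 2)\<^sup>2"
  have a2: "a\<^sup>2 > 0" using ab by simp
  have "EE q L u \<in> disc \<alpha> \<longleftrightarrow> (norm (EE q L u))\<^sup>2 < b\<^sup>2"
    using ab(2) by (simp add: disc_eq abs_square_less_1 power2_less_imp_less) (smt (verit) norm_ge_zero power2_less_imp_less power_strict_mono pos2)
  also have "\<dots> \<longleftrightarrow> 0 < a\<^sup>2 * t\<^sup>2 + 2 * b * BB L * t - (L / 2)\<^sup>2"
    unfolding norm_EE[OF assms] t_def[symmetric] by auto
  \<comment> \<open>Multiplying by the square of \<open>a\<close> completes the square in
    \<open>t\<close>, so that the condition becomes a comparison of \<open>t\<close> with the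
    positive root \<open>tau0 L\<close>.\<close>
  also have "\<dots> \<longleftrightarrow> 0 < a\<^sup>2 * (a\<^sup>2 * t\<^sup>2 + 2 * b * BB L * t - (L / 2)\<^sup>2)"
    using a2 by (simp add: zero_less_mult_iff)
  also have "a\<^sup>2 * (a\<^sup>2 * t\<^sup>2 + 2 * b * BB L * t - (L / 2)\<^sup>2) = (a\<^sup>2 * t + b * BB L)\<^sup>2 - ?D"
    by algebra
  also have "0 < (a\<^sup>2 * t + b * BB L)\<^sup>2 - ?D \<longleftrightarrow> sqrt ?D < a\<^sup>2 * t + b * BB L"
  proof -
    have nn: "0 \<le> a\<^sup>2 * t + b * BB L" using a2 t(1) ab B by simp
    have "sqrt ?D < a\<^sup>2 * t + b * BB L \<longleftrightarrow> sqrt ?D < sqrt ((a\<^sup>2 * t + b * BB L)\<^sup>2)" using nn by simp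
    then show ?thesis by (simp only: real_sqrt_less_iff diff_gt_0_iff_gt)
  qed
  also have "\<dots> \<longleftrightarrow> tau0 L < t" unfolding tau0_def using a2 by (simp add: pos_divide_less_eq mult.commute) linarith
  also have "\<dots> \<longleftrightarrow> (tau0 L)\<^sup>2 < t\<^sup>2"
    using t(1) tau0_pos[OF assms(2)] by (auto intro: power_strict_mono power2_less_imp_less)
  finally show ?thesis using t(2) by auto
qed

definition arc where "arc q L = {x \<in> disc \<alpha>. phi q x = L}"

section \<open>Arcs in the disc: injectivity and separation of points\<close>

lemma sq_less: "u\<^sup>2 < 1 - (t::real)\<^sup>2 \<Longrightarrow> \<bar>u\<bar> < 1"
  using zero_le_power2[of t] abs_square_less_1[of u] by linarith

lemma arc_eq: assumes "norm q = 1" "2 * a < L" shows "arc q L = EE q L ` {u. u\<^sup>2 < 1 - (tau0 L)\<^sup>2}"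
proof (intro equalityI subsetI)
  fix x assume x: "x \<in> arc q L"
  note E = EE_of_phi[OF assms, of x]
  have "x \<in> disc \<alpha>" "phi q x = L" using x by (auto simp: arc_def)
  then show "x \<in> EE q L ` {u. u\<^sup>2 < 1 - (tau0 L)\<^sup>2}"
    using E EE_disc[OF assms, of "x \<bullet> rot q / (L / 2)"] by (intro image_eqI[of _ _ "x \<bullet> rot q / (L / 2)"]) auto
next
  fix x assume "x \<in> EE q L ` {u. u\<^sup>2 < 1 - (tau0 L)\<^sup>2}"
  then obtain u where u: "u\<^sup>2 < 1 - (tau0 L)\<^sup>2" "x = EE q L u" by auto
  then have "\<bar>u\<bar> \<le> 1" using sq_less by fastforce
  then show "x \<in> arc q L" using u EE_disc[OF assms] phi_EE[OF assms] by (auto simp: arc_def)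
qed

lemma EE_has_derivative:
  assumes "\<bar>u\<bar> < 1"
  shows "(EE q L has_derivative (\<lambda>h. h *\<^sub>R ((L / 2) *\<^sub>R rot q + (BB L * (u / sqrt (1 - u\<^sup>2))) *\<^sub>R q))) (at u)"
proof -
  have "u\<^sup>2 < 1" using assms by (simp add: abs_square_less_1)
  then have "1 - u\<^sup>2 > 0" by simp
  then show ?thesis unfolding EE_def
    by (auto intro!: derivative_eq_intros simp: fun_eq_iff algebra_simps field_simps)
qed

text \<open>On a fixed ellipse the points of the disc form an interval in the parameter
  \<open>u\<close>. The velocity of \<open>EE\<close> lies in the kernel of \<open>grad\<close>, so
  \<open>phis\<close> has nonzero derivative along this interval, and Rolle's theorem excludes a
  repeated value.\<close>

lemma phi_phis_inj:
  assumes q: "norm q = 1" and x: "x \<in> disc \<alpha>" "x' \<in> disc \<alpha>" and e: "phi q x = phi q x'" "phis q x = phis q x'"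
  shows "x = x'"
proof -
  define L where "L = phi q x"
  have L: "2 * a < L" using phi_gt[OF q x(1)] by (simp add: L_def)
  have "x \<in> arc q L" "x' \<in> arc q L" using x e by (auto simp: arc_def L_def)
  then obtain u u' where u: "u\<^sup>2 < 1 - (tau0 L)\<^sup>2" "x = EE q L u" "u'\<^sup>2 < 1 - (tau0 L)\<^sup>2" "x' = EE q L u'"
    unfolding arc_eq[OF q L] by auto
  have False if lt: "v < v'" and v: "v\<^sup>2 < 1 - (tau0 L)\<^sup>2" "v'\<^sup>2 < 1 - (tau0 L)\<^sup>2" and ev: "phis q (EE q L v) = phis q (EE q L v')" for v v'
  proof -
    \<comment> \<open>The admissible parameters form an interval symmetric about 0, so everything
      between \<open>v\<close> and \<open>v'\<close> is admissible.\<close>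
    have I: "z\<^sup>2 < 1 - (tau0 L)\<^sup>2" if "v \<le> z" "z \<le> v'" for z
    proof -
      have "\<bar>z\<bar> \<le> \<bar>v\<bar> \<or> \<bar>z\<bar> \<le> \<bar>v'\<bar>" using that by linarith
      then have "z\<^sup>2 \<le> v\<^sup>2 \<or> z\<^sup>2 \<le> v'\<^sup>2" by (simp add: abs_le_square_iff)
      then show ?thesis using v by linarith
    qed
    let ?E' = "\<lambda>u. (L / 2) *\<^sub>R rot q + (BB L * (u / sqrt (1 - u\<^sup>2))) *\<^sub>R q"
    have D: "\<exists>D. ((\<lambda>u. phis q (EE q L u)) has_derivative D) (at z) \<and> D \<noteq> (\<lambda>h. 0)" if z: "v \<le> z" "z \<le> v'" for z
    proof -
      have z1: "\<bar>z\<bar> < 1" and zd: "EE q L z \<in> disc \<alpha>" using I[OF z] sq_less EE_disc[OF q L, of z] by force+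
      have "(q, EE q L z) \<in> Reg" by (rule disc_Reg[OF q zd])
      from phi_has_derivative[OF has_derivative_const EE_has_derivative[OF z1] this]
      have "((\<lambda>u. phi q (EE q L u)) has_derivative (\<lambda>h. h * (grad q (EE q L z) \<bullet> ?E' z))) (at z)"
        by (rule has_derivative_eq_rhs) (simp add: grad_def fun_eq_iff inner_add_left algebra_simps)
      moreover have "((\<lambda>u. phi q (EE q L u)) has_derivative (\<lambda>h. 0)) (at z)"
      proof (rule has_derivative_transform_within_open[OF has_derivative_const])
        show "open {-1<..<1::real}" "z \<in> {-1<..<1}" using z1 by auto
        show "L = phi q (EE q L u)" if "u \<in> {-1<..<1}" for u using that by (intro phi_EE[OF q L, symmetric]) auto
      qed
      \<comment> \<open>\<open>phi\<close> is constantly \<open>L\<close> along the curve; comparing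
        its two derivatives puts the velocity into the kernel of \<open>grad\<close>.\<close>
      ultimately have "(\<lambda>h. h * (grad q (EE q L z) \<bullet> ?E' z)) = (\<lambda>h. 0)" by (rule has_derivative_unique)
      then have g0: "grad q (EE q L z) \<bullet> ?E' z = 0" by (metis mult_1)
      have "?E' z \<bullet> rot q = L / 2" using q by (simp add: inner_add_left norm_eq_1)
      then have nz: "?E' z \<noteq> 0" using BB(4)[OF L] by force
      have "((\<lambda>u. phis q (EE q L u)) has_derivative (\<lambda>h. phis_deriv_x q (EE q L z) (h *\<^sub>R ?E' z))) (at z)"
        by (rule phis_x_has_derivative[OF q zd EE_has_derivative[OF z1]])
      moreover have "phis_deriv_x q (EE q L z) (1 *\<^sub>R ?E' z) \<noteq> 0" using phis_deriv_x_eq_0[OF q zd g0] nz by auto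
      ultimately show ?thesis by metis
    qed
    \<comment> \<open>\<open>Rolle_deriv\<close> takes the derivative as a function of the point,
      hence one is chosen at every \<open>z\<close>.\<close>
    let ?F = "\<lambda>z. SOME D. ((\<lambda>u. phis q (EE q L u)) has_derivative D) (at z) \<and> D \<noteq> (\<lambda>h. 0)"
    have F: "((\<lambda>u. phis q (EE q L u)) has_derivative ?F z) (at z) \<and> ?F z \<noteq> (\<lambda>h. 0)" if "v \<le> z" "z \<le> v'" for z
      by (rule someI_ex[OF D[OF that]])
    have "\<exists>z. v < z \<and> z < v' \<and> ?F z = (\<lambda>v. 0)"
    proof (rule Rolle_deriv[OF lt ev])
      show "continuous_on {v..v'} (\<lambda>u. phis q (EE q L u))"
        using F has_derivative_continuous by (intro continuous_at_imp_continuous_on) fastforce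
    qed (use F in auto)
    then show False using F by (meson less_imp_le)
  qed
  from this[of u u'] this[of u' u] u e(2) show ?thesis by (metis linorder_neqE_linordered_idom)
qed

text \<open>For \<open>q\<close> along \<open>x1 - x2\<close> the two points have the same
  coordinate parallel to the line of the foci but different distances from that line, and the focal
  sum increases strictly with this distance.\<close>

lemma separate_points:
  assumes "x1 \<in> disc \<alpha>" "x2 \<in> disc \<alpha>" "x1 \<noteq> x2" obtains q where "norm q = 1" "phi q x1 \<noteq> phi q x2"
proof
  let ?q = "sgn (x1 - x2)"
  show q: "norm ?q = 1" using assms(3) by (simp add: norm_sgn)
  have "d \<bullet> rot (sgn d) = 0" for d :: "real^2" by (simp add: sgn_div_norm)
  then have "(x1 - x2) \<bullet> rot ?q = 0" .
  then have u: "uu ?q x1 = uu ?q x2" by (simp add: uu_def inner_diff_left)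
  have "(x1 - x2) \<bullet> ?q = norm (x1 - x2)" using assms(3) by (simp add: sgn_div_norm dot_square_norm power2_eq_square)
  moreover have "norm (x1 - x2) > 0" using assms(3) by simp
  ultimately have "vv ?q x2 < vv ?q x1" unfolding vv_def inner_diff_left by linarith
  then have "\<bar>vv ?q x1\<bar> < \<bar>vv ?q x2\<bar>" using vv_neg[OF q assms(1)] by simp
  then have "(vv ?q x1)\<^sup>2 < (vv ?q x2)\<^sup>2" by (metis abs_ge_zero power2_abs power_strict_mono pos2)
  then have "sqrt (c + (vv ?q x1)\<^sup>2) < sqrt (c + (vv ?q x2)\<^sup>2)" for c by simp
  from this[of "(uu ?q x2 + a)\<^sup>2"] this[of "(uu ?q x2 - a)\<^sup>2"]
  show "phi ?q x1 \<noteq> phi ?q x2" unfolding phi_uv[OF q] u by linarith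
qed

lemma arc_nonempty: assumes "norm q = 1" "2 * a < L" shows "arc q L \<noteq> {} \<longleftrightarrow> tau0 L < 1"
proof -
  have "arc q L \<noteq> {} \<longleftrightarrow> (\<exists>u. u\<^sup>2 < 1 - (tau0 L)\<^sup>2)" unfolding arc_eq[OF assms] by auto
  also have "\<dots> \<longleftrightarrow> (tau0 L)\<^sup>2 < 1"
  proof
    assume "\<exists>u. u\<^sup>2 < 1 - (tau0 L)\<^sup>2"
    then obtain u where "u\<^sup>2 < 1 - (tau0 L)\<^sup>2" by blast
    then show "(tau0 L)\<^sup>2 < 1" using zero_le_power2[of u] by linarith
  qed (auto intro: exI[of _ 0])
  also have "\<dots> \<longleftrightarrow> tau0 L < 1" using tau0_pos[OF assms(2)] by (simp add: abs_square_less_1)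
  finally show ?thesis .
qed

text \<open>The squared norm in \<open>norm_EE\<close> decreases in
  \<open>sqrt (1 - u\<^sup>2)\<close>, so \<open>EE q L 0\<close>, an endpoint of the minor axis, is
  the only point of the arc nearest to the origin. This singles the point out from the arc as a set,
  which is what \<open>arc_inj\<close> starts from. The same point minimizes the component along
  \<open>q\<close>.\<close>

lemma arc_min:
  assumes "norm q = 1" "2 * a < L" "tau0 L < 1" "y \<in> arc q L"
  shows "EE q L 0 \<in> arc q L" "norm (EE q L 0) \<le> norm y" "norm y = norm (EE q L 0) \<Longrightarrow> y = EE q L 0" "b - BB L \<le> y \<bullet> q"
proof -
  have t0: "(tau0 L)\<^sup>2 < 1" using tau0_pos[OF assms(2)] assms(3) by (simp add: abs_square_less_1)
  then show "EE q L 0 \<in> arc q L" unfolding arc_eq[OF assms(1,2)] by auto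
  obtain u where u: "u\<^sup>2 < 1 - (tau0 L)\<^sup>2" "y = EE q L u" using assms(4) unfolding arc_eq[OF assms(1,2)] by auto
  have u1: "\<bar>u\<bar> < 1" using sq_less[OF u(1)] .
  then have us: "u\<^sup>2 < 1" by (simp add: abs_square_less_1)
  define t where "t = sqrt (1 - u\<^sup>2)"
  have t: "0 \<le> t" "t \<le> 1" "t = 1 \<longleftrightarrow> u = 0" using us by (simp_all add: t_def)
  have B: "0 < BB L" using BB[OF assms(2)] by simp
  have n0: "(norm (EE q L 0))\<^sup>2 = b\<^sup>2 + (L / 2)\<^sup>2 - a\<^sup>2 - 2 * b * BB L"
    using norm_EE[OF assms(1,2), of 0] by simp
  have nu: "(norm y)\<^sup>2 = b\<^sup>2 + (L / 2)\<^sup>2 - a\<^sup>2 * t\<^sup>2 - 2 * b * BB L * t"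
    using norm_EE[OF assms(1,2), of u] u1 by (simp add: u(2) t_def)
  have 1: "a\<^sup>2 * t\<^sup>2 \<le> a\<^sup>2 * 1" using t by (intro mult_left_mono) (auto simp: power_le_one)
  have 2: "(2 * b * BB L) * t \<le> (2 * b * BB L) * 1" using t ab B by (intro mult_left_mono) auto
  have "(norm (EE q L 0))\<^sup>2 \<le> (norm y)\<^sup>2" using n0 nu 1 2 by linarith
  then show "norm (EE q L 0) \<le> norm y" by (rule power2_le_imp_le) simp
  show "y = EE q L 0" if "norm y = norm (EE q L 0)"
  proof -
    have "(norm y)\<^sup>2 = (norm (EE q L 0))\<^sup>2" using that by simp
    then have "(2 * b * BB L) * t = (2 * b * BB L) * 1" using n0 nu 1 2 by linarith
    then have "t = 1" using ab B by simp
    then show ?thesis using t(3) u(2) by simp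
  qed
  have "BB L * t \<le> BB L * 1" using B t by (intro mult_left_mono) auto
  then show "b - BB L \<le> y \<bullet> q" by (simp add: u(2) EE_uv[OF assms(1)] t_def)
qed

text \<open>The nearest point is common to both arcs. There the component along \<open>q2\<close> is
  minimal over the arc and the tangent direction is \<open>rot q1\<close>, so \<open>q2\<close> is a
  multiple of \<open>q1\<close>. If it were \<open>- q1\<close>, the component along
  \<open>q1\<close> would have a maximum as well as a strict minimum at that point.\<close>

lemma arc_inj:
  assumes q: "norm q1 = 1" "norm q2 = 1" and L: "2 * a < L1" "2 * a < L2" and ne: "tau0 L1 < 1" and eq: "arc q1 L1 = arc q2 L2"
  shows "q1 = q2 \<and> L1 = L2"
proof -
  have ne2: "tau0 L2 < 1" using arc_nonempty[OF q(1) L(1)] arc_nonempty[OF q(2) L(2)] ne eq by simp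
  obtain y where y: "y \<in> arc q1 L1" "y \<in> arc q2 L2" using arc_nonempty[OF q(1) L(1)] ne eq by auto
  note m1 = arc_min[OF q(1) L(1) ne] and m2 = arc_min[OF q(2) L(2) ne2]
  have z: "EE q1 L1 0 = EE q2 L2 0"
  proof -
    have i: "EE q2 L2 0 \<in> arc q1 L1" "EE q1 L1 0 \<in> arc q2 L2" using m1(1)[OF y(1)] m2(1)[OF y(2)] eq by auto
    have "norm (EE q2 L2 0) = norm (EE q1 L1 0)" by (rule antisym[OF m2(2)[OF i(2)] m1(2)[OF i(1)]])
    then show ?thesis using m1(3)[OF i(1)] by simp
  qed
  then have zq: "(b - BB L1) *\<^sub>R q1 = (b - BB L2) *\<^sub>R q2" by (simp add: EE_def)
  have qq: "q1 \<bullet> q1 = 1" "q2 \<bullet> q2 = 1" using q by (simp_all add: norm_eq_1)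
  have t0: "(tau0 L1)\<^sup>2 < 1" using tau0_pos[OF L(1)] ne by (simp add: abs_square_less_1)
  define d where "d = sqrt (1 - (tau0 L1)\<^sup>2)"
  have d: "0 < d" "d\<^sup>2 = 1 - (tau0 L1)\<^sup>2" using t0 by (simp_all add: d_def)
  have in2: "EE q1 L1 u \<in> arc q2 L2" if "\<bar>u\<bar> < d" for u
  proof -
    have "u\<^sup>2 < d\<^sup>2" using that by (metis abs_ge_zero pos2 power2_abs power_strict_mono)
    then show ?thesis using d(2) arc_eq[OF q(1) L(1)] eq by auto
  qed
  have min: "EE q1 L1 0 \<bullet> q2 \<le> EE q1 L1 u \<bullet> q2" if "\<bar>u\<bar> < d" for u
  proof -
    have "EE q1 L1 0 \<bullet> q2 = b - BB L2" unfolding z by (simp add: EE_uv[OF q(2)])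
    then show ?thesis using m2(4)[OF in2[OF that]] by simp
  qed
  have "((\<lambda>u. EE q1 L1 u \<bullet> q2) has_derivative (\<lambda>h. (h *\<^sub>R ((L1 / 2) *\<^sub>R rot q1 + (BB L1 * (0 / sqrt (1 - 0\<^sup>2))) *\<^sub>R q1)) \<bullet> q2)) (at 0)"
    by (intro has_derivative_inner_left EE_has_derivative) auto
  then have "((\<lambda>u. EE q1 L1 u \<bullet> q2) has_real_derivative ((L1 / 2) * (rot q1 \<bullet> q2))) (at 0)"
    unfolding has_field_derivative_def by (rule has_derivative_eq_rhs) (simp add: fun_eq_iff)
  then have "(L1 / 2) * (rot q1 \<bullet> q2) = 0"
    by (rule DERIV_local_min[OF _ d(1)]) (use min in auto)
  then have "q2 \<bullet> rot q1 = 0" using BB(4)[OF L(1)] by (simp add: inner_commute)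
  then have q2: "q2 = (q2 \<bullet> q1) *\<^sub>R q1" using vec_frame[OF q(1), of q2] by simp
  define c where "c = q2 \<bullet> q1"
  have qc: "q2 = c *\<^sub>R q1" using q2 by (simp add: c_def)
  then have "\<bar>c\<bar> = 1" using q by simp
  then consider "c = 1" | "c = -1" by linarith
  then show ?thesis
  proof cases
    case 1
    then have "q1 = q2" using qc by simp
    moreover have "y \<in> arc q1 L1" "y \<in> arc q2 L2" using y by auto
    ultimately show ?thesis by (auto simp: arc_def)
  next
    case 2
    then have q2': "q2 = - q1" using qc by simp
    have "((b - BB L1) *\<^sub>R q1) \<bullet> q1 = ((b - BB L2) *\<^sub>R q2) \<bullet> q1" by (simp only: zq)
    then have bb: "b - BB L1 = - (b - BB L2)" unfolding q2' by (simp add: qq)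
    have dd: "\<bar>d / 2\<bar> < d" using d by simp
    have "b - BB L2 \<le> EE q1 L1 (d / 2) \<bullet> q2" using m2(4)[OF in2[OF dd]] .
    then have "EE q1 L1 (d / 2) \<bullet> q1 \<le> b - BB L1" unfolding q2' bb by simp
    then have "BB L1 * 1 \<le> BB L1 * sqrt (1 - (d / 2)\<^sup>2)" by (simp add: EE_uv[OF q(1)])
    then have "1 \<le> sqrt (1 - (d / 2)\<^sup>2)" using BB(1)[OF L(1)] by (simp only: mult_le_cancel_left_pos)
    then have False using d(1) by simp
    then show ?thesis ..
  qed
qed

end

section \<open>Arc length and the coarea formula\<close>

text \<open>The change of variables takes place on \<open>real^2\<close>, whereas parameters such as
  \<open>(L, t)\<close> form pairs; this map transports Lebesgue measure between the two.\<close>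

definition vec2 :: "real \<times> real \<Rightarrow> real^2" where "vec2 p = fst p *\<^sub>R axis 1 1 + snd p *\<^sub>R axis 2 1"

lemma vec2_nth [simp]: "vec2 p $ 1 = fst p" "vec2 p $ 2 = snd p"
  by (simp_all add: vec2_def axis_def)

lemma vec2_measurable [measurable]: "vec2 \<in> borel_measurable borel"
  unfolding vec2_def by (intro borel_measurable_continuous_onI continuous_intros)

lemma lborel_vec2: "lborel = distr lborel borel vec2"
proof -
  have B1: "Basis = {(1 :: real, 0), (0, 1 :: real)}"
    by (auto simp: Basis_prod_def Basis_real_def)
  have B2: "(Basis :: (real^2) set) = {axis 1 1, axis 2 1}" by (auto simp: Basis_vec_def UNIV_2)
  have ne: "axis 1 1 \<noteq> (axis 2 1 :: real^2)" by (simp add: axis_eq_axis)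
  interpret coord_inj vec2
    by unfold_locales (auto simp: B1 B2 vec2_def inj_on_def ne ne[symmetric])
  have im: "vec2 ` Basis = Basis" by (auto simp: B1 B2 vec2_def)
  have "coord_emb vec2 = vec2"
    by (rule ext) (simp add: coord_emb_def B1 vec2_def inner_prod_def)
  moreover have "coord_lborel (Basis :: (real^2) set) = lborel"
    unfolding coord_lborel_def by (rule lborel_eq[symmetric])
  ultimately show ?thesis using coord_lborel_eq im by simp
qed

lemma nn_integral_vec2:
  assumes "f \<in> borel_measurable borel"
  shows "(\<integral>\<^sup>+z. f z \<partial>(lborel :: (real^2) measure)) = (\<integral>\<^sup>+p. f (vec2 p) \<partial>lborel)"
  by (subst lborel_vec2) (use assms in \<open>simp add: nn_integral_distr\<close>)

lemma has_integral_indicator_UNIV: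
  fixes f :: "'a::euclidean_space \<Rightarrow> real"
  shows "((\<lambda>x. indicator S x * f x) has_integral I) UNIV \<longleftrightarrow> (f has_integral I) S"
proof -
  have "(\<lambda>x. indicator S x * f x) = (\<lambda>x. if x \<in> S then f x else 0)" by (auto simp: indicator_def)
  then show ?thesis by (simp only: has_integral_restrict_UNIV)
qed

context elliptic_radon begin

text \<open>The whole ellipse by the eccentric anomaly, written with \<open>q\<close> instead of the
  angle. \<open>EE\<close> is its half with \<open>t\<close> between \<pi> and 2\<pi>,
  reparametrized by \<open>u = cos t\<close>; arc length is simpler in \<open>t\<close>, membership
  in the disc is simpler in \<open>u\<close>.\<close>

definition EP where "EP q L t = b *\<^sub>R q + (L / 2 * cos t) *\<^sub>R rot q + (BB L * sin t) *\<^sub>R q"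
definition speed where "speed L t = sqrt ((L / 2 * sin t)\<^sup>2 + (BB L * cos t)\<^sup>2)"
text \<open>The coarea factor: arc length on the ellipses times \<open>dL\<close> is \<open>norm (grad (circ s) x) dx\<close>. The extension
  by zero confines the integrals over \<open>real^2\<close> to the disc.\<close>

definition wt where "wt s x = (if x \<in> disc \<alpha> then norm (grad (circ s) x) else 0)"

lemma norm_circ1: "norm (circ s) = 1" by simp

lemma ellipse_param_eq: "ellipse_param \<alpha> s L t = EP (circ s) L t"
  by (simp add: ellipse_param_def EP_def BB_def a_def b_def circ_shift)

lemma EP_EE: assumes "pi \<le> t" "t \<le> 2 * pi" shows "EP q L t = EE q L (cos t)"
proof -
  have "sin t \<le> 0" using sin_le_zero[of t] assms by (cases "t = 2 * pi") auto
  have "sqrt (1 - (cos t)\<^sup>2) = \<bar>sin t\<bar>" by (simp add: sin_squared_eq[symmetric])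
  then have "sqrt (1 - (cos t)\<^sup>2) = - sin t" using \<open>sin t \<le> 0\<close> by simp
  then show ?thesis by (simp add: EP_def EE_def scaleR_add_left scaleR_diff_left)
qed

lemma EP_disc: assumes "norm q = 1" "2 * a < L" "EP q L t \<in> disc \<alpha>" shows "sin t < 0"
proof -
  have "EP q L t \<bullet> q = b + BB L * sin t" using assms(1) by (simp add: EP_def inner_add_left norm_eq_1)
  then have "BB L * sin t < 0" using vv_neg[OF assms(1,3)] by (simp add: vv_def)
  then show ?thesis using BB(1)[OF assms(2)] by (simp add: mult_less_0_iff)
qed

lemma sin_neg_range: assumes "0 \<le> t" "t < 2 * pi" "sin t < 0" shows "pi < t"
  using sin_ge_zero[of t] assms by (meson leI not_le)

lemma EP_disc_range: assumes "norm q = 1" "2 * a < L" "EP q L t \<in> disc \<alpha>" "0 \<le> t" "t < 2 * pi" shows "pi < t"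
  using sin_neg_range[OF assms(4,5) EP_disc[OF assms(1-3)]] .

lemma phi_EP: assumes "norm q = 1" "2 * a < L" "pi \<le> t" "t \<le> 2 * pi" shows "phi q (EP q L t) = L"
  unfolding EP_EE[OF assms(3,4)] by (rule phi_EE[OF assms(1,2)]) simp

lemma EP_inj:
  assumes "norm q = 1" "2 * a < L" "2 * a < L'" "pi < t" "t < 2 * pi" "pi < t'" "t' < 2 * pi" "EP q L t = EP q L' t'"
  shows "L = L' \<and> t = t'"
proof -
  have L: "L = L'" using phi_EP[OF assms(1,2), of t] phi_EP[OF assms(1,3), of t'] assms by simp
  have "EP q L t \<bullet> rot q = EP q L t' \<bullet> rot q" "EP q L t \<bullet> q = EP q L t' \<bullet> q" using assms(8) L by simp_all
  then have "cos t = cos t'" "sin t = sin t'"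
    using assms(1) BB(1,4)[OF assms(2)] by (auto simp: EP_def inner_add_left norm_eq_1)
  then have "circ t = circ t'" by (simp add: vec2_eq_iff)
  then show ?thesis using circ_eq_close[of t t'] assms(4-7) L by auto
qed

lemma EP_surj:
  assumes "norm q = 1" "x \<in> disc \<alpha>" obtains t where "pi < t" "t < 2 * pi" "x = EP q (phi q x) t"
proof -
  let ?u = "x \<bullet> rot q / (phi q x / 2)"
  have u: "\<bar>?u\<bar> < 1" "x = EE q (phi q x) ?u" using EE_of_phi[OF assms(1) phi_gt[OF assms] assms(2) refl] .
  \<comment> \<open>Of the two angles with this cosine, the one in (\<pi>, 2\<pi>), which lies on
    the side of the disc.\<close>
  define t where "t = 2 * pi - arccos ?u"
  have ar: "0 < arccos ?u" "arccos ?u < pi" using arccos_lt_bounded[of ?u] u(1) unfolding abs_less_iff by linarith+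
  have "cos (arccos ?u) = ?u" using u(1) by (rule cos_arccos_abs[OF less_imp_le])
  then have "cos t = ?u" unfolding t_def by (simp add: cos_diff)
  moreover have "pi < t" "t < 2 * pi" using ar unfolding t_def by linarith+
  ultimately show ?thesis using u(2) EP_EE[of t q "phi q x"] by (intro that[of t]) auto
qed

lemma BB_deriv: assumes "2 * a < L" shows "(BB has_real_derivative L / (4 * BB L)) (at L)"
proof -
  have p: "0 < (L / 2)\<^sup>2 - a\<^sup>2" using BB(3)[OF assms] .
  then show ?thesis unfolding BB_def
    by (auto intro!: derivative_eq_intros simp: field_simps)
qed

lemma EP_has_derivative:
  assumes "2 * a < f z" "(f has_derivative f') (at z within S)" "(g has_derivative g') (at z within S)"
  shows "((\<lambda>z. EP q (f z) (g z)) has_derivative (\<lambda>h.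
     f' h *\<^sub>R ((cos (g z) / 2) *\<^sub>R rot q + (f z / (4 * BB (f z)) * sin (g z)) *\<^sub>R q) +
     g' h *\<^sub>R ((- (f z / 2 * sin (g z))) *\<^sub>R rot q + (BB (f z) * cos (g z)) *\<^sub>R q))) (at z within S)"
proof -
  have B: "((\<lambda>z. BB (f z)) has_derivative (\<lambda>h. f z / (4 * BB (f z)) * f' h)) (at z within S)"
    by (rule has_derivative_compose[OF assms(2), of BB "(*) (f z / (4 * BB (f z)))"])
      (use BB_deriv[OF assms(1)] in \<open>simp add: has_field_derivative_def\<close>)
  show ?thesis unfolding EP_def
    by (auto intro!: derivative_eq_intros B assms(2,3) simp: fun_eq_iff vec2_eq_iff algebra_simps add_divide_distrib diff_divide_distrib)
qed

lemma speed_norm: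
  assumes "norm q = 1" shows "speed L t = norm ((- (L / 2 * sin t)) *\<^sub>R rot q + (BB L * cos t) *\<^sub>R q)"
  using norm_frame[OF assms, of "BB L * cos t" "- (L / 2 * sin t)"] by (simp add: speed_def add.commute)

lemma speed_pos: assumes "2 * a < L" shows "0 < speed L t"
proof -
  have "0 < (L / 2 * sin t)\<^sup>2 + (BB L * cos t)\<^sup>2"
  proof (cases "cos t = 0")
    case True
    then have "sin t \<noteq> 0" using sin_cos_squared_add[of t] by auto
    then show ?thesis using BB(4)[OF assms] True by simp
  next
    case False
    then show ?thesis using BB(1)[OF assms] by (intro add_nonneg_pos) auto
  qed
  then show ?thesis by (simp add: speed_def)
qed

lemma norm_vector_derivative_ellipse:
  assumes "2 * a < L" shows "norm (vector_derivative (ellipse_param \<alpha> s L) (at t)) = speed L t"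
proof -
  have e: "ellipse_param \<alpha> s L = (\<lambda>t. EP (circ s) L t)" by (auto simp: ellipse_param_eq)
  have "((\<lambda>t. EP (circ s) L t) has_vector_derivative ((- (L / 2 * sin t)) *\<^sub>R rot (circ s) + (BB L * cos t) *\<^sub>R circ s)) (at t)"
    unfolding has_vector_derivative_def
    by (rule has_derivative_eq_rhs[OF EP_has_derivative[OF _ has_derivative_const has_derivative_ident]]) (use assms in auto)
  then show ?thesis unfolding e speed_norm[OF norm_circ1, of L t s] by (simp add: vector_derivative_at)
qed

text \<open>Differentiating the identity \<open>phi q (EP q L t) = L\<close> gives
  \<open>grad\<close> the inner product 1 with \<open>EL\<close> and 0 with \<open>Et\<close>. In
  the plane this forces \<open>grad\<close> to be \<open>c *\<^sub>R rot Et\<close>, where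
  \<open>c\<close> is up to sign the reciprocal of the determinant.\<close>

lemma jacobian:
  assumes q: "norm q = 1" and L: "2 * a < L" and t: "pi < t" "t < 2 * pi" and d: "EP q L t \<in> disc \<alpha>"
  defines "EL \<equiv> (cos t / 2) *\<^sub>R rot q + (L / (4 * BB L) * sin t) *\<^sub>R q"
  defines "Et \<equiv> (- (L / 2 * sin t)) *\<^sub>R rot q + (BB L * cos t) *\<^sub>R q"
  shows "\<bar>EL $ 1 * Et $ 2 - Et $ 1 * EL $ 2\<bar> * norm (grad q (EP q L t)) = speed L t"
proof -
  let ?g = "grad q (EP q L t)"
  have R: "(q, EP q (fst (L, t)) (snd (L, t))) \<in> Reg" using disc_Reg[OF q d] by simp
  have L': "2 * a < fst (L, t)" using L by simp
  have "((\<lambda>z. phi q (EP q (fst z) (snd z))) has_derivative (\<lambda>h. fst h * (?g \<bullet> EL) + snd h * (?g \<bullet> Et))) (at (L, t))"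
    by (rule has_derivative_eq_rhs[OF phi_has_derivative[OF has_derivative_const EP_has_derivative[OF L' has_derivative_fst[OF has_derivative_ident] has_derivative_snd[OF has_derivative_ident]] R]])
      (simp add: fun_eq_iff grad_def EL_def Et_def inner_add_left inner_add_right algebra_simps)
  moreover have "((\<lambda>z. phi q (EP q (fst z) (snd z))) has_derivative fst) (at (L, t))"
  proof (rule has_derivative_transform_within_open[OF has_derivative_fst[OF has_derivative_ident]])
    show "open ({2 * a<..} \<times> {pi<..<2 * pi})" by (intro open_Times) auto
    show "(L, t) \<in> {2 * a<..} \<times> {pi<..<2 * pi}" using L t by simp
    show "fst z = phi q (EP q (fst z) (snd z))" if "z \<in> {2 * a<..} \<times> {pi<..<2 * pi}" for z
      using that by (intro phi_EP[OF q, symmetric]) auto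
  qed
  ultimately have e: "(\<lambda>h. fst h * (?g \<bullet> EL) + snd h * (?g \<bullet> Et)) = fst" by (rule has_derivative_unique)
  have gl: "?g \<bullet> EL = 1" "?g \<bullet> Et = 0" using fun_cong[OF e, of "(1, 0)"] fun_cong[OF e, of "(0, 1)"] by simp_all
  have sp: "norm Et = speed L t" unfolding Et_def by (rule speed_norm[OF q, symmetric])
  then have "Et \<noteq> 0" using speed_pos[OF L, of t] by auto
  then obtain c where c: "?g = c *\<^sub>R rot Et" by (rule vec2_orthogonal[OF gl(2)])
  have "EL $ 1 * Et $ 2 - Et $ 1 * EL $ 2 = - (rot Et \<bullet> EL)" by (simp add: inner_vec2)
  moreover have "c * (rot Et \<bullet> EL) = 1" using gl(1) unfolding c by simp
  then have "\<bar>c\<bar> * \<bar>rot Et \<bullet> EL\<bar> = 1" by (metis abs_mult abs_one)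
  moreover have "norm ?g = \<bar>c\<bar> * norm Et" unfolding c by simp
  ultimately show ?thesis using sp
    by (metis (no_types, lifting) abs_minus_cancel mult.assoc mult.commute mult_1)
qed

lemma BB_continuous [continuous_intros]: "continuous_on S f \<Longrightarrow> continuous_on S (\<lambda>x. BB (f x))"
  unfolding BB_def by (intro continuous_intros) auto

lemma EP_continuous [continuous_intros]:
  fixes S :: "'z::t2_space set"
  shows "continuous_on S f \<Longrightarrow> continuous_on S g \<Longrightarrow> continuous_on S h \<Longrightarrow> continuous_on S (\<lambda>x. EP (f x) (g x) (h x))"
  unfolding EP_def by (intro continuous_intros) auto

lemma speed_continuous [continuous_intros]:
  fixes S :: "'z::t2_space set"
  shows "continuous_on S g \<Longrightarrow> continuous_on S h \<Longrightarrow> continuous_on S (\<lambda>x. speed (g x) (h x))"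
  unfolding speed_def by (intro continuous_intros) auto

lemma EP_measurable [measurable]:
  assumes [measurable]: "f \<in> borel_measurable M" "g \<in> borel_measurable M" "h \<in> borel_measurable M"
  shows "(\<lambda>x. EP (f x) (g x) (h x)) \<in> borel_measurable M"
proof -
  have "(\<lambda>(q, L, t). EP q L t) \<in> borel_measurable borel"
    unfolding split_beta by (intro borel_measurable_continuous_onI continuous_intros)
  from measurable_compose[OF _ this, of "\<lambda>x. (f x, g x, h x)" M] show ?thesis by simp
qed

lemma speed_measurable [measurable]:
  assumes [measurable]: "g \<in> borel_measurable M" "h \<in> borel_measurable M"
  shows "(\<lambda>x. speed (g x) (h x)) \<in> borel_measurable M"
proof -
  have "(\<lambda>(L, t). speed L t) \<in> borel_measurable borel"
    unfolding split_beta by (intro borel_measurable_continuous_onI continuous_intros)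
  from measurable_compose[OF _ this, of "\<lambda>x. (g x, h x)" M] show ?thesis by simp
qed

lemma phi_measurable [measurable]:
  assumes [measurable]: "f \<in> borel_measurable M" "g \<in> borel_measurable M"
  shows "(\<lambda>x. phi (f x) (g x)) \<in> borel_measurable M"
proof -
  have "(\<lambda>(q, x). phi q x) \<in> borel_measurable borel"
    unfolding split_beta by (intro borel_measurable_continuous_onI continuous_intros)
  from measurable_compose[OF _ this, of "\<lambda>x. (f x, g x)" M] show ?thesis by simp
qed

lemma disc_sets [measurable]: "disc \<alpha> \<in> sets borel" by (simp add: disc_eq)

lemma open_disc: "open (disc \<alpha>)" by (simp add: disc_eq)

lemma wt_smooth: "smooth_open (UNIV \<times> disc \<alpha>) (\<lambda>(s, x). wt s x)"
proof -
  have o: "open (UNIV \<times> disc \<alpha> :: (real \<times> (real^2)) set)" by (simp add: open_Times disc_eq)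
  have R: "(circ (fst p), snd p) \<in> Reg" "grad (circ (fst p)) (snd p) \<noteq> 0" if "p \<in> UNIV \<times> disc \<alpha>" for p
    using that by (auto intro!: disc_Reg simp: grad_nz)
  have "smooth_open (UNIV \<times> disc \<alpha>) (\<lambda>p. norm (grad (circ (fst p)) (snd p)))"
    by (intro smooth_open_norm o smooth_geom(2) smooth_open_circ smooth_open_fst smooth_open_snd smooth_open_id R)
  then show ?thesis by (rule smooth_open_cong[OF o, rotated]) (auto simp: wt_def)
qed

lemma wt_measurable [measurable]:
  assumes [measurable]: "f \<in> borel_measurable M" "g \<in> borel_measurable M"
  shows "(\<lambda>x. wt (f x) (g x)) \<in> borel_measurable M"
proof -
  have "(\<lambda>p. if p \<in> UNIV \<times> disc \<alpha> then (\<lambda>(s, x). wt s x) p else 0) \<in> borel_measurable borel"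
    by (intro borel_measurable_continuous_on_if smooth_open_continuous_on[OF wt_smooth] borel_open)
      (auto simp: open_Times disc_eq)
  also have "(\<lambda>p. if p \<in> UNIV \<times> disc \<alpha> then (\<lambda>(s, x). wt s x) p else 0) = (\<lambda>(s, x). wt s x)"
    by (auto simp: wt_def)
  finally have "(\<lambda>(s, x). wt s x) \<in> borel_measurable borel" .
  from measurable_compose[OF _ this, of "\<lambda>x. (f x, g x)" M] show ?thesis by simp
qed

lemma wt_bounds: "0 \<le> wt s x" "wt s x \<le> 2" "x \<in> disc \<alpha> \<Longrightarrow> 0 < wt s x"
  using norm_grad_le grad_nz by (auto simp: wt_def)

text \<open>Change of variables by \<open>(L, t)\<close> in the disc: by \<open>jacobian\<close> the
  determinant times the weight is the speed. Every point of the disc is reached exactly once by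
  angles strictly between \<pi> and 2\<pi>.\<close>

lemma coarea_sets:
  assumes N: "N \<in> sets borel" "N \<subseteq> disc \<alpha>"
  shows "(\<integral>\<^sup>+z. indicator {z. 2 * a < z $ 1 \<and> pi < z $ 2 \<and> z $ 2 < 2 * pi \<and> EP (circ s) (z $ 1) (z $ 2) \<in> N} z * ennreal (speed (z $ 1) (z $ 2)) \<partial>(lborel :: (real^2) measure)) =
    (\<integral>\<^sup>+x. indicator N x * ennreal (wt s x) \<partial>lborel)"
proof -
  let ?q = "circ s"
  have q: "norm ?q = 1" by simp
  define S where "S = {z :: real^2. 2 * a < z $ 1 \<and> pi < z $ 2 \<and> z $ 2 < 2 * pi \<and> EP ?q (z $ 1) (z $ 2) \<in> N}"
  define g where "g z = EP ?q (z $ 1) (z $ 2)" for z :: "real^2"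
  define g' where "g' z h = h $ 1 *\<^sub>R ((cos (z $ 2) / 2) *\<^sub>R rot ?q + (z $ 1 / (4 * BB (z $ 1)) * sin (z $ 2)) *\<^sub>R ?q) +
     h $ 2 *\<^sub>R ((- (z $ 1 / 2 * sin (z $ 2))) *\<^sub>R rot ?q + (BB (z $ 1) * cos (z $ 2)) *\<^sub>R ?q)" for z h :: "real^2"
  note N(1) [measurable]
  have [measurable]: "(\<lambda>z :: real^2. z $ i) \<in> borel_measurable borel" for i
    by (intro borel_measurable_continuous_onI continuous_intros)
  have Sb [measurable]: "S \<in> sets borel" unfolding S_def by measurable
  have der: "(g has_derivative g' z) (at z within S)" if "z \<in> S" for z
    unfolding g_def g'_def using that
    by (intro EP_has_derivative bounded_linear.has_derivative[OF bounded_linear_vec_nth] has_derivative_ident) (auto simp: S_def)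
  have inj: "inj_on g S"
  proof (rule inj_onI)
    fix z z' assume "z \<in> S" "z' \<in> S" "g z = g z'"
    then show "z = z'" using EP_inj[OF q, of "z $ 1" "z' $ 1" "z $ 2" "z' $ 2"] by (auto simp: S_def g_def vec2_eq_iff)
  qed
  have gS: "g ` S = N"
  proof (intro equalityI subsetI)
    fix x assume "x \<in> N"
    then have xd: "x \<in> disc \<alpha>" using N by auto
    obtain t where "pi < t" "t < 2 * pi" "x = EP ?q (phi ?q x) t" by (rule EP_surj[OF q xd])
    then show "x \<in> g ` S" using \<open>x \<in> N\<close> phi_gt[OF q xd]
      by (intro image_eqI[of _ _ "vec2 (phi ?q x, t)"]) (auto simp: S_def g_def)
  qed (auto simp: S_def g_def)
  have det: "\<bar>det (matrix (g' z))\<bar> * wt s (g z) = speed (z $ 1) (z $ 2)" if "z \<in> S" for z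
  proof -
    have "g z \<in> disc \<alpha>" using that N by (auto simp: S_def g_def)
    then show ?thesis
      using jacobian[OF q, of "z $ 1" "z $ 2"] that
      by (simp add: S_def g_def wt_def det_2 matrix_def g'_def axis_def mult.commute)
  qed
  \<comment> \<open>The theorem on change of variables is applied to functions with values in
    \<open>real^1\<close>; the scalar identity is its single component.\<close>
  let ?f = "\<lambda>x. vec (wt s x) :: real^1"
  have wN: "(\<lambda>x. indicator N x * wt s x) \<in> borel_measurable borel" by measurable
  have int: "integrable lborel (\<lambda>x. indicator N x * wt s x)"
  proof (rule Bochner_Integration.integrable_bound)
    have "emeasure lborel (cball (0::real^2) 1) < \<infinity>" by (rule emeasure_bounded_finite[OF bounded_cball])
    then show "integrable lborel (\<lambda>x :: real^2. 2 * indicator (cball 0 1) x :: real)"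
      by (intro integrable_mult_right) (simp add: integrable_real_indicator)
    show "AE x in lborel. norm (indicator N x * wt s x) \<le> norm (2 * indicator (cball 0 1) x :: real)"
    proof (intro AE_I2)
      fix x
      have "x \<in> cball 0 1" if "x \<in> N" using that N(2) ab by (auto simp: disc_eq)
      then show "norm (indicator N x * wt s x) \<le> norm (2 * indicator (cball 0 1) x :: real)"
        using wt_bounds(1,2)[of s x] by (cases "x \<in> N") (auto simp: abs_mult)
    qed
  qed (use wN in simp)
  have hi: "((\<lambda>x. indicator N x * wt s x) has_integral (\<integral>x. indicator N x * wt s x \<partial>lborel)) UNIV"
    by (rule has_integral_integral_lborel[OF int])
  \<comment> \<open>Absolute integrability refers to the completed Lebesgue measure, the surrounding
    integrals to \<open>lborel\<close>.\<close>
  have aw: "(\<lambda>x. wt s x) absolutely_integrable_on N"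
    unfolding absolutely_integrable_on_def set_integrable_def
    using integrable_completion[of "\<lambda>x. indicator N x * wt s x" lborel] int wN by simp
  have fT: "?f = (\<lambda>x. wt s x *\<^sub>R vec 1)" by (auto simp: vec_eq_iff)
  have af: "?f absolutely_integrable_on N"
    using integrable_bounded_linear[OF bounded_linear_scaleR_left[of "vec 1 :: real^1"] aw[unfolded absolutely_integrable_on_def set_integrable_def]]
    unfolding absolutely_integrable_on_def set_integrable_def fT by simp
  let ?b = "integral N ?f"
  have cv: "(\<lambda>z. \<bar>det (matrix (g' z))\<bar> *\<^sub>R ?f (g z)) absolutely_integrable_on S \<and>
           integral S (\<lambda>z. \<bar>det (matrix (g' z))\<bar> *\<^sub>R ?f (g z)) = ?b"
    by (subst has_absolute_integral_change_of_variables[OF _ der inj]) (use af gS in auto)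
  have 1: "((\<lambda>z. \<bar>det (matrix (g' z))\<bar> *\<^sub>R ?f (g z)) has_integral ?b) S"
    using integrable_integral[OF set_lebesgue_integral_eq_integral(1)[OF conjunct1[OF cv]]] unfolding conjunct2[OF cv] .
  have 2: "(?f has_integral ?b) N"
    by (rule integrable_integral[OF set_lebesgue_integral_eq_integral(1)[OF af]])
  have "((\<lambda>z. (\<bar>det (matrix (g' z))\<bar> *\<^sub>R ?f (g z)) $ 1) has_integral ?b $ 1) S"
    using has_integral_linear[OF 1 bounded_linear_vec_nth[of 1]] by (simp add: o_def)
  then have 3: "((\<lambda>z. speed (z $ 1) (z $ 2)) has_integral ?b $ 1) S"
    by (rule has_integral_eq[rotated]) (use det in simp)
  have 4: "((\<lambda>x. wt s x) has_integral ?b $ 1) N" using has_integral_linear[OF 2 bounded_linear_vec_nth[of 1]] by (simp add: o_def)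
  have "(\<integral>\<^sup>+z. ennreal (indicator S z * speed (z $ 1) (z $ 2)) \<partial>lborel) = ennreal (?b $ 1)"
  proof (rule nn_integral_has_integral_lborel)
    show "((\<lambda>z. indicator S z * speed (z $ 1) (z $ 2)) has_integral ?b $ 1) UNIV"
      using 3 by (simp only: has_integral_indicator_UNIV)
    show "(\<lambda>z. indicator S z * speed (z $ 1) (z $ 2)) \<in> borel_measurable borel" by measurable
  qed (simp add: speed_def)
  moreover have "(\<integral>\<^sup>+x. ennreal (indicator N x * wt s x) \<partial>lborel) = ennreal (?b $ 1)"
  proof (rule nn_integral_has_integral_lborel[OF wN])
    show "((\<lambda>x. indicator N x * wt s x) has_integral ?b $ 1) UNIV"
      using 4 by (simp only: has_integral_indicator_UNIV)
  qed (auto simp: wt_bounds)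
  moreover have "ennreal (indicator A z * r) = indicator A z * ennreal r" for A :: "(real^2) set" and z r
    by (simp add: indicator_def)
  ultimately show ?thesis unfolding S_def[symmetric] by simp
qed

lemma coarea_nn:
  assumes A [measurable]: "A \<in> sets borel"
  shows "(\<integral>\<^sup>+L. \<integral>\<^sup>+t. indicator {2 * a<..} L * (indicator {0..<2*pi} t * (indicator (disc \<alpha>) (EP (circ s) L t) * (ennreal (speed L t) * indicator A (EP (circ s) L t)))) \<partial>lborel \<partial>lborel) =
    (\<integral>\<^sup>+x. indicator A x * ennreal (wt s x) \<partial>lborel)"
proof -
  let ?F = "\<lambda>L t. indicator {2 * a<..} L * (indicator {0..<2*pi} t * (indicator (disc \<alpha>) (EP (circ s) L t) * (ennreal (speed L t) * indicator A (EP (circ s) L t))))"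
  have q: "norm (circ s) = 1" by simp
  have m: "(\<lambda>(L, t). ?F L t) \<in> borel_measurable (lborel \<Otimes>\<^sub>M lborel)" by measurable
  let ?S = "{z :: real^2. 2 * a < z $ 1 \<and> pi < z $ 2 \<and> z $ 2 < 2 * pi \<and> EP (circ s) (z $ 1) (z $ 2) \<in> A \<inter> disc \<alpha>}"
  have [measurable]: "(\<lambda>z :: real^2. z $ i) \<in> borel_measurable borel" for i
    by (intro borel_measurable_continuous_onI continuous_intros)
  have mS: "(\<lambda>z :: real^2. indicator ?S z * ennreal (speed (z $ 1) (z $ 2))) \<in> borel_measurable borel" by measurable
  have "(\<integral>\<^sup>+L. \<integral>\<^sup>+t. ?F L t \<partial>lborel \<partial>lborel) = (\<integral>\<^sup>+p. (\<lambda>(L, t). ?F L t) p \<partial>(lborel \<Otimes>\<^sub>M lborel))"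
    by (subst lborel.nn_integral_fst[OF m, symmetric]) simp
  also have "\<dots> = (\<integral>\<^sup>+p. indicator ?S (vec2 p) * ennreal (speed (vec2 p $ 1) (vec2 p $ 2)) \<partial>lborel)"
    unfolding lborel_prod
  proof (intro nn_integral_cong)
    fix p :: "real \<times> real"
    obtain L t where p: "p = (L, t)" by (cases p)
    \<comment> \<open>Angles of the period outside (\<pi>, 2\<pi>) give no point of the disc, so the
      full period may be replaced by that interval.\<close>
    show "(\<lambda>(L, t). ?F L t) p = indicator ?S (vec2 p) * ennreal (speed (vec2 p $ 1) (vec2 p $ 2))"
      using EP_disc_range[OF q, of L t] pi_gt_zero by (auto simp: p indicator_def)
  qed
  also have "\<dots> = (\<integral>\<^sup>+z. indicator ?S z * ennreal (speed (z $ 1) (z $ 2)) \<partial>lborel)"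
    by (rule nn_integral_vec2[OF mS, symmetric])
  also have "\<dots> = (\<integral>\<^sup>+x. indicator (A \<inter> disc \<alpha>) x * ennreal (wt s x) \<partial>lborel)"
    by (rule coarea_sets) auto
  also have "\<dots> = (\<integral>\<^sup>+x. indicator A x * ennreal (wt s x) \<partial>lborel)"
    by (intro nn_integral_cong) (auto simp: indicator_def wt_def)
  finally show ?thesis .
qed

text \<open>Density of the measure on \<open>Z\<close> in the coordinates \<open>(s, x)\<close>.
  Below, \<open>ell_density\<close> is the density of the same measure in the coordinates
  \<open>((s, L), t)\<close>, namely arc length times Lebesgue measure in
  \<open>(s, L)\<close>.\<close>

definition base_density where "base_density p = indicator {0..<2*pi} (fst p) * wt (fst p) (snd p)"

lemma base_density_measurable [measurable]: "base_density \<in> borel_measurable borel"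
  unfolding base_density_def borel_prod[symmetric] by measurable

definition ell_density where
  "ell_density z = indicator {0..<2*pi} (fst (fst z)) * indicator {2 * a<..} (snd (fst z)) *
     (indicator {0..<2*pi} (snd z) * indicator (disc \<alpha>) (EP (circ (fst (fst z))) (snd (fst z)) (snd z)) * speed (snd (fst z)) (snd z))"

lemma ell_density_measurable [measurable]: "ell_density \<in> borel_measurable borel"
  unfolding ell_density_def borel_prod[symmetric] by measurable

definition ell_map where "ell_map z = (fst (fst z), EP (circ (fst (fst z))) (snd (fst z)) (snd z))"

lemma ell_map_measurable [measurable]: "ell_map \<in> borel_measurable borel"
  unfolding ell_map_def borel_prod[symmetric] by measurable

text \<open>This is \<open>coarea_nn\<close> integrated over \<open>s\<close> by Tonelli's theorem.
  As an equality of measures it yields the integral identities for Banach-valued functions at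
  once.\<close>

lemma coarea_measure:
  "density lborel (\<lambda>p. ennreal (base_density p)) = distr (density lborel (\<lambda>z. ennreal (ell_density z))) borel ell_map"
proof (rule measure_eqI)
  fix A assume "A \<in> sets (density lborel (\<lambda>p. ennreal (base_density p)))"
  then have A [measurable]: "A \<in> sets borel" by simp
  have As [measurable]: "Pair s -` A \<in> sets borel" for s :: real
    using measurable_sets_borel[of "Pair s" borel A] A by simp
  let ?G = "\<lambda>s x. ennreal (indicator {0..<2*pi} s * wt s x) * indicator A (s, x)"
  have mG: "(\<lambda>(s, x). ?G s x) \<in> borel_measurable (lborel \<Otimes>\<^sub>M lborel)" by measurable
  have "emeasure (density lborel (\<lambda>p. ennreal (base_density p))) A = (\<integral>\<^sup>+p. (\<lambda>(s, x). ?G s x) p \<partial>lborel)"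
    by (subst emeasure_density, measurable) (auto simp: base_density_def intro!: nn_integral_cong)
  also have "\<dots> = (\<integral>\<^sup>+s. \<integral>\<^sup>+x. ?G s x \<partial>lborel \<partial>lborel)"
    by (subst lborel_prod[symmetric], subst lborel.nn_integral_fst[OF mG, symmetric]) simp
  finally have 1: "emeasure (density lborel (\<lambda>p. ennreal (base_density p))) A = (\<integral>\<^sup>+s. \<integral>\<^sup>+x. ?G s x \<partial>lborel \<partial>lborel)" .
  let ?H = "\<lambda>s L t. indicator {0..<2*pi} s * (indicator {2 * a<..} L * (indicator {0..<2*pi} t * (indicator (disc \<alpha>) (EP (circ s) L t) * (ennreal (speed L t) * indicator (Pair s -` A) (EP (circ s) L t)))))"
  have Hi: "?H s L t = indicator {0..<2*pi} s * (indicator {2 * a<..} L * (indicator {0..<2*pi} t * (indicator (disc \<alpha>) (EP (circ s) L t) * (ennreal (speed L t) * indicator A (s, EP (circ s) L t)))))" for s L t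
    by (simp add: indicator_def)
  have mH: "(\<lambda>z. ?H (fst (fst z)) (snd (fst z)) (snd z)) \<in> borel_measurable ((lborel \<Otimes>\<^sub>M lborel) \<Otimes>\<^sub>M lborel)"
    unfolding Hi by measurable
  have mH': "(\<lambda>p. \<integral>\<^sup>+t. ?H (fst p) (snd p) t \<partial>lborel) \<in> borel_measurable (lborel \<Otimes>\<^sub>M lborel)"
    unfolding Hi by measurable
  have "emeasure (distr (density lborel (\<lambda>z. ennreal (ell_density z))) borel ell_map) A =
      (\<integral>\<^sup>+z. ennreal (ell_density z) * indicator A (ell_map z) \<partial>lborel)"
    by (subst emeasure_distr, measurable, subst emeasure_density, measurable) (auto intro!: nn_integral_cong simp: indicator_def)
  also have "\<dots> = (\<integral>\<^sup>+z. ?H (fst (fst z)) (snd (fst z)) (snd z) \<partial>lborel)"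
    by (intro nn_integral_cong) (auto simp: ell_density_def ell_map_def indicator_def)
  also have "\<dots> = (\<integral>\<^sup>+p. \<integral>\<^sup>+t. ?H (fst p) (snd p) t \<partial>lborel \<partial>lborel)"
    by (subst lborel_prod[symmetric], subst lborel_prod[symmetric], subst lborel.nn_integral_fst[OF mH, symmetric]) (simp add: lborel_prod)
  also have "\<dots> = (\<integral>\<^sup>+s. \<integral>\<^sup>+L. \<integral>\<^sup>+t. ?H s L t \<partial>lborel \<partial>lborel \<partial>lborel)"
    using lborel.nn_integral_fst[OF mH', symmetric] by (simp add: lborel_prod)
  also have "\<dots> = (\<integral>\<^sup>+s. indicator {0..<2*pi} s * (\<integral>\<^sup>+x. indicator (Pair s -` A) x * ennreal (wt s x) \<partial>lborel) \<partial>lborel)"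
  proof (intro nn_integral_cong)
    fix s :: real
    show "(\<integral>\<^sup>+L. \<integral>\<^sup>+t. ?H s L t \<partial>lborel \<partial>lborel) = indicator {0..<2*pi} s * (\<integral>\<^sup>+x. indicator (Pair s -` A) x * ennreal (wt s x) \<partial>lborel)"
      using coarea_nn[OF As, of s s] by (cases "s \<in> {0..<2*pi}") auto
  qed
  also have "\<dots> = (\<integral>\<^sup>+s. \<integral>\<^sup>+x. ?G s x \<partial>lborel \<partial>lborel)"
  proof (intro nn_integral_cong)
    fix s :: real
    show "indicator {0..<2*pi} s * (\<integral>\<^sup>+x. indicator (Pair s -` A) x * ennreal (wt s x) \<partial>lborel) = (\<integral>\<^sup>+x. ?G s x \<partial>lborel)"
      by (cases "s \<in> {0..<2*pi}") (auto simp: mult.commute indicator_def intro!: nn_integral_cong)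
  qed
  finally show "emeasure (density lborel (\<lambda>p. ennreal (base_density p))) A = emeasure (distr (density lborel (\<lambda>z. ennreal (ell_density z))) borel ell_map) A"
    using 1 by simp
qed simp

lemma coarea_integral:
  fixes H :: "real \<times> (real^2) \<Rightarrow> 'c::{banach, second_countable_topology}"
  assumes [measurable]: "H \<in> borel_measurable borel"
    and int: "integrable lborel (\<lambda>p. base_density p *\<^sub>R H p)"
  shows "(\<integral>p. base_density p *\<^sub>R H p \<partial>lborel) =
    (\<integral>y. (indicator {0..<2*pi} (fst y) * indicator {2 * a<..} (snd y)) *\<^sub>R
       (\<integral>t. (indicator {0..<2*pi} t * indicator (disc \<alpha>) (EP (circ (fst y)) (snd y) t) * speed (snd y) t) *\<^sub>R
          H (fst y, EP (circ (fst y)) (snd y) t) \<partial>lborel) \<partial>lborel)"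
proof -
  have nn: "0 \<le> base_density p" "0 \<le> ell_density z" for p z
    by (simp_all add: base_density_def ell_density_def wt_bounds speed_def)
  have i1: "integrable (density lborel (\<lambda>p. ennreal (base_density p))) H"
    by (subst integrable_density) (use nn int in auto)
  then have i2: "integrable lborel (\<lambda>z. ell_density z *\<^sub>R H (ell_map z))"
    unfolding coarea_measure by (subst (asm) integrable_distr_eq, measurable, subst (asm) integrable_density) (use nn in auto)
  have "(\<integral>p. base_density p *\<^sub>R H p \<partial>lborel) = (\<integral>p. H p \<partial>density lborel (\<lambda>p. ennreal (base_density p)))"
    by (subst integral_density) (use nn in auto)
  also have "\<dots> = (\<integral>z. ell_density z *\<^sub>R H (ell_map z) \<partial>lborel)"
    unfolding coarea_measure by (subst integral_distr, measurable, subst integral_density) (use nn in auto)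
  also have "\<dots> = (\<integral>y. (\<integral>t. ell_density (y, t) *\<^sub>R H (ell_map (y, t)) \<partial>lborel) \<partial>lborel)"
    using lborel_pair.integral_fst'[of "\<lambda>z. ell_density z *\<^sub>R H (ell_map z)"] i2 by (simp add: lborel_prod)
  also have "\<dots> = (\<integral>y. (indicator {0..<2*pi} (fst y) * indicator {2 * a<..} (snd y)) *\<^sub>R
       (\<integral>t. (indicator {0..<2*pi} t * indicator (disc \<alpha>) (EP (circ (fst y)) (snd y) t) * speed (snd y) t) *\<^sub>R
          H (fst y, EP (circ (fst y)) (snd y) t) \<partial>lborel) \<partial>lborel)"
    by (intro Bochner_Integration.integral_cong refl) (simp add: ell_density_def ell_map_def flip: scaleR_scaleR)
  finally show ?thesis .
qed

end

section \<open>Double fibration\<close>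

text \<open>The inverse of a chart is continuous on the image; extended by 0 it is a Borel function,
  and the image of \<open>B\<close> is, within the image of the chart, a preimage under it.\<close>

lemma chart_image_borel:
  assumes "chart V \<psi> M" "M \<in> sets borel" "B \<in> sets borel" "B \<subseteq> V"
  shows "\<psi> ` B \<in> sets borel"
proof -
  obtain h where h: "openin (top_of_set M) (\<psi> ` V)" "diffeo V (\<psi> ` V) \<psi> h"
    using assms(1) unfolding chart_def by blast
  then have phis_deriv: "smooth_map_on (\<psi> ` V) h" "\<And>z. z \<in> V \<Longrightarrow> h (\<psi> z) = z" by (auto simp: diffeo_def)
  have mV: "\<psi> ` V \<in> sets borel" using h(1) assms(2) by (auto simp: openin_open)
  have mh: "(\<lambda>m. if m \<in> \<psi> ` V then h m else 0) \<in> borel_measurable borel"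
    by (rule borel_measurable_continuous_on_if[OF mV smooth_map_on_continuous_on[OF phis_deriv(1)]]) auto
  have eq: "\<psi> ` B = \<psi> ` V \<inter> (\<lambda>m. if m \<in> \<psi> ` V then h m else 0) -` B"
  proof (intro equalityI subsetI)
    fix m assume "m \<in> \<psi> ` B"
    then obtain z where "z \<in> B" "z \<in> V" "m = \<psi> z" using assms(4) by auto
    then show "m \<in> \<psi> ` V \<inter> (\<lambda>m. if m \<in> \<psi> ` V then h m else 0) -` B" using phis_deriv(2)[of z] by simp
  next
    fix m assume m: "m \<in> \<psi> ` V \<inter> (\<lambda>m. if m \<in> \<psi> ` V then h m else 0) -` B"
    then obtain z where "z \<in> V" "m = \<psi> z" by blast
    then show "m \<in> \<psi> ` B" using m phis_deriv(2)[of z] by simp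
  qed
  show ?thesis
    unfolding eq by (rule sets.Int[OF mV measurable_sets_borel[OF mh assms(3)]])
qed

lemma bounded_integrable:
  fixes f :: "'a::euclidean_space \<Rightarrow> 'b::{banach, second_countable_topology}"
  assumes "f \<in> borel_measurable borel" "bounded S" "\<And>x. norm (f x) \<le> C" "\<And>x. x \<notin> S \<Longrightarrow> f x = 0"
  shows "integrable lborel f"
proof -
  obtain r where "\<forall>x\<in>S. norm x \<le> r" using assms(2) unfolding bounded_iff by (elim exE)
  then have r: "S \<subseteq> cball 0 r" by auto
  have C: "0 \<le> C" by (rule order_trans[OF norm_ge_zero assms(3)[of 0]])
  show ?thesis
  proof (rule Bochner_Integration.integrable_bound)
    have "emeasure lborel (cball (0::'a) r) < \<infinity>" by (rule emeasure_bounded_finite[OF bounded_cball])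
    then show "integrable lborel (\<lambda>x :: 'a. C * indicator (cball 0 r) x :: real)"
      by (intro integrable_mult_right) (simp add: integrable_real_indicator)
    show "AE x in lborel. norm (f x) \<le> norm (C * indicator (cball 0 r) x :: real)"
    proof (intro AE_I2)
      fix x
      have "x \<notin> S" if "x \<notin> cball 0 r" using that r by blast
      then show "norm (f x) \<le> norm (C * indicator (cball 0 r) x :: real)"
        using assms(3)[of x] assms(4)[of x] r C by (cases "x \<in> cball 0 r") auto
    qed
  qed (use assms(1) in simp)
qed

lemma Cc_functions_bounded_measurable:
  fixes f :: "'a::euclidean_space \<Rightarrow> 'b::real_normed_vector"
  assumes "f \<in> Cc_functions M" "M \<in> sets borel"
  shows "f \<in> borel_measurable borel" "\<exists>C. \<forall>x. norm (f x) \<le> C" "x \<notin> M \<Longrightarrow> f x = 0"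
proof -
  obtain K where K: "continuous_on M f" "compact K" "K \<subseteq> M" "\<And>p. p \<notin> K \<Longrightarrow> f p = 0"
    using assms(1) by (auto simp: Cc_functions_def)
  show "x \<notin> M \<Longrightarrow> f x = 0" using K by auto
  have "(\<lambda>x. if x \<in> M then f x else 0) \<in> borel_measurable borel"
    by (rule borel_measurable_continuous_on_if) (use assms(2) K in auto)
  moreover have "(\<lambda>x. if x \<in> M then f x else 0) = f"
  proof
    fix x show "(if x \<in> M then f x else 0) = f x" using K(3) K(4)[of x] by auto
  qed
  ultimately show "f \<in> borel_measurable borel" by simp
  have "bounded (f ` K)" by (rule compact_imp_bounded[OF compact_continuous_image[OF continuous_on_subset[OF K(1,3)] K(2)]])
  then obtain C where "\<And>x. x \<in> K \<Longrightarrow> norm (f x) \<le> C" unfolding bounded_iff by auto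
  then have "norm (f x) \<le> max C 0" for x using K(4)[of x] by (cases "x \<in> K") (auto simp: le_max_iff_disj)
  then show "\<exists>C. \<forall>x. norm (f x) \<le> C" by blast
qed

lemma smooth_measure_open:
  fixes M :: "'a::euclidean_space set"
  assumes "open M" shows "smooth_measure M (density lborel (indicator M))"
proof (rule smooth_measureI[where 'b = 'a])
  have [measurable]: "M \<in> sets borel" using assms by auto
  show "emeasure (density lborel (indicator M)) (- M) = 0"
  proof -
    have "(\<integral>\<^sup>+x. indicator M x * indicator (- M) x \<partial>lborel) = (\<integral>\<^sup>+x. 0 \<partial>(lborel :: 'a measure))"
      by (intro nn_integral_cong) (auto simp: indicator_def)
    then show ?thesis by (subst emeasure_density) auto
  qed
  fix p assume "p \<in> M"
  moreover have "emeasure (density lborel (indicator M)) B = (\<integral>\<^sup>+z\<in>B. ennreal 1 \<partial>lborel)"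
    if "B \<in> sets borel" "B \<subseteq> M" for B
  proof -
    have "(\<integral>\<^sup>+x. indicator M x * indicator B x \<partial>lborel) = (\<integral>\<^sup>+z\<in>B. ennreal 1 \<partial>lborel)"
      using that by (intro nn_integral_cong) (auto simp: indicator_def)
    then show ?thesis using that by (subst emeasure_density) auto
  qed
  ultimately show "\<exists>V \<psi> \<rho>. chart V (\<psi> :: 'a \<Rightarrow> 'a) M \<and> p \<in> \<psi> ` V \<and>
     smooth_open V \<rho> \<and> (\<forall>z\<in>V. \<rho> z > 0) \<and>
     (\<forall>B\<in>sets borel. B \<subseteq> V \<longrightarrow> emeasure (density lborel (indicator M)) (\<psi> ` B) = (\<integral>\<^sup>+z\<in>B. ennreal (\<rho> z) \<partial>lborel))"
    using open_chart[OF assms subset_refl]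
    by (intro exI[of _ M] exI[of _ "\<lambda>x. x"] exI[of _ "\<lambda>x. 1"]) auto
qed (use assms in auto)

text \<open>Accounts for the difference between the closed period [0, 2\<pi>] in the adjointness
  condition and the half-open period of the measures.\<close>

lemma AE_fst_neq: "AE q in (lborel :: (real \<times> 'a::euclidean_space) measure). fst q \<noteq> c"
proof (rule AE_I')
  have "emeasure (lborel \<Otimes>\<^sub>M lborel) ({c} \<times> (UNIV :: 'a set)) = emeasure lborel {c} * emeasure lborel (UNIV :: 'a set)"
    by (rule lborel.emeasure_pair_measure_Times) auto
  then have "emeasure lborel ({c} \<times> (UNIV :: 'a set)) = 0" by (simp add: lborel_prod)
  then show "{c} \<times> (UNIV :: 'a set) \<in> null_sets lborel"
    by (intro null_setsI) (auto intro!: borel_closed closed_Times)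
qed auto

lemma mem_Y_fiber: "x \<in> Y_fiber Z y \<longleftrightarrow> (y, x) \<in> Z" and mem_X_fiber: "y \<in> X_fiber Z x \<longleftrightarrow> (y, x) \<in> Z"
  by (force simp: Y_fiber_def X_fiber_def)+

lemma circ_angle: assumes "norm q = 1" shows "circ (angle q) = q"
proof -
  obtain s where s: "0 \<le> s" "s < 2 * pi" "q = circ s" by (rule circ_surj[OF assms])
  have "\<exists>!s. 0 \<le> s \<and> s < 2 * pi \<and> circ s = q"
  proof (rule ex1I)
    show "0 \<le> s \<and> s < 2 * pi \<and> circ s = q" using s by simp
    fix t assume "0 \<le> t \<and> t < 2 * pi \<and> circ t = q"
    then show "t = s" using s by (intro circ_eq_close) auto
  qed
  from theI'[OF this] show ?thesis by (simp add: angle_def)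
qed

context elliptic_radon begin

section \<open>Parametrizations of the parameter manifold, the incidence relation and the
  fibres\<close>

lemma Yset_eq: "Yset \<alpha> = Y_coord ` (UNIV \<times> {2 * a<..})"
proof (intro equalityI subsetI)
  fix y assume "y \<in> Y_coord ` (UNIV \<times> {2 * a<..})"
  then obtain s L where y: "y = (circ s, L)" "2 * a < L" by (auto simp: Y_coord_def)
  obtain t where "0 \<le> t" "t < 2 * pi" "circ s = circ t" by (rule circ_surj[of "circ s"]) auto
  then show "y \<in> Yset \<alpha>" using y unfolding Yset_def Y_coord_def a_def by (intro image_eqI[of _ _ "(t, L)"]) auto
qed (auto simp: Yset_def a_def)

lemma Y_coord_image: "Y_coord ` (UNIV \<times> S) = {y. norm (fst y) = 1 \<and> snd y \<in> S}"
proof (intro equalityI subsetI)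
  fix y :: "(real^2) \<times> real" assume "y \<in> {y. norm (fst y) = 1 \<and> snd y \<in> S}"
  then have y: "norm (fst y) = 1" "snd y \<in> S" by auto
  obtain t where "fst y = circ t" by (rule circ_surj[OF y(1)])
  then show "y \<in> Y_coord ` (UNIV \<times> S)" using y by (intro image_eqI[of _ _ "(t, snd y)"]) (auto simp: Y_coord_def prod_eq_iff)
qed (auto simp: Y_coord_def)

definition Z_coord where "Z_coord p = ((circ (fst p), phi (circ (fst p)) (snd p)), snd p)"

lemma mem_Zset: "z \<in> Zset \<alpha> \<longleftrightarrow> norm (fst (fst z)) = 1 \<and> snd z \<in> disc \<alpha> \<and> snd (fst z) = phi (fst (fst z)) (snd z)"
proof
  assume "z \<in> Zset \<alpha>"
  then show "norm (fst (fst z)) = 1 \<and> snd z \<in> disc \<alpha> \<and> snd (fst z) = phi (fst (fst z)) (snd z)"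
    by (auto simp: Zset_def Y_coord_def ellipse_def focal_sum_eq)
next
  assume h: "norm (fst (fst z)) = 1 \<and> snd z \<in> disc \<alpha> \<and> snd (fst z) = phi (fst (fst z)) (snd z)"
  then obtain s where s: "0 \<le> s" "s < 2 * pi" "fst (fst z) = circ s" using circ_surj by blast
  moreover have "2 * sin \<alpha> < phi (circ s) (snd z)" using phi_gt[of "circ s" "snd z"] h by (simp add: a_def)
  ultimately show "z \<in> Zset \<alpha>" using h unfolding Zset_def
    by (intro CollectI exI[of _ s] exI[of _ "snd (fst z)"] exI[of _ "snd z"]) (auto simp: Y_coord_def prod_eq_iff ellipse_def focal_sum_eq)
qed

lemma Zset_eq: "Zset \<alpha> = Z_coord ` (UNIV \<times> disc \<alpha>)"
proof (intro equalityI subsetI)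
  fix z assume z: "z \<in> Zset \<alpha>"
  then obtain s where "fst (fst z) = circ s" using circ_surj mem_Zset by blast
  then show "z \<in> Z_coord ` (UNIV \<times> disc \<alpha>)" using z
    by (intro image_eqI[of _ _ "(s, snd z)"]) (auto simp: Z_coord_def mem_Zset prod_eq_iff)
qed (auto simp: mem_Zset Z_coord_def)

lemma Y_fiber_Zset: assumes "norm (fst y) = 1" shows "Y_fiber (Zset \<alpha>) y = arc (fst y) (snd y)"
  using assms by (auto simp: mem_Y_fiber arc_def mem_Zset)

lemma X_fiber_Zset: assumes "x \<in> disc \<alpha>" shows "X_fiber (Zset \<alpha>) x = {y. norm (fst y) = 1 \<and> snd y = phi (fst y) x}"
  using assms by (auto simp: mem_X_fiber mem_Zset)

text \<open>By rotational symmetry it depends on \<open>L\<close> alone whether an ellipse meets the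
  disc, so \<open>Y_meeting\<close> is again a circle times an open set.\<close>

definition LL where "LL = {L. 2 * a < L \<and> tau0 L < 1}"

lemma Y_meeting_eq': "Y_meeting \<alpha> = Y_coord ` (UNIV \<times> LL)"
proof -
  have "y \<in> Y_meeting \<alpha> \<longleftrightarrow> norm (fst y) = 1 \<and> snd y \<in> LL" for y
  proof -
    have "y \<in> Y_meeting \<alpha> \<longleftrightarrow> (\<exists>x. norm (fst y) = 1 \<and> x \<in> disc \<alpha> \<and> snd y = phi (fst y) x)"
    proof -
      have "y \<in> Y_meeting \<alpha> \<longleftrightarrow> (\<exists>x. (y, x) \<in> Zset \<alpha>)" unfolding Y_meeting_eq by force
      then show ?thesis by (simp add: mem_Zset)
    qed
    also have "\<dots> \<longleftrightarrow> norm (fst y) = 1 \<and> 2 * a < snd y \<and> arc (fst y) (snd y) \<noteq> {}"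
      using phi_gt by (auto simp: arc_def)
    also have "\<dots> \<longleftrightarrow> norm (fst y) = 1 \<and> snd y \<in> LL"
      using arc_nonempty by (auto simp: LL_def)
    finally show ?thesis .
  qed
  then show ?thesis unfolding Y_coord_image by auto
qed

lemma tau0_smooth: "smooth_open {2 * a<..} tau0" and BB_smooth: "smooth_open {2 * a<..} BB"
proof -
  have p: "0 < (L / 2)\<^sup>2 - a\<^sup>2" "0 < BB L" "0 < L" if "L \<in> {2 * a<..}" for L using BB[of L] that by auto
  show B: "smooth_open {2 * a<..} BB" unfolding BB_def
    by (intro smooth_open_sqrt smooth_open_diff smooth_open_power smooth_open_divide smooth_open_arith p) auto
  have q: "0 < b\<^sup>2 * (BB L)\<^sup>2 + a\<^sup>2 * (L / 2)\<^sup>2" if "L \<in> {2 * a<..}" for L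
    using p[OF that] ab by (intro add_pos_pos) auto
  show "smooth_open {2 * a<..} tau0" unfolding tau0_def
    by (intro smooth_open_sqrt smooth_open_diff smooth_open_add smooth_open_mult smooth_open_power smooth_open_divide smooth_open_arith B q)
      (use ab in auto)
qed

lemma open_LL: "open LL"
proof -
  have "open ({2 * a<..} \<inter> tau0 -` {..<1})"
    by (rule continuous_open_preimage[OF smooth_open_continuous_on[OF tau0_smooth]]) auto
  moreover have "LL = {2 * a<..} \<inter> tau0 -` {..<1}" by (auto simp: LL_def)
  ultimately show ?thesis by simp
qed

lemma Y_param:
  assumes "open S" shows "circle_param Y_coord (UNIV \<times> S) (1, 0) UNIV fst (\<lambda>p. (fst p, snd (snd p)))"
proof
  show "open (UNIV \<times> S :: (real \<times> real) set)" by (intro open_Times assms) auto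
  show "smooth_open (UNIV \<times> S) Y_coord" unfolding Y_coord_def split_beta
    by (intro smooth_open_Pair smooth_open_circ smooth_open_fst smooth_open_snd smooth_open_id open_Times assms) auto
qed (auto simp: Y_coord_def inner_prod_def Basis_prod_def smooth_open_fst smooth_open_snd smooth_open_Pair open_Times)

lemma open_R_disc: "open (UNIV \<times> disc \<alpha> :: (real \<times> (real^2)) set)"
  by (intro open_Times open_disc) auto

lemma Z_coord_smooth: "smooth_open (UNIV \<times> disc \<alpha>) Z_coord"
proof -
  have c: "smooth_open (UNIV \<times> disc \<alpha>) (\<lambda>p :: real \<times> (real^2). circ (fst p))"
    by (intro smooth_open_circ smooth_open_fst smooth_open_id open_R_disc)
  have "smooth_open (UNIV \<times> disc \<alpha>) (\<lambda>p. phi (circ (fst p)) (snd p))"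
    by (rule smooth_geom(1)[OF open_R_disc c]) (auto intro!: smooth_open_snd open_R_disc disc_Reg)
  then show ?thesis unfolding Z_coord_def
    by (intro smooth_open_Pair c smooth_open_snd smooth_open_id open_R_disc)
qed

lemma Z_param: "circle_param Z_coord (UNIV \<times> disc \<alpha>) (1, 0) UNIV (\<lambda>z. fst (fst z)) (\<lambda>p. (fst p, snd (snd p)))"
  by unfold_locales (use Z_coord_smooth open_R_disc in
    \<open>auto simp: Z_coord_def inner_prod_def Basis_prod_def smooth_open_fst smooth_open_snd smooth_open_Pair open_Times\<close>)

lemma X_param: assumes "x \<in> disc \<alpha>" shows "circle_param (\<lambda>s. Y_coord (s, phi (circ s) x)) UNIV 1 UNIV fst fst"
proof
  have "smooth_open UNIV (\<lambda>s. phi (circ s) x)"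
    by (intro smooth_geom(1) smooth_open_circ) (use assms disc_Reg in auto)
  then show "smooth_open UNIV (\<lambda>s. Y_coord (s, phi (circ s) x))" unfolding Y_coord_def
    by (simp add: smooth_open_Pair smooth_open_circ)
qed (auto simp: Y_coord_def smooth_open_fst)

lemma Y_coord_measurable [measurable]: "Y_coord \<in> borel_measurable borel"
  unfolding Y_coord_def split_beta by (intro borel_measurable_continuous_onI continuous_intros)

lemma Z_coord_measurable [measurable]: "Z_coord \<in> borel_measurable borel"
  unfolding Z_coord_def by (intro borel_measurable_continuous_onI continuous_intros)

lemma Z_borel: "Zset \<alpha> \<in> sets borel"
proof -
  have "Zset \<alpha> = {z. norm (fst (fst z)) = 1} \<inter> {z. snd z \<in> disc \<alpha>} \<inter> {z. snd (fst z) = phi (fst (fst z)) (snd z)}"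
    by (auto simp: mem_Zset)
  moreover have "closed {z :: ((real^2) \<times> real) \<times> (real^2). norm (fst (fst z)) = 1}"
    "closed {z :: ((real^2) \<times> real) \<times> (real^2). snd (fst z) = phi (fst (fst z)) (snd z)}"
    "open {z :: ((real^2) \<times> real) \<times> (real^2). snd z \<in> disc \<alpha>}"
    using open_vimage[OF open_disc continuous_on_snd[OF continuous_on_id]]
    by (auto intro!: closed_Collect_eq continuous_intros simp: vimage_def)
  ultimately show ?thesis by (auto intro!: sets.Int)
qed

lemma Y_borel: assumes "open S" shows "Y_coord ` (UNIV \<times> S) \<in> sets borel"
proof -
  have "Y_coord ` (UNIV \<times> S) = {y. norm (fst y) = 1} \<inter> {y. snd y \<in> S}" unfolding Y_coord_image by auto
  moreover have "closed {y :: (real^2) \<times> real. norm (fst y) = 1}" "open {y :: (real^2) \<times> real. snd y \<in> S}"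
    using open_vimage[OF assms continuous_on_snd[OF continuous_on_id]]
    by (auto intro!: closed_Collect_eq continuous_intros simp: vimage_def)
  ultimately show ?thesis by (auto intro!: sets.Int)
qed

lemma X_fiber_borel: "{y :: (real^2) \<times> real. norm (fst y) = 1 \<and> snd y = phi (fst y) x} \<in> sets borel"
proof -
  have "{y :: (real^2) \<times> real. norm (fst y) = 1 \<and> snd y = phi (fst y) x} = {y. norm (fst y) = 1} \<inter> {y. snd y = phi (fst y) x}" by auto
  moreover have "closed {y :: (real^2) \<times> real. norm (fst y) = 1}" "closed {y :: (real^2) \<times> real. snd y = phi (fst y) x}"
    by (auto intro!: closed_Collect_eq continuous_intros)
  ultimately show ?thesis by (auto intro!: sets.Int)
qed

lemma X_fiber_image: assumes "x \<in> disc \<alpha>" shows "(\<lambda>s. Y_coord (s, phi (circ s) x)) ` UNIV = X_fiber (Zset \<alpha>) x"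
proof (intro equalityI subsetI)
  fix y assume y: "y \<in> X_fiber (Zset \<alpha>) x"
  then obtain s where "fst y = circ s" using circ_surj unfolding X_fiber_Zset[OF assms] by blast
  then show "y \<in> range (\<lambda>s. Y_coord (s, phi (circ s) x))" using y unfolding X_fiber_Zset[OF assms]
    by (intro image_eqI[of _ _ s]) (auto simp: Y_coord_def prod_eq_iff)
qed (auto simp: X_fiber_Zset[OF assms] Y_coord_def)

text \<open>Arc length on the part of the ellipse inside the disc, that is, on the fibre over
  \<open>y\<close>. Its counterpart \<open>m_x\<close> carries the weight dictated by the coarea
  formula, so that both families disintegrate the same measure on \<open>Z\<close>.\<close>

definition m_y where "m_y y = distr (density lborel (\<lambda>t. ennreal (indicator {0..<2*pi} t * indicator (disc \<alpha>) (EP (fst y) (snd y) t) * speed (snd y) t)))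
   borel (EP (fst y) (snd y))"

definition m_x where "m_x x = distr (density lborel (\<lambda>s. ennreal (indicator {0..<2*pi} s * wt s x))) borel (\<lambda>s. Y_coord (s, phi (circ s) x))"

lemma m_y_integral:
  fixes f :: "real^2 \<Rightarrow> 'c::{banach, second_countable_topology}"
  assumes [measurable]: "f \<in> borel_measurable borel"
  shows "(\<integral>x. f x \<partial>m_y y) = (\<integral>t. (indicator {0..<2*pi} t * indicator (disc \<alpha>) (EP (fst y) (snd y) t) * speed (snd y) t) *\<^sub>R f (EP (fst y) (snd y) t) \<partial>lborel)"
    "integrable (m_y y) f \<longleftrightarrow> integrable lborel (\<lambda>t. (indicator {0..<2*pi} t * indicator (disc \<alpha>) (EP (fst y) (snd y) t) * speed (snd y) t) *\<^sub>R f (EP (fst y) (snd y) t))"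
proof -
  have nn: "0 \<le> indicator {0..<2*pi} t * indicator (disc \<alpha>) (EP (fst y) (snd y) t) * speed (snd y) t" for t
    by (simp add: speed_def)
  show "(\<integral>x. f x \<partial>m_y y) = (\<integral>t. (indicator {0..<2*pi} t * indicator (disc \<alpha>) (EP (fst y) (snd y) t) * speed (snd y) t) *\<^sub>R f (EP (fst y) (snd y) t) \<partial>lborel)"
    unfolding m_y_def by (subst integral_distr, measurable, subst integral_density) (auto simp: nn)
  show "integrable (m_y y) f \<longleftrightarrow> integrable lborel (\<lambda>t. (indicator {0..<2*pi} t * indicator (disc \<alpha>) (EP (fst y) (snd y) t) * speed (snd y) t) *\<^sub>R f (EP (fst y) (snd y) t))"
    unfolding m_y_def by (subst integrable_distr_eq, measurable, subst integrable_density) (auto simp: nn)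
qed

lemma m_x_integral:
  fixes f :: "(real^2) \<times> real \<Rightarrow> 'c::{banach, second_countable_topology}"
  assumes [measurable]: "f \<in> borel_measurable borel"
  shows "(\<integral>y. f y \<partial>m_x x) = (\<integral>s. (indicator {0..<2*pi} s * wt s x) *\<^sub>R f (Y_coord (s, phi (circ s) x)) \<partial>lborel)"
    "integrable (m_x x) f \<longleftrightarrow> integrable lborel (\<lambda>s. (indicator {0..<2*pi} s * wt s x) *\<^sub>R f (Y_coord (s, phi (circ s) x)))"
proof -
  have nn: "0 \<le> indicator {0..<2*pi} s * wt s x" for s by (simp add: wt_bounds)
  show "(\<integral>y. f y \<partial>m_x x) = (\<integral>s. (indicator {0..<2*pi} s * wt s x) *\<^sub>R f (Y_coord (s, phi (circ s) x)) \<partial>lborel)"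
    unfolding m_x_def by (subst integral_distr, measurable, subst integral_density) (auto simp: nn)
  show "integrable (m_x x) f \<longleftrightarrow> integrable lborel (\<lambda>s. (indicator {0..<2*pi} s * wt s x) *\<^sub>R f (Y_coord (s, phi (circ s) x)))"
    unfolding m_x_def by (subst integrable_distr_eq, measurable, subst integrable_density) (auto simp: nn)
qed

lemma arc_chart:
  assumes q: "norm q = 1" and L: "2 * a < L"
  defines "V \<equiv> {t. pi < t \<and> t < 2 * pi \<and> EP q L t \<in> disc \<alpha>}"
  shows "chart V (EP q L) (arc q L)" "EP q L ` V = arc q L" "open V"
proof -
  have c: "continuous_on UNIV (EP q L)" by (intro continuous_intros)
  have "V = {pi<..<2*pi} \<inter> EP q L -` disc \<alpha>" by (auto simp: V_def)
  then show o: "open V" using open_vimage[OF open_disc c] by auto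
  show im: "EP q L ` V = arc q L"
  proof (intro equalityI subsetI)
    fix x assume x: "x \<in> arc q L"
    then obtain t where "pi < t" "t < 2 * pi" "x = EP q (phi q x) t" using EP_surj[OF q, of x] by (auto simp: arc_def)
    then show "x \<in> EP q L ` V" using x by (intro image_eqI[of _ _ t]) (auto simp: arc_def V_def)
  qed (use phi_EP[OF q L] in \<open>auto simp: V_def arc_def\<close>)
  \<comment> \<open>For \<pi> < t < 2\<pi> one has cos t = sin(t - 3\<pi>/2) with t - 3\<pi>/2 in
    (-\<pi>/2, \<pi>/2), and \<open>x \<bullet> rot q / (L / 2)\<close> is cos t on the
    ellipse.\<close>
  let ?h = "\<lambda>x. 3 * pi / 2 + arcsin (x \<bullet> rot q / (L / 2))"
  let ?O = "{x :: real^2. \<bar>x \<bullet> rot q / (L / 2)\<bar> < 1}"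
  have oO: "open ?O" using BB(4)[OF L] by (intro open_Collect_less continuous_intros) auto
  show "chart V (EP q L) (arc q L)"
  proof (rule chartI[OF o, where h = ?h])
    show "openin (top_of_set (arc q L)) (EP q L ` V)" unfolding im by simp
    show "smooth_open V (EP q L)" unfolding EP_def
      by (intro smooth_open_add smooth_open_scaleR smooth_open_mult smooth_open_sin smooth_open_cos smooth_open_const smooth_open_id o)
    have "smooth_open ?O ?h"
      by (intro smooth_open_add smooth_open_arcsin smooth_open_divide smooth_open_inner smooth_open_const smooth_open_id oO) (use BB(4)[OF L] in auto)
    moreover have "EP q L ` V \<subseteq> ?O"
      unfolding im using EE_of_phi(1)[OF q L] by (auto simp: arc_def)
    ultimately show "smooth_map_on (EP q L ` V) ?h" by (intro smooth_map_onI[OF _ oO]) auto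
    show "?h (EP q L t) = t" if "t \<in> V" for t
    proof -
      have qq: "q \<bullet> q = 1" using q by (simp add: norm_eq_1)
      have "EP q L t \<bullet> rot q / (L / 2) = cos t" using BB(4)[OF L] by (simp add: EP_def inner_add_left qq)
      also have "cos t = sin (t - 3 * pi / 2)"
      proof -
        have "sin (t - 3 * pi / 2) = sin ((t + pi / 2) - 2 * pi)" by (rule arg_cong[where f = sin]) simp
        also have "\<dots> = sin (t + pi / 2)" by (simp only: sin_diff) simp
        also have "\<dots> = cos t" by (simp add: sin_add)
        finally show ?thesis by simp
      qed
      finally have "arcsin (EP q L t \<bullet> rot q / (L / 2)) = arcsin (sin (t - 3 * pi / 2))" by simp
      also have "\<dots> = t - 3 * pi / 2" by (rule arcsin_sin) (use that in \<open>auto simp: V_def\<close>)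
      finally show ?thesis by simp
    qed
  qed
qed

text \<open>The arc inside the disc has one global chart, by the angle, so that no period has to be
  shifted as in \<open>smooth_measure_push\<close>.\<close>

lemma smooth_measure_m_y:
  assumes y: "norm (fst y) = 1" "2 * a < snd y"
  shows "smooth_measure (Y_fiber (Zset \<alpha>) y) (m_y y)"
proof -
  obtain q L where yq: "y = (q, L)" by (cases y)
  have q: "norm q = 1" and L: "2 * a < L" using y yq by auto
  note C = arc_chart[OF q L]
  let ?V = "{t. pi < t \<and> t < 2 * pi \<and> EP q L t \<in> disc \<alpha>}"
  have arcb: "arc q L \<in> sets borel"
  proof -
    have "arc q L = disc \<alpha> \<inter> {x. phi q x = L}" by (auto simp: arc_def)
    moreover have "closed {x. phi q x = L}" by (intro closed_Collect_eq continuous_intros)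
    ultimately show ?thesis by (auto intro!: sets.Int)
  qed
  let ?d = "\<lambda>t. ennreal (indicator {0..<2*pi} t * indicator (disc \<alpha>) (EP q L t) * speed L t)"
  have em: "emeasure (m_y y) A = (\<integral>\<^sup>+t. ?d t * indicator A (EP q L t) \<partial>lborel)" if [measurable]: "A \<in> sets borel" for A
    unfolding m_y_def yq fst_conv snd_conv
    by (subst emeasure_distr, measurable, subst emeasure_density, measurable) (auto intro!: nn_integral_cong simp: indicator_def)
  have "smooth_measure (arc q L) (m_y y)"
  proof (rule smooth_measureI[where 'b = real, OF arcb])
    show "sets (m_y y) = sets borel" by (simp add: m_y_def)
    show "emeasure (m_y y) (- arc q L) = 0"
    proof -
      have "?d t * indicator (- arc q L) (EP q L t) = 0" for t
        using EP_disc_range[OF q L, of t] phi_EP[OF q L, of t] by (auto simp: indicator_def arc_def)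
      then show ?thesis using arcb by (subst em) (auto simp del: mult_eq_0_iff)
    qed
    fix p assume p: "p \<in> arc q L"
    have "emeasure (m_y y) (EP q L ` B) = (\<integral>\<^sup>+t\<in>B. ennreal (speed L t) \<partial>lborel)" if B: "B \<in> sets borel" "B \<subseteq> ?V" for B
    proof -
      have "EP q L ` B \<in> sets borel" by (rule chart_image_borel[OF C(1) arcb B])
      then have "emeasure (m_y y) (EP q L ` B) = (\<integral>\<^sup>+t. ?d t * indicator (EP q L ` B) (EP q L t) \<partial>lborel)" by (rule em)
      also have "\<dots> = (\<integral>\<^sup>+t\<in>B. ennreal (speed L t) \<partial>lborel)"
      proof (rule nn_integral_cong)
        fix t
        have "t \<in> B" if t: "0 \<le> t" "t < 2 * pi" "EP q L t \<in> disc \<alpha>" "EP q L t \<in> EP q L ` B"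
        proof -
          obtain t' where t': "t' \<in> B" "EP q L t = EP q L t'" using t(4) by auto
          then show ?thesis using EP_inj[OF q L L, of t t'] EP_disc_range[OF q L t(3,1,2)] t B(2) by auto
        qed
        moreover have "0 \<le> t \<and> t < 2 * pi \<and> EP q L t \<in> disc \<alpha>" if "t \<in> B"
        proof -
          have "pi < t" "t < 2 * pi" "EP q L t \<in> disc \<alpha>" using that B(2) by auto
          then show ?thesis using pi_gt_zero by linarith
        qed
        ultimately show "?d t * indicator (EP q L ` B) (EP q L t) = ennreal (speed L t) * indicator B t"
          by (auto simp: indicator_def)
      qed
      finally show ?thesis .
    qed
    moreover have "smooth_open ?V (speed L)"
    proof -
      have p: "0 < (L / 2 * sin t)\<^sup>2 + (BB L * cos t)\<^sup>2" for t using speed_pos[OF L, of t] by (simp add: speed_def)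
      show ?thesis unfolding speed_def
        by (intro smooth_open_sqrt smooth_open_add smooth_open_power smooth_open_mult smooth_open_sin smooth_open_cos smooth_open_const smooth_open_id C(3) p)
    qed
    ultimately show "\<exists>V \<psi> \<rho>. chart V (\<psi> :: real \<Rightarrow> _) (arc q L) \<and> p \<in> \<psi> ` V \<and> smooth_open V \<rho> \<and> (\<forall>z\<in>V. \<rho> z > 0) \<and>
     (\<forall>B\<in>sets borel. B \<subseteq> V \<longrightarrow> emeasure (m_y y) (\<psi> ` B) = (\<integral>\<^sup>+z\<in>B. ennreal (\<rho> z) \<partial>lborel))"
      using C p speed_pos[OF L] by (intro exI[of _ ?V] exI[of _ "EP q L"] exI[of _ "speed L"]) auto
  qed simp
  then show ?thesis using Y_fiber_Zset[OF y(1)] yq by simp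
qed

lemma wt_period: "circ (s + t) = circ s \<Longrightarrow> wt (s + t) x = wt s x"
  by (simp add: wt_def)

lemma smooth_measure_m_x:
  assumes x: "x \<in> disc \<alpha>" shows "smooth_measure (X_fiber (Zset \<alpha>) x) (m_x x)"
proof -
  interpret circle_param "\<lambda>s. Y_coord (s, phi (circ s) x)" UNIV 1 UNIV fst fst by (rule X_param[OF x])
  have "m_x x = push (\<lambda>s. wt s x)" unfolding m_x_def push_def by (auto simp: ennreal_mult' indicator_def intro!: arg_cong[where f = "\<lambda>m. distr m _ _"] arg_cong[where f = "density _"])
  moreover have "smooth_measure (range (\<lambda>s. Y_coord (s, phi (circ s) x))) (push (\<lambda>s. wt s x))"
  proof (rule smooth_measure_push)
    show "range (\<lambda>s. Y_coord (s, phi (circ s) x)) \<in> sets borel"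
      using X_fiber_borel[of x] unfolding X_fiber_image[OF x] X_fiber_Zset[OF x] .
    have "smooth_open UNIV (\<lambda>s. case (s, x) of (s, x) \<Rightarrow> wt s x)"
      by (rule smooth_open_compose[OF wt_smooth]) (auto intro!: smooth_open_Pair open_R_disc x)
    then show "smooth_open UNIV (\<lambda>s. wt s x)" by simp
  qed (use wt_bounds(3)[OF x] wt_period in auto)
  ultimately show ?thesis by (simp add: X_fiber_image[OF x])
qed

text \<open>The set \<open>S\<close> of admissible \<open>L\<close> is a parameter because the
  measure conditions are proved both over \<open>Yset\<close> and over
  \<open>Y_meeting\<close>.\<close>

definition mu_Y where "mu_Y S = circle_param.push Y_coord (UNIV \<times> S) (1, 0) (\<lambda>_. 1)"
definition mu_Z where "mu_Z = circle_param.push Z_coord (UNIV \<times> disc \<alpha>) (1, 0) (\<lambda>p. wt (fst p) (snd p))"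

lemma smooth_measure_mu_Y: assumes "open S" shows "smooth_measure (Y_coord ` (UNIV \<times> S)) (mu_Y S)"
proof -
  interpret circle_param Y_coord "UNIV \<times> S" "(1, 0)" UNIV fst "\<lambda>p. (fst p, snd (snd p))" by (rule Y_param[OF assms])
  show ?thesis unfolding mu_Y_def by (rule smooth_measure_push[OF _ Y_borel[OF assms]]) auto
qed

lemma smooth_measure_mu_Z: "smooth_measure (Zset \<alpha>) mu_Z"
proof -
  interpret circle_param Z_coord "UNIV \<times> disc \<alpha>" "(1, 0)" UNIV "\<lambda>z. fst (fst z)" "\<lambda>p. (fst p, snd (snd p))" by (rule Z_param)
  have [measurable]: "(\<lambda>p. wt (fst p) (snd p)) \<in> borel_measurable (borel :: (real \<times> (real^2)) measure)"
    unfolding borel_prod[symmetric] by measurable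
  show ?thesis unfolding mu_Z_def Zset_eq
  proof (rule smooth_measure_push)
    show "Z_coord ` (UNIV \<times> disc \<alpha>) \<in> sets borel" using Z_borel by (simp add: Zset_eq)
    show "smooth_open (UNIV \<times> disc \<alpha>) (\<lambda>p. wt (fst p) (snd p))"
      by (rule smooth_open_cong[OF open_R_disc _ wt_smooth]) auto
  qed (auto simp: wt_bounds wt_period inner_prod_def)
qed

lemma integral_mu_Y:
  fixes f :: "(real^2) \<times> real \<Rightarrow> 'c::{banach, second_countable_topology}"
  assumes "open S" "f \<in> borel_measurable borel"
  shows "(\<integral>y. f y \<partial>mu_Y S) = (\<integral>p. (indicator {0..<2*pi} (fst p) * indicator S (snd p)) *\<^sub>R f (Y_coord p) \<partial>lborel)"
proof -
  interpret circle_param Y_coord "UNIV \<times> S" "(1, 0)" UNIV fst "\<lambda>p. (fst p, snd (snd p))" by (rule Y_param[OF assms(1)])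
  have "(\<integral>y. f y \<partial>mu_Y S) = (\<integral>z. (indicator (UNIV \<times> S) z * indicator {0..<2*pi} (z \<bullet> (1, 0)) * 1) *\<^sub>R f (Y_coord z) \<partial>lborel)"
    unfolding mu_Y_def by (rule push_integral(1)) (use assms in auto)
  also have "\<dots> = (\<integral>p. (indicator {0..<2*pi} (fst p) * indicator S (snd p)) *\<^sub>R f (Y_coord p) \<partial>lborel)"
    by (intro Bochner_Integration.integral_cong) (auto simp: inner_prod_def indicator_def)
  finally show ?thesis .
qed

lemma integral_mu_Z:
  fixes f :: "((real^2) \<times> real) \<times> (real^2) \<Rightarrow> 'c::{banach, second_countable_topology}"
  assumes "f \<in> borel_measurable borel"
  shows "(\<integral>z. f z \<partial>mu_Z) = (\<integral>p. base_density p *\<^sub>R f (Z_coord p) \<partial>lborel)"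
proof -
  interpret circle_param Z_coord "UNIV \<times> disc \<alpha>" "(1, 0)" UNIV "\<lambda>z. fst (fst z)" "\<lambda>p. (fst p, snd (snd p))" by (rule Z_param)
  have [measurable]: "(\<lambda>p. wt (fst p) (snd p)) \<in> borel_measurable (borel :: (real \<times> (real^2)) measure)"
    unfolding borel_prod[symmetric] by measurable
  have "(\<integral>z. f z \<partial>mu_Z) = (\<integral>p. (indicator (UNIV \<times> disc \<alpha>) p * indicator {0..<2*pi} (p \<bullet> (1, 0)) * wt (fst p) (snd p)) *\<^sub>R f (Z_coord p) \<partial>lborel)"
    unfolding mu_Z_def by (rule push_integral(1)) (use assms wt_bounds in auto)
  also have "\<dots> = (\<integral>p. base_density p *\<^sub>R f (Z_coord p) \<partial>lborel)"
    by (intro Bochner_Integration.integral_cong) (auto simp: inner_prod_def indicator_def base_density_def wt_def)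
  finally show ?thesis .
qed

lemma base_integrable:
  fixes h :: "((real^2) \<times> real) \<times> (real^2) \<Rightarrow> 'c::{banach, second_countable_topology}"
  assumes h [measurable]: "h \<in> borel_measurable borel" and C: "\<And>z. norm (h z) \<le> C"
  shows "integrable lborel (\<lambda>p. base_density p *\<^sub>R h (Z_coord p))"
proof (rule bounded_integrable)
  show "(\<lambda>p. base_density p *\<^sub>R h (Z_coord p)) \<in> borel_measurable borel" by measurable
  show "bounded ({0..2*pi} \<times> disc \<alpha>)" by (intro bounded_Times) (auto simp: disc_eq)
  have C0: "0 \<le> C" by (rule order_trans[OF norm_ge_zero C[of undefined]])
  show "norm (base_density p *\<^sub>R h (Z_coord p)) \<le> 2 * C" for p
  proof -
    have "\<bar>base_density p\<bar> \<le> 2" using wt_bounds(1,2)[of "fst p" "snd p"] by (auto simp: base_density_def indicator_def)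
    then show ?thesis using C[of "Z_coord p"] by (simp add: mult_mono)
  qed
  show "base_density p *\<^sub>R h (Z_coord p) = 0" if "p \<notin> {0..2*pi} \<times> disc \<alpha>" for p
    using that by (cases p) (auto simp: base_density_def wt_def indicator_def)
qed

text \<open>The disintegration over \<open>Y\<close> is the coarea formula; the one over
  \<open>X\<close> that follows is Fubini's theorem in the coordinates
  \<open>(s, x)\<close>.\<close>

lemma disint_Y:
  fixes h :: "((real^2) \<times> real) \<times> (real^2) \<Rightarrow> 'c::{banach, second_countable_topology}"
  assumes h [measurable]: "h \<in> borel_measurable borel" and C: "\<And>z. norm (h z) \<le> C"
  shows "(\<integral>p. base_density p *\<^sub>R h (Z_coord p) \<partial>lborel) =
    (\<integral>p. (indicator {0..<2*pi} (fst p) * indicator {2 * a<..} (snd p)) *\<^sub>R (\<integral>x. h (Y_coord p, x) \<partial>m_y (Y_coord p)) \<partial>lborel)"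
proof -
  have m [measurable]: "(\<lambda>x. h (y, x)) \<in> borel_measurable borel" for y by measurable
  have "(\<integral>p. base_density p *\<^sub>R h (Z_coord p) \<partial>lborel) =
    (\<integral>y. (indicator {0..<2*pi} (fst y) * indicator {2 * a<..} (snd y)) *\<^sub>R
       (\<integral>t. (indicator {0..<2*pi} t * indicator (disc \<alpha>) (EP (circ (fst y)) (snd y) t) * speed (snd y) t) *\<^sub>R
          h (Z_coord (fst y, EP (circ (fst y)) (snd y) t)) \<partial>lborel) \<partial>lborel)"
    by (rule coarea_integral) (use base_integrable[OF assms] in auto)
  also have "\<dots> = (\<integral>p. (indicator {0..<2*pi} (fst p) * indicator {2 * a<..} (snd p)) *\<^sub>R (\<integral>x. h (Y_coord p, x) \<partial>m_y (Y_coord p)) \<partial>lborel)"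
  proof (intro Bochner_Integration.integral_cong refl)
    fix p :: "real \<times> real"
    obtain s L where p: "p = (s, L)" by (cases p)
    have "(\<integral>t. (indicator {0..<2*pi} t * indicator (disc \<alpha>) (EP (circ s) L t) * speed L t) *\<^sub>R h (Z_coord (s, EP (circ s) L t)) \<partial>lborel) =
      (\<integral>x. h (Y_coord p, x) \<partial>m_y (Y_coord p))" if L: "2 * a < L"
      unfolding m_y_integral(1)[OF m] p Y_coord_def prod.case fst_conv snd_conv
    proof (intro Bochner_Integration.integral_cong refl)
      fix t
      have q: "norm (circ s) = 1" by simp
      show "(indicator {0..<2*pi} t * indicator (disc \<alpha>) (EP (circ s) L t) * speed L t) *\<^sub>R h (Z_coord (s, EP (circ s) L t)) =
        (indicator {0..<2*pi} t * indicator (disc \<alpha>) (EP (circ s) L t) * speed L t) *\<^sub>R h ((circ s, L), EP (circ s) L t)"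
        using phi_EP[OF q L, of t] EP_disc_range[OF q L, of t] by (auto simp: indicator_def Z_coord_def)
    qed
    then show "(indicator {0..<2*pi} (fst p) * indicator {2 * a<..} (snd p)) *\<^sub>R
       (\<integral>t. (indicator {0..<2*pi} t * indicator (disc \<alpha>) (EP (circ (fst p)) (snd p) t) * speed (snd p) t) *\<^sub>R
          h (Z_coord (fst p, EP (circ (fst p)) (snd p) t)) \<partial>lborel) =
       (indicator {0..<2*pi} (fst p) * indicator {2 * a<..} (snd p)) *\<^sub>R (\<integral>x. h (Y_coord p, x) \<partial>m_y (Y_coord p))"
      by (cases "2 * a < L") (auto simp: p)
  qed
  finally show ?thesis .
qed

lemma disint_X:
  fixes h :: "((real^2) \<times> real) \<times> (real^2) \<Rightarrow> 'c::{banach, second_countable_topology}"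
  assumes h [measurable]: "h \<in> borel_measurable borel" and C: "\<And>z. norm (h z) \<le> C"
  shows "(\<integral>p. base_density p *\<^sub>R h (Z_coord p) \<partial>lborel) = (\<integral>x. (\<integral>y. h (y, x) \<partial>m_x x) \<partial>lborel)"
proof -
  have m [measurable]: "(\<lambda>y. h (y, x)) \<in> borel_measurable borel" for x by measurable
  have "(\<integral>p. base_density p *\<^sub>R h (Z_coord p) \<partial>lborel) = (\<integral>x. (\<integral>s. base_density (s, x) *\<^sub>R h (Z_coord (s, x)) \<partial>lborel) \<partial>lborel)"
  proof -
    have e: "case_prod (\<lambda>s x. base_density (s, x) *\<^sub>R h (Z_coord (s, x))) = (\<lambda>p. base_density p *\<^sub>R h (Z_coord p))"
      by auto
    show ?thesis
      using lborel_pair.integral_snd[of "\<lambda>s x. base_density (s, x) *\<^sub>R h (Z_coord (s, x))"] base_integrable[OF assms]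
      unfolding e lborel_prod by simp
  qed
  also have "\<dots> = (\<integral>x. (\<integral>y. h (y, x) \<partial>m_x x) \<partial>lborel)"
    unfolding m_x_integral(1)[OF m] by (simp add: base_density_def Z_coord_def Y_coord_def)
  finally show ?thesis .
qed

end

lemma borel_measurable_fst [measurable]: "(fst :: 'a::euclidean_space \<times> 'b::euclidean_space \<Rightarrow> 'a) \<in> borel_measurable borel"
  and borel_measurable_snd [measurable]: "(snd :: 'a::euclidean_space \<times> 'b::euclidean_space \<Rightarrow> 'b) \<in> borel_measurable borel"
  by (intro borel_measurable_continuous_onI continuous_intros)+

lemma borel_measurable_integral_borel:
  fixes f :: "'a::euclidean_space \<Rightarrow> 'b::euclidean_space \<Rightarrow> 'c::{banach, second_countable_topology}"
  assumes "(\<lambda>p. f (fst p) (snd p)) \<in> borel_measurable borel"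
  shows "(\<lambda>x. \<integral>y. f x y \<partial>lborel) \<in> borel_measurable borel"
proof (rule lborel.borel_measurable_lebesgue_integral)
  have "sets (borel \<Otimes>\<^sub>M (lborel :: 'b measure)) = sets (borel :: ('a \<times> 'b) measure)"
    unfolding borel_prod[symmetric] by (intro sets_pair_measure_cong) auto
  then show "case_prod f \<in> borel_measurable (borel \<Otimes>\<^sub>M lborel)"
    using assms by (subst measurable_cong_sets[OF _ refl, of _ borel]) (auto simp: case_prod_beta')
qed

context elliptic_radon begin

section \<open>Radon transform and backprojection as fibre integrals\<close>

lemma Y_coord_fst: "norm (fst (Y_coord p)) = 1" "snd (Y_coord p) = snd p"
  by (simp_all add: Y_coord_def split_beta)

lemma radon_eq:
  assumes f: "f \<in> borel_measurable borel" "\<And>x. x \<notin> disc \<alpha> \<Longrightarrow> f x = 0" and y: "norm (fst y) = 1" "2 * a < snd y"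
  shows "radon \<alpha> f y = (\<integral>x. f x \<partial>m_y y)"
proof -
  note [measurable] = f(1)
  have e: "ellipse_param \<alpha> (angle (fst y)) (snd y) = EP (fst y) (snd y)"
    by (rule ext) (simp add: ellipse_param_eq circ_angle[OF y(1)])
  have nv: "norm (vector_derivative (EP (fst y) (snd y)) (at t)) = speed (snd y) t" for t
    using norm_vector_derivative_ellipse[OF y(2), of "angle (fst y)" t] unfolding e .
  have d: "(\<lambda>t. indicator {0..<2*pi} t * ennreal (speed (snd y) t)) = (\<lambda>t. ennreal (indicator {0..<2*pi} t * speed (snd y) t))"
    by (auto simp: indicator_def)
  have nn: "0 \<le> indicator {0..<2*pi} t * speed (snd y) t" for t by (simp add: speed_def)
  have "radon \<alpha> f y = (\<integral>x. f x \<partial>distr (density lborel (\<lambda>t. ennreal (indicator {0..<2*pi} t * speed (snd y) t))) borel (EP (fst y) (snd y)))"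
    unfolding radon_def ellipse_arc_length_def e nv d ..
  also have "\<dots> = (\<integral>t. (indicator {0..<2*pi} t * speed (snd y) t) *\<^sub>R f (EP (fst y) (snd y) t) \<partial>lborel)"
    by (subst integral_distr, measurable, subst integral_density) (auto simp: nn)
  also have "\<dots> = (\<integral>x. f x \<partial>m_y y)"
    unfolding m_y_integral(1)[OF f(1)]
  proof (intro Bochner_Integration.integral_cong refl)
    fix t
    show "(indicator {0..<2*pi} t * speed (snd y) t) *\<^sub>R f (EP (fst y) (snd y) t) =
      (indicator {0..<2*pi} t * indicator (disc \<alpha>) (EP (fst y) (snd y) t) * speed (snd y) t) *\<^sub>R f (EP (fst y) (snd y) t)"
      using f(2)[of "EP (fst y) (snd y) t"] by (cases "EP (fst y) (snd y) t \<in> disc \<alpha>") auto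
  qed
  finally show ?thesis .
qed

lemma m_y_integrable:
  fixes f :: "real^2 \<Rightarrow> 'c::{banach, second_countable_topology}"
  assumes [measurable]: "f \<in> borel_measurable borel" and C: "\<And>x. norm (f x) \<le> C"
  shows "integrable (m_y y) f"
  unfolding m_y_integral(2)[OF assms(1)]
proof -
  have "continuous_on {0..2*pi} (speed (snd y))" by (intro continuous_intros)
  then have "bounded (speed (snd y) ` {0..2*pi})"
    by (intro compact_imp_bounded compact_continuous_image) auto
  then obtain B where "\<forall>x\<in>speed (snd y) ` {0..2*pi}. norm x \<le> B" unfolding bounded_iff by (elim exE)
  then have B: "norm (speed (snd y) t) \<le> B" if "t \<in> {0..2*pi}" for t using that by simp
  have C0: "0 \<le> C" by (rule order_trans[OF norm_ge_zero C[of undefined]])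
  show "integrable lborel (\<lambda>t. (indicator {0..<2*pi} t * indicator (disc \<alpha>) (EP (fst y) (snd y) t) * speed (snd y) t) *\<^sub>R f (EP (fst y) (snd y) t))"
  proof (rule bounded_integrable)
    show "norm ((indicator {0..<2*pi} t * indicator (disc \<alpha>) (EP (fst y) (snd y) t) * speed (snd y) t) *\<^sub>R f (EP (fst y) (snd y) t)) \<le> max B 0 * C" for t
    proof -
      have "\<bar>indicator {0..<2*pi} t * indicator (disc \<alpha>) (EP (fst y) (snd y) t) * speed (snd y) t\<bar> \<le> max B 0"
        using B[of t] by (auto simp: indicator_def le_max_iff_disj)
      then show ?thesis using C C0 by (simp only: norm_scaleR real_norm_def) (intro mult_mono, auto)
    qed
    show "bounded {0..2*pi}" by simp
  qed (auto simp: indicator_def)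
qed

lemma m_x_integrable:
  fixes g :: "(real^2) \<times> real \<Rightarrow> 'c::{banach, second_countable_topology}"
  assumes [measurable]: "g \<in> borel_measurable borel" and C: "\<And>x. norm (g x) \<le> C"
  shows "integrable (m_x x) g"
  unfolding m_x_integral(2)[OF assms(1)]
proof -
  have C0: "0 \<le> C" by (rule order_trans[OF norm_ge_zero C[of undefined]])
  show "integrable lborel (\<lambda>s. (indicator {0..<2*pi} s * wt s x) *\<^sub>R g (Y_coord (s, phi (circ s) x)))"
  proof (rule bounded_integrable)
    show "norm ((indicator {0..<2*pi} s * wt s x) *\<^sub>R g (Y_coord (s, phi (circ s) x))) \<le> 2 * C" for s
    proof -
      have "\<bar>indicator {0..<2*pi} s * wt s x\<bar> \<le> 2" using wt_bounds(1,2)[of s x] by (auto simp: indicator_def)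
      then show ?thesis using C C0 by (simp only: norm_scaleR real_norm_def) (intro mult_mono, auto)
    qed
    show "bounded {0..2*pi}" by simp
  qed (auto simp: indicator_def)
qed

lemma backprojection_eq:
  assumes [measurable]: "g \<in> borel_measurable borel"
  shows "backprojection \<alpha> wt g x = (\<integral>y. g y \<partial>m_x x)"
  unfolding m_x_integral(1)[OF assms] backprojection_def set_lebesgue_integral_def focal_sum_eq
proof (rule integral_cong_AE)
  have "AE s in lborel. s \<noteq> 2 * pi" by (rule AE_lborel_singleton)
  then show "AE s in lborel. indicator {0..2*pi} s *\<^sub>R wt s x *\<^sub>R g (Y_coord (s, phi (circ s) x)) =
     (indicator {0..<2*pi} s * wt s x) *\<^sub>R g (Y_coord (s, phi (circ s) x))"
    by eventually_elim (auto simp: indicator_def)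
qed measurable

text \<open>The fibre measure vanishes when the ellipse misses the disc, so the integral over all
  \<open>L > 2 * a\<close> reduces to any open set \<open>S\<close> of such \<open>L\<close> that
  contains all values of \<open>phi\<close> on the disc.\<close>

lemma disint_mu_Y:
  fixes h :: "((real^2) \<times> real) \<times> (real^2) \<Rightarrow> 'c::{banach, second_countable_topology}"
  assumes S: "open S" "S \<subseteq> {2 * a<..}" "\<And>q x. norm q = 1 \<Longrightarrow> x \<in> disc \<alpha> \<Longrightarrow> phi q x \<in> S"
    and h [measurable]: "h \<in> borel_measurable borel" and C: "\<And>z. norm (h z) \<le> C"
  shows "(\<integral>z. h z \<partial>mu_Z) = (\<integral>y. (\<integral>x. h (y, x) \<partial>m_y y) \<partial>mu_Y S)"
proof -
  have m [measurable]: "(\<lambda>x. h (y, x)) \<in> borel_measurable borel" for y by measurable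
  have F: "(\<lambda>y. \<integral>x. h (y, x) \<partial>m_y y) \<in> borel_measurable borel"
    unfolding m_y_integral(1)[OF m] by (rule borel_measurable_integral_borel) measurable
  show ?thesis
    unfolding integral_mu_Z[OF h] disint_Y[OF h C] integral_mu_Y[OF S(1) F]
  proof (intro Bochner_Integration.integral_cong refl)
    fix p :: "real \<times> real"
    obtain s L where p: "p = (s, L)" by (cases p)
    have "(\<integral>x. h (Y_coord p, x) \<partial>m_y (Y_coord p)) = 0" if L: "2 * a < L" "L \<notin> S"
    proof -
      have "(indicator {0..<2*pi} t * indicator (disc \<alpha>) (EP (circ s) L t) * speed L t) = 0" for t
      proof -
        have q: "norm (circ s) = 1" by simp
        have False if "0 \<le> t" "t < 2 * pi" "EP (circ s) L t \<in> disc \<alpha>"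
          using EP_disc_range[OF q L(1) that(3,1,2)] phi_EP[OF q L(1), of t] S(3)[OF q that(3)] L(2) that(2) by auto
        then show ?thesis by (auto simp: indicator_def)
      qed
      then show ?thesis unfolding m_y_integral(1)[OF m] p Y_coord_def prod.case fst_conv snd_conv
        by (simp only: scaleR_zero_left integral_zero)
    qed
    then show "(indicator {0..<2*pi} (fst p) * indicator {2 * a<..} (snd p)) *\<^sub>R (\<integral>x. h (Y_coord p, x) \<partial>m_y (Y_coord p)) =
         (indicator {0..<2*pi} (fst p) * indicator S (snd p)) *\<^sub>R (\<integral>x. h (Y_coord p, x) \<partial>m_y (Y_coord p))"
      using S(2) by (auto simp: p indicator_def)
  qed
qed

lemma df_measures_general:
  assumes S: "open S" "S \<subseteq> {2 * a<..}" "\<And>q x. norm q = 1 \<Longrightarrow> x \<in> disc \<alpha> \<Longrightarrow> phi q x \<in> S"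
  shows "df_measures (disc \<alpha>) (Y_coord ` (UNIV \<times> S)) (Zset \<alpha>) (radon \<alpha>) (backprojection \<alpha> wt)"
proof -
  let ?mX = "density lborel (indicator (disc \<alpha>)) :: (real^2) measure"
  have y: "norm (fst y) = 1 \<and> 2 * a < snd y" if "y \<in> Y_coord ` (UNIV \<times> S)" for y
    using that S(2) unfolding Y_coord_image by auto
  have dX: "indicator (disc \<alpha>) = (\<lambda>x. ennreal (indicator (disc \<alpha>) x))" by (auto simp: indicator_def)
  have "smooth_measure (disc \<alpha>) ?mX" by (rule smooth_measure_open[OF open_disc])
  moreover have "smooth_measure (Y_coord ` (UNIV \<times> S)) (mu_Y S)" by (rule smooth_measure_mu_Y[OF S(1)])
  moreover have "\<forall>y\<in>Y_coord ` (UNIV \<times> S). smooth_measure (Y_fiber (Zset \<alpha>) y) (m_y y)"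
    using y smooth_measure_m_y by auto
  moreover have "\<forall>x\<in>disc \<alpha>. smooth_measure (X_fiber (Zset \<alpha>) x) (m_x x)"
    using smooth_measure_m_x by auto
  moreover have "integrable (m_y y) f \<and> radon \<alpha> f y = (\<integral>x. f x \<partial>m_y y)"
    if "f \<in> Cc_functions (disc \<alpha>)" "y \<in> Y_coord ` (UNIV \<times> S)" for f :: "real^2 \<Rightarrow> complex" and y
  proof -
    note F = Cc_functions_bounded_measurable[OF that(1) disc_sets]
    obtain C where C: "\<And>x. norm (f x) \<le> C" using F(2) by blast
    show ?thesis using m_y_integrable[OF F(1) C] radon_eq[OF F(1) F(3)] y[OF that(2)] by auto
  qed
  moreover have "integrable (m_x x) g \<and> backprojection \<alpha> wt g x = (\<integral>y. g y \<partial>m_x x)"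
    if "g \<in> Cc_functions (Y_coord ` (UNIV \<times> S))" for g :: "(real^2) \<times> real \<Rightarrow> complex" and x
  proof -
    note F = Cc_functions_bounded_measurable[OF that(1) Y_borel[OF S(1)]]
    obtain C where C: "\<And>x. norm (g x) \<le> C" using F(2) by blast
    show ?thesis using m_x_integrable[OF F(1) C] backprojection_eq[OF F(1)] by auto
  qed
  moreover have "(\<integral>z. h z \<partial>mu_Z) = (\<integral>y. (\<integral>x. h (y, x) \<partial>m_y y) \<partial>mu_Y S)" and
     "(\<integral>z. h z \<partial>mu_Z) = (\<integral>x. (\<integral>y. h (y, x) \<partial>m_x x) \<partial>?mX)"
    if "h \<in> Cc_functions (Zset \<alpha>)" for h :: "_ \<Rightarrow> real"
  proof -
    note F = Cc_functions_bounded_measurable[OF that(1) Z_borel]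
    obtain C where C: "\<And>x. norm (h x) \<le> C" using F(2) by blast
    show "(\<integral>z. h z \<partial>mu_Z) = (\<integral>y. (\<integral>x. h (y, x) \<partial>m_y y) \<partial>mu_Y S)"
      by (rule disint_mu_Y[OF S F(1) C])
    note F(1) [measurable]
    have m [measurable]: "(\<lambda>y. h (y, x)) \<in> borel_measurable borel" for x by measurable
    have mm: "(\<lambda>x. \<integral>y. h (y, x) \<partial>m_x x) \<in> borel_measurable borel"
      unfolding m_x_integral(1)[OF m] Y_coord_def prod.case by (rule borel_measurable_integral_borel) measurable
    have "(\<integral>z. h z \<partial>mu_Z) = (\<integral>x. (\<integral>y. h (y, x) \<partial>m_x x) \<partial>lborel)"
      unfolding integral_mu_Z[OF F(1)] by (rule disint_X[OF F(1) C])
    also have "\<dots> = (\<integral>x. indicator (disc \<alpha>) x *\<^sub>R (\<integral>y. h (y, x) \<partial>m_x x) \<partial>lborel)"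
    proof (intro Bochner_Integration.integral_cong refl)
      fix x
      have "wt s x = 0" if "x \<notin> disc \<alpha>" for s using that by (simp add: wt_def)
      then show "(\<integral>y. h (y, x) \<partial>m_x x) = indicator (disc \<alpha>) x *\<^sub>R (\<integral>y. h (y, x) \<partial>m_x x)"
        unfolding m_x_integral(1)[OF m] by (cases "x \<in> disc \<alpha>") auto
    qed
    also have "\<dots> = (\<integral>x. (\<integral>y. h (y, x) \<partial>m_x x) \<partial>?mX)"
      unfolding dX by (subst integral_density) (use mm in auto)
    finally show "(\<integral>z. h z \<partial>mu_Z) = (\<integral>x. (\<integral>y. h (y, x) \<partial>m_x x) \<partial>?mX)" .
  qed
  ultimately show ?thesis
    unfolding df_measures_def
    by (intro exI[of _ ?mX] exI[of _ "mu_Y S"] exI[of _ mu_Z] exI[of _ m_y] exI[of _ m_x])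
      (simp add: smooth_measure_mu_Z)
qed

text \<open>Smoothness of a test function is given in the coordinates. Local inverses of
  \<open>Y_coord\<close> turn it into continuity on the manifold, and compact support does the
  rest.\<close>

lemma test_functions_bounded_measurable:
  assumes "g \<in> test_functions Y_coord (UNIV \<times> S)" "open S"
  shows "g \<in> borel_measurable borel" "\<exists>C. \<forall>x. norm (g x) \<le> C"
proof -
  obtain KK where KK: "smooth_open (UNIV \<times> S) (g \<circ> Y_coord)" "compact KK" "KK \<subseteq> Y_coord ` (UNIV \<times> S)" "\<And>p. p \<notin> KK \<Longrightarrow> g p = 0"
    using assms(1) by (auto simp: test_functions_def)
  interpret circle_param Y_coord "UNIV \<times> S" "(1, 0)" UNIV fst "\<lambda>p. (fst p, snd (snd p))" by (rule Y_param[OF assms(2)])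
  have "continuous_on (Y_coord ` (UNIV \<times> S)) g"
    unfolding continuous_on_eq_continuous_within
  proof
    fix m assume "m \<in> Y_coord ` (UNIV \<times> S)"
    then obtain z where z: "z \<in> UNIV \<times> S" "m = Y_coord z" by auto
    obtain h where h: "openin (top_of_set (Y_coord ` (UNIV \<times> S))) (Y_coord ` window z)" "diffeo (window z) (Y_coord ` window z) Y_coord h"
      using chart_window[of z] unfolding chart_def by blast
    then have phis_deriv: "smooth_map_on (Y_coord ` window z) h" "\<And>p. p \<in> window z \<Longrightarrow> h (Y_coord p) = p" by (auto simp: diffeo_def)
    have "continuous_on (Y_coord ` window z) (\<lambda>m. (g \<circ> Y_coord) (h m))"
      by (rule continuous_on_compose2[OF smooth_open_continuous_on[OF KK(1)] smooth_map_on_continuous_on[OF phis_deriv(1)]])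
        (use phis_deriv(2) in \<open>auto simp: window_def\<close>)
    then have "continuous_on (Y_coord ` window z) g"
      by (rule continuous_on_cong[THEN iffD1, rotated -1]) (use phis_deriv(2) in auto)
    moreover have "m \<in> Y_coord ` window z" using z window_mem[OF z(1)] by auto
    ultimately have "continuous (at m within Y_coord ` window z) g"
      unfolding continuous_on_eq_continuous_within by blast
    moreover have "at m within Y_coord ` window z = at m within Y_coord ` (UNIV \<times> S)"
    proof -
      obtain W where W: "open W" "Y_coord ` window z = Y_coord ` (UNIV \<times> S) \<inter> W" using h(1) by (auto simp: openin_open)
      show ?thesis by (rule at_within_nhd[of m W]) (use W \<open>m \<in> Y_coord ` window z\<close> in auto)
    qed
    ultimately show "continuous (at m within Y_coord ` (UNIV \<times> S)) g" by simp
  qed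
  then have "g \<in> Cc_functions (Y_coord ` (UNIV \<times> S))" unfolding Cc_functions_def using KK by blast
  from Cc_functions_bounded_measurable[OF this Y_borel[OF assms(2)]]
  show "g \<in> borel_measurable borel" "\<exists>C. \<forall>x. norm (g x) \<le> C" by auto
qed

lemma coord_domain_eq: "coord_domain \<alpha> = UNIV \<times> {2 * a<..}" by (simp add: coord_domain_def a_def)

lemma test_functions_disc:
  assumes "f \<in> test_functions (\<lambda>x. x) (disc \<alpha>)" shows "f \<in> Cc_functions (disc \<alpha>)"
  using assms smooth_open_continuous_on[of "disc \<alpha>" f] by (auto simp: test_functions_def Cc_functions_def o_def)

text \<open>Both sides are the integral over \<open>Z\<close> of f(x) times the conjugate of g(y),
  disintegrated once over \<open>Y\<close> and once over \<open>X\<close>.\<close>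

lemma L2_adjoint: "L2_adjoint_weight \<alpha> wt"
  unfolding L2_adjoint_weight_def
proof (intro conjI ballI allI wt_smooth wt_bounds)
  show "wt (s + 2 * pi) x = wt s x" for s x by (rule wt_period) (simp add: vec2_eq_iff)
  fix f g assume f: "f \<in> test_functions (\<lambda>x. x) (disc \<alpha>)" and g: "g \<in> test_functions Y_coord (coord_domain \<alpha>)"
  note F = Cc_functions_bounded_measurable[OF test_functions_disc[OF f] disc_sets]
  note G = test_functions_bounded_measurable[OF g[unfolded coord_domain_eq] open_greaterThan]
  obtain Cf Cg where C: "\<And>x. norm (f x) \<le> Cf" "\<And>x. norm (g x) \<le> Cg" using F(2) G(2) by blast
  note [measurable] = F(1) G(1)
  have [measurable]: "{0..2*pi} \<times> {2 * sin \<alpha> <..} \<in> sets borel"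
    by (intro borel_Times) auto
  have [measurable]: "(\<lambda>z. cnj z) \<in> borel_measurable borel" by (intro borel_measurable_continuous_onI continuous_intros)
  let ?h = "\<lambda>z. f (snd z) * cnj (g (fst z))"
  have hm: "?h \<in> borel_measurable borel" by measurable
  have hC: "norm (?h z) \<le> Cf * Cg" for z
    unfolding norm_mult complex_mod_cnj
    by (intro mult_mono C norm_ge_zero order_trans[OF norm_ge_zero C(1)[of undefined]])
  have "(LINT q:{0..2*pi} \<times> {2 * sin \<alpha> <..}|lborel. radon \<alpha> f (Y_coord q) * cnj (g (Y_coord q))) =
     (\<integral>p. (indicator {0..<2*pi} (fst p) * indicator {2 * a<..} (snd p)) *\<^sub>R (\<integral>x. ?h (Y_coord p, x) \<partial>m_y (Y_coord p)) \<partial>lborel)"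
    unfolding set_lebesgue_integral_def
  proof (rule integral_cong_AE)
    have eq: "(\<integral>x. ?h (Y_coord p, x) \<partial>m_y (Y_coord p)) = (\<integral>x. f x \<partial>m_y (Y_coord p)) * cnj (g (Y_coord p))" for p
      by (simp add: m_y_integrable[OF F(1) C(1)])
    have "AE p in (lborel :: (real \<times> real) measure). fst p \<noteq> 2 * pi" by (rule AE_fst_neq)
    then show "AE p in lborel. indicator ({0..2*pi} \<times> {2 * sin \<alpha> <..}) p *\<^sub>R (radon \<alpha> f (Y_coord p) * cnj (g (Y_coord p))) =
      (indicator {0..<2*pi} (fst p) * indicator {2 * a<..} (snd p)) *\<^sub>R (\<integral>x. ?h (Y_coord p, x) \<partial>m_y (Y_coord p))"
    proof eventually_elim
      case (elim p)
      then show ?case unfolding eq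
        using radon_eq[OF F(1) F(3), of "Y_coord p"] by (cases p) (auto simp: indicator_def a_def Y_coord_def)
    qed
    have mm: "(\<lambda>p. \<integral>x. f x \<partial>m_y (Y_coord p)) \<in> borel_measurable borel"
      unfolding m_y_integral(1)[OF F(1)] Y_coord_def split_beta fst_conv snd_conv
      by (rule borel_measurable_integral_borel) measurable
    show "(\<lambda>p. (indicator {0..<2*pi} (fst p) * indicator {2 * a<..} (snd p)) *\<^sub>R (\<integral>x. ?h (Y_coord p, x) \<partial>m_y (Y_coord p))) \<in> borel_measurable lborel"
      unfolding eq using mm by measurable
    have "(\<lambda>p. indicator ({0..2*pi} \<times> {2 * sin \<alpha> <..}) p *\<^sub>R ((\<integral>x. f x \<partial>m_y (Y_coord p)) * cnj (g (Y_coord p)))) \<in> borel_measurable lborel"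
      using mm by measurable
    moreover have "(\<lambda>p. indicator ({0..2*pi} \<times> {2 * sin \<alpha> <..}) p *\<^sub>R (radon \<alpha> f (Y_coord p) * cnj (g (Y_coord p)))) =
      (\<lambda>p. indicator ({0..2*pi} \<times> {2 * sin \<alpha> <..}) p *\<^sub>R ((\<integral>x. f x \<partial>m_y (Y_coord p)) * cnj (g (Y_coord p))))"
    proof
      fix p show "indicator ({0..2*pi} \<times> {2 * sin \<alpha> <..}) p *\<^sub>R (radon \<alpha> f (Y_coord p) * cnj (g (Y_coord p))) =
        indicator ({0..2*pi} \<times> {2 * sin \<alpha> <..}) p *\<^sub>R ((\<integral>x. f x \<partial>m_y (Y_coord p)) * cnj (g (Y_coord p)))"
        using radon_eq[OF F(1) F(3), of "Y_coord p"] by (cases p) (auto simp: indicator_def a_def Y_coord_def)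
    qed
    ultimately show "(\<lambda>p. indicator ({0..2*pi} \<times> {2 * sin \<alpha> <..}) p *\<^sub>R (radon \<alpha> f (Y_coord p) * cnj (g (Y_coord p)))) \<in> borel_measurable lborel"
      by simp
  qed
  also have "\<dots> = (\<integral>x. (\<integral>y. ?h (y, x) \<partial>m_x x) \<partial>lborel)"
    using disint_Y[OF hm hC] disint_X[OF hm hC] by simp
  also have "\<dots> = (LINT x:disc \<alpha>|lborel. f x * cnj (backprojection \<alpha> wt g x))"
    unfolding set_lebesgue_integral_def
  proof (intro Bochner_Integration.integral_cong refl)
    fix x
    have "(\<integral>y. ?h (y, x) \<partial>m_x x) = f x * (\<integral>y. cnj (g y) \<partial>m_x x)" by simp
    also have "(\<integral>y. cnj (g y) \<partial>m_x x) = cnj (backprojection \<alpha> wt g x)"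
      unfolding backprojection_eq[OF G(1)] by simp
    finally show "(\<integral>y. ?h (y, x) \<partial>m_x x) = indicator (disc \<alpha>) x *\<^sub>R (f x * cnj (backprojection \<alpha> wt g x))"
      using F(3)[of x] by (cases "x \<in> disc \<alpha>") auto
  qed
  finally show "(LINT q:{0..2*pi} \<times> {2 * sin \<alpha> <..}|lborel. radon \<alpha> f (Y_coord q) * cnj (g (Y_coord q))) =
     (LINT x:disc \<alpha>|lborel. f x * cnj (backprojection \<alpha> wt g x))" .
qed

section \<open>The manifold, separation, properness and fibration conditions\<close>

lemma disc_submanifold: "smooth_submanifold 2 (disc \<alpha>)"
  by (rule smooth_submanifold_open[OF open_disc]) simp

lemma Y_submanifold: assumes "open S" shows "smooth_submanifold 2 (Y_coord ` (UNIV \<times> S))"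
proof -
  interpret circle_param Y_coord "UNIV \<times> S" "(1, 0)" UNIV fst "\<lambda>p. (fst p, snd (snd p))" by (rule Y_param[OF assms])
  show ?thesis by (rule submanifold) auto
qed

lemma Z_submanifold: "smooth_submanifold 3 (Zset \<alpha>)"
proof -
  interpret circle_param Z_coord "UNIV \<times> disc \<alpha>" "(1, 0)" UNIV "\<lambda>z. fst (fst z)" "\<lambda>p. (fst p, snd (snd p))" by (rule Z_param)
  show ?thesis unfolding Zset_eq by (rule submanifold) auto
qed

lemma connected_Z: "connected (Zset \<alpha>)"
proof -
  have "connected (UNIV \<times> disc \<alpha> :: (real \<times> (real^2)) set)"
    by (intro connected_Times) (auto simp: disc_eq)
  then show ?thesis unfolding Zset_eq
    by (intro connected_continuous_image smooth_open_continuous_on[OF Z_coord_smooth])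
qed

lemma Y_meeting_image: "Y_meeting \<alpha> = fst ` Zset \<alpha>" by (rule Y_meeting_eq)

lemma df_manifolds_all:
  "df_manifolds (disc \<alpha>) (Yset \<alpha>) (Zset \<alpha>)" "df_manifolds (disc \<alpha>) (Y_meeting \<alpha>) (Zset \<alpha>)"
proof -
  have cd: "connected (disc \<alpha>)" by (simp add: disc_eq)
  have cY: "connected (Yset \<alpha>)" unfolding Yset_eq Y_coord_def split_beta
    by (intro connected_continuous_image continuous_intros connected_Times) auto
  have cM: "connected (Y_meeting \<alpha>)" unfolding Y_meeting_image
    by (intro connected_continuous_image connected_Z continuous_intros)
  have ZM: "Zset \<alpha> \<subseteq> Y_meeting \<alpha> \<times> disc \<alpha>" 
  proof
    fix z assume z: "z \<in> Zset \<alpha>"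
    then have "fst z \<in> Y_meeting \<alpha>" "snd z \<in> disc \<alpha>" unfolding Y_meeting_image using mem_Zset by auto
    then show "z \<in> Y_meeting \<alpha> \<times> disc \<alpha>" by (simp add: mem_Times_iff)
  qed
  have MY: "Y_meeting \<alpha> \<subseteq> Yset \<alpha>" unfolding Yset_eq Y_meeting_eq' by (auto simp: LL_def)
  have "smooth_submanifold 2 (Yset \<alpha>)" unfolding Yset_eq by (rule Y_submanifold) auto
  moreover have "smooth_submanifold 2 (Y_meeting \<alpha>)" unfolding Y_meeting_eq' by (rule Y_submanifold[OF open_LL])
  ultimately show "df_manifolds (disc \<alpha>) (Yset \<alpha>) (Zset \<alpha>)" "df_manifolds (disc \<alpha>) (Y_meeting \<alpha>) (Zset \<alpha>)"
    unfolding df_manifolds_def using cd cY cM connected_Z disc_submanifold Z_submanifold ZM MY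
    by (intro exI[of _ 2] exI[of _ 1]; auto)+
qed

lemma phi_LL: assumes "norm q = 1" "x \<in> disc \<alpha>" shows "phi q x \<in> LL"
proof -
  have "((q, phi q x), x) \<in> Zset \<alpha>" using assms by (simp add: mem_Zset)
  then have "(q, phi q x) \<in> Y_meeting \<alpha>" unfolding Y_meeting_image by force
  then show ?thesis unfolding Y_meeting_eq' by (auto simp: Y_coord_def)
qed

lemma df_measures_all:
  "df_measures (disc \<alpha>) (Yset \<alpha>) (Zset \<alpha>) (radon \<alpha>) (backprojection \<alpha> wt)"
  "df_measures (disc \<alpha>) (Y_meeting \<alpha>) (Zset \<alpha>) (radon \<alpha>) (backprojection \<alpha> wt)"
  unfolding Yset_eq Y_meeting_eq' using phi_gt phi_LL open_LL
  by (intro df_measures_general; auto simp: LL_def)+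

lemma df_points_meeting: "df_points (disc \<alpha>) (Y_meeting \<alpha>) (Zset \<alpha>)"
  unfolding df_points_def
proof (intro conjI ballI iffI)
  fix y1 y2 assume y: "y1 \<in> Y_meeting \<alpha>" "y2 \<in> Y_meeting \<alpha>" and e: "Y_fiber (Zset \<alpha>) y1 = Y_fiber (Zset \<alpha>) y2"
  have n: "norm (fst y1) = 1" "norm (fst y2) = 1" "snd y1 \<in> LL" "snd y2 \<in> LL"
    using y unfolding Y_meeting_eq' Y_coord_image by auto
  have "fst y1 = fst y2 \<and> snd y1 = snd y2"
    by (rule arc_inj) (use n e in \<open>auto simp: LL_def Y_fiber_Zset\<close>)
  then show "y1 = y2" by (simp add: prod_eq_iff)
next
  fix x1 x2 assume x: "x1 \<in> disc \<alpha>" "x2 \<in> disc \<alpha>" and e: "X_fiber (Zset \<alpha>) x1 = X_fiber (Zset \<alpha>) x2"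
  show "x1 = x2"
  proof (rule ccontr)
    assume "x1 \<noteq> x2"
    then obtain q where q: "norm q = 1" "phi q x1 \<noteq> phi q x2" by (rule separate_points[OF x])
    have "(q, phi q x1) \<in> X_fiber (Zset \<alpha>) x1" using q x by (simp add: X_fiber_Zset)
    then show False using q x unfolding e by (simp add: X_fiber_Zset)
  qed
qed auto

text \<open>The preimage of a compact set \<open>K\<close> is the image of the compact set
  \<open>sphere 0 1 \<times> K\<close> under a continuous map.\<close>

lemma df_proper_Z: "df_proper (disc \<alpha>) (Zset \<alpha>)"
  unfolding df_proper_def
proof (rule compact_imp_proper_map)
  show "k_space (top_of_set (disc \<alpha>))" "kc_space (top_of_set (disc \<alpha>))"
    by (intro metrizable_imp_k_space Hausdorff_imp_kc_space metrizable_imp_Hausdorff_space metrizable_space_subtopology metrizable_space_euclidean)+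
  show "snd \<in> topspace (top_of_set (Zset \<alpha>)) \<rightarrow> topspace (top_of_set (disc \<alpha>))" by (auto simp: mem_Zset)
  show "continuous_map (top_of_set (Zset \<alpha>)) (top_of_set (disc \<alpha>)) snd \<or> kc_space (top_of_set (Zset \<alpha>))"
    by (intro disjI2 Hausdorff_imp_kc_space metrizable_imp_Hausdorff_space metrizable_space_subtopology metrizable_space_euclidean)
  fix K assume "compactin (top_of_set (disc \<alpha>)) K"
  then have K: "compact K" "K \<subseteq> disc \<alpha>" by (auto simp: compactin_subtopology)
  have "{z \<in> Zset \<alpha>. snd z \<in> K} = (\<lambda>p. ((fst p, phi (fst p) (snd p)), snd p)) ` (sphere 0 1 \<times> K)"
  proof (intro equalityI subsetI)
    fix z assume "z \<in> {z \<in> Zset \<alpha>. snd z \<in> K}"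
    then show "z \<in> (\<lambda>p. ((fst p, phi (fst p) (snd p)), snd p)) ` (sphere 0 1 \<times> K)"
      by (intro image_eqI[of _ _ "(fst (fst z), snd z)"]) (auto simp: mem_Zset prod_eq_iff)
  qed (use K(2) in \<open>auto simp: mem_Zset\<close>)
  moreover have "compact \<dots>"
    by (intro compact_continuous_image continuous_intros compact_Times compact_sphere K)
  ultimately show "compactin (top_of_set (Zset \<alpha>)) {z \<in> topspace (top_of_set (Zset \<alpha>)). snd z \<in> K}"
    by (auto simp: compactin_subtopology)
qed

text \<open>The bundle is globally trivial: keep \<open>q\<close>, replace \<open>x\<close> by the
  base point \<open>x0\<close>, and let \<open>L\<close> follow as the focal sum.\<close>

lemma fiber_map_snd: "fiber_map snd (Zset \<alpha>) (disc \<alpha>)"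
  unfolding fiber_map_def
proof (intro conjI ballI)
  show "snd ` Zset \<alpha> = disc \<alpha>" unfolding Zset_eq Z_coord_def by (force simp: image_iff)
  show "smooth_map_on (Zset \<alpha>) snd" by (rule smooth_map_onI[of UNIV]) (auto intro!: smooth_open_snd)
  fix x0 assume x0: "x0 \<in> disc \<alpha>"
  let ?F = "Zset \<alpha> \<inter> snd -` {x0}"
  let ?h = "\<lambda>z. (snd z, ((fst (fst z), phi (fst (fst z)) x0), x0))"
  let ?k = "\<lambda>p :: (real^2) \<times> (((real^2) \<times> real) \<times> (real^2)). ((fst (fst (snd p)), phi (fst (fst (snd p))) (fst p)), fst p)"
  have D: "Zset \<alpha> \<inter> snd -` disc \<alpha> = Zset \<alpha>" by (auto simp: mem_Zset)
  have cf: "smooth_open S (\<lambda>z :: ((real^2) \<times> real) \<times> (real^2). fst (fst z))" if "open S" for S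
    using that by (intro smooth_open_fst smooth_open_id)
  have "diffeo (Zset \<alpha>) (disc \<alpha> \<times> ?F) ?h ?k"
    unfolding diffeo_def
  proof (intro conjI ballI)
    let ?O = "{z :: ((real^2) \<times> real) \<times> (real^2). (fst (fst z), x0) \<in> Reg}"
    have oO: "open ?O"
    proof -
      have "continuous_on UNIV (\<lambda>z :: ((real^2) \<times> real) \<times> (real^2). (fst (fst z), x0))" by (intro continuous_intros)
      from open_vimage[OF open_Reg this] show ?thesis by (simp add: vimage_def)
    qed
    have "smooth_open ?O (\<lambda>z. phi (fst (fst z)) x0)" by (intro smooth_geom(1) oO cf) auto
    then have "smooth_open ?O ?h" by (intro smooth_open_Pair smooth_open_snd smooth_open_id cf oO smooth_open_const)
    then show "smooth_map_on (Zset \<alpha>) ?h"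
      by (rule smooth_map_onI) (use oO x0 disc_Reg in \<open>auto simp: mem_Zset\<close>)
    let ?O' = "{p :: (real^2) \<times> (((real^2) \<times> real) \<times> (real^2)). (fst (fst (snd p)), fst p) \<in> Reg}"
    have oO': "open ?O'"
    proof -
      have "continuous_on UNIV (\<lambda>p :: (real^2) \<times> (((real^2) \<times> real) \<times> (real^2)). (fst (fst (snd p)), fst p))" by (intro continuous_intros)
      from open_vimage[OF open_Reg this] show ?thesis by (simp add: vimage_def)
    qed
    have "smooth_open ?O' (\<lambda>p. phi (fst (fst (snd p))) (fst p))"
      by (intro smooth_geom(1) oO' smooth_open_fst smooth_open_snd smooth_open_id) auto
    then have "smooth_open ?O' ?k" by (intro smooth_open_Pair smooth_open_fst smooth_open_snd smooth_open_id oO')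
    then show "smooth_map_on (disc \<alpha> \<times> ?F) ?k"
      by (rule smooth_map_onI) (use oO' disc_Reg in \<open>auto simp: mem_Zset\<close>)
    show "?h ` Zset \<alpha> = disc \<alpha> \<times> ?F"
    proof (intro equalityI subsetI)
      fix p assume "p \<in> disc \<alpha> \<times> ?F"
      then show "p \<in> ?h ` Zset \<alpha>" by (intro image_eqI[of _ _ "?k p"]) (auto simp: mem_Zset prod_eq_iff)
    qed (use x0 in \<open>auto simp: mem_Zset\<close>)
    show "?k (?h z) = z" if "z \<in> Zset \<alpha>" for z using that by (auto simp: mem_Zset prod_eq_iff)
  qed
  then show "\<exists>U h k. openin (top_of_set (disc \<alpha>)) U \<and> x0 \<in> U \<and>
      diffeo (Zset \<alpha> \<inter> snd -` U) (U \<times> ?F) h k \<and> (\<forall>z\<in>Zset \<alpha> \<inter> snd -` U. fst (h z) = snd z)"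
    using x0 D by (intro exI[of _ "disc \<alpha>"] exI[of _ ?h] exI[of _ ?k]) simp
qed

text \<open>The arc over \<open>(q, L)\<close> corresponds to the range |u| < \<open>UU L\<close> of
  the parameter of \<open>EE\<close>.\<close>

definition UU where "UU L = sqrt (1 - (tau0 L)\<^sup>2)"

lemma UU: assumes "L \<in> LL" shows "0 < UU L" "UU L < 1" "(UU L)\<^sup>2 = 1 - (tau0 L)\<^sup>2" "0 < 1 - (tau0 L)\<^sup>2"
proof -
  have t: "0 < tau0 L" "tau0 L < 1" using assms tau0_pos by (auto simp: LL_def)
  then have "(tau0 L)\<^sup>2 < 1" "0 < (tau0 L)\<^sup>2" by (simp_all add: abs_square_less_1)
  then show "0 < UU L" "(UU L)\<^sup>2 = 1 - (tau0 L)\<^sup>2" "0 < 1 - (tau0 L)\<^sup>2" "UU L < 1" by (simp_all add: UU_def)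
qed

lemma UU_smooth: "smooth_open LL UU"
  unfolding UU_def
  by (intro smooth_open_sqrt smooth_open_diff smooth_open_power smooth_open_const open_LL smooth_open_mono[OF tau0_smooth])
    (use UU(4) in \<open>auto simp: LL_def\<close>)

lemma arc_UU: assumes "norm q = 1" "L \<in> LL"
  shows "\<bar>u\<bar> < UU L \<Longrightarrow> EE q L u \<in> arc q L" "x \<in> arc q L \<Longrightarrow> \<bar>x \<bullet> rot q / (L / 2)\<bar> < UU L"
    "x \<in> arc q L \<Longrightarrow> EE q L (x \<bullet> rot q / (L / 2)) = x"
proof -
  have L: "2 * a < L" using assms by (simp add: LL_def)
  have *: "\<bar>u\<bar> < UU L \<longleftrightarrow> u\<^sup>2 < 1 - (tau0 L)\<^sup>2" for u
    using UU[OF assms(2)] by (metis abs_le_square_iff abs_of_pos not_le)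
  show "EE q L u \<in> arc q L" if "\<bar>u\<bar> < UU L"
    using that * unfolding arc_eq[OF assms(1) L] by auto
  assume x: "x \<in> arc q L"
  then obtain v where v: "v\<^sup>2 < 1 - (tau0 L)\<^sup>2" "x = EE q L v" unfolding arc_eq[OF assms(1) L] by auto
  have "x \<bullet> rot q / (L / 2) = v" using v(2) EE_uv[OF assms(1), of L v] BB(4)[OF L] by simp
  then show "\<bar>x \<bullet> rot q / (L / 2)\<bar> < UU L" "EE q L (x \<bullet> rot q / (L / 2)) = x" using v * by auto
qed

lemma EE_smooth:
  assumes "open S" "smooth_open S f" "smooth_open S g" "smooth_open S h" "\<And>x. x \<in> S \<Longrightarrow> 2 * a < g x" "\<And>x. x \<in> S \<Longrightarrow> \<bar>h x\<bar> < 1"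
  shows "smooth_open S (\<lambda>x. EE (f x) (g x) (h x))"
proof -
  have B: "smooth_open S (\<lambda>x. BB (g x))" by (rule smooth_open_compose[OF BB_smooth]) (use assms in auto)
  have h: "0 < 1 - (h x)\<^sup>2" if "x \<in> S" for x using assms(6)[OF that] by (simp add: abs_square_less_1)
  show ?thesis unfolding EE_def
    by (intro smooth_open_add smooth_open_scaleR smooth_open_mult smooth_open_divide smooth_open_rot smooth_open_diff smooth_open_sqrt
        smooth_open_power smooth_open_const assms(1-4) B h) auto
qed

text \<open>The fibres are open arcs. Scaling \<open>u\<close> by the ratio of the two parameter
  lengths maps the arc over \<open>(q, L)\<close> onto the arc over the base point, which
  trivializes the bundle globally.\<close>

lemma fiber_map_fst: "fiber_map fst (Zset \<alpha>) (Y_meeting \<alpha>)"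
  unfolding fiber_map_def
proof (intro conjI ballI)
  show "fst ` Zset \<alpha> = Y_meeting \<alpha>" by (rule Y_meeting_image[symmetric])
  show "smooth_map_on (Zset \<alpha>) fst" by (rule smooth_map_onI[of UNIV]) (auto intro!: smooth_open_fst)
  have mM: "y \<in> Y_meeting \<alpha> \<longleftrightarrow> norm (fst y) = 1 \<and> snd y \<in> LL" for y unfolding Y_meeting_eq' Y_coord_image by auto
  have mZ: "z \<in> Zset \<alpha> \<longleftrightarrow> norm (fst (fst z)) = 1 \<and> snd (fst z) \<in> LL \<and> snd z \<in> arc (fst (fst z)) (snd (fst z))" for z
    using phi_LL by (auto simp: mem_Zset arc_def)
  fix y0 assume "y0 \<in> Y_meeting \<alpha>"
  then obtain q0 L0 where y0: "y0 = (q0, L0)" "norm q0 = 1" "L0 \<in> LL" using mM by (cases y0) auto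
  have Lp: "2 * a < L" "0 < L" if "L \<in> LL" for L using that BB(4) by (auto simp: LL_def)
  let ?F = "Zset \<alpha> \<inter> fst -` {y0}"
  \<comment> \<open>The parameter of \<open>EE\<close> at the point, rescaled from
    \<open>UU L\<close> to \<open>UU L0\<close>; \<open>uk\<close> is the inverse rescaling.\<close>
  define uh where "uh = (\<lambda>z :: ((real^2) \<times> real) \<times> (real^2). (snd z \<bullet> rot (fst (fst z))) / (snd (fst z) / 2) * (UU L0 / UU (snd (fst z))))"
  define uk where "uk = (\<lambda>p :: ((real^2) \<times> real) \<times> (((real^2) \<times> real) \<times> (real^2)). (snd (snd p) \<bullet> rot q0) / (L0 / 2) * (UU (snd (fst p)) / UU L0))"
  let ?h = "\<lambda>z. (fst z, (y0, EE q0 L0 (uh z)))"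
  let ?k = "\<lambda>p. (fst p, EE (fst (fst p)) (snd (fst p)) (uk p))"
  have D: "Zset \<alpha> \<inter> fst -` Y_meeting \<alpha> = Zset \<alpha>" by (auto simp: Y_meeting_image)
  have uhb: "\<bar>uh z\<bar> < UU L0" if z: "z \<in> Zset \<alpha>" for z
  proof -
    have z': "norm (fst (fst z)) = 1" "snd (fst z) \<in> LL" "snd z \<in> arc (fst (fst z)) (snd (fst z))" using z mZ by auto
    have "\<bar>uh z\<bar> = \<bar>(snd z \<bullet> rot (fst (fst z))) / (snd (fst z) / 2)\<bar> * (UU L0 / UU (snd (fst z)))"
      using UU(1)[OF y0(3)] UU(1)[OF z'(2)] by (simp add: uh_def abs_mult)
    also have "\<dots> < UU (snd (fst z)) * (UU L0 / UU (snd (fst z)))"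
      using arc_UU(2)[OF z'] UU(1)[OF y0(3)] UU(1)[OF z'(2)] by (intro mult_strict_right_mono) auto
    finally show ?thesis using UU(1)[OF z'(2)] by simp
  qed
  have ukb: "\<bar>uk p\<bar> < UU (snd (fst p))" if p: "p \<in> Y_meeting \<alpha> \<times> ?F" for p
  proof -
    have p': "snd (fst p) \<in> LL" "snd (snd p) \<in> arc q0 L0" using p mM mZ y0 by auto
    have "\<bar>uk p\<bar> = \<bar>(snd (snd p) \<bullet> rot q0) / (L0 / 2)\<bar> * (UU (snd (fst p)) / UU L0)"
      using UU(1)[OF y0(3)] UU(1)[OF p'(1)] by (simp add: uk_def abs_mult)
    also have "\<dots> < UU L0 * (UU (snd (fst p)) / UU L0)"
      using arc_UU(2)[OF y0(2,3) p'(2)] UU(1)[OF y0(3)] UU(1)[OF p'(1)] by (intro mult_strict_right_mono) auto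
    finally show ?thesis using UU(1)[OF y0(3)] by simp
  qed
  have "diffeo (Zset \<alpha>) (Y_meeting \<alpha> \<times> ?F) ?h ?k"
    unfolding diffeo_def
  proof (intro conjI ballI)
    let ?O1 = "{z :: ((real^2) \<times> real) \<times> (real^2). snd (fst z) \<in> LL}"
    have "continuous_on UNIV (\<lambda>z :: ((real^2) \<times> real) \<times> (real^2). snd (fst z))" by (intro continuous_intros)
    from open_vimage[OF open_LL this] have o1: "open ?O1" by (simp add: vimage_def)
    have UU1: "smooth_open ?O1 (\<lambda>z. UU (snd (fst z)))"
      by (rule smooth_open_compose[OF UU_smooth open_LL o1]) (auto intro!: smooth_open_snd smooth_open_fst o1)
    have su: "smooth_open ?O1 uh" unfolding uh_def
      by (intro smooth_open_mult smooth_open_divide smooth_open_inner smooth_open_rot smooth_open_snd smooth_open_fst smooth_open_id smooth_open_const UU1 o1)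
        (use Lp(2) UU(1) in force)+
    let ?O = "?O1 \<inter> uh -` {-1<..<1}"
    have oO: "open ?O" by (rule continuous_open_preimage[OF smooth_open_continuous_on[OF su] o1]) auto
    have "smooth_open ?O (\<lambda>z. EE q0 L0 (uh z))"
      by (intro EE_smooth oO smooth_open_const smooth_open_mono[OF su]) (use Lp(1)[OF y0(3)] in auto)
    then have "smooth_open ?O ?h" by (intro smooth_open_Pair smooth_open_fst smooth_open_id smooth_open_const oO)
    then show "smooth_map_on (Zset \<alpha>) ?h"
    proof (rule smooth_map_onI[OF _ oO])
      show "Zset \<alpha> \<subseteq> ?O"
      proof
        fix z assume z: "z \<in> Zset \<alpha>"
        then show "z \<in> ?O" using uhb[OF z] UU(2)[OF y0(3)] mZ[of z] by auto
      qed
    qed auto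
    let ?P1 = "{p :: ((real^2) \<times> real) \<times> (((real^2) \<times> real) \<times> (real^2)). snd (fst p) \<in> LL}"
    have "continuous_on UNIV (\<lambda>z :: ((real^2) \<times> real) \<times> (((real^2) \<times> real) \<times> (real^2)). snd (fst z))" by (intro continuous_intros)
    from open_vimage[OF open_LL this] have p1: "open ?P1" by (simp add: vimage_def)
    have UU2: "smooth_open ?P1 (\<lambda>z. UU (snd (fst z)))"
      by (rule smooth_open_compose[OF UU_smooth open_LL p1]) (auto intro!: smooth_open_snd smooth_open_fst p1)
    have sk: "smooth_open ?P1 uk" unfolding uk_def
      by (intro smooth_open_mult smooth_open_divide smooth_open_inner smooth_open_snd smooth_open_fst smooth_open_id smooth_open_const UU2 p1)
        (use Lp(2)[OF y0(3)] UU(1)[OF y0(3)] in force)+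
    let ?P = "?P1 \<inter> uk -` {-1<..<1}"
    have oP: "open ?P" by (rule continuous_open_preimage[OF smooth_open_continuous_on[OF sk] p1]) auto
    have "smooth_open ?P (\<lambda>p. EE (fst (fst p)) (snd (fst p)) (uk p))"
      by (intro EE_smooth oP smooth_open_fst smooth_open_snd smooth_open_id smooth_open_mono[OF sk]) (use Lp(1) in auto)
    then have "smooth_open ?P ?k" by (intro smooth_open_Pair smooth_open_fst smooth_open_id oP)
    then show "smooth_map_on (Y_meeting \<alpha> \<times> ?F) ?k"
    proof (rule smooth_map_onI[OF _ oP])
      show "Y_meeting \<alpha> \<times> ?F \<subseteq> ?P"
      proof
        fix p assume p: "p \<in> Y_meeting \<alpha> \<times> ?F"
        then have "snd (fst p) \<in> LL" using mM by auto
        then show "p \<in> ?P" using ukb[OF p] UU(2)[of "snd (fst p)"] by auto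
      qed
    qed auto
    have kh: "?k (?h z) = z" if z: "z \<in> Zset \<alpha>" for z
    proof -
      have z': "norm (fst (fst z)) = 1" "snd (fst z) \<in> LL" "snd z \<in> arc (fst (fst z)) (snd (fst z))" using z mZ by auto
      have "uk (?h z) = uh z * (UU (snd (fst z)) / UU L0)"
        using EE_uv(1)[OF y0(2), of L0 "uh z"] Lp(2)[OF y0(3)] by (simp add: uk_def)
      also have "\<dots> = snd z \<bullet> rot (fst (fst z)) / (snd (fst z) / 2)"
        using UU(1)[OF y0(3)] UU(1)[OF z'(2)] by (simp add: uh_def)
      finally show ?thesis using arc_UU(3)[OF z'] by (simp add: prod_eq_iff)
    qed
    have hk: "?h (?k p) = p \<and> ?k p \<in> Zset \<alpha>" if p: "p \<in> Y_meeting \<alpha> \<times> ?F" for p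
    proof -
      have p': "norm (fst (fst p)) = 1" "snd (fst p) \<in> LL" "snd (snd p) \<in> arc q0 L0" "fst (snd p) = y0" using p mM mZ y0 by auto
      have "uh (?k p) = uk p * (UU L0 / UU (snd (fst p)))"
        using EE_uv(1)[OF p'(1), of "snd (fst p)" "uk p"] Lp(2)[OF p'(2)] by (simp add: uh_def)
      also have "\<dots> = snd (snd p) \<bullet> rot q0 / (L0 / 2)"
        using UU(1)[OF y0(3)] UU(1)[OF p'(2)] by (simp add: uk_def)
      finally have "?h (?k p) = p" using arc_UU(3)[OF y0(2,3) p'(3)] p'(4) by (simp add: prod_eq_iff)
      moreover have "?k p \<in> Zset \<alpha>" using arc_UU(1)[OF p'(1,2) ukb[OF p]] p' by (simp add: mZ)
      ultimately show ?thesis ..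
    qed
    have hin: "?h z \<in> Y_meeting \<alpha> \<times> ?F" if z: "z \<in> Zset \<alpha>" for z
      using arc_UU(1)[OF y0(2,3) uhb[OF z]] z y0 by (auto simp: mZ mM)
    show "?h ` Zset \<alpha> = Y_meeting \<alpha> \<times> ?F"
    proof (intro equalityI subsetI)
      fix p assume "p \<in> Y_meeting \<alpha> \<times> ?F"
      then show "p \<in> ?h ` Zset \<alpha>" using hk[of p] by (metis (lifting) imageI)
    qed (use hin in blast)
    show "?k (?h z) = z" if "z \<in> Zset \<alpha>" for z by (rule kh[OF that])
  qed
  then show "\<exists>U h k. openin (top_of_set (Y_meeting \<alpha>)) U \<and> y0 \<in> U \<and>
      diffeo (Zset \<alpha> \<inter> fst -` U) (U \<times> ?F) h k \<and> (\<forall>z\<in>Zset \<alpha> \<inter> fst -` U. fst (h z) = fst z)"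
    using \<open>y0 \<in> Y_meeting \<alpha>\<close> D by (intro exI[of _ "Y_meeting \<alpha>"] exI[of _ ?h] exI[of _ ?k]) simp
qed

lemma double_fibration_meeting:
  "double_fibration (disc \<alpha>) (Y_meeting \<alpha>) (Zset \<alpha>) (radon \<alpha>) (backprojection \<alpha> wt)"
  unfolding double_fibration_def df_fibrations_def
  using df_manifolds_all df_measures_all df_points_meeting df_proper_Z fiber_map_fst fiber_map_snd by blast

section \<open>The canonical relation\<close>

text \<open>\<open>phis_deriv\<close> and \<open>grad_deriv\<close> together form the Hessian of the
  focal sum in the angle and the point, applied to the direction \<open>(s, v)\<close>.\<close>

definition phis_deriv where
  "phis_deriv q x s v = - (sgn (x - gam1 q) \<bullet> rot (gam1 (s *\<^sub>R rot q)) + (inverse (norm (x - gam1 q)) *\<^sub>R (v - gam1 (s *\<^sub>R rot q) - ((v - gam1 (s *\<^sub>R rot q)) \<bullet> sgn (x - gam1 q)) *\<^sub>R sgn (x - gam1 q))) \<bullet> rot (gam1 q))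
     - (sgn (x - gam2 q) \<bullet> rot (gam2 (s *\<^sub>R rot q)) + (inverse (norm (x - gam2 q)) *\<^sub>R (v - gam2 (s *\<^sub>R rot q) - ((v - gam2 (s *\<^sub>R rot q)) \<bullet> sgn (x - gam2 q)) *\<^sub>R sgn (x - gam2 q))) \<bullet> rot (gam2 q))"

definition grad_deriv where
  "grad_deriv q x s v = inverse (norm (x - gam1 q)) *\<^sub>R (v - gam1 (s *\<^sub>R rot q) - ((v - gam1 (s *\<^sub>R rot q)) \<bullet> sgn (x - gam1 q)) *\<^sub>R sgn (x - gam1 q))
     + inverse (norm (x - gam2 q)) *\<^sub>R (v - gam2 (s *\<^sub>R rot q) - ((v - gam2 (s *\<^sub>R rot q)) \<bullet> sgn (x - gam2 q)) *\<^sub>R sgn (x - gam2 q))"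

lemma phis_circ_has_derivative:
  assumes "(f has_derivative f') (at z within S)" "(g has_derivative g') (at z within S)" "(circ (f z), g z) \<in> Reg"
  shows "((\<lambda>z. phis (circ (f z)) (g z)) has_derivative (\<lambda>h. phis_deriv (circ (f z)) (g z) (f' h) (g' h))) (at z within S)"
  unfolding phis_deriv_def by (rule phis_has_derivative[OF circ_has_derivative[OF assms(1) refl] assms(2,3)])

lemma grad_circ_has_derivative:
  assumes "(f has_derivative f') (at z within S)" "(g has_derivative g') (at z within S)" "(circ (f z), g z) \<in> Reg"
  shows "((\<lambda>z. grad (circ (f z)) (g z)) has_derivative (\<lambda>h. grad_deriv (circ (f z)) (g z) (f' h) (g' h))) (at z within S)"
  unfolding grad_deriv_def by (rule grad_has_derivative[OF circ_has_derivative[OF assms(1) refl] assms(2,3)])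

lemma phis_deriv_0: assumes "norm q = 1" "x \<in> disc \<alpha>" shows "phis_deriv q x 0 v = phis_deriv_x q x v"
proof -
  have "((\<lambda>x. phis q x) has_derivative (\<lambda>v. phis_deriv q x 0 v)) (at x)"
    using phis_has_derivative[OF has_derivative_const has_derivative_ident disc_Reg[OF assms]] by (simp add: phis_deriv_def)
  moreover have "((\<lambda>x. phis q x) has_derivative (\<lambda>v. phis_deriv_x q x v)) (at x)"
    by (rule phis_x_has_derivative[OF assms(1) _ has_derivative_ident]) (rule assms(2))
  ultimately have "(\<lambda>v. phis_deriv q x 0 v) = (\<lambda>v. phis_deriv_x q x v)" by (rule has_derivative_unique)
  then show ?thesis by metis
qed

text \<open>Symmetry is read off an explicit bilinear form: each focus contributes a multiple of
  \<open>s * s'\<close> and the inner product of the parts of the relative velocities orthogonal to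
  the line of sight, divided by the distance.\<close>

lemma hessian_symmetric: "phis_deriv q x s1 v1 * s2 + grad_deriv q x s1 v1 \<bullet> v2 = phis_deriv q x s2 v2 * s1 + grad_deriv q x s2 v2 \<bullet> v1"
proof -
  have "phis_deriv q x s v * s' + grad_deriv q x s v \<bullet> v' =
      s * s' * (sgn (x - gam1 q) \<bullet> gam1 q + sgn (x - gam2 q) \<bullet> gam2 q) +
      inverse (norm (x - gam1 q)) * ((v - s *\<^sub>R rot (gam1 q)) \<bullet> (v' - s' *\<^sub>R rot (gam1 q)) - ((v - s *\<^sub>R rot (gam1 q)) \<bullet> sgn (x - gam1 q)) * ((v' - s' *\<^sub>R rot (gam1 q)) \<bullet> sgn (x - gam1 q))) +
      inverse (norm (x - gam2 q)) * ((v - s *\<^sub>R rot (gam2 q)) \<bullet> (v' - s' *\<^sub>R rot (gam2 q)) - ((v - s *\<^sub>R rot (gam2 q)) \<bullet> sgn (x - gam2 q)) * ((v' - s' *\<^sub>R rot (gam2 q)) \<bullet> sgn (x - gam2 q)))"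
    for s s' v v'
    unfolding phis_deriv_def grad_deriv_def
    by (simp add: inner_add_left inner_diff_left inner_diff_right inner_commute[of "sgn (x - gam1 q)" "rot _"]
        inner_commute[of "sgn (x - gam2 q)" "rot _"] inner_commute[of "sgn (x - gam1 q)" v'] inner_commute[of "sgn (x - gam2 q)" v'] algebra_simps)
  then show ?thesis by (simp add: inner_commute mult.commute mult.left_commute)
qed

definition C_coord where
  "C_coord p = (((circ (fst p), phi (circ (fst p)) (fst (snd p))), (- (snd (snd p) * phis (circ (fst p)) (fst (snd p))) *\<^sub>R rot (circ (fst p)), snd (snd p))),
     (fst (snd p), snd (snd p) *\<^sub>R grad (circ (fst p)) (fst (snd p))))"

abbreviation C_dom where "C_dom \<equiv> (UNIV :: real set) \<times> (disc \<alpha> \<times> (- {0 :: real}))"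

lemma open_C_dom: "open C_dom"
  by (intro open_Times open_disc) auto

lemma C_coord_smooth: "smooth_open C_dom C_coord"
proof -
  have c: "smooth_open C_dom (\<lambda>p. circ (fst p))"
    by (intro smooth_open_circ smooth_open_fst smooth_open_id open_C_dom)
  have x: "smooth_open C_dom (\<lambda>p. fst (snd p))" and l: "smooth_open C_dom (\<lambda>p. snd (snd p))"
    by (intro smooth_open_fst smooth_open_snd smooth_open_id open_C_dom)+
  note g = smooth_geom[OF open_C_dom c x]
  have R: "(circ (fst p), fst (snd p)) \<in> Reg" if "p \<in> C_dom" for p using that by (auto intro!: disc_Reg)
  show ?thesis unfolding C_coord_def
    by (intro smooth_open_Pair smooth_open_scaleR smooth_open_minus smooth_open_mult smooth_open_rot c x l g R open_C_dom)
qed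

lemma C_param: "circle_param C_coord C_dom (1, 0) UNIV (\<lambda>c. fst (fst (fst c))) (\<lambda>p. (fst p, (fst (snd (snd p)), snd (snd (fst (snd p))))))"
  by unfold_locales (use C_coord_smooth open_C_dom in
    \<open>auto simp: C_coord_def inner_prod_def Basis_prod_def smooth_open_fst smooth_open_snd smooth_open_Pair open_Times\<close>)

lemma C_coord_has_derivative:
  assumes "p \<in> C_dom"
  shows "(C_coord has_derivative (\<lambda>h.
    (((fst h *\<^sub>R rot (circ (fst p)), phis (circ (fst p)) (fst (snd p)) * fst h + grad (circ (fst p)) (fst (snd p)) \<bullet> fst (snd h)),
      (- (snd (snd h) * phis (circ (fst p)) (fst (snd p)) + snd (snd p) * phis_deriv (circ (fst p)) (fst (snd p)) (fst h) (fst (snd h))) *\<^sub>R rot (circ (fst p))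
        + (snd (snd p) * phis (circ (fst p)) (fst (snd p)) * fst h) *\<^sub>R circ (fst p), snd (snd h))),
     (fst (snd h), snd (snd h) *\<^sub>R grad (circ (fst p)) (fst (snd p)) + snd (snd p) *\<^sub>R grad_deriv (circ (fst p)) (fst (snd p)) (fst h) (fst (snd h)))))) (at p)"
proof -
  have R: "(circ (fst p), fst (snd p)) \<in> Reg" using assms by (auto intro!: disc_Reg)
  have d: "(fst has_derivative fst) (at p)" "((\<lambda>p. fst (snd p)) has_derivative (\<lambda>h. fst (snd h))) (at p)" "((\<lambda>p. snd (snd p)) has_derivative (\<lambda>h. snd (snd h))) (at p)"
    by (intro has_derivative_fst has_derivative_snd has_derivative_ident)+
  note g = phi_circ_has_derivative[OF d(1,2) R] phis_circ_has_derivative[OF d(1,2) R] grad_circ_has_derivative[OF d(1,2) R]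
  have c: "((\<lambda>p. circ (fst p)) has_derivative (\<lambda>h. fst h *\<^sub>R rot (circ (fst p)))) (at p)"
    by (rule circ_has_derivative[OF d(1) refl])
  have r: "((\<lambda>p. rot (circ (fst p))) has_derivative (\<lambda>h. - (fst h *\<^sub>R circ (fst p)))) (at p)"
    using bounded_linear.has_derivative[OF bounded_linear_rot c] by simp
  have m: "((\<lambda>p. - (snd (snd p) * phis (circ (fst p)) (fst (snd p))) *\<^sub>R rot (circ (fst p))) has_derivative
     (\<lambda>h. - (snd (snd h) * phis (circ (fst p)) (fst (snd p)) + snd (snd p) * phis_deriv (circ (fst p)) (fst (snd p)) (fst h) (fst (snd h))) *\<^sub>R rot (circ (fst p))
        + (snd (snd p) * phis (circ (fst p)) (fst (snd p)) * fst h) *\<^sub>R circ (fst p))) (at p)"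
    by (rule has_derivative_eq_rhs[OF has_derivative_scaleR[OF has_derivative_minus[OF has_derivative_mult[OF d(3) g(2)]] r]])
      (simp add: fun_eq_iff algebra_simps)
  have n: "((\<lambda>p. snd (snd p) *\<^sub>R grad (circ (fst p)) (fst (snd p))) has_derivative
     (\<lambda>h. snd (snd h) *\<^sub>R grad (circ (fst p)) (fst (snd p)) + snd (snd p) *\<^sub>R grad_deriv (circ (fst p)) (fst (snd p)) (fst h) (fst (snd h)))) (at p)"
    by (rule has_derivative_eq_rhs[OF has_derivative_scaleR[OF d(3) g(3)]]) (simp add: fun_eq_iff add.commute)
  show ?thesis unfolding C_coord_def[abs_def]
    by (intro has_derivative_Pair c g(1) m n d(2,3))
qed

section \<open>Tangent spaces and membership in the canonical relation\<close>

lemma tangent_Y: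
  assumes "open S" "norm (fst y) = 1" "snd y \<in> S"
  shows "tangent_space (Y_coord ` (UNIV \<times> S)) y = {(\<mu> *\<^sub>R rot (fst y), l) |\<mu> l. True}"
proof -
  interpret circle_param Y_coord "UNIV \<times> S" "(1, 0)" UNIV fst "\<lambda>p. (fst p, snd (snd p))" by (rule Y_param[OF assms(1)])
  obtain s where s: "fst y = circ s" using circ_surj[OF assms(2)] by metis
  have y: "y = Y_coord (s, snd y)" "(s, snd y) \<in> UNIV \<times> S" using s assms(3) by (auto simp: Y_coord_def prod_eq_iff)
  have "(Y_coord has_derivative (\<lambda>h. (fst h *\<^sub>R rot (circ (fst (s, snd y))), snd h))) (at (s, snd y))"
    unfolding Y_coord_def split_beta[abs_def]
    by (intro has_derivative_Pair circ_has_derivative[OF _ refl] has_derivative_fst has_derivative_snd has_derivative_ident)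
  from tangent[OF y(2) this] show ?thesis using y(1) s by (auto simp: image_iff)
qed

definition YD_coord where "YD_coord p = ((circ (fst p), fst (snd p)), snd (snd p))"

lemma YD_param: "circle_param YD_coord (UNIV \<times> ({2 * a<..} \<times> disc \<alpha>)) (1, 0) UNIV (\<lambda>z. fst (fst z)) (\<lambda>p. (fst p, (snd (fst (snd p)), snd (snd p))))"
proof -
  have o: "open ((UNIV :: real set) \<times> ({2 * a<..} \<times> disc \<alpha>))" by (intro open_Times open_disc) auto
  have "smooth_open ((UNIV :: real set) \<times> ({2 * a<..} \<times> disc \<alpha>)) YD_coord" unfolding YD_coord_def
    by (intro smooth_open_Pair smooth_open_circ smooth_open_fst smooth_open_snd smooth_open_id o)
  then show ?thesis
    by unfold_locales (use o in
      \<open>auto simp: YD_coord_def inner_prod_def Basis_prod_def smooth_open_fst smooth_open_snd smooth_open_Pair open_Times\<close>)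
qed

lemma tangent_YD:
  assumes "norm q = 1" "2 * a < L" "x \<in> disc \<alpha>"
  shows "tangent_space (Yset \<alpha> \<times> disc \<alpha>) ((q, L), x) = {((\<mu> *\<^sub>R rot q, l), v) |\<mu> l v. True}"
proof -
  interpret circle_param YD_coord "UNIV \<times> ({2 * a<..} \<times> disc \<alpha>)" "(1, 0)" UNIV "\<lambda>z. fst (fst z)" "\<lambda>p. (fst p, (snd (fst (snd p)), snd (snd p)))"
    by (rule YD_param)
  obtain s where s: "q = circ s" using circ_surj[OF assms(1)] by metis
  have im: "YD_coord ` (UNIV \<times> ({2 * a<..} \<times> disc \<alpha>)) = Yset \<alpha> \<times> disc \<alpha>"
    unfolding Yset_eq by (force simp: YD_coord_def Y_coord_def image_iff)
  have z: "(s, (L, x)) \<in> UNIV \<times> ({2 * a<..} \<times> disc \<alpha>)" using assms by auto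
  have "(YD_coord has_derivative (\<lambda>h. ((fst h *\<^sub>R rot (circ (fst (s, (L, x)))), fst (snd h)), snd (snd h)))) (at (s, (L, x)))"
    unfolding YD_coord_def[abs_def]
    by (intro has_derivative_Pair circ_has_derivative[OF _ refl] has_derivative_fst has_derivative_snd has_derivative_ident)
  from tangent[OF z this] show ?thesis unfolding im s by (auto simp: image_iff YD_coord_def)
qed

lemma tangent_Z:
  assumes "norm q = 1" "x \<in> disc \<alpha>"
  shows "tangent_space (Zset \<alpha>) ((q, phi q x), x) = {((\<mu> *\<^sub>R rot q, phis q x * \<mu> + grad q x \<bullet> v), v) |\<mu> v. True}"
proof -
  interpret circle_param Z_coord "UNIV \<times> disc \<alpha>" "(1, 0)" UNIV "\<lambda>z. fst (fst z)" "\<lambda>p. (fst p, snd (snd p))" by (rule Z_param)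
  obtain s where s: "q = circ s" using circ_surj[OF assms(1)] by metis
  have z: "(s, x) \<in> UNIV \<times> disc \<alpha>" using assms by auto
  have R: "(circ (fst (s, x)), snd (s, x)) \<in> Reg" using assms by (auto intro!: disc_Reg)
  have "(Z_coord has_derivative (\<lambda>h. ((fst h *\<^sub>R rot (circ (fst (s, x))), phis (circ (fst (s, x))) (snd (s, x)) * fst h + grad (circ (fst (s, x))) (snd (s, x)) \<bullet> snd h), snd h))) (at (s, x))"
    unfolding Z_coord_def[abs_def]
    by (intro has_derivative_Pair circ_has_derivative[OF _ refl] phi_circ_has_derivative has_derivative_fst has_derivative_snd has_derivative_ident R)
  from tangent[OF z this] show ?thesis unfolding s Zset_eq by (auto simp: image_iff Z_coord_def)
qed

text \<open>\<open>Z\<close> is a graph over the angle and the point, so its tangent vectors have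
  free components \<open>\<mu>\<close> and \<open>v\<close>, and the conormal condition splits into
  one equation for each. The component \<open>l\<close> belonging to \<open>L\<close> determines the
  others linearly, so it cannot vanish on a nonzero covector.\<close>

lemma mem_C:
  "c \<in> radon_canonical_relation \<alpha> \<longleftrightarrow>
    norm (fst (fst (fst c))) = 1 \<and> fst (snd c) \<in> disc \<alpha> \<and> snd (fst (fst c)) = phi (fst (fst (fst c))) (fst (snd c)) \<and>
    fst (snd (fst c)) = - (snd (snd (fst c)) * phis (fst (fst (fst c))) (fst (snd c))) *\<^sub>R rot (fst (fst (fst c))) \<and>
    snd (snd c) = snd (snd (fst c)) *\<^sub>R grad (fst (fst (fst c))) (fst (snd c)) \<and> snd (snd (fst c)) \<noteq> 0"
proof -
  obtain q L \<eta> l x \<xi> where c: "c = (((q, L), (\<eta>, l)), (x, \<xi>))" by (metis surj_pair)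
  have "c \<in> radon_canonical_relation \<alpha> \<longleftrightarrow>
     (norm q = 1 \<and> x \<in> disc \<alpha> \<and> L = phi q x) \<and> ((\<eta>, l), - \<xi>) \<in> tangent_space (Yset \<alpha> \<times> disc \<alpha>) ((q, L), x) \<and>
     (\<forall>v\<in>tangent_space (Zset \<alpha>) ((q, L), x). ((\<eta>, l), - \<xi>) \<bullet> v = 0) \<and> ((\<eta>, l), \<xi>) \<noteq> (0, 0)"
    unfolding c radon_canonical_relation_def conormal_bundle_def by (auto simp: mem_Zset)
  also have "\<dots> \<longleftrightarrow> (norm q = 1 \<and> x \<in> disc \<alpha> \<and> L = phi q x) \<and> \<eta> = - (l * phis q x) *\<^sub>R rot q \<and> \<xi> = l *\<^sub>R grad q x \<and> l \<noteq> 0"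
  proof (rule conj_cong[OF refl])
    assume z: "norm q = 1 \<and> x \<in> disc \<alpha> \<and> L = phi q x"
    then have q: "norm q = 1" "rot q \<bullet> rot q = 1" "x \<in> disc \<alpha>" by (auto simp: norm_eq_1)
    have L: "2 * a < L" using z phi_gt by auto
    have "(\<forall>v\<in>tangent_space (Zset \<alpha>) ((q, L), x). ((\<eta>, l), - \<xi>) \<bullet> v = 0) \<longleftrightarrow>
       (\<forall>\<mu> v. \<mu> * (\<eta> \<bullet> rot q + l * phis q x) + (l *\<^sub>R grad q x - \<xi>) \<bullet> v = 0)"
    proof -
      have "((\<eta>, l), - \<xi>) \<bullet> ((\<mu> *\<^sub>R rot q, phis q x * \<mu> + grad q x \<bullet> v), v) = \<mu> * (\<eta> \<bullet> rot q + l * phis q x) + (l *\<^sub>R grad q x - \<xi>) \<bullet> v" for \<mu> v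
        by (simp add: inner_diff_left algebra_simps)
      moreover have T: "tangent_space (Zset \<alpha>) ((q, L), x) = {((\<mu> *\<^sub>R rot q, phis q x * \<mu> + grad q x \<bullet> v), v) |\<mu> v. True}"
        using z tangent_Z[OF q(1,3)] by simp
      moreover have "(\<forall>w\<in>{((\<mu> *\<^sub>R rot q, phis q x * \<mu> + grad q x \<bullet> v), v) |\<mu> v. True}. P w) \<longleftrightarrow>
          (\<forall>\<mu> v. P ((\<mu> *\<^sub>R rot q, phis q x * \<mu> + grad q x \<bullet> v), v))" for P by auto
      ultimately show ?thesis by presburger
    qed
    \<comment> \<open>Test with \<open>\<mu> = 1\<close>, \<open>v = 0\<close>, and then with
      \<open>\<mu> = 0\<close> and \<open>v\<close> the very vector that has to vanish.\<close>
    also have "\<dots> \<longleftrightarrow> \<eta> \<bullet> rot q + l * phis q x = 0 \<and> l *\<^sub>R grad q x - \<xi> = 0" (is "?A \<longleftrightarrow> ?B")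
    proof
      assume A: ?A
      have "\<eta> \<bullet> rot q + l * phis q x = 0" using A[rule_format, of 1 0] by simp
      moreover have "(l *\<^sub>R grad q x - \<xi>) \<bullet> (l *\<^sub>R grad q x - \<xi>) = 0" using A[rule_format, of 0 "l *\<^sub>R grad q x - \<xi>"] by simp
      ultimately show ?B by simp
    qed simp
    finally have 1: "(\<forall>v\<in>tangent_space (Zset \<alpha>) ((q, L), x). ((\<eta>, l), - \<xi>) \<bullet> v = 0) \<longleftrightarrow> \<eta> \<bullet> rot q = - (l * phis q x) \<and> \<xi> = l *\<^sub>R grad q x"
      by auto
    have 2: "((\<eta>, l), - \<xi>) \<in> tangent_space (Yset \<alpha> \<times> disc \<alpha>) ((q, L), x) \<longleftrightarrow> (\<exists>\<mu>. \<eta> = \<mu> *\<^sub>R rot q)"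
      unfolding tangent_YD[OF q(1) L q(3)] by auto
    have 3: "(\<exists>\<mu>. \<eta> = \<mu> *\<^sub>R rot q) \<and> \<eta> \<bullet> rot q = - (l * phis q x) \<longleftrightarrow> \<eta> = - (l * phis q x) *\<^sub>R rot q"
      using q(2) by (auto intro: exI[of _ "- (l * phis q x)"])
    show "((\<eta>, l), - \<xi>) \<in> tangent_space (Yset \<alpha> \<times> disc \<alpha>) ((q, L), x) \<and>
     (\<forall>v\<in>tangent_space (Zset \<alpha>) ((q, L), x). ((\<eta>, l), - \<xi>) \<bullet> v = 0) \<and> ((\<eta>, l), \<xi>) \<noteq> (0, 0) \<longleftrightarrow>
     \<eta> = - (l * phis q x) *\<^sub>R rot q \<and> \<xi> = l *\<^sub>R grad q x \<and> l \<noteq> 0"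
      unfolding 1 2 using 3 by (auto simp: zero_prod_def)
  qed
  finally show ?thesis unfolding c by auto
qed

lemma C_eq: "radon_canonical_relation \<alpha> = C_coord ` C_dom"
proof (intro equalityI subsetI)
  fix c assume c: "c \<in> radon_canonical_relation \<alpha>"
  then obtain s where s: "fst (fst (fst c)) = circ s" using mem_C circ_surj by metis
  show "c \<in> C_coord ` C_dom"
    by (rule image_eqI[of _ _ "(s, (fst (snd c), snd (snd (fst c))))"]) (use c s mem_C[of c] in \<open>auto simp: C_coord_def prod_eq_iff\<close>)
qed (auto simp: mem_C C_coord_def)

lemma C_submanifold: "smooth_submanifold 4 (radon_canonical_relation \<alpha>)"
proof -
  interpret circle_param C_coord C_dom "(1, 0)" UNIV "\<lambda>c. fst (fst (fst c))" "\<lambda>p. (fst p, (fst (snd (snd p)), snd (snd (fst (snd p)))))" by (rule C_param)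
  show ?thesis unfolding C_eq by (rule submanifold) auto
qed

lemma tangent_C:
  assumes "v \<in> tangent_space (radon_canonical_relation \<alpha>) c" "c \<in> radon_canonical_relation \<alpha>"
  obtains q x l s' x' l' where "norm q = 1" "x \<in> disc \<alpha>" "l \<noteq> 0"
    "v = (((s' *\<^sub>R rot q, phis q x * s' + grad q x \<bullet> x'),
      (- (l' * phis q x + l * phis_deriv q x s' x') *\<^sub>R rot q + (l * phis q x * s') *\<^sub>R q, l')),
     (x', l' *\<^sub>R grad q x + l *\<^sub>R grad_deriv q x s' x'))" "c = (((q, phi q x), (- (l * phis q x) *\<^sub>R rot q, l)), (x, l *\<^sub>R grad q x))"
proof -
  interpret circle_param C_coord C_dom "(1, 0)" UNIV "\<lambda>c. fst (fst (fst c))" "\<lambda>p. (fst p, (fst (snd (snd p)), snd (snd (fst (snd p)))))" by (rule C_param)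
  obtain p where p: "p \<in> C_dom" "c = C_coord p" using assms(2) unfolding C_eq by auto
  note T = tangent[OF p(1) C_coord_has_derivative[OF p(1)]]
  obtain h where h: "v = (((fst h *\<^sub>R rot (circ (fst p)), phis (circ (fst p)) (fst (snd p)) * fst h + grad (circ (fst p)) (fst (snd p)) \<bullet> fst (snd h)),
      (- (snd (snd h) * phis (circ (fst p)) (fst (snd p)) + snd (snd p) * phis_deriv (circ (fst p)) (fst (snd p)) (fst h) (fst (snd h))) *\<^sub>R rot (circ (fst p))
        + (snd (snd p) * phis (circ (fst p)) (fst (snd p)) * fst h) *\<^sub>R circ (fst p), snd (snd h))),
     (fst (snd h), snd (snd h) *\<^sub>R grad (circ (fst p)) (fst (snd p)) + snd (snd p) *\<^sub>R grad_deriv (circ (fst p)) (fst (snd p)) (fst h) (fst (snd h))))"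
    using assms(1) T unfolding C_eq p(2) by blast
  show ?thesis
    by (rule that[of "circ (fst p)" "fst (snd p)" "snd (snd p)" "fst h" "fst (snd h)" "snd (snd h)"])
      (use p h in \<open>auto simp: C_coord_def\<close>)
qed

lemma cotangent_Y: "(y, \<eta>) \<in> cotangent_bundle (Yset \<alpha>) \<longleftrightarrow> norm (fst y) = 1 \<and> 2 * a < snd y \<and> (\<exists>\<mu>. fst \<eta> = \<mu> *\<^sub>R rot (fst y))"
proof -
  have o: "open {2 * a<..}" by simp
  have "y \<in> Yset \<alpha> \<longleftrightarrow> norm (fst y) = 1 \<and> 2 * a < snd y" unfolding Yset_eq Y_coord_image by auto
  moreover have "\<eta> \<in> tangent_space (Yset \<alpha>) y \<longleftrightarrow> (\<exists>\<mu>. fst \<eta> = \<mu> *\<^sub>R rot (fst y))" if "norm (fst y) = 1" "2 * a < snd y"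
    using tangent_Y[OF o that(1)] that(2) by (cases \<eta>) (auto simp: Yset_eq)
  ultimately show ?thesis by (auto simp: cotangent_bundle_def)
qed

lemma cotangent_disc: "(x, \<xi>) \<in> cotangent_bundle (disc \<alpha>) \<longleftrightarrow> x \<in> disc \<alpha>"
  using tangent_space_open[OF open_disc] by (auto simp: cotangent_bundle_def)

lemma geom_continuous_on:
  fixes f g :: "'z::topological_space \<Rightarrow> real^2"
  assumes "continuous_on S f" "continuous_on S g" "\<And>x. x \<in> S \<Longrightarrow> (f x, g x) \<in> Reg"
  shows "continuous_on S (\<lambda>x. grad (f x) (g x))" "continuous_on S (\<lambda>x. phis (f x) (g x))"
proof -
  have p: "smooth_open Reg (\<lambda>p :: (real^2) \<times> (real^2). fst p)" "smooth_open Reg (\<lambda>p :: (real^2) \<times> (real^2). snd p)"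
    by (intro smooth_open_fst smooth_open_snd smooth_open_id open_Reg)+
  have c: "continuous_on Reg (\<lambda>p. grad (fst p) (snd p))" "continuous_on Reg (\<lambda>p. phis (fst p) (snd p))"
    by (intro smooth_open_continuous_on smooth_geom(2,3) open_Reg p; simp)+
  have fg: "continuous_on S (\<lambda>x. (f x, g x))" by (intro continuous_intros assms)
  show "continuous_on S (\<lambda>x. grad (f x) (g x))" "continuous_on S (\<lambda>x. phis (f x) (g x))"
    using continuous_on_compose2[OF c(1) fg] continuous_on_compose2[OF c(2) fg] assms(3) by auto
qed

section \<open>Lagrangian property and Bolker condition\<close>

lemma canonical_relation_C: "canonical_relation 4 (Yset \<alpha>) (disc \<alpha>) (radon_canonical_relation \<alpha>)"
  unfolding canonical_relation_def
proof (intro conjI)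
  show "radon_canonical_relation \<alpha> \<subseteq> {((y, \<eta>), (x, \<xi>)). (y, \<eta>) \<in> cotangent_bundle (Yset \<alpha>) \<and> \<eta> \<noteq> 0 \<and> (x, \<xi>) \<in> cotangent_bundle (disc \<alpha>) \<and> \<xi> \<noteq> 0}"
  proof
    fix c assume "c \<in> radon_canonical_relation \<alpha>"
    moreover obtain q L \<eta> l x \<xi> where c: "c = (((q, L), (\<eta>, l)), (x, \<xi>))" by (metis surj_pair)
    ultimately have h: "norm q = 1" "x \<in> disc \<alpha>" "L = phi q x" "\<eta> = - (l * phis q x) *\<^sub>R rot q" "\<xi> = l *\<^sub>R grad q x" "l \<noteq> 0"
      by (simp_all add: mem_C)
    have "((q, L), (\<eta>, l)) \<in> cotangent_bundle (Yset \<alpha>)" unfolding cotangent_Y fst_conv snd_conv using h phi_gt by blast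
    then show "c \<in> {((y, \<eta>), (x, \<xi>)). (y, \<eta>) \<in> cotangent_bundle (Yset \<alpha>) \<and> \<eta> \<noteq> 0 \<and> (x, \<xi>) \<in> cotangent_bundle (disc \<alpha>) \<and> \<xi> \<noteq> 0}"
      using h grad_nz[OF h(1,2)] by (simp add: c cotangent_disc zero_prod_def)
  qed
  let ?A = "{((y, \<eta>), (x, \<xi>)). (y, \<eta>) \<in> cotangent_bundle (Yset \<alpha>) \<and> (x, \<xi>) \<in> cotangent_bundle (disc \<alpha>) \<and> (\<eta>, \<xi>) \<noteq> 0}"
  show "closedin (top_of_set ?A) (radon_canonical_relation \<alpha>)"
  proof -
    \<comment> \<open>The three defining equations. Together with
      \<open>(\<eta>, \<xi>) \<noteq> 0\<close> in the ambient set they imply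
      \<open>l \<noteq> 0\<close>, so no open condition is left and the relation is relatively
      closed.\<close>
    let ?f = "\<lambda>c. (snd (fst (fst c)) - phi (fst (fst (fst c))) (fst (snd c)),
       fst (snd (fst c)) + (snd (snd (fst c)) * phis (fst (fst (fst c))) (fst (snd c))) *\<^sub>R rot (fst (fst (fst c))),
       snd (snd c) - snd (snd (fst c)) *\<^sub>R grad (fst (fst (fst c))) (fst (snd c)))"
    have A: "norm (fst (fst (fst c))) = 1 \<and> fst (snd c) \<in> disc \<alpha>" if "c \<in> ?A" for c
      using that by (auto simp: cotangent_Y cotangent_disc)
    then have R: "(fst (fst (fst c)), fst (snd c)) \<in> Reg" if "c \<in> ?A" for c using that disc_Reg by blast
    have c1: "continuous_on ?A (\<lambda>c. fst (fst (fst c)))" "continuous_on ?A (\<lambda>c. fst (snd c))" by (intro continuous_intros)+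
    have "continuous_on ?A ?f"
      by (intro continuous_intros geom_continuous_on c1 R)
    then have "closedin (top_of_set ?A) {c \<in> ?A. ?f c = (0, 0, 0)}" by (rule continuous_closedin_preimage_constant)
    moreover have "{c \<in> ?A. ?f c = (0, 0, 0)} = radon_canonical_relation \<alpha>"
    proof (intro equalityI subsetI)
      fix c assume c: "c \<in> {c \<in> ?A. ?f c = (0, 0, 0)}"
      obtain q L \<eta> l x \<xi> where cc: "c = (((q, L), (\<eta>, l)), (x, \<xi>))" by (metis surj_pair)
      have "norm q = 1" "x \<in> disc \<alpha>" "L = phi q x" "\<eta> = - (l * phis q x) *\<^sub>R rot q" "\<xi> = l *\<^sub>R grad q x" "((\<eta>, l), \<xi>) \<noteq> 0"
        using c A[of c] by (auto simp: cc eq_neg_iff_add_eq_0)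
      then show "c \<in> radon_canonical_relation \<alpha>" by (auto simp: cc mem_C zero_prod_def)
    next
      fix c assume "c \<in> radon_canonical_relation \<alpha>"
      moreover obtain q L \<eta> l x \<xi> where c: "c = (((q, L), (\<eta>, l)), (x, \<xi>))" by (metis surj_pair)
      ultimately have h: "norm q = 1" "x \<in> disc \<alpha>" "L = phi q x" "\<eta> = - (l * phis q x) *\<^sub>R rot q" "\<xi> = l *\<^sub>R grad q x" "l \<noteq> 0"
        by (simp_all add: mem_C)
      have "((q, L), (\<eta>, l)) \<in> cotangent_bundle (Yset \<alpha>)" unfolding cotangent_Y fst_conv snd_conv using h phi_gt by blast
      then show "c \<in> {c \<in> ?A. ?f c = (0, 0, 0)}" using h by (simp add: c cotangent_disc zero_prod_def)
    qed
    ultimately show ?thesis by simp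
  qed
  show "\<forall>y \<eta> x \<xi> t. ((y, \<eta>), (x, \<xi>)) \<in> radon_canonical_relation \<alpha> \<and> t > 0 \<longrightarrow> ((y, t *\<^sub>R \<eta>), (x, t *\<^sub>R \<xi>)) \<in> radon_canonical_relation \<alpha>"
    by (auto simp: mem_C scaleR_prod_def)
  show "smooth_submanifold 4 (radon_canonical_relation \<alpha>)" by (rule C_submanifold)
  have "\<forall>c\<in>radon_canonical_relation \<alpha>. \<forall>v1\<in>tangent_space (radon_canonical_relation \<alpha>) c. \<forall>v2\<in>tangent_space (radon_canonical_relation \<alpha>) c.
     (snd (fst v1) \<bullet> fst (fst v2) - snd (fst v2) \<bullet> fst (fst v1)) - (snd (snd v1) \<bullet> fst (snd v2) - snd (snd v2) \<bullet> fst (snd v1)) = 0"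
  proof (intro ballI)
    fix c v1 v2 assume c: "c \<in> radon_canonical_relation \<alpha>" and v: "v1 \<in> tangent_space (radon_canonical_relation \<alpha>) c"
      "v2 \<in> tangent_space (radon_canonical_relation \<alpha>) c"
    obtain q x l s1 x1 l1 where 1: "norm q = 1" "v1 = (((s1 *\<^sub>R rot q, phis q x * s1 + grad q x \<bullet> x1),
      (- (l1 * phis q x + l * phis_deriv q x s1 x1) *\<^sub>R rot q + (l * phis q x * s1) *\<^sub>R q, l1)),
     (x1, l1 *\<^sub>R grad q x + l *\<^sub>R grad_deriv q x s1 x1))" "c = (((q, phi q x), (- (l * phis q x) *\<^sub>R rot q, l)), (x, l *\<^sub>R grad q x))"
      by (rule tangent_C[OF v(1) c])
    obtain q' x' l' s2 x2 l2 where 2: "v2 = (((s2 *\<^sub>R rot q', phis q' x' * s2 + grad q' x' \<bullet> x2),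
      (- (l2 * phis q' x' + l' * phis_deriv q' x' s2 x2) *\<^sub>R rot q' + (l' * phis q' x' * s2) *\<^sub>R q', l2)),
     (x2, l2 *\<^sub>R grad q' x' + l' *\<^sub>R grad_deriv q' x' s2 x2))" "c = (((q', phi q' x'), (- (l' * phis q' x') *\<^sub>R rot q', l')), (x', l' *\<^sub>R grad q' x'))"
      by (rule tangent_C[OF v(2) c])
    have e: "q' = q" "x' = x" "l' = l" using 1(3) 2(2) by auto
    have qq: "q \<bullet> q = 1" using 1(1) by (simp add: norm_eq_1)
    \<comment> \<open>For two tangent vectors the difference of the symplectic forms reduces, up to
      sign, to \<open>l\<close> times the antisymmetric part of the Hessian.\<close>
    have "l * (phis_deriv q x s1 x1 * s2 + grad_deriv q x s1 x1 \<bullet> x2) = l * (phis_deriv q x s2 x2 * s1 + grad_deriv q x s2 x2 \<bullet> x1)"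
      by (simp only: hessian_symmetric)
    then show "(snd (fst v1) \<bullet> fst (fst v2) - snd (fst v2) \<bullet> fst (fst v1)) - (snd (snd v1) \<bullet> fst (snd v2) - snd (snd v2) \<bullet> fst (snd v1)) = 0"
      unfolding 1(2) 2(1) e by (simp add: inner_add_left qq algebra_simps)
  qed
  then show "\<forall>c\<in>radon_canonical_relation \<alpha>. \<forall>((y1, \<eta>1), (x1, \<xi>1)) \<in> tangent_space (radon_canonical_relation \<alpha>) c.
     \<forall>((y2, \<eta>2), (x2, \<xi>2)) \<in> tangent_space (radon_canonical_relation \<alpha>) c. (\<eta>1 \<bullet> y2 - \<eta>2 \<bullet> y1) - (\<xi>1 \<bullet> x2 - \<xi>2 \<bullet> x1) = 0"
    unfolding split_beta .
qed

definition T_coord where "T_coord p = ((circ (fst p), fst (snd p)), (fst (snd (snd p)) *\<^sub>R rot (circ (fst p)), snd (snd (snd p))))"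

lemma cotangent_submanifold: "smooth_submanifold 4 (cotangent_bundle (Yset \<alpha>))"
proof -
  let ?V = "(UNIV :: real set) \<times> ({2 * a<..} \<times> (UNIV :: (real \<times> real) set))"
  let ?K = "\<lambda>p :: real \<times> (((real^2) \<times> real) \<times> ((real^2) \<times> real)). (fst p, (snd (fst (snd p)), (fst (snd (snd p)) \<bullet> rot (fst (fst (snd p))), snd (snd (snd p)))))"
  have o: "open ?V" by (intro open_Times) auto
  have s: "smooth_open ?V T_coord" unfolding T_coord_def
    by (intro smooth_open_Pair smooth_open_scaleR smooth_open_circ smooth_open_rot smooth_open_fst smooth_open_snd smooth_open_id o)
  have k: "smooth_open (UNIV \<times> UNIV) ?K"
    by (intro smooth_open_Pair smooth_open_inner smooth_open_rot smooth_open_fst smooth_open_snd smooth_open_id open_Times) auto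
  have one: "circ s \<bullet> circ s = 1" for s by (simp add: norm_eq_1[symmetric] del: norm_eq_1)
  have cp: "circle_param T_coord ?V (1, 0) UNIV (\<lambda>z. fst (fst z)) ?K"
    by unfold_locales (use o s k one in
      \<open>auto simp: T_coord_def inner_prod_def Basis_prod_def smooth_open_fst\<close>)
  interpret circle_param T_coord ?V "(1, 0)" UNIV "\<lambda>z. fst (fst z)" ?K by (rule cp)
  have "T_coord ` ?V = cotangent_bundle (Yset \<alpha>)"
  proof (intro equalityI subsetI)
    fix c assume c: "c \<in> cotangent_bundle (Yset \<alpha>)"
    obtain q L \<eta> l where cc: "c = ((q, L), (\<eta>, l))" by (metis surj_pair)
    then obtain \<mu> where h: "norm q = 1" "2 * a < L" "\<eta> = \<mu> *\<^sub>R rot q" using c by (auto simp: cotangent_Y)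
    obtain s where "q = circ s" using circ_surj[OF h(1)] by metis
    then show "c \<in> T_coord ` ?V" using h by (intro image_eqI[of _ _ "(s, (L, (\<mu>, l)))"]) (auto simp: cc T_coord_def)
  qed (auto simp: T_coord_def cotangent_Y)
  then show ?thesis using submanifold[of 4] by simp
qed

text \<open>A covector over \<open>Y\<close> reveals \<open>q\<close>, \<open>L\<close> and
  \<open>l\<close>, and its circle component divided by \<open>- l\<close> gives
  \<open>phis\<close>; \<open>phi_phis_inj\<close> then recovers \<open>x\<close>. The infinitesimal
  version of the same argument rests on \<open>phis_deriv_x_eq_0\<close>.\<close>

lemma bolker: "bolker_assumption (Yset \<alpha>) (radon_canonical_relation \<alpha>)"
  unfolding bolker_assumption_def injective_immersion_def
proof (intro conjI)
  let ?C = "radon_canonical_relation \<alpha>"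
  show "\<exists>d. smooth_submanifold d ?C" using C_submanifold by blast
  show "\<exists>d. smooth_submanifold d (cotangent_bundle (Yset \<alpha>))" using cotangent_submanifold by blast
  show "fst ` ?C \<subseteq> cotangent_bundle (Yset \<alpha>)"
  proof
    fix d assume "d \<in> fst ` ?C"
    then obtain c where c: "c \<in> ?C" "d = fst c" by auto
    then have "norm (fst (fst d)) = 1 \<and> 2 * a < snd (fst d) \<and> (\<exists>\<mu>. fst (snd d) = \<mu> *\<^sub>R rot (fst (fst d)))"
      using mem_C[of c] phi_gt by (auto intro!: exI[of _ "- (snd (snd (fst c)) * phis (fst (fst (fst c))) (fst (snd c)))"])
    then show "d \<in> cotangent_bundle (Yset \<alpha>)" using cotangent_Y[of "fst d" "snd d"] by simp
  qed
  show "inj_on fst ?C"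
  proof (rule inj_onI)
    fix c c' assume c: "c \<in> ?C" "c' \<in> ?C" "fst c = fst c'"
    obtain q L \<eta> l x \<xi> where cc: "c = (((q, L), (\<eta>, l)), (x, \<xi>))" by (metis surj_pair)
    obtain x' \<xi>' where cc': "c' = (((q, L), (\<eta>, l)), (x', \<xi>'))" using c(3) cc by (cases c') auto
    have h: "norm q = 1" "x \<in> disc \<alpha>" "L = phi q x" "\<eta> = - (l * phis q x) *\<^sub>R rot q" "\<xi> = l *\<^sub>R grad q x" "l \<noteq> 0"
      using c(1) by (simp_all add: mem_C cc)
    have h': "x' \<in> disc \<alpha>" "L = phi q x'" "\<eta> = - (l * phis q x') *\<^sub>R rot q" "\<xi>' = l *\<^sub>R grad q x'"
      using c(2) by (simp_all add: mem_C cc')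
    have "rot q \<noteq> 0" using h(1) by auto
    then have "phis q x = phis q x'" using h(4,6) h'(3) by auto
    then have "x = x'" using phi_phis_inj[OF h(1,2) h'(1)] h(3) h'(2) by simp
    then show "c = c'" using h h' by (simp add: cc cc')
  qed
  show "immersion_on ?C fst"
    unfolding immersion_on_def
  proof (intro conjI ballI allI impI)
    show "smooth_map_on ?C fst" by (rule smooth_map_onI[of UNIV]) (auto intro!: smooth_open_fst)
    fix p c assume p: "p \<in> ?C" and c: "smooth_curve_at ?C p c \<and> ((fst \<circ> c) has_vector_derivative 0) (at 0)"
    obtain \<epsilon> where e: "\<epsilon> > 0" "smooth_open {-\<epsilon><..<\<epsilon>} c" using c by (auto simp: smooth_curve_at_def)
    have "(c has_derivative frechet_derivative c (at 0)) (at 0)"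
      by (rule smooth_open_has_derivative[OF e(2)]) (use e in auto)
    then have "c differentiable at 0" by (rule differentiableI)
    then have v: "(c has_vector_derivative vector_derivative c (at 0)) (at 0)" by (simp only: vector_derivative_works)
    define v where "v = vector_derivative c (at 0)"
    note v = v[folded v_def]
    then have vT: "v \<in> tangent_space ?C p" using c by (auto simp: tangent_space_def)
    have "((fst \<circ> c) has_vector_derivative fst v) (at 0)"
      using has_derivative_fst[OF v[unfolded has_vector_derivative_def]] by (simp add: has_vector_derivative_def o_def)
    then have f0: "fst v = 0" using vector_derivative_unique_at[OF _ conjunct2[OF c]] by simp
    obtain q x l s' x' l' where t: "norm q = 1" "x \<in> disc \<alpha>" "l \<noteq> 0"
      "v = (((s' *\<^sub>R rot q, phis q x * s' + grad q x \<bullet> x'),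
      (- (l' * phis q x + l * phis_deriv q x s' x') *\<^sub>R rot q + (l * phis q x * s') *\<^sub>R q, l')),
     (x', l' *\<^sub>R grad q x + l *\<^sub>R grad_deriv q x s' x'))" by (rule tangent_C[OF vT p])
    have r: "rot q \<noteq> 0" using t(1) by auto
    \<comment> \<open>A vanishing image kills the motion in \<open>s\<close> and in
      \<open>l\<close>; the two equations that remain for \<open>x'\<close> are those of
      \<open>phis_deriv_x_eq_0\<close>.\<close>
    have "s' = 0" "l' = 0" using f0 r unfolding t(4) by (auto simp: zero_prod_def)
    then have "grad q x \<bullet> x' = 0" "phis_deriv q x 0 x' = 0" using f0 r t(3) unfolding t(4) by (auto simp: zero_prod_def)
    then have x0: "x' = 0" using phis_deriv_x_eq_0[OF t(1,2), of x'] phis_deriv_0[OF t(1,2)] by simp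
    have "grad_deriv q x 0 0 = 0" by (simp add: grad_deriv_def)
    then have "v = 0" unfolding t(4) using x0 \<open>s' = 0\<close> \<open>l' = 0\<close> phis_deriv_0[OF t(1,2), of 0] by (simp add: zero_prod_def phis_deriv_x_def)
    then show "(c has_vector_derivative 0) (at 0)" using v by simp
  qed
qed

end

section \<open>Truncated oscillatory integrals\<close>

lemma integrable_inverse_square: "integrable lborel (\<lambda>x :: real. inverse (1 + x\<^sup>2))"
  using integrable_inverse_1_plus_square by (simp add: set_integrable_def)

text \<open>The test function as a function of \<open>L\<close> alone. Two derivatives give
  integrable decay of its Fourier transform; the constants \<open>R\<close> and \<open>M\<close> are
  parameters of the locale so that the bounds are uniform over a family of such functions.\<close>

locale C2_bump =
  fixes G G' G'' :: "real \<Rightarrow> complex" and R M :: real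
  assumes d1: "\<And>t. (G has_vector_derivative G' t) (at t)" and d2: "\<And>t. (G' has_vector_derivative G'' t) (at t)"
    and c2: "continuous_on UNIV G''" and MG: "\<And>t. norm (G t) \<le> M" "\<And>t. norm (G'' t) \<le> M"
    and R: "0 \<le> R" and z: "\<And>t. R \<le> \<bar>t\<bar> \<Longrightarrow> G t = 0" "\<And>t. R \<le> \<bar>t\<bar> \<Longrightarrow> G' t = 0" "\<And>t. R \<le> \<bar>t\<bar> \<Longrightarrow> G'' t = 0"
begin

lemma cont: "continuous_on UNIV G"
  using d1 has_vector_derivative_continuous by (intro continuous_at_imp_continuous_on) blast

lemma measG [measurable]: "G \<in> borel_measurable borel" "G'' \<in> borel_measurable borel"
  by (auto intro: borel_measurable_continuous_onI cont c2)

definition bump_fourier where "bump_fourier c \<theta> = (\<integral>t. exp (\<i> * complex_of_real (\<theta> * (t - c))) * G t \<partial>lborel)"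

lemma norm_iexp: "norm (exp (\<i> * complex_of_real r)) = 1"
  using norm_exp_i_times[of r] by simp

lemma int1: "integrable lborel (\<lambda>t. exp (\<i> * complex_of_real (\<theta> * (t - c))) * G t)"
  "integrable lborel (\<lambda>t. exp (\<i> * complex_of_real (\<theta> * (t - c))) * G'' t)"
  by (rule bounded_integrable[where S = "{-R..R}" and C = M];
      use z MG in \<open>auto simp: norm_mult norm_iexp abs_if split: if_splits intro!: borel_measurable_continuous_onI continuous_intros cont c2\<close>)+

lemma bound_bump:
  assumes [measurable]: "H \<in> borel_measurable borel" and H: "\<And>t. norm (H t) \<le> K" "\<And>t. R \<le> \<bar>t\<bar> \<Longrightarrow> H t = (0 :: complex)"
  shows "norm (\<integral>t. H t \<partial>lborel) \<le> 2 * R * K"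
proof -
  have "norm (\<integral>t. H t \<partial>lborel) \<le> (\<integral>t. norm (H t) \<partial>lborel)" by (rule integral_norm_bound)
  also have "\<dots> \<le> (\<integral>t. indicator {-R..R} t * K \<partial>lborel)"
  proof (rule integral_mono)
    show "integrable lborel (\<lambda>t. norm (H t))"
      by (intro integrable_norm bounded_integrable[where S = "{-R..R}" and C = K]) (use H in \<open>auto simp: abs_if split: if_splits\<close>)
    show "norm (H t) \<le> indicator {-R..R} t * K" for t
      using H(1)[of t] H(2)[of t] by (cases "t \<in> {-R..R}") (auto simp: abs_if split: if_splits)
    show "integrable lborel (\<lambda>t. indicator {-R..R} t * K)"
      by (intro integrable_mult_left integrable_real_indicator) (auto simp: emeasure_lborel_Icc_eq)
  qed
  also have "\<dots> = 2 * R * K" using R by simp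
  finally show ?thesis .
qed

text \<open>Adding the trivial bound to the one from two integrations by parts produces the factor
  \<open>1 + \<theta>\<^sup>2\<close>; \<open>G\<close> and \<open>G''\<close> contribute
  \<open>2 * R * M\<close> each.\<close>

lemma bump_fourier_decay: "norm (bump_fourier c \<theta>) \<le> 4 * R * M * inverse (1 + \<theta>\<^sup>2)"
proof -
  let ?E = "\<lambda>t. exp (\<i> * complex_of_real (\<theta> * (t - c)))"
  have E: "(?E has_vector_derivative (\<i> * complex_of_real \<theta>) * ?E t) (at t)" for t
  proof -
    have "((\<lambda>t. complex_of_real (\<theta> * (t - c))) has_vector_derivative complex_of_real \<theta>) (at t)"
      by (rule has_vector_derivative_of_real) (auto intro!: derivative_eq_intros)
    then have "((\<lambda>t. \<i> * complex_of_real (\<theta> * (t - c))) has_vector_derivative \<i> * complex_of_real \<theta>) (at t)"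
      by (rule has_vector_derivative_mult_right)
    from field_vector_diff_chain_at[OF this DERIV_exp] show ?thesis by (simp add: o_def)
  qed
  \<comment> \<open>An antiderivative of the exponential times
    \<open>\<theta>\<^sup>2 * G + G''\<close>, so that a single use of the fundamental theorem
    replaces two integrations by parts.\<close>
  let ?F = "\<lambda>t. ?E t * (G' t - \<i> * complex_of_real \<theta> * G t)"
  have F: "(?F has_vector_derivative ?E t * (complex_of_real (\<theta>\<^sup>2) * G t + G'' t)) (at t)" for t
    by (rule has_vector_derivative_eq_rhs[OF has_vector_derivative_mult[OF E has_vector_derivative_diff[OF d2 has_vector_derivative_mult_right[OF d1]]]])
      (simp add: algebra_simps power2_eq_square)
  have "(\<integral>t. indicator {-R..R} t *\<^sub>R (?E t * (complex_of_real (\<theta>\<^sup>2) * G t + G'' t)) \<partial>lborel) = ?F R - ?F (- R)"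
  proof (rule integral_FTC_Icc)
    show "- R \<le> R" using R by simp
    show "(?F has_vector_derivative ?E t * (complex_of_real (\<theta>\<^sup>2) * G t + G'' t)) (at t within {-R..R})" for t
      by (rule has_vector_derivative_at_within[OF F])
    have "continuous_on UNIV (\<lambda>t. ?E t * (complex_of_real (\<theta>\<^sup>2) * G t + G'' t))"
      by (intro continuous_intros cont c2)
    then show "continuous_on {-R..R} (\<lambda>t. ?E t * (complex_of_real (\<theta>\<^sup>2) * G t + G'' t))"
      by (rule continuous_on_subset) simp
  qed
  also have "\<dots> = 0" using z R by simp
  also have "(\<lambda>t. indicator {-R..R} t *\<^sub>R (?E t * (complex_of_real (\<theta>\<^sup>2) * G t + G'' t))) = (\<lambda>t. ?E t * (complex_of_real (\<theta>\<^sup>2) * G t + G'' t))"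
  proof
    fix t show "indicator {-R..R} t *\<^sub>R (?E t * (complex_of_real (\<theta>\<^sup>2) * G t + G'' t)) = ?E t * (complex_of_real (\<theta>\<^sup>2) * G t + G'' t)"
      using z[of t] by (cases "t \<in> {-R..R}") (auto simp: abs_if split: if_splits)
  qed
  finally have "(\<integral>t. ?E t * (complex_of_real (\<theta>\<^sup>2) * G t + G'' t) \<partial>lborel) = 0" .
  moreover have "(\<lambda>t. ?E t * (complex_of_real (\<theta>\<^sup>2) * G t + G'' t)) = (\<lambda>t. complex_of_real (\<theta>\<^sup>2) * (?E t * G t) + ?E t * G'' t)"
    by (auto simp: algebra_simps)
  ultimately have "complex_of_real (\<theta>\<^sup>2) * bump_fourier c \<theta> + (\<integral>t. ?E t * G'' t \<partial>lborel) = 0"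
    using int1[of \<theta> c] by (simp add: bump_fourier_def)
  then have "complex_of_real (1 + \<theta>\<^sup>2) * bump_fourier c \<theta> = bump_fourier c \<theta> - (\<integral>t. ?E t * G'' t \<partial>lborel)"
    by (simp add: algebra_simps add_eq_0_iff)
  then have "norm (complex_of_real (1 + \<theta>\<^sup>2) * bump_fourier c \<theta>) \<le> norm (bump_fourier c \<theta>) + norm (\<integral>t. ?E t * G'' t \<partial>lborel)"
    by (metis norm_triangle_ineq4)
  also have "norm (bump_fourier c \<theta>) \<le> 2 * R * M" unfolding bump_fourier_def
    by (rule bound_bump) (use MG z in \<open>auto simp: norm_mult norm_iexp\<close>)
  also have "norm (\<integral>t. ?E t * G'' t \<partial>lborel) \<le> 2 * R * M"
    by (rule bound_bump) (use MG z in \<open>auto simp: norm_mult norm_iexp\<close>)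
  finally have "(1 + \<theta>\<^sup>2) * norm (bump_fourier c \<theta>) \<le> 4 * R * M"
    unfolding norm_mult norm_of_real abs_of_nonneg[OF add_nonneg_nonneg[OF zero_le_one zero_le_power2]] by linarith
  moreover have "0 < 1 + \<theta>\<^sup>2" by (rule add_pos_nonneg) auto
  ultimately show ?thesis by (simp add: field_simps)
qed

lemma bump_fourier_measurable [measurable]: "bump_fourier c \<in> borel_measurable borel"
  unfolding bump_fourier_def[abs_def] by (rule borel_measurable_integral_borel) measurable

text \<open>Every uniformly bounded regularization that tends to 1 has the same limit. This is used
  twice: with Gaussians to prove the inversion formula, and with the cutoffs of the oscillatory
  integral.\<close>

lemma bump_fourier_dominated:
  fixes k :: "nat \<Rightarrow> real \<Rightarrow> real"
  assumes [measurable]: "\<And>n. k n \<in> borel_measurable borel" and B: "\<And>n \<theta>. \<bar>k n \<theta>\<bar> \<le> B" and lim: "\<And>\<theta>. (\<lambda>n. k n \<theta>) \<longlonglongrightarrow> 1"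
  shows "(\<lambda>n. \<integral>\<theta>. complex_of_real (k n \<theta>) * bump_fourier c \<theta> \<partial>lborel) \<longlonglongrightarrow> (\<integral>\<theta>. bump_fourier c \<theta> \<partial>lborel)"
    "norm (\<integral>\<theta>. complex_of_real (k n \<theta>) * bump_fourier c \<theta> \<partial>lborel) \<le> B * (4 * R * M * (\<integral>\<theta>. inverse (1 + \<theta>\<^sup>2) \<partial>lborel))"
proof -
  let ?w = "\<lambda>\<theta> :: real. B * (4 * R * M * inverse (1 + \<theta>\<^sup>2))"
  have w: "integrable lborel ?w" by (intro integrable_mult_right integrable_inverse_square)
  have B0: "0 \<le> B" by (rule order_trans[OF abs_ge_zero B[of 0 0]])
  have bd: "norm (complex_of_real (k n \<theta>) * bump_fourier c \<theta>) \<le> ?w \<theta>" for n \<theta>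
    unfolding norm_mult norm_of_real by (intro mult_mono B bump_fourier_decay B0 norm_ge_zero)
  show "(\<lambda>n. \<integral>\<theta>. complex_of_real (k n \<theta>) * bump_fourier c \<theta> \<partial>lborel) \<longlonglongrightarrow> (\<integral>\<theta>. bump_fourier c \<theta> \<partial>lborel)"
  proof (rule integral_dominated_convergence[OF _ _ w])
    have "(\<lambda>n. complex_of_real (k n \<theta>) * bump_fourier c \<theta>) \<longlonglongrightarrow> complex_of_real 1 * bump_fourier c \<theta>" for \<theta>
      by (intro tendsto_mult tendsto_of_real lim tendsto_const)
    then show "AE \<theta> in lborel. (\<lambda>n. complex_of_real (k n \<theta>) * bump_fourier c \<theta>) \<longlonglongrightarrow> bump_fourier c \<theta>" by simp
  qed (use bd in auto)
  have "norm (\<integral>\<theta>. complex_of_real (k n \<theta>) * bump_fourier c \<theta> \<partial>lborel) \<le> (\<integral>\<theta>. ?w \<theta> \<partial>lborel)"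
  proof (rule order_trans[OF integral_norm_bound integral_mono])
    show "integrable lborel (\<lambda>\<theta>. norm (complex_of_real (k n \<theta>) * bump_fourier c \<theta>))"
      by (intro integrable_norm Bochner_Integration.integrable_bound[OF w] AE_I2)
        (use order_trans[OF bd abs_ge_self] in auto)
  qed (use w bd in auto)
  then show "norm (\<integral>\<theta>. complex_of_real (k n \<theta>) * bump_fourier c \<theta> \<partial>lborel) \<le> B * (4 * R * M * (\<integral>\<theta>. inverse (1 + \<theta>\<^sup>2) \<partial>lborel))"
    by simp
qed

text \<open>Moves the regularization from the \<open>\<theta>\<close>-side to the
  \<open>t\<close>-side, where the Fourier transform of \<open>k\<close> becomes the integration
  kernel.\<close>

lemma fubini_kernel:
  fixes k :: "real \<Rightarrow> real"
  assumes k: "integrable lborel k"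
  shows "(\<integral>\<theta>. complex_of_real (k \<theta>) * bump_fourier c \<theta> \<partial>lborel) =
    (\<integral>t. G t * (\<integral>\<theta>. complex_of_real (k \<theta>) * exp (\<i> * complex_of_real (\<theta> * (t - c))) \<partial>lborel) \<partial>lborel)"
proof -
  let ?f = "\<lambda>\<theta> t. complex_of_real (k \<theta>) * (exp (\<i> * complex_of_real (\<theta> * (t - c))) * G t)"
  have [measurable]: "k \<in> borel_measurable borel" using borel_measurable_integrable[OF k] by simp
  have nG: "integrable lborel (\<lambda>t. norm (G t))"
    by (intro integrable_norm bounded_integrable[where S = "{-R..R}" and C = M]) (use MG z in \<open>auto simp: abs_if split: if_splits\<close>)
  have "integrable (lborel \<Otimes>\<^sub>M lborel) (case_prod ?f)"
  proof (rule lborel_pair.Fubini_integrable)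
    show "case_prod ?f \<in> borel_measurable (lborel \<Otimes>\<^sub>M lborel)" by measurable
    have "(\<lambda>\<theta>. \<integral>t. norm (case_prod ?f (\<theta>, t)) \<partial>lborel) = (\<lambda>\<theta>. \<bar>k \<theta>\<bar> * (\<integral>t. norm (G t) \<partial>lborel))"
      by (simp add: norm_mult norm_iexp)
    then show "integrable lborel (\<lambda>\<theta>. \<integral>t. norm (case_prod ?f (\<theta>, t)) \<partial>lborel)"
      using integrable_norm[OF k] by simp
    show "AE \<theta> in lborel. integrable lborel (\<lambda>t. case_prod ?f (\<theta>, t))"
      using int1(1) by (intro AE_I2) simp
  qed
  from lborel_pair.Fubini_integral[OF this]
  have A: "(\<integral>t. (\<integral>\<theta>. ?f \<theta> t \<partial>lborel) \<partial>lborel) = (\<integral>\<theta>. (\<integral>t. ?f \<theta> t \<partial>lborel) \<partial>lborel)" .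
  have B: "(\<integral>t. ?f \<theta> t \<partial>lborel) = complex_of_real (k \<theta>) * bump_fourier c \<theta>" for \<theta> by (simp add: bump_fourier_def)
  have C: "(\<integral>\<theta>. ?f \<theta> t \<partial>lborel) = G t * (\<integral>\<theta>. complex_of_real (k \<theta>) * exp (\<i> * complex_of_real (\<theta> * (t - c))) \<partial>lborel)" for t
  proof -
    have "(\<integral>\<theta>. ?f \<theta> t \<partial>lborel) = (\<integral>\<theta>. G t * (complex_of_real (k \<theta>) * exp (\<i> * complex_of_real (\<theta> * (t - c)))) \<partial>lborel)"
      by (simp add: mult.commute mult.left_commute)
    then show ?thesis by simp
  qed
  show ?thesis using A unfolding B C by (rule sym)
qed

lemma gauss_fourier: "(\<integral>y. complex_of_real (exp (- y\<^sup>2 / 2)) * exp (\<i> * complex_of_real (y * t)) \<partial>lborel) = complex_of_real (sqrt (2 * pi) * exp (- t\<^sup>2 / 2))"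
proof -
  \<comment> \<open>The Fourier transform of the Gaussian is, up to normalization, the
    characteristic function of the standard normal distribution.\<close>
  have "complex_of_real (exp (- (t^2) / 2)) = char std_normal_distribution t" by (simp add: char_std_normal_distribution)
  also have "\<dots> = (\<integral>y. iexp (t * y) \<partial>density lborel std_normal_density)" by (simp add: char_def)
  also have "\<dots> = (\<integral>y. std_normal_density y *\<^sub>R iexp (t * y) \<partial>lborel)"
    by (rule integral_density) auto
  also have "\<dots> = (\<integral>y. complex_of_real (1 / sqrt (2 * pi)) * (complex_of_real (exp (- y\<^sup>2 / 2)) * exp (\<i> * complex_of_real (y * t))) \<partial>lborel)"
    by (simp add: std_normal_density_def scaleR_conv_of_real mult.commute mult.left_commute)
  also have "\<dots> = complex_of_real (1 / sqrt (2 * pi)) * (\<integral>y. complex_of_real (exp (- y\<^sup>2 / 2)) * exp (\<i> * complex_of_real (y * t)) \<partial>lborel)"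
    by simp
  finally show ?thesis by (simp add: field_simps)
qed

lemma gauss_integrable: "integrable lborel (\<lambda>y :: real. exp (- y\<^sup>2 / 2))" and gauss_integral: "(\<integral>y. exp (- (y :: real)\<^sup>2 / 2) \<partial>lborel) = sqrt (2 * pi)"
proof -
  have e: "(\<lambda>y :: real. exp (- y\<^sup>2 / 2)) = (\<lambda>y. sqrt (2 * pi) * std_normal_density y)"
    by (auto simp: std_normal_density_def)
  have "integrable lborel (\<lambda>y. std_normal_density y)" using integrable_std_normal_moment[of 0] by simp
  moreover have "(\<integral>y. std_normal_density y \<partial>lborel) = 1" using integral_std_normal_moment_even[of 0] by simp
  ultimately show "integrable lborel (\<lambda>y :: real. exp (- y\<^sup>2 / 2))" "(\<integral>y. exp (- (y :: real)\<^sup>2 / 2) \<partial>lborel) = sqrt (2 * pi)"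
    unfolding e by simp_all
qed

text \<open>The \<open>\<theta>\<close>-integral is regularized by a Gaussian whose width tends to infinity.\<close>

lemma inversion: "(\<integral>\<theta>. bump_fourier c \<theta> \<partial>lborel) = complex_of_real (2 * pi) * G c"
proof (rule LIMSEQ_unique)
  define e where "e n = 1 / real (Suc n)" for n
  have e: "0 < e n" for n by (simp add: e_def)
  have e0: "e \<longlonglongrightarrow> 0" unfolding e_def[abs_def] using LIMSEQ_Suc[OF lim_1_over_n] by simp
  define k where "k n \<theta> = exp (- (e n * \<theta>)\<^sup>2 / 2)" for n \<theta>
  have [measurable]: "k n \<in> borel_measurable borel" for n unfolding k_def[abs_def] by measurable
  show "(\<lambda>n. \<integral>\<theta>. complex_of_real (k n \<theta>) * bump_fourier c \<theta> \<partial>lborel) \<longlonglongrightarrow> (\<integral>\<theta>. bump_fourier c \<theta> \<partial>lborel)"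
  proof (rule bump_fourier_dominated(1)[where B = 1])
    show "\<bar>k n \<theta>\<bar> \<le> 1" for n \<theta> by (simp add: k_def)
    have "(\<lambda>n. exp (- (e n * \<theta>)\<^sup>2 / 2)) \<longlonglongrightarrow> exp (- (0 * \<theta>)\<^sup>2 / 2)" for \<theta>
      by (intro tendsto_intros e0) auto
    then show "(\<lambda>n. k n \<theta>) \<longlonglongrightarrow> 1" for \<theta> by (simp add: k_def)
  qed measurable
  have K: "(\<integral>\<theta>. complex_of_real (k n \<theta>) * exp (\<i> * complex_of_real (\<theta> * \<tau>)) \<partial>lborel) = complex_of_real (sqrt (2 * pi) / e n * exp (- (\<tau> / e n)\<^sup>2 / 2))" for n \<tau>
  proof -
    let ?g = "\<lambda>y. complex_of_real (exp (- y\<^sup>2 / 2)) * exp (\<i> * complex_of_real (y * (\<tau> / e n)))"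
    have "(\<integral>y. ?g y \<partial>lborel) = \<bar>e n\<bar> *\<^sub>R (\<integral>\<theta>. ?g (0 + e n * \<theta>) \<partial>lborel)"
      by (rule lborel_integral_real_affine) (use e[of n] in simp)
    also have "(\<lambda>\<theta>. ?g (0 + e n * \<theta>)) = (\<lambda>\<theta>. complex_of_real (k n \<theta>) * exp (\<i> * complex_of_real (\<theta> * \<tau>)))"
      using e[of n] by (auto simp: k_def)
    finally show ?thesis using e[of n] unfolding gauss_fourier by (simp add: scaleR_conv_of_real field_simps)
  qed
  \<comment> \<open>The substitution \<open>t = c + e n * y\<close> concentrates \<open>G\<close> at
    \<open>c\<close> and leaves the Gaussian weight fixed, so dominated convergence applies in
    \<open>y\<close>.\<close>
  have I: "(\<integral>\<theta>. complex_of_real (k n \<theta>) * bump_fourier c \<theta> \<partial>lborel) = complex_of_real (sqrt (2 * pi)) * (\<integral>y. G (c + e n * y) * complex_of_real (exp (- y\<^sup>2 / 2)) \<partial>lborel)" for n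
  proof -
    have "integrable lborel (\<lambda>\<theta>. exp (- (0 + e n * \<theta>)\<^sup>2 / 2))"
      by (rule lborel_integrable_real_affine[OF gauss_integrable]) (use e[of n] in simp)
    then have ki: "integrable lborel (k n)" by (simp add: k_def[abs_def])
    let ?g = "\<lambda>t. G t * complex_of_real (sqrt (2 * pi) / e n * exp (- ((t - c) / e n)\<^sup>2 / 2))"
    have "(\<integral>\<theta>. complex_of_real (k n \<theta>) * bump_fourier c \<theta> \<partial>lborel) = (\<integral>t. ?g t \<partial>lborel)"
      unfolding fubini_kernel[OF ki] K ..
    also have "\<dots> = \<bar>e n\<bar> *\<^sub>R (\<integral>y. ?g (c + e n * y) \<partial>lborel)"
      by (rule lborel_integral_real_affine) (use e[of n] in simp)
    also have "(\<lambda>y. ?g (c + e n * y)) = (\<lambda>y. complex_of_real (sqrt (2 * pi) / e n) * (G (c + e n * y) * complex_of_real (exp (- y\<^sup>2 / 2))))"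
      using e[of n] by (auto simp: algebra_simps)
    finally show ?thesis using e[of n] by (simp add: scaleR_conv_of_real)
  qed
  have "(\<lambda>n. \<integral>y. G (c + e n * y) * complex_of_real (exp (- y\<^sup>2 / 2)) \<partial>lborel) \<longlonglongrightarrow> (\<integral>y. G c * complex_of_real (exp (- y\<^sup>2 / 2)) \<partial>lborel)"
  proof (rule integral_dominated_convergence)
    show "integrable lborel (\<lambda>y :: real. M * exp (- y\<^sup>2 / 2))" by (intro integrable_mult_right gauss_integrable)
    have "(\<lambda>n. G (c + e n * y)) \<longlonglongrightarrow> G (c + 0 * y)" for y
      by (rule isCont_tendsto_compose[of _ G]) (use cont in \<open>auto simp: continuous_on_eq_continuous_at intro!: tendsto_eq_intros e0\<close>)
    then show "AE y in lborel. (\<lambda>n. G (c + e n * y) * complex_of_real (exp (- y\<^sup>2 / 2))) \<longlonglongrightarrow> G c * complex_of_real (exp (- y\<^sup>2 / 2))"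
      by (intro AE_I2 tendsto_mult tendsto_const) simp
    show "AE y in lborel. norm (G (c + e n * y) * complex_of_real (exp (- y\<^sup>2 / 2))) \<le> M * exp (- y\<^sup>2 / 2)" for n
      using MG by (intro AE_I2) (simp add: norm_mult)
  qed measurable
  then have "(\<lambda>n. complex_of_real (sqrt (2 * pi)) * (\<integral>y. G (c + e n * y) * complex_of_real (exp (- y\<^sup>2 / 2)) \<partial>lborel)) \<longlonglongrightarrow>
     complex_of_real (sqrt (2 * pi)) * (\<integral>y. G c * complex_of_real (exp (- y\<^sup>2 / 2)) \<partial>lborel)"
    by (intro tendsto_mult tendsto_const)
  also have "(\<integral>y. G c * complex_of_real (exp (- y\<^sup>2 / 2)) \<partial>lborel) = G c * complex_of_real (sqrt (2 * pi))"
    using gauss_integral by (simp flip: of_real_exp)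
  also have "complex_of_real (sqrt (2 * pi)) * (G c * complex_of_real (sqrt (2 * pi))) = complex_of_real (2 * pi) * G c"
  proof -
    have "complex_of_real (sqrt (2 * pi)) * complex_of_real (sqrt (2 * pi)) = complex_of_real (2 * pi)"
      by (simp flip: of_real_mult)
    then show ?thesis by (metis mult.assoc mult.commute)
  qed
  finally show "(\<lambda>n. \<integral>\<theta>. complex_of_real (k n \<theta>) * bump_fourier c \<theta> \<partial>lborel) \<longlonglongrightarrow> complex_of_real (2 * pi) * G c"
    unfolding I .
qed

end

text \<open>The result of the \<open>\<theta>\<close>-integration in the truncated oscillatory
  integral. For a cutoff \<open>\<kappa>\<close> it approximates 2\<pi> times the delta function as
  \<open>\<epsilon>\<close> tends to 0.\<close>

definition cut_kernel :: "(real \<Rightarrow> real) \<Rightarrow> real \<Rightarrow> real \<Rightarrow> complex" where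
  "cut_kernel \<kappa> \<epsilon> \<tau> = (\<integral>\<theta>. complex_of_real (\<kappa> (\<epsilon> * \<bar>\<theta>\<bar>)) * exp (\<i> * complex_of_real (\<theta> * \<tau>)) \<partial>lborel)"

text \<open>The second claim, a bound independent of \<open>n\<close> and \<open>c\<close>, is what
  later dominates the outer integral over the angle and the point.\<close>

lemma (in C2_bump) cut_kernel_limit:
  fixes cut :: "real \<Rightarrow> real" and X :: "nat \<Rightarrow> real"
  assumes cut: "continuous_on UNIV cut" "\<And>t. \<bar>cut t\<bar> \<le> B" "\<delta> > 0" "\<And>t. \<bar>t\<bar> < \<delta> \<Longrightarrow> cut t = 1" "\<And>t. \<bar>t\<bar> > bb \<Longrightarrow> cut t = 0"
    and X: "\<And>n. 0 < X n" "X \<longlonglongrightarrow> 0"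
  shows "(\<lambda>n. \<integral>t. G t * cut_kernel cut (X n) (t - c) \<partial>lborel) \<longlonglongrightarrow> complex_of_real (2 * pi) * G c"
    "norm (\<integral>t. G t * cut_kernel cut (X n) (t - c) \<partial>lborel) \<le> B * (4 * R * M * (\<integral>\<theta>. inverse (1 + \<theta>\<^sup>2) \<partial>lborel))"
proof -
  define k where "k n \<theta> = cut (X n * \<bar>\<theta>\<bar>)" for n \<theta>
  have ck: "continuous_on UNIV (k n)" for n
    unfolding k_def[abs_def] by (intro continuous_on_compose2[OF cut(1)] continuous_intros) auto
  then have km: "k n \<in> borel_measurable borel" for n by (rule borel_measurable_continuous_onI)
  have ki: "integrable lborel (k n)" for n
  proof (rule bounded_integrable[OF km, where S = "{- (\<bar>bb\<bar> / X n)..\<bar>bb\<bar> / X n}"])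
    fix \<theta> assume "\<theta> \<notin> {- (\<bar>bb\<bar> / X n)..\<bar>bb\<bar> / X n}"
    then have "\<bar>bb\<bar> / X n < \<bar>\<theta>\<bar>" by auto
    then have "\<bar>bb\<bar> < X n * \<bar>\<theta>\<bar>" using X(1)[of n] by (simp add: field_simps)
    then have "bb < \<bar>X n * \<bar>\<theta>\<bar>\<bar>" using X(1)[of n] by (simp add: abs_mult)
    then show "k n \<theta> = 0" unfolding k_def by (rule cut(5))
  qed (use cut(2) in \<open>auto simp: k_def\<close>)
  have e: "(\<integral>t. G t * cut_kernel cut (X n) (t - c) \<partial>lborel) = (\<integral>\<theta>. complex_of_real (k n \<theta>) * bump_fourier c \<theta> \<partial>lborel)" for n
    using fubini_kernel[OF ki, of n c] by (simp only: cut_kernel_def k_def)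
  have lim: "(\<lambda>n. k n \<theta>) \<longlonglongrightarrow> 1" for \<theta>
  proof -
    have "(\<lambda>n. X n * \<bar>\<theta>\<bar>) \<longlonglongrightarrow> 0 * \<bar>\<theta>\<bar>" by (intro tendsto_intros X)
    then have "(\<lambda>n. cut (X n * \<bar>\<theta>\<bar>)) \<longlonglongrightarrow> cut (0 * \<bar>\<theta>\<bar>)"
      by (rule isCont_tendsto_compose[rotated]) (use cut(1) in \<open>auto simp: continuous_on_eq_continuous_at\<close>)
    then show ?thesis using cut(4)[of 0] cut(3) by (simp add: k_def)
  qed
  have kB: "\<bar>k n \<theta>\<bar> \<le> B" for n \<theta> by (simp add: k_def cut(2))
  show "(\<lambda>n. \<integral>t. G t * cut_kernel cut (X n) (t - c) \<partial>lborel) \<longlonglongrightarrow> complex_of_real (2 * pi) * G c"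
    unfolding e using bump_fourier_dominated(1)[OF km kB lim] unfolding inversion .
  show "norm (\<integral>t. G t * cut_kernel cut (X n) (t - c) \<partial>lborel) \<le> B * (4 * R * M * (\<integral>\<theta>. inverse (1 + \<theta>\<^sup>2) \<partial>lborel))"
    unfolding e by (rule bump_fourier_dominated(2)[OF km kB lim])
qed

text \<open>With one phase variable the product measure over \<open>{..<1}\<close> is the image of
  \<open>lborel\<close> under the passage from a number to an extensional function.\<close>

lemma integral_PiM_1:
  fixes F :: "'z::euclidean_space \<Rightarrow> (nat \<Rightarrow> real) \<Rightarrow> complex"
  assumes "(\<lambda>p. F (fst p) (\<lambda>i\<in>{..<1}. snd p)) \<in> borel_measurable borel" and "(\<lambda>(z, \<theta>). F z \<theta>) \<in> borel_measurable (lborel \<Otimes>\<^sub>M Pi\<^sub>M {..<1} (\<lambda>_. lborel))"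
  shows "(\<integral>(z, \<theta>). F z \<theta> \<partial>(lborel \<Otimes>\<^sub>M Pi\<^sub>M {..<1} (\<lambda>_. lborel))) = (\<integral>p. F (fst p) (\<lambda>i\<in>{..<1}. snd p) \<partial>lborel)"
proof -
  interpret product_sigma_finite "\<lambda>_::nat. lborel :: real measure" ..
  have i: "{..<1} = {0::nat}" by auto
  let ?r = "\<lambda>x::real. \<lambda>i\<in>{..<1::nat}. x"
  have D: "distr lborel (Pi\<^sub>M {..<1} (\<lambda>_. lborel)) ?r = Pi\<^sub>M {..<1} (\<lambda>_. lborel)"
    using distr_component[of 0] unfolding i .
  have rm: "?r \<in> measurable lborel (Pi\<^sub>M {..<1} (\<lambda>_. lborel))" by (intro measurable_restrict) auto
  interpret P: finite_product_sigma_finite "\<lambda>_::nat. lborel :: real measure" "{..<1}" by standard auto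
  have "(lborel :: 'z measure) \<Otimes>\<^sub>M Pi\<^sub>M {..<1::nat} (\<lambda>_. lborel :: real measure) = distr lborel lborel (\<lambda>x. x) \<Otimes>\<^sub>M distr lborel (Pi\<^sub>M {..<1} (\<lambda>_. lborel)) ?r"
    unfolding D by (simp add: distr_id2)
  also have "\<dots> = distr (lborel \<Otimes>\<^sub>M lborel) (lborel \<Otimes>\<^sub>M Pi\<^sub>M {..<1} (\<lambda>_. lborel)) (\<lambda>(x, y). (x, ?r y))"
  proof (rule pair_measure_distr[OF _ rm])
    show "sigma_finite_measure (distr lborel (Pi\<^sub>M {..<1} (\<lambda>_. lborel)) ?r)"
      unfolding D by (rule P.sigma_finite_measure_axioms)
  qed simp
  finally have E: "(lborel :: 'z measure) \<Otimes>\<^sub>M Pi\<^sub>M {..<1::nat} (\<lambda>_. lborel :: real measure) = distr (lborel \<Otimes>\<^sub>M lborel) (lborel \<Otimes>\<^sub>M Pi\<^sub>M {..<1} (\<lambda>_. lborel)) (\<lambda>(x, y). (x, ?r y))" .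
  have m: "(\<lambda>(x, y). (x, ?r y)) \<in> measurable (lborel \<Otimes>\<^sub>M lborel) ((lborel :: 'z measure) \<Otimes>\<^sub>M Pi\<^sub>M {..<1} (\<lambda>_. lborel))"
    using rm by measurable
  have "(\<integral>(z, \<theta>). F z \<theta> \<partial>(lborel \<Otimes>\<^sub>M Pi\<^sub>M {..<1} (\<lambda>_. lborel))) = (\<integral>p. (\<lambda>(z, \<theta>). F z \<theta>) ((\<lambda>(x, y). (x, ?r y)) p) \<partial>(lborel \<Otimes>\<^sub>M lborel))"
    by (subst (1) E) (rule integral_distr[OF m assms(2)])
  also have "\<dots> = (\<integral>p. F (fst p) (\<lambda>i\<in>{..<1}. snd p) \<partial>lborel)"
    unfolding lborel_prod by (simp add: split_beta)
  finally show ?thesis .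
qed

section \<open>Backprojection of test functions\<close>

lemma frechet_derivative_cong_open:
  assumes "open S" "x \<in> S" "\<And>y. y \<in> S \<Longrightarrow> f y = g y" "f differentiable at x"
  shows "frechet_derivative f (at x) = frechet_derivative g (at x)"
proof -
  have "(g has_derivative frechet_derivative f (at x)) (at x)"
    by (rule has_derivative_transform_within_open[OF assms(4)[unfolded frechet_derivative_works] assms(1,2)]) (use assms(3) in auto)
  then show ?thesis by (rule frechet_derivative_at)
qed

context elliptic_radon begin

abbreviation RD where "RD \<equiv> (UNIV :: real set) \<times> disc \<alpha>"
abbreviation VD where "VD \<equiv> (UNIV :: real set) \<times> {2 * a<..}"

lemma open_VD: "open VD" by (intro open_Times) auto

definition circle_integral :: "(real \<times> (real^2) \<Rightarrow> complex) \<Rightarrow> real^2 \<Rightarrow> complex" where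
  "circle_integral H x = integral {0..2*pi} (\<lambda>s. H (s, x))"

lemma slice_continuous: assumes "continuous_on RD H" "x \<in> disc \<alpha>" shows "continuous_on S (\<lambda>s. H (s, x))"
  by (rule continuous_on_compose2[OF assms(1)]) (use assms(2) in \<open>auto intro!: continuous_intros\<close>)

text \<open>Differentiation under the integral. \<open>leibniz_rule\<close> asks for the derivative
  in \<open>x\<close> as a jointly continuous family of bounded linear maps; continuity is checked
  on fixed directions.\<close>

lemma circle_integral_has_derivative:
  assumes H: "smooth_open RD H" and x: "x \<in> disc \<alpha>"
  shows "(circle_integral H has_derivative (\<lambda>v. circle_integral (\<lambda>p. frechet_derivative H (at p) (0, v)) x)) (at x)"
proof -
  let ?D = "\<lambda>p. frechet_derivative H (at p)"
  define fx where "fx x t = Blinfun (\<lambda>v. ?D (t, x) (0, v))" for x t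
  have hd: "((\<lambda>x. H (t, x)) has_derivative (\<lambda>v. ?D (t, x) (0, v))) (at x)" if "x \<in> disc \<alpha>" for x t
    by (rule has_derivative_compose[of "\<lambda>x. (t, x)" "\<lambda>v. (0, v)"])
      (use smooth_open_has_derivative[OF H, of "(t, x)"] that in \<open>auto intro!: derivative_eq_intros\<close>)
  have fx: "blinfun_apply (fx x t) = (\<lambda>v. ?D (t, x) (0, v))" if "x \<in> disc \<alpha>" for x t
    unfolding fx_def by (rule bounded_linear_Blinfun_apply[OF has_derivative_bounded_linear[OF hd[OF that]]])
  have cv: "continuous_on RD (\<lambda>p. ?D p w)" for w
    by (rule smooth_open_continuous_on[OF smooth_open_deriv[OF H]])
  have cfx: "continuous_on (disc \<alpha> \<times> cbox 0 (2 * pi)) (\<lambda>(x, t). fx x t)"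
  proof (rule continuous_on_blinfun_componentwise)
    fix i :: "real^2"
    have "continuous_on (disc \<alpha> \<times> cbox 0 (2 * pi)) (\<lambda>p. ?D (snd p, fst p) (0, i))"
      by (rule continuous_on_compose2[OF cv]) (auto intro!: continuous_intros)
    then show "continuous_on (disc \<alpha> \<times> cbox 0 (2 * pi)) (\<lambda>p. blinfun_apply (case p of (x, t) \<Rightarrow> fx x t) i)"
      by (rule continuous_on_cong[THEN iffD1, rotated -1]) (auto simp: fx)
  qed
  have "((\<lambda>x. integral (cbox 0 (2 * pi)) (\<lambda>t. H (t, x))) has_derivative integral (cbox 0 (2 * pi)) (fx x)) (at x within disc \<alpha>)"
  proof (rule leibniz_rule[OF _ _ cfx x])
    show "((\<lambda>x. H (t, x)) has_derivative blinfun_apply (fx y t)) (at y within disc \<alpha>)" if "y \<in> disc \<alpha>" for y t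
      unfolding fx[OF that] by (rule has_derivative_at_withinI[OF hd[OF that]])
    show "(\<lambda>t. H (t, y)) integrable_on cbox 0 (2 * pi)" if "y \<in> disc \<alpha>" for y
      by (intro integrable_continuous slice_continuous smooth_open_continuous_on[OF H] that)
    show "convex (disc \<alpha>)" by (simp add: disc_eq)
  qed
  then have "(circle_integral H has_derivative integral (cbox 0 (2 * pi)) (fx x)) (at x)"
    unfolding circle_integral_def[abs_def] using at_within_open[OF x open_disc] by (simp add: cbox_interval)
  moreover have "blinfun_apply (integral (cbox 0 (2 * pi)) (fx x)) v = circle_integral (\<lambda>p. ?D p (0, v)) x" for v
  proof -
    have "continuous_on (cbox 0 (2 * pi)) (\<lambda>t. (x, t))" by (intro continuous_intros)
    then have cx: "continuous_on (cbox 0 (2 * pi)) (fx x)"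
      using continuous_on_compose2[OF cfx, of "cbox 0 (2 * pi)" "\<lambda>t. (x, t)"] x
      by (simp add: image_subset_iff cbox_interval)
    have "integral (cbox 0 (2 * pi)) (\<lambda>t. blinfun_apply (fx x t) v) = blinfun_apply (integral (cbox 0 (2 * pi)) (fx x)) v"
      by (rule blinfun_apply_integral[OF integrable_continuous[OF cx], symmetric])
    then show ?thesis by (simp add: circle_integral_def fx[OF x] cbox_interval)
  qed
  ultimately show ?thesis by (elim has_derivative_eq_rhs) (simp add: fun_eq_iff)
qed

lemma smooth_BI: assumes "smooth_open RD H" shows "smooth_open (disc \<alpha>) (circle_integral H)"
proof -
  have "Ck_on k (disc \<alpha>) (circle_integral H)" for k
    using assms
  proof (induction k arbitrary: H)
    case 0
    then show ?case using circle_integral_has_derivative[OF 0]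
      by (auto intro!: continuous_at_imp_continuous_on has_derivative_continuous)
  next
    case (Suc k)
    show ?case
      by (rule Ck_on_SucI[OF open_disc circle_integral_has_derivative[OF Suc.prems] Suc.IH[OF smooth_open_deriv[OF Suc.prems]]])
  qed
  then show ?thesis by (simp add: smooth_open_def)
qed

lemma smooth_dir_derivs: "smooth_open S f \<Longrightarrow> smooth_open S (dir_derivs vs f)"
  by (induction vs) (auto intro: smooth_open_deriv)

lemma dir_derivs_BI:
  assumes "smooth_open RD H" "x \<in> disc \<alpha>"
  shows "dir_derivs vs (circle_integral H) x = circle_integral (dir_derivs (map (Pair 0) vs) H) x"
  using assms(2)
proof (induction vs arbitrary: x)
  case (Cons v vs)
  have s: "smooth_open RD (dir_derivs (map (Pair 0) vs) H)" by (rule smooth_dir_derivs[OF assms(1)])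
  have "frechet_derivative (circle_integral (dir_derivs (map (Pair 0) vs) H)) (at x) = frechet_derivative (dir_derivs vs (circle_integral H)) (at x)"
  proof (rule frechet_derivative_cong_open[OF open_disc Cons.prems])
    show "circle_integral (dir_derivs (map (Pair 0) vs) H) y = dir_derivs vs (circle_integral H) y" if "y \<in> disc \<alpha>" for y using Cons.IH[OF that] by simp
    show "circle_integral (dir_derivs (map (Pair 0) vs) H) differentiable at x" using circle_integral_has_derivative[OF s Cons.prems] by (rule differentiableI)
  qed
  then show ?case using frechet_derivative_at[OF circle_integral_has_derivative[OF s Cons.prems]] by (simp add: fun_eq_iff)
qed simp

definition Phi where "Phi p = (fst p, phi (circ (fst p)) (snd p))"

lemma phi_coord_smooth: "smooth_open RD (\<lambda>p. phi (circ (fst p)) (snd p))"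
  using smooth_open_snd[OF open_R_disc smooth_open_fst[OF open_R_disc Z_coord_smooth]] by (simp add: Z_coord_def)

lemma Phi_smooth: "smooth_open RD Phi"
  unfolding Phi_def by (intro smooth_open_Pair smooth_open_fst smooth_open_id phi_coord_smooth open_R_disc)

lemma Phi_VD: "p \<in> RD \<Longrightarrow> Phi p \<in> VD"
  using phi_gt[of "circ (fst p)" "snd p"] by (auto simp: Phi_def)

definition dphi where "dphi v p = frechet_derivative (\<lambda>p. phi (circ (fst p)) (snd p)) (at p) (0, v)"

lemma dphi_smooth: "smooth_open RD (dphi v)"
  unfolding dphi_def[abs_def] by (rule smooth_open_deriv[OF phi_coord_smooth])

definition L_derivs where "L_derivs j G = dir_derivs (replicate j (0 :: real, 1 :: real)) (G :: real \<times> real \<Rightarrow> complex)"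

lemma L_derivs_smooth: "smooth_open S G \<Longrightarrow> smooth_open S (L_derivs j G)"
  unfolding L_derivs_def by (rule smooth_dir_derivs)

text \<open>Sums of terms \<open>a (\<partial>\<^sub>L\<^sup>j G) \<circ> \<Phi>\<close> with \<open>j \<le> n\<close> and smooth coefficients \<open>a\<close> not depending on \<open>G\<close>.\<close>

inductive pullback_sum :: "nat \<Rightarrow> ((real \<times> real \<Rightarrow> complex) \<Rightarrow> real \<times> (real^2) \<Rightarrow> complex) \<Rightarrow> bool" where
  base: "smooth_open RD c \<Longrightarrow> j \<le> n \<Longrightarrow> pullback_sum n (\<lambda>G p. c p * L_derivs j G (Phi p))"
| add: "pullback_sum n S \<Longrightarrow> pullback_sum n T \<Longrightarrow> pullback_sum n (\<lambda>G p. S G p + T G p)"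

text \<open>An \<open>x\<close>-derivative keeps \<open>s\<close> fixed, so the chain rule through
  \<open>Phi\<close> produces only one further \<open>L\<close>-derivative of \<open>G\<close>, with
  the smooth factor \<open>dphi v\<close>. Sums of this shape are therefore stable, with the order
  raised by one.\<close>

lemma pullback_sum_deriv:
  assumes "pullback_sum n T"
  shows "\<exists>T'. pullback_sum (Suc n) T' \<and> (\<forall>G. smooth_open VD G \<longrightarrow> smooth_open RD (T G) \<and>
    (\<forall>p\<in>RD. frechet_derivative (T G) (at p) (0, v) = T' G p))"
  using assms
proof induction
  case (base c j n)
  let ?T' = "\<lambda>G p. (frechet_derivative c (at p) (0, v)) * L_derivs j G (Phi p) + (c p * complex_of_real (dphi v p)) * L_derivs (Suc j) G (Phi p)"
  have "pullback_sum (Suc n) ?T'"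
  proof (rule pullback_sum.add)
    show "pullback_sum (Suc n) (\<lambda>G p. frechet_derivative c (at p) (0, v) * L_derivs j G (Phi p))"
      by (rule pullback_sum.base[OF smooth_open_deriv[OF base(1)]]) (use base(2) in simp)
    show "pullback_sum (Suc n) (\<lambda>G p. c p * complex_of_real (dphi v p) * L_derivs (Suc j) G (Phi p))"
      by (rule pullback_sum.base) (use base in \<open>auto intro!: smooth_open_mult smooth_open_of_real dphi_smooth open_R_disc\<close>)
  qed
  moreover have "smooth_open RD (\<lambda>p. c p * L_derivs j G (Phi p)) \<and>
    (\<forall>p\<in>RD. frechet_derivative (\<lambda>p. c p * L_derivs j G (Phi p)) (at p) (0, v) = ?T' G p)" if G: "smooth_open VD G" for G
  proof
    have sG: "smooth_open RD (\<lambda>p. L_derivs j G (Phi p))"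
      by (rule smooth_open_compose[OF L_derivs_smooth[OF G] open_VD open_R_disc Phi_smooth Phi_VD])
    then show "smooth_open RD (\<lambda>p. c p * L_derivs j G (Phi p))" by (intro smooth_open_mult open_R_disc base(1))
    show "\<forall>p\<in>RD. frechet_derivative (\<lambda>p. c p * L_derivs j G (Phi p)) (at p) (0, v) = ?T' G p"
    proof
      fix p assume p: "p \<in> RD"
      have d1: "(c has_derivative frechet_derivative c (at p)) (at p)" by (rule smooth_open_has_derivative[OF base(1) p])
      have d2: "((\<lambda>p. phi (circ (fst p)) (snd p)) has_derivative frechet_derivative (\<lambda>p. phi (circ (fst p)) (snd p)) (at p)) (at p)"
        by (rule smooth_open_has_derivative[OF phi_coord_smooth p])
      have d3: "(Phi has_derivative (\<lambda>h. (fst h, frechet_derivative (\<lambda>p. phi (circ (fst p)) (snd p)) (at p) h))) (at p)"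
        unfolding Phi_def[abs_def] by (intro has_derivative_Pair has_derivative_fst has_derivative_ident d2)
      let ?g = "frechet_derivative (L_derivs j G) (at (Phi p))"
      have d4: "(L_derivs j G has_derivative ?g) (at (Phi p))"
        by (rule smooth_open_has_derivative[OF L_derivs_smooth[OF G] Phi_VD[OF p]])
      have d5: "((\<lambda>p. L_derivs j G (Phi p)) has_derivative (\<lambda>h. ?g (fst h, frechet_derivative (\<lambda>p. phi (circ (fst p)) (snd p)) (at p) h))) (at p)"
        by (rule has_derivative_compose[OF d3 d4])
      have "frechet_derivative (\<lambda>p. c p * L_derivs j G (Phi p)) (at p) (0, v) =
        c p * ?g (0, dphi v p) + frechet_derivative c (at p) (0, v) * L_derivs j G (Phi p)"
        using fun_cong[OF frechet_derivative_at[OF has_derivative_mult[OF d1 d5]], of "(0, v)"] by (simp add: dphi_def)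
      moreover have "?g (0, dphi v p) = complex_of_real (dphi v p) * L_derivs (Suc j) G (Phi p)"
      proof -
        interpret bounded_linear ?g using d4 by (rule has_derivative_bounded_linear)
        have "?g (0, dphi v p) = ?g (dphi v p *\<^sub>R (0, 1))" by simp
        also have "\<dots> = dphi v p *\<^sub>R ?g (0, 1)" by (rule scale)
        finally show ?thesis by (simp add: L_derivs_def scaleR_conv_of_real)
      qed
      ultimately show "frechet_derivative (\<lambda>p. c p * L_derivs j G (Phi p)) (at p) (0, v) = ?T' G p" by simp
    qed
  qed
  ultimately show ?case by (intro exI[of _ ?T']) simp
next
  case (add n S T)
  obtain S' where S': "pullback_sum (Suc n) S'" "\<And>G. smooth_open VD G \<Longrightarrow> smooth_open RD (S G)"
    "\<And>G p. smooth_open VD G \<Longrightarrow> p \<in> RD \<Longrightarrow> frechet_derivative (S G) (at p) (0, v) = S' G p" using add.IH(1) by auto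
  obtain T' where T': "pullback_sum (Suc n) T'" "\<And>G. smooth_open VD G \<Longrightarrow> smooth_open RD (T G)"
    "\<And>G p. smooth_open VD G \<Longrightarrow> p \<in> RD \<Longrightarrow> frechet_derivative (T G) (at p) (0, v) = T' G p" using add.IH(2) by auto
  have "frechet_derivative (\<lambda>p. S G p + T G p) (at p) (0, v) = S' G p + T' G p" if G: "smooth_open VD G" and p: "p \<in> RD" for G p
    using fun_cong[OF frechet_derivative_at[OF has_derivative_add[OF smooth_open_has_derivative[OF S'(2)[OF G] p] smooth_open_has_derivative[OF T'(2)[OF G] p]]], of "(0, v)"]
      S'(3)[OF G p] T'(3)[OF G p] by simp
  then show ?case using pullback_sum.add[OF S'(1) T'(1)] S'(2) T'(2)
    by (intro exI[of _ "\<lambda>G p. S' G p + T' G p"]) (simp add: smooth_open_add open_R_disc)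
qed

text \<open>The coefficients are independent of \<open>G\<close> and bounded on the compact set, so
  one constant serves for all \<open>G\<close>.\<close>

lemma pullback_sum_bound:
  assumes "pullback_sum n T" "compact K" "K \<subseteq> RD"
  shows "\<exists>C\<ge>0. \<forall>G m. 0 \<le> m \<longrightarrow> (\<forall>j\<le>n. \<forall>z\<in>VD. norm (L_derivs j G z) \<le> m) \<longrightarrow> (\<forall>p\<in>K. norm (T G p) \<le> C * m)"
  using assms(1)
proof induction
  case (base c j n)
  have "continuous_on K c" by (rule continuous_on_subset[OF smooth_open_continuous_on[OF base(1)] assms(3)])
  then have "bounded (c ` K)" by (intro compact_imp_bounded compact_continuous_image assms(2))
  then obtain C where C: "\<forall>x\<in>c ` K. norm x \<le> C" unfolding bounded_iff by (elim exE)
  have "norm (c p * L_derivs j G (Phi p)) \<le> max C 0 * m" if "0 \<le> m" "\<forall>j\<le>n. \<forall>z\<in>VD. norm (L_derivs j G z) \<le> m" "p \<in> K" for G m p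
  proof -
    have "p \<in> RD" by (rule subsetD[OF assms(3) that(3)])
    then have "Phi p \<in> VD" by (rule Phi_VD)
    then have "norm (L_derivs j G (Phi p)) \<le> m" by (rule bspec[OF mp[OF spec[OF that(2)] base(2)]])
    moreover have "norm (c p) \<le> max C 0" using C that(3) by (auto simp: le_max_iff_disj)
    ultimately show ?thesis unfolding norm_mult by (intro mult_mono) auto
  qed
  then show ?case by (intro exI[of _ "max C 0"] conjI allI impI ballI) simp_all
next
  case (add n S T)
  obtain C where C0: "0 \<le> C \<and> (\<forall>G m. 0 \<le> m \<longrightarrow> (\<forall>j\<le>n. \<forall>z\<in>VD. norm (L_derivs j G z) \<le> m) \<longrightarrow> (\<forall>p\<in>K. norm (S G p) \<le> C * m))"
    using add.IH(1) by (elim exE)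
  obtain C' where C0': "0 \<le> C' \<and> (\<forall>G m. 0 \<le> m \<longrightarrow> (\<forall>j\<le>n. \<forall>z\<in>VD. norm (L_derivs j G z) \<le> m) \<longrightarrow> (\<forall>p\<in>K. norm (T G p) \<le> C' * m))"
    using add.IH(2) by (elim exE)
  have C: "0 \<le> C" "\<And>G m p. 0 \<le> m \<Longrightarrow> (\<forall>j\<le>n. \<forall>z\<in>VD. norm (L_derivs j G z) \<le> m) \<Longrightarrow> p \<in> K \<Longrightarrow> norm (S G p) \<le> C * m"
    using C0 by simp_all
  have C': "0 \<le> C'" "\<And>G m p. 0 \<le> m \<Longrightarrow> (\<forall>j\<le>n. \<forall>z\<in>VD. norm (L_derivs j G z) \<le> m) \<Longrightarrow> p \<in> K \<Longrightarrow> norm (T G p) \<le> C' * m"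
    using C0' by simp_all
  have "norm (S G p + T G p) \<le> (C + C') * m" if "0 \<le> m" "\<forall>j\<le>n. \<forall>z\<in>VD. norm (L_derivs j G z) \<le> m" "p \<in> K" for G m p
    using norm_triangle_ineq[of "S G p" "T G p"] C(2)[OF that] C'(2)[OF that] by (simp add: algebra_simps)
  then show ?case by (intro exI[of _ "C + C'"] conjI allI impI ballI add_nonneg_nonneg[OF C(1) C'(1)])
qed

definition weighted_pullback where "weighted_pullback G p = complex_of_real (wt (fst p) (snd p)) * G (Phi p)"

lemma wt_smooth': "smooth_open RD (\<lambda>p. complex_of_real (wt (fst p) (snd p)))"
proof -
  have "smooth_open RD (\<lambda>p. wt (fst p) (snd p))" by (rule smooth_open_cong[OF open_R_disc _ wt_smooth]) auto
  then show ?thesis by (rule smooth_open_of_real[OF open_R_disc])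
qed

lemma weighted_pullback_smooth: assumes "smooth_open VD G" shows "smooth_open RD (weighted_pullback G)"
  unfolding weighted_pullback_def[abs_def]
  by (intro smooth_open_mult open_R_disc wt_smooth' smooth_open_compose[OF assms open_VD open_R_disc Phi_smooth Phi_VD])

lemma dir_derivs_adm:
  "\<exists>T. pullback_sum (length vs) T \<and> (\<forall>G. smooth_open VD G \<longrightarrow> (\<forall>p\<in>RD. dir_derivs (map (Pair 0) vs) (weighted_pullback G) p = T G p))"
proof (induction vs)
  case Nil
  have "pullback_sum 0 (\<lambda>G p. complex_of_real (wt (fst p) (snd p)) * L_derivs 0 G (Phi p))" by (rule pullback_sum.base[OF wt_smooth']) simp
  then show ?case by (intro exI) (auto simp: weighted_pullback_def L_derivs_def)
next
  case (Cons v vs)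
  obtain T where T: "pullback_sum (length vs) T" "\<And>G p. smooth_open VD G \<Longrightarrow> p \<in> RD \<Longrightarrow> dir_derivs (map (Pair 0) vs) (weighted_pullback G) p = T G p"
    using Cons.IH by auto
  obtain T' where T': "pullback_sum (Suc (length vs)) T'" "\<And>G. smooth_open VD G \<Longrightarrow> smooth_open RD (T G)"
    "\<And>G p. smooth_open VD G \<Longrightarrow> p \<in> RD \<Longrightarrow> frechet_derivative (T G) (at p) (0, v) = T' G p" using pullback_sum_deriv[OF T(1), of v] by auto
  have "dir_derivs (map (Pair 0) (v # vs)) (weighted_pullback G) p = T' G p" if G: "smooth_open VD G" and p: "p \<in> RD" for G p
  proof -
    have "frechet_derivative (T G) (at p) = frechet_derivative (dir_derivs (map (Pair 0) vs) (weighted_pullback G)) (at p)"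
    proof (rule frechet_derivative_cong_open[OF open_R_disc p])
      show "T G differentiable at p" by (rule differentiableI[OF smooth_open_has_derivative[OF T'(2)[OF G] p]])
    qed (use T(2)[OF G] in simp)
    then show ?thesis using T'(3)[OF G p] by simp
  qed
  then show ?case using T'(1) by (intro exI[of _ T']) simp
qed

lemma backprojection_BI:
  assumes "smooth_open VD (g \<circ> Y_coord)" "x \<in> disc \<alpha>"
  shows "backprojection \<alpha> wt g x = circle_integral (weighted_pullback (g \<circ> Y_coord)) x" "set_integrable lborel {0..2*pi} (\<lambda>s. wt s x *\<^sub>R g (Y_coord (s, focal_sum \<alpha> s x)))"
proof -
  have e: "(\<lambda>s. wt s x *\<^sub>R g (Y_coord (s, focal_sum \<alpha> s x))) = (\<lambda>s. weighted_pullback (g \<circ> Y_coord) (s, x))"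
    by (auto simp: weighted_pullback_def Phi_def focal_sum_eq scaleR_conv_of_real)
  show s: "set_integrable lborel {0..2*pi} (\<lambda>s. wt s x *\<^sub>R g (Y_coord (s, focal_sum \<alpha> s x)))"
    unfolding e by (intro borel_integrable_atLeastAtMost' slice_continuous smooth_open_continuous_on weighted_pullback_smooth assms)
  show "backprojection \<alpha> wt g x = circle_integral (weighted_pullback (g \<circ> Y_coord)) x"
    unfolding backprojection_def circle_integral_def using set_borel_integral_eq_integral(2)[OF s] unfolding e .
qed

lemma backprojection_outside: "x \<notin> disc \<alpha> \<Longrightarrow> backprojection \<alpha> wt g x = 0"
  by (simp add: backprojection_def wt_def)

lemma backprojection_smooth:
  assumes "smooth_open VD (g \<circ> Y_coord)" shows "smooth_open (disc \<alpha>) (backprojection \<alpha> wt g)"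
  by (rule smooth_open_cong[OF open_disc _ smooth_BI[OF weighted_pullback_smooth[OF assms]]]) (simp add: backprojection_BI[OF assms])

lemma backprojection_linear:
  assumes f: "smooth_open VD (f \<circ> Y_coord)" and g: "smooth_open VD (g \<circ> Y_coord)"
  shows "backprojection \<alpha> wt (\<lambda>p. c * f p + d * g p) = (\<lambda>x. c * backprojection \<alpha> wt f x + d * backprojection \<alpha> wt g x)"
proof
  fix x show "backprojection \<alpha> wt (\<lambda>p. c * f p + d * g p) x = c * backprojection \<alpha> wt f x + d * backprojection \<alpha> wt g x"
  proof (cases "x \<in> disc \<alpha>")
    case True
    have "(\<lambda>s. wt s x *\<^sub>R (c * f (Y_coord (s, focal_sum \<alpha> s x)) + d * g (Y_coord (s, focal_sum \<alpha> s x)))) =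
      (\<lambda>s. c * (wt s x *\<^sub>R f (Y_coord (s, focal_sum \<alpha> s x))) + d * (wt s x *\<^sub>R g (Y_coord (s, focal_sum \<alpha> s x))))"
      by (auto simp: scaleR_right_distrib)
    moreover have i: "set_integrable lborel {0..2*pi} (\<lambda>s. c * (wt s x *\<^sub>R f (Y_coord (s, focal_sum \<alpha> s x))))"
      "set_integrable lborel {0..2*pi} (\<lambda>s. d * (wt s x *\<^sub>R g (Y_coord (s, focal_sum \<alpha> s x))))"
      by (rule set_integrable_mult_right, rule backprojection_BI(2)[OF f True], rule set_integrable_mult_right, rule backprojection_BI(2)[OF g True])
    ultimately show ?thesis
      unfolding backprojection_def by (simp only: set_integral_add(2)[OF i] set_integral_mult_right)
  qed (simp add: backprojection_outside)
qed

lemma test_smooth: "g \<in> test_functions Y_coord (coord_domain \<alpha>) \<Longrightarrow> smooth_open VD (g \<circ> Y_coord)"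
  by (simp add: test_functions_def coord_domain_eq)

text \<open>The continuity estimate of the backprojection, with a constant independent of
  \<open>g\<close>; integration over the circle contributes the factor 2\<pi>.\<close>

lemma backprojection_derivs_bound:
  assumes "compact K" "K \<subseteq> disc \<alpha>"
  shows "\<exists>C\<ge>0. \<forall>g m. smooth_open VD (g \<circ> Y_coord) \<longrightarrow> 0 \<le> m \<longrightarrow>
     (\<forall>j\<le>length vs. \<forall>z\<in>VD. norm (L_derivs j (g \<circ> Y_coord) z) \<le> m) \<longrightarrow>
     (\<forall>x\<in>K. norm (dir_derivs vs (backprojection \<alpha> wt g) x) \<le> C * m)"
proof -
  obtain T where T: "pullback_sum (length vs) T" "\<And>G p. smooth_open VD G \<Longrightarrow> p \<in> RD \<Longrightarrow> dir_derivs (map (Pair 0) vs) (weighted_pullback G) p = T G p"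
    using dir_derivs_adm[of vs] by auto
  have cK: "compact ({0..2*pi} \<times> K)" "{0..2*pi} \<times> K \<subseteq> RD" using assms by (auto intro: compact_Times)
  obtain C where C0: "0 \<le> C \<and> (\<forall>G m. 0 \<le> m \<longrightarrow> (\<forall>j\<le>length vs. \<forall>z\<in>VD. norm (L_derivs j G z) \<le> m) \<longrightarrow> (\<forall>p\<in>{0..2*pi} \<times> K. norm (T G p) \<le> C * m))"
    using pullback_sum_bound[OF T(1) cK] by (elim exE)
  have C: "0 \<le> C" by (rule conjunct1[OF C0])
  have C2: "norm (T G p) \<le> C * m" if "0 \<le> m" "\<forall>j\<le>length vs. \<forall>z\<in>VD. norm (L_derivs j G z) \<le> m" "p \<in> {0..2*pi} \<times> K" for G m p
    by (rule bspec[OF mp[OF mp[OF spec[OF spec[OF conjunct2[OF C0]]] that(1)] that(2)] that(3)])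
  have "norm (dir_derivs vs (backprojection \<alpha> wt g) x) \<le> (C * (2 * pi)) * m"
    if g: "smooth_open VD (g \<circ> Y_coord)" and m: "0 \<le> m" "\<forall>j\<le>length vs. \<forall>z\<in>VD. norm (L_derivs j (g \<circ> Y_coord) z) \<le> m" and x: "x \<in> K" for g m x
  proof -
    let ?G = "g \<circ> Y_coord"
    have xd: "x \<in> disc \<alpha>" using x assms(2) by auto
    have H: "smooth_open RD (weighted_pullback ?G)" by (rule weighted_pullback_smooth[OF g])
    \<comment> \<open>The two functions are compared on the open disc only, so equality of their
      iterated derivatives is carried along by induction on the list of directions.\<close>
    have loc: "dir_derivs ws (backprojection \<alpha> wt g) y = dir_derivs ws (circle_integral (weighted_pullback ?G)) y" if "y \<in> disc \<alpha>" for ws y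
      using that
    proof (induction ws arbitrary: y)
      case Nil then show ?case using backprojection_BI(1)[OF g Nil] by (simp only: dir_derivs.simps)
    next
      case (Cons w ws)
      have "frechet_derivative (dir_derivs ws (circle_integral (weighted_pullback ?G))) (at y) = frechet_derivative (dir_derivs ws (backprojection \<alpha> wt g)) (at y)"
      proof (rule frechet_derivative_cong_open[OF open_disc Cons.prems])
        show "dir_derivs ws (circle_integral (weighted_pullback ?G)) differentiable at y"
          by (rule differentiableI[OF smooth_open_has_derivative[OF smooth_dir_derivs[OF smooth_BI[OF H]] Cons.prems]])
      qed (rule Cons.IH[symmetric])
      then show ?case by (simp only: dir_derivs.simps)
    qed
    have "norm (integral (cbox 0 (2 * pi)) (\<lambda>s. dir_derivs (map (Pair 0) vs) (weighted_pullback ?G) (s, x))) \<le> (C * m) * measure lborel (cbox 0 (2 * pi))"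
    proof (rule has_integral_bound[OF _ integrable_integral])
      show "0 \<le> C * m" using C m by simp
      show "(\<lambda>s. dir_derivs (map (Pair 0) vs) (weighted_pullback ?G) (s, x)) integrable_on cbox 0 (2 * pi)"
        by (intro integrable_continuous slice_continuous smooth_open_continuous_on smooth_dir_derivs H xd)
      show "norm (dir_derivs (map (Pair 0) vs) (weighted_pullback ?G) (s, x)) \<le> C * m" if "s \<in> cbox 0 (2 * pi)" for s
        using T(2)[OF g, of "(s, x)"] C2[OF m, of "(s, x)"] that x xd by (simp add: cbox_interval)
    qed
    then show ?thesis
      unfolding loc[OF xd] dir_derivs_BI[OF H xd] circle_integral_def by (simp add: cbox_interval mult_ac)
  qed
  then show ?thesis using C by (intro exI[of _ "C * (2 * pi)"] conjI allI impI ballI) simp_all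
qed

text \<open>By duality the estimate for \<open>u\<close> applies to the backprojected test function,
  whose derivatives on \<open>K\<close> are controlled by finitely many \<open>L\<close>-derivatives
  of \<open>g\<close>.\<close>

lemma radon_dist_distribution:
  assumes u: "u \<in> compact_distributions (disc \<alpha>)"
  shows "radon_dist \<alpha> wt u \<in> distributions Y_coord (coord_domain \<alpha>)"
proof -
  have lin: "linear_functional {f. smooth_open (disc \<alpha>) f} u" using u by (simp add: compact_distributions_def)
  obtain K k C where K: "compact K" "K \<subseteq> disc \<alpha>" and C: "\<And>f m. smooth_open (disc \<alpha>) f \<Longrightarrow>
      (\<forall>vs. set vs \<subseteq> Basis \<and> length vs \<le> k \<longrightarrow> (\<forall>x\<in>K. norm (dir_derivs vs f x) \<le> m)) \<Longrightarrow> norm (u f) \<le> C * m"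
  proof -
    have "\<exists>K k C. compact K \<and> K \<subseteq> disc \<alpha> \<and> (\<forall>f. smooth_open (disc \<alpha>) f \<longrightarrow>
        (\<forall>b. (\<forall>vs. set vs \<subseteq> Basis \<and> length vs \<le> k \<longrightarrow> (\<forall>x\<in>K. norm (dir_derivs vs f x) \<le> b)) \<longrightarrow> norm (u f) \<le> C * b))"
      using u unfolding compact_distributions_def by simp
    then obtain K k C where *: "compact K" "K \<subseteq> disc \<alpha>" "\<forall>f. smooth_open (disc \<alpha>) f \<longrightarrow>
        (\<forall>b. (\<forall>vs. set vs \<subseteq> Basis \<and> length vs \<le> k \<longrightarrow> (\<forall>x\<in>K. norm (dir_derivs vs f x) \<le> b)) \<longrightarrow> norm (u f) \<le> C * b)"
      by (elim exE conjE)
    show thesis by (rule that[OF *(1,2) mp[OF spec[OF mp[OF spec[OF *(3)]]]]])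
  qed
  let ?VS = "{vs :: (real^2) list. set vs \<subseteq> Basis \<and> length vs \<le> k}"
  have fin: "finite ?VS" by (rule finite_lists_length_le) simp
  \<comment> \<open>One constant for each of the finitely many lists of directions of length at most
    \<open>k\<close>; their sum \<open>M\<close> serves for all of them.\<close>
  define cc where "cc vs = (SOME c. 0 \<le> c \<and> (\<forall>g m. smooth_open VD (g \<circ> Y_coord) \<longrightarrow> 0 \<le> m \<longrightarrow>
     (\<forall>j\<le>length vs. \<forall>z\<in>VD. norm (L_derivs j (g \<circ> Y_coord) z) \<le> m) \<longrightarrow>
     (\<forall>x\<in>K. norm (dir_derivs vs (backprojection \<alpha> wt g) x) \<le> c * m)))" for vs
  have cc: "0 \<le> cc vs \<and> (\<forall>g m. smooth_open VD (g \<circ> Y_coord) \<longrightarrow> 0 \<le> m \<longrightarrow>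
     (\<forall>j\<le>length vs. \<forall>z\<in>VD. norm (L_derivs j (g \<circ> Y_coord) z) \<le> m) \<longrightarrow>
     (\<forall>x\<in>K. norm (dir_derivs vs (backprojection \<alpha> wt g) x) \<le> cc vs * m))" for vs
    unfolding cc_def by (rule someI_ex[OF backprojection_derivs_bound[OF K]])
  define M where "M = (\<Sum>vs\<in>?VS. cc vs)"
  have M: "cc vs \<le> M" if "vs \<in> ?VS" for vs
    unfolding M_def by (rule member_le_sum[OF that _ fin]) (use cc in auto)
  have bound: "norm (radon_dist \<alpha> wt u g) \<le> (C * M) * m"
    if g: "g \<in> test_functions Y_coord (coord_domain \<alpha>)" and
      m: "\<forall>vs. set vs \<subseteq> Basis \<and> length vs \<le> k \<longrightarrow> (\<forall>z\<in>coord_domain \<alpha>. norm (dir_derivs vs (g \<circ> Y_coord) z) \<le> m)" for g m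
  proof -
    have sg: "smooth_open VD (g \<circ> Y_coord)" by (rule test_smooth[OF g])
    have m': "norm (dir_derivs vs (g \<circ> Y_coord) z) \<le> m" if "set vs \<subseteq> Basis" "length vs \<le> k" "z \<in> VD" for vs z
      by (rule bspec[OF mp[OF spec[OF m]]]) (use that in \<open>simp_all add: coord_domain_eq\<close>)
    \<comment> \<open>Any point of the domain will do: it shows that the bound \<open>m\<close> is
      nonnegative.\<close>
    have "(0, 2 * a + 1) \<in> VD" by simp
    from order_trans[OF norm_ge_zero m'[of "[]", OF _ _ this]] have m0: "0 \<le> m" by simp
    have "\<forall>vs. set vs \<subseteq> Basis \<and> length vs \<le> k \<longrightarrow> (\<forall>x\<in>K. norm (dir_derivs (vs :: (real^2) list) (backprojection \<alpha> wt g) x) \<le> M * m)"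
    proof (intro allI impI ballI)
      fix vs :: "(real^2) list" and x assume vs: "set vs \<subseteq> Basis \<and> length vs \<le> k" and x: "x \<in> K"
      have "norm (L_derivs j (g \<circ> Y_coord) z) \<le> m" if "j \<le> length vs" "z \<in> VD" for j z
        unfolding L_derivs_def using that vs by (intro m') (auto simp: Basis_prod_def)
      then have "norm (dir_derivs vs (backprojection \<alpha> wt g) x) \<le> cc vs * m" using cc[of vs] sg m0 x by simp
      also have "\<dots> \<le> M * m" using M[of vs] vs m0 by (intro mult_right_mono) auto
      finally show "norm (dir_derivs vs (backprojection \<alpha> wt g) x) \<le> M * m" .
    qed
    from C[OF backprojection_smooth[OF sg] this] show ?thesis by (simp add: radon_dist_def mult.assoc)
  qed
  have "linear_functional (test_functions Y_coord (coord_domain \<alpha>)) (radon_dist \<alpha> wt u)"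
    unfolding linear_functional_def radon_dist_def
  proof (intro ballI allI)
    fix f g c d assume "f \<in> test_functions Y_coord (coord_domain \<alpha>)" "g \<in> test_functions Y_coord (coord_domain \<alpha>)"
    then have s: "smooth_open VD (f \<circ> Y_coord)" "smooth_open VD (g \<circ> Y_coord)" using test_smooth by auto
    show "u (backprojection \<alpha> wt (\<lambda>p. c * f p + d * g p)) = c * u (backprojection \<alpha> wt f) + d * u (backprojection \<alpha> wt g)"
      unfolding backprojection_linear[OF s] using lin backprojection_smooth[OF s(1)] backprojection_smooth[OF s(2)]
      unfolding linear_functional_def by blast
  qed
  then show ?thesis unfolding distributions_def using bound by blast
qed

end

section \<open>Phase functions and the Fourier integral representation\<close>

text \<open>The simplifier should leave the index set \<open>{..<1}\<close> of a single phase variable alone.\<close>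

declare One_nat_def [simp del]

lemma lessThan_1_eq [simp]: "{..<1::nat} = {0}" by auto

text \<open>Phase and amplitude both have the form of a power of the phase variable times a function
  of the base variable, with exponents 1 and 0. This form is stable under all partial
  derivatives.\<close>

lemma along_power_has_derivative:
  fixes h :: "'z::euclidean_space \<Rightarrow> 'c::real_normed_vector"
  assumes U: "open U" and h: "smooth_open U h" and F: "\<forall>z\<in>U. \<forall>\<theta>. F z \<theta> = (\<theta> 0) ^ k *\<^sub>R h z" and z: "z \<in> U"
  shows "(along (Inl v) F z \<theta> has_vector_derivative (\<theta> 0) ^ k *\<^sub>R frechet_derivative h (at z) v) (at 0)"
    "(along (Inr 0) F z \<theta> has_vector_derivative (\<theta> 0) ^ (k - 1) *\<^sub>R (real k *\<^sub>R h z)) (at 0)"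
proof -
  let ?f = "\<lambda>t. (\<theta> 0) ^ k *\<^sub>R h (z + t *\<^sub>R v)"
  interpret bounded_linear "frechet_derivative h (at z)"
    by (rule has_derivative_bounded_linear[OF smooth_open_has_derivative[OF h z]])
  have "((\<lambda>t. h (z + t *\<^sub>R v)) has_derivative (\<lambda>t. frechet_derivative h (at z) (t *\<^sub>R v))) (at (0::real))"
    by (rule has_derivative_compose[of "\<lambda>t. z + t *\<^sub>R v" "\<lambda>t. t *\<^sub>R v" 0 UNIV h])
      (use smooth_open_has_derivative[OF h z] in \<open>auto intro!: derivative_eq_intros\<close>)
  then have "((\<lambda>t. h (z + t *\<^sub>R v)) has_vector_derivative frechet_derivative h (at z) v) (at (0::real))"
    unfolding has_vector_derivative_def scale .
  then have d: "(?f has_vector_derivative (\<theta> 0) ^ k *\<^sub>R frechet_derivative h (at z) v) (at 0)"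
    by (rule bounded_linear.has_vector_derivative[OF bounded_linear_scaleR_right])
  have o: "open ((\<lambda>t::real. z + t *\<^sub>R v) -` U)"
    by (rule open_vimage[OF U]) (intro continuous_intros)
  show "(along (Inl v) F z \<theta> has_vector_derivative (\<theta> 0) ^ k *\<^sub>R frechet_derivative h (at z) v) (at 0)"
    by (rule has_vector_derivative_transform_within_open[OF d o]) (use z F in \<open>auto simp: along_def\<close>)
  have "((\<lambda>t. (\<theta> 0 + t) ^ k) has_real_derivative real k * (\<theta> 0) ^ (k - 1)) (at 0)"
    by (auto intro!: derivative_eq_intros simp: One_nat_def)
  from has_vector_derivative_scaleR[OF this has_vector_derivative_const[of "h z"]]
  show "(along (Inr 0) F z \<theta> has_vector_derivative (\<theta> 0) ^ (k - 1) *\<^sub>R (real k *\<^sub>R h z)) (at 0)"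
    using F z by (simp add: along_def mult.commute)
qed

text \<open>The last clause records that with exponent 0 a single phase derivative annihilates the
  function, which yields the symbol estimates of order 0.\<close>

lemma pderivs_power:
  fixes h :: "'z::euclidean_space \<Rightarrow> 'c::real_normed_vector"
  assumes U: "open U" and h: "smooth_open U h" and ds: "set ds \<subseteq> directions 1"
  shows "\<exists>h' k'. smooth_open U h' \<and> (\<forall>z\<in>U. \<forall>\<theta>. pderivs ds (\<lambda>z \<theta>. (\<theta> 0) ^ k *\<^sub>R h z) z \<theta> = (\<theta> 0) ^ k' *\<^sub>R h' z) \<and> k' \<le> k \<and>
    (k = 0 \<and> \<not> (\<forall>d\<in>set ds. isl d) \<longrightarrow> (\<forall>z\<in>U. h' z = 0))"
  using ds
proof (induction ds)
  case Nil
  show ?case using h by (intro exI[of _ h] exI[of _ k]) (simp add: pderivs_def)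
next
  case (Cons d ds)
  let ?F = "\<lambda>z \<theta>. (\<theta> (0::nat)) ^ k *\<^sub>R h z"
  have "set ds \<subseteq> directions 1" using Cons.prems by simp
  from Cons.IH[OF this] obtain h' k' where h': "smooth_open U h'" "\<forall>z\<in>U. \<forall>\<theta>. pderivs ds ?F z \<theta> = (\<theta> 0) ^ k' *\<^sub>R h' z" "k' \<le> k"
    "k = 0 \<and> \<not> (\<forall>d\<in>set ds. isl d) \<longrightarrow> (\<forall>z\<in>U. h' z = 0)" by (elim exE conjE)
  note D = along_power_has_derivative[OF U h'(1,2)]
  have c: "pderivs (d # ds) ?F z \<theta> = vector_derivative (along d (pderivs ds ?F) z \<theta>) (at 0)" for z \<theta>
    by (simp add: pderivs_def pderiv_dir_def)
  show ?case
  proof (cases d)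
    case (Inl v)
    have "frechet_derivative h' (at z) v = 0" if "k = 0" "\<not> (\<forall>d\<in>set ds. isl d)" "z \<in> U" for z
    proof -
      have "h' y = 0" if "y \<in> U" for y using h'(4) \<open>k = 0\<close> \<open>\<not> _\<close> that by simp
      from frechet_derivative_cong_open[OF U \<open>z \<in> U\<close> this differentiableI[OF smooth_open_has_derivative[OF h'(1) \<open>z \<in> U\<close>]]]
      show ?thesis by (simp add: frechet_derivative_const)
    qed
    then show ?thesis using D(1) h'(3) smooth_open_deriv[OF h'(1)]
      by (intro exI[of _ "\<lambda>z. frechet_derivative h' (at z) v"] exI[of _ k']) (simp add: Inl c[unfolded Inl] vector_derivative_at)
  next
    case (Inr j)
    then have d: "d = Inr 0" using Cons.prems by (auto simp: directions_def)
    \<comment> \<open>For \<open>k' = 0\<close> the truncated exponent \<open>k' - 1\<close> does no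
      harm, since the coefficient \<open>real k'\<close> vanishes.\<close>
    show ?thesis using D(2) h'(3) smooth_open_scaleR[OF U smooth_open_const h'(1), of "real k'"]
      by (intro exI[of _ "\<lambda>z. real k' *\<^sub>R h' z"] exI[of _ "k' - 1"]) (auto simp: d c[unfolded d] vector_derivative_at)
  qed
qed

lemma continuous_on_phase: "continuous_on S (\<lambda>p :: 'z::topological_space \<times> (nat \<Rightarrow> real). snd p i)"
  by (rule continuous_on_compose2[OF continuous_on_product_coordinates continuous_on_snd[OF continuous_on_id]]) simp

lemma smooth_phase_power:
  fixes h :: "'z::euclidean_space \<Rightarrow> 'c::real_normed_vector"
  assumes U: "open U" and h: "smooth_open U h" and G: "G \<subseteq> U \<times> UNIV"
  shows "smooth_phase_on 1 G (\<lambda>z \<theta>. (\<theta> 0) ^ k *\<^sub>R h z)"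
  unfolding smooth_phase_on_def
proof (intro allI impI)
  fix ds :: "('z + nat) list" assume ds: "set ds \<subseteq> directions 1"
  let ?F = "\<lambda>z \<theta>. (\<theta> (0::nat)) ^ k *\<^sub>R h z"
  obtain h' k' where h': "smooth_open U h'" "\<forall>z\<in>U. \<forall>\<theta>. pderivs ds ?F z \<theta> = (\<theta> 0) ^ k' *\<^sub>R h' z"
    using pderivs_power[OF U h ds, of k] by (elim exE conjE)
  note D = along_power_has_derivative[OF U h'(1,2)]
  have "continuous_on G (\<lambda>p. (snd p 0) ^ k' *\<^sub>R h' (fst p))"
    by (intro continuous_on_scaleR continuous_on_power continuous_on_phase
        continuous_on_compose2[OF smooth_open_continuous_on[OF h'(1)] continuous_on_fst[OF continuous_on_id]]) (use G in auto)
  then have "continuous_on G (\<lambda>(z, \<theta>). pderivs ds ?F z \<theta>)"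
    by (rule continuous_on_eq) (use G h'(2) in auto)
  moreover have "along d (pderivs ds ?F) z \<theta> differentiable (at 0)" if "d \<in> directions 1" "(z, \<theta>) \<in> G" for d z \<theta>
  proof -
    have z: "z \<in> U" using that(2) G by auto
    have "\<exists>D. (along d (pderivs ds ?F) z \<theta> has_vector_derivative D) (at 0)"
      using that(1) D[OF z] by (auto simp: directions_def)
    then show ?thesis by (auto simp: has_vector_derivative_def differentiable_def)
  qed
  ultimately show "continuous_on G (\<lambda>(z, \<theta>). pderivs ds ?F z \<theta>) \<and>
     (\<forall>d\<in>directions 1. \<forall>(z, \<theta>)\<in>G. along d (pderivs ds ?F) z \<theta> differentiable (at 0))" by auto
qed

text \<open>Phase derivatives vanish, and base derivatives are independent of the phase variable and
  bounded on compact sets.\<close>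

lemma symbol_class_0:
  fixes h :: "'z::euclidean_space \<Rightarrow> complex"
  assumes U: "open U" and h: "smooth_open U h"
  shows "symbol_class U 1 0 (\<lambda>z \<theta>. h z)"
proof -
  have e: "(\<lambda>z \<theta>. h z) = (\<lambda>z \<theta>. (\<theta> (0::nat)) ^ 0 *\<^sub>R h z)" by simp
  show ?thesis
    unfolding symbol_class_def e
  proof (intro conjI allI impI)
    show "smooth_phase_on 1 (U \<times> phase_space 1) (\<lambda>z \<theta>. (\<theta> 0) ^ 0 *\<^sub>R h z)"
      by (rule smooth_phase_power[OF U h]) auto
    fix KK :: "'z set" and ds :: "('z + nat) list" assume K: "compact KK \<and> KK \<subseteq> U \<and> set ds \<subseteq> directions 1"
    let ?F = "\<lambda>z \<theta>. (\<theta> (0::nat)) ^ 0 *\<^sub>R h z"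
    have ds: "set ds \<subseteq> directions 1" using K by simp
    obtain h' k' where h': "smooth_open U h'" "\<forall>z\<in>U. \<forall>\<theta>. pderivs ds ?F z \<theta> = (\<theta> 0) ^ k' *\<^sub>R h' z" "k' \<le> 0"
      "(0::nat) = 0 \<and> \<not> (\<forall>d\<in>set ds. isl d) \<longrightarrow> (\<forall>z\<in>U. h' z = 0)"
      using pderivs_power[OF U h ds, of 0] by (elim exE conjE)
    have "continuous_on KK h'" by (rule continuous_on_subset[OF smooth_open_continuous_on[OF h'(1)]]) (use K in simp)
    then have "bounded (h' ` KK)" using K by (intro compact_imp_bounded compact_continuous_image) auto
    then obtain C where C: "\<forall>x\<in>h' ` KK. norm x \<le> C" unfolding bounded_iff by (elim exE)
    have "norm (pderivs ds ?F z \<theta>) \<le> max C 0 * (1 + phase_norm 1 \<theta>) powr (0 - real (length (filter (\<lambda>d. \<not> isl d) ds)))" if z: "z \<in> KK" for z \<theta>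
    proof -
      have zU: "z \<in> U" using z K by auto
      have p: "pderivs ds ?F z \<theta> = h' z" using h'(2,3) zU by simp
      show ?thesis
      proof (cases "\<forall>d\<in>set ds. isl d")
        case True
        then have "filter (\<lambda>d. \<not> isl d) ds = []" by (simp add: filter_empty_conv)
        moreover have "1 + phase_norm 1 \<theta> \<noteq> 0" using L2_set_nonneg[of \<theta> "{..<1}"] unfolding phase_norm_def by linarith
        moreover have "norm (h' z) \<le> max C 0" using C z by (simp add: le_max_iff_disj)
        ultimately show ?thesis unfolding p by simp
      next
        case False
        then have "h' z = 0" using h'(4) zU by simp
        then show ?thesis unfolding p by simp
      qed
    qed
    then show "\<exists>C. \<forall>z\<in>KK. \<forall>\<theta>\<in>phase_space 1. norm (pderivs ds ?F z \<theta>) \<le>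
           C * (1 + phase_norm 1 \<theta>) powr (0 - real (length (filter (\<lambda>d. \<not> isl d) ds)))" by (intro exI ballI)
  qed
qed

lemma phase_norm_1: "phase_norm 1 \<theta> = \<bar>\<theta> 0\<bar>"
  by (simp add: phase_norm_def L2_set_def)

lemma mem_phase_space0_1: "\<theta> \<in> phase_space0 1 \<longleftrightarrow> \<theta> \<in> phase_space 1 \<and> \<theta> 0 \<noteq> 0"
  by (simp add: phase_space0_def phase_norm_1)

lemma conic_phase_space0: "conic 1 (U \<times> phase_space0 1)"
  unfolding conic_def by (auto simp: mem_phase_space0_1 phase_scale_def phase_space_def)

lemma open_cone_full: assumes "open V" "V \<subseteq> U" shows "open_cone 1 U (V \<times> phase_space0 1)"
  unfolding open_cone_def
proof (intro conjI conic_phase_space0)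
  have "open ((\<lambda>\<theta>::nat \<Rightarrow> real. \<theta> 0) -` (- {0}))"
    by (rule open_vimage) (auto intro: continuous_on_product_coordinates)
  then have "open (V \<times> ((\<lambda>\<theta>::nat \<Rightarrow> real. \<theta> 0) -` (- {0})))" by (intro open_Times assms)
  moreover have "V \<times> phase_space0 1 = (UNIV \<times> phase_space 1) \<inter> (V \<times> ((\<lambda>\<theta>::nat \<Rightarrow> real. \<theta> 0) -` (- {0})))"
    by (auto simp: mem_phase_space0_1)
  ultimately show "openin (top_of_set (UNIV \<times> phase_space 1)) (V \<times> phase_space0 1)" by (auto simp: openin_open)
qed (use assms in auto)

context elliptic_radon begin

section \<open>Phase, amplitude and critical points for the Radon transform\<close>

lemma Y_coord_frechet: "frechet_derivative Y_coord (at y) = (\<lambda>h. (fst h *\<^sub>R rot (circ (fst y)), snd h))"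
proof -
  have "(Y_coord has_derivative (\<lambda>h. (fst h *\<^sub>R rot (circ (fst y)), snd h))) (at y)"
    unfolding Y_coord_def split_beta[abs_def]
    by (intro has_derivative_Pair circ_has_derivative[OF _ refl] has_derivative_fst has_derivative_snd has_derivative_ident)
  then show ?thesis by (rule frechet_derivative_at[symmetric])
qed

lemma etale: "etale_param Y_coord (coord_domain \<alpha>) (Yset \<alpha>)"
  unfolding etale_param_def coord_domain_eq Yset_eq
proof (intro conjI ballI refl open_VD)
  fix y assume y: "y \<in> VD"
  interpret circle_param Y_coord VD "(1, 0)" UNIV fst "\<lambda>p. (fst p, snd (snd p))" by (rule Y_param) simp
  have "chart (window y) Y_coord (Y_coord ` VD)" by (rule chart_window)
  then obtain h where "open (window y)" "openin (top_of_set (Y_coord ` VD)) (Y_coord ` window y)" "diffeo (window y) (Y_coord ` window y) Y_coord h"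
    unfolding chart_def by (elim exE conjE)
  moreover have "window y \<subseteq> VD" by (auto simp: window_def)
  ultimately show "\<exists>B h. open B \<and> y \<in> B \<and> B \<subseteq> VD \<and> openin (top_of_set (Y_coord ` VD)) (Y_coord ` B) \<and> diffeo B (Y_coord ` B) Y_coord h"
    using window_mem[OF y] by (intro exI conjI)
qed

definition psi where "psi z = snd (fst z) - phi (circ (fst (fst z))) (snd z)"
definition phase where "phase = (\<lambda>z (\<theta> :: nat \<Rightarrow> real). \<theta> 0 * psi z)"
definition amp :: "(real \<times> real) \<times> (real^2) \<Rightarrow> complex" where "amp z = complex_of_real (wt (fst (fst z)) (snd z) / (2 * pi))"

abbreviation YX where "YX \<equiv> (UNIV :: (real \<times> real) set) \<times> disc \<alpha>"

lemma open_YX: "open YX" by (intro open_Times open_disc) simp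

lemma psi_has_derivative:
  assumes "z \<in> YX"
  shows "(psi has_derivative (\<lambda>v. snd (fst v) - (phis (circ (fst (fst z))) (snd z) * fst (fst v) + grad (circ (fst (fst z))) (snd z) \<bullet> snd v))) (at z)"
  unfolding psi_def[abs_def] using assms
  by (intro has_derivative_diff phi_circ_has_derivative has_derivative_fst has_derivative_snd has_derivative_ident disc_Reg) auto

lemma psi_smooth: "smooth_open YX psi"
  unfolding psi_def[abs_def]
  by (intro smooth_open_diff smooth_geom(1) smooth_open_circ smooth_open_fst smooth_open_snd smooth_open_id open_YX) (auto intro: disc_Reg)

lemma amp_smooth: "smooth_open YX amp"
proof -
  have "smooth_open YX (\<lambda>z. wt (fst (fst z)) (snd z))"
  proof (rule smooth_open_cong[OF open_YX])
    show "smooth_open YX (\<lambda>z. (\<lambda>(s, x). wt s x) (fst (fst z), snd z))"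
      by (rule smooth_open_compose[OF wt_smooth open_R_disc open_YX])
        (auto intro!: smooth_open_Pair smooth_open_fst smooth_open_snd smooth_open_id open_YX)
  qed auto
  then have "smooth_open YX (\<lambda>z. complex_of_real (wt (fst (fst z)) (snd z) * (1 / (2 * pi))))"
    by (intro smooth_open_of_real smooth_open_mult open_YX smooth_open_const)
  then show ?thesis unfolding amp_def[abs_def] by simp
qed

lemma phase_power: "phase = (\<lambda>z \<theta>. (\<theta> 0) ^ 1 *\<^sub>R psi z)" by (simp add: phase_def)

lemma pderiv_phase:
  assumes "z \<in> YX"
  shows "pderiv_dir (Inl v) phase z \<theta> = \<theta> 0 * (snd (fst v) - (phis (circ (fst (fst z))) (snd z) * fst (fst v) + grad (circ (fst (fst z))) (snd z) \<bullet> snd v))"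
    "pderiv_dir (Inr 0) phase z \<theta> = psi z"
proof -
  have e: "\<forall>z\<in>YX. \<forall>\<theta>. phase z \<theta> = (\<theta> 0) ^ 1 *\<^sub>R psi z" by (simp add: phase_def)
  note D = along_power_has_derivative[OF open_YX psi_smooth e assms]
  show "pderiv_dir (Inl v) phase z \<theta> = \<theta> 0 * (snd (fst v) - (phis (circ (fst (fst z))) (snd z) * fst (fst v) + grad (circ (fst (fst z))) (snd z) \<bullet> snd v))"
    using vector_derivative_at[OF D(1)] unfolding pderiv_dir_def frechet_derivative_at[OF psi_has_derivative[OF assms], symmetric] by simp
  show "pderiv_dir (Inr 0) phase z \<theta> = psi z"
    using vector_derivative_at[OF D(2)] unfolding pderiv_dir_def by simp
qed

text \<open>That this single mixed derivative is nonzero makes the phase nondegenerate.\<close>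

lemma pderiv_phase_mixed: assumes "z \<in> YX" shows "pderivs [Inl ((0, 1), 0), Inr 0] phase z \<theta> = 1"
proof -
  have e: "\<forall>z\<in>YX. \<forall>\<theta>. pderiv_dir (Inr 0) phase z \<theta> = (\<theta> 0) ^ 0 *\<^sub>R psi z"
    by (intro ballI allI) (simp add: pderiv_phase(2))
  note D = along_power_has_derivative[OF open_YX psi_smooth e assms]
  show ?thesis
    using vector_derivative_at[OF D(1)[of "((0, 1), 0)" \<theta>]] unfolding frechet_derivative_at[OF psi_has_derivative[OF assms], symmetric]
    by (simp add: pderivs_def pderiv_dir_def[of "Inl ((0, 1), 0)" "pderiv_dir (Inr 0) phase"])
qed

text \<open>Matches the critical points with the canonical relation: the phase variable is the
  \<open>L\<close>-component of the covector.\<close>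

lemma phase_crit_iff:
  assumes G: "G \<subseteq> YX \<times> UNIV"
  shows "phase_crit Y_coord 1 G phase y x \<theta> \<eta> \<xi> \<longleftrightarrow> ((y, x), \<theta>) \<in> G \<and> snd y = phi (circ (fst y)) x \<and>
    \<eta> = (- (\<theta> 0 * phis (circ (fst y)) x) *\<^sub>R rot (circ (fst y)), \<theta> 0) \<and> \<xi> = \<theta> 0 *\<^sub>R grad (circ (fst y)) x"
proof (cases "((y, x), \<theta>) \<in> G")
  case True
  then have z: "(y, x) \<in> YX" using G by auto
  let ?q = "circ (fst y)" and ?p = "phis (circ (fst y)) x" and ?g = "grad (circ (fst y)) x"
  have b: "(\<forall>v\<in>Basis. P v) \<longleftrightarrow> P (1, 0) \<and> P (0, 1)" for P :: "real \<times> real \<Rightarrow> bool" by (auto simp: Basis_prod_def)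
  have x: "(\<forall>v\<in>Basis. \<xi> \<bullet> v = - pderiv_dir (Inl (0, v)) phase (y, x) \<theta>) \<longleftrightarrow> \<xi> = \<theta> 0 *\<^sub>R ?g"
    unfolding pderiv_phase(1)[OF z] by (subst euclidean_eq_iff) simp
  have n: "rot ?q \<bullet> rot ?q = 1" by (simp add: dot_square_norm)
  have y: "\<eta> \<in> range (frechet_derivative Y_coord (at y)) \<and> (\<forall>v\<in>Basis. \<eta> \<bullet> frechet_derivative Y_coord (at y) v = pderiv_dir (Inl (v, 0)) phase (y, x) \<theta>)
    \<longleftrightarrow> \<eta> = (- (\<theta> 0 * ?p) *\<^sub>R rot ?q, \<theta> 0)"
  proof
    assume "\<eta> \<in> range (frechet_derivative Y_coord (at y)) \<and> (\<forall>v\<in>Basis. \<eta> \<bullet> frechet_derivative Y_coord (at y) v = pderiv_dir (Inl (v, 0)) phase (y, x) \<theta>)"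
    then have l: "\<eta> \<in> range (frechet_derivative Y_coord (at y))" "\<eta> \<bullet> (rot ?q, 0) = - (\<theta> 0 * ?p)" "\<eta> \<bullet> (0, 1) = \<theta> 0"
      unfolding b Y_coord_frechet pderiv_phase(1)[OF z] by simp_all
    from l(1) obtain v where v: "\<eta> = (fst v *\<^sub>R rot ?q, snd v)" unfolding Y_coord_frechet by auto
    show "\<eta> = (- (\<theta> 0 * ?p) *\<^sub>R rot ?q, \<theta> 0)" using l(2,3) n unfolding v by simp
  next
    assume e: "\<eta> = (- (\<theta> 0 * ?p) *\<^sub>R rot ?q, \<theta> 0)"
    have "\<eta> = (\<lambda>h. (fst h *\<^sub>R rot ?q, snd h)) (- (\<theta> 0 * ?p), \<theta> 0)" unfolding e by simp
    then have "\<eta> \<in> range (frechet_derivative Y_coord (at y))" unfolding Y_coord_frechet by (rule range_eqI)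
    then show "\<eta> \<in> range (frechet_derivative Y_coord (at y)) \<and> (\<forall>v\<in>Basis. \<eta> \<bullet> frechet_derivative Y_coord (at y) v = pderiv_dir (Inl (v, 0)) phase (y, x) \<theta>)"
      using n unfolding b pderiv_phase(1)[OF z] Y_coord_frechet e by simp
  qed
  have p: "(\<forall>j<1. pderiv_dir (Inr j) phase (y, x) \<theta> = 0) \<longleftrightarrow> snd y = phi ?q x"
    using pderiv_phase(2)[OF z, of \<theta>] by (simp add: psi_def)
  show ?thesis unfolding phase_crit_def x p using y True by blast
qed (simp add: phase_crit_def)

lemma fio_term_phase:
  assumes B: "open B" and W: "open W" "W \<subseteq> disc \<alpha>"
  shows "fio_term Y_coord (radon_canonical_relation \<alpha>) (- 1 / 2) (B \<times> W) (1, (B \<times> W) \<times> phase_space0 1, phase, \<lambda>z \<theta>. amp z)"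
proof -
  let ?U = "B \<times> W" let ?G = "?U \<times> phase_space0 1"
  have oU: "open ?U" by (rule open_Times[OF B W(1)])
  have UY: "?U \<subseteq> YX" using W(2) by auto
  then have GY: "?G \<subseteq> YX \<times> UNIV" by auto
  have "phase_function 1 ?G phase"
    unfolding phase_function_def
  proof (intro conjI ballI)
    show "smooth_phase_on 1 ?G phase" unfolding phase_power by (rule smooth_phase_power[OF open_YX psi_smooth GY])
    fix p assume p: "p \<in> ?G"
    then obtain z \<theta> where p': "p = (z, \<theta>)" "z \<in> YX" "\<theta> 0 \<noteq> 0" using UY by (cases p) (auto simp: mem_phase_space0_1)
    let ?g = "grad (circ (fst (fst z))) (snd z)"
    have "?g \<noteq> 0" using p'(2) by (intro grad_nz) auto
    then obtain v where v: "v \<in> Basis" "?g \<bullet> v \<noteq> 0" using euclidean_all_zero_iff by blast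
    have "pderiv_dir (Inl ((0, 1), 0)) phase z \<theta> \<noteq> 0" using p'(3) by (simp add: pderiv_phase(1)[OF p'(2)])
    then have 1: "\<exists>v\<in>Basis. pderiv_dir (Inl (v, 0)) phase z \<theta> \<noteq> 0" by (rule bexI) (simp add: Basis_prod_def)
    have "pderiv_dir (Inl (0, v)) phase z \<theta> \<noteq> 0" using p'(3) v(2) by (simp add: pderiv_phase(1)[OF p'(2)])
    then have 2: "\<exists>v\<in>Basis. pderiv_dir (Inl (0, v)) phase z \<theta> \<noteq> 0" using v(1) by (rule bexI)
    show "case p of (z, \<theta>) \<Rightarrow> (\<forall>t>0. phase z (phase_scale 1 t \<theta>) = t * phase z \<theta>) \<and>
        ((\<exists>v\<in>Basis. pderiv_dir (Inl (v, 0)) phase z \<theta> \<noteq> 0) \<or> (\<exists>j<1. pderiv_dir (Inr j) phase z \<theta> \<noteq> 0)) \<and>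
        ((\<exists>v\<in>Basis. pderiv_dir (Inl (0, v)) phase z \<theta> \<noteq> 0) \<or> (\<exists>j<1. pderiv_dir (Inr j) phase z \<theta> \<noteq> 0))"
      using 1 2 unfolding p'(1) by (simp add: phase_def phase_scale_def)
  qed
  moreover have "nondegenerate 1 ?G phase"
    unfolding nondegenerate_def
  proof (intro ballI)
    fix p assume p: "p \<in> ?G"
    then obtain z \<theta> where p': "p = (z, \<theta>)" "z \<in> YX" using UY by (cases p) auto
    have "c 0 = 0" if "\<forall>d\<in>directions 1. (\<Sum>j<1. c j * pderivs [d, Inr j] phase z \<theta>) = 0" for c
    proof -
      have "Inl ((0, 1), 0) \<in> (directions 1 :: (((real \<times> real) \<times> (real^2)) + nat) set)" by (simp add: directions_def Basis_prod_def)
      from bspec[OF that this] show ?thesis using pderiv_phase_mixed[OF p'(2), of \<theta>] by simp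
    qed
    then show "case p of (z, \<theta>) \<Rightarrow> (\<forall>j<1. pderiv_dir (Inr j) phase z \<theta> = 0) \<longrightarrow>
      (\<forall>c. (\<forall>d\<in>directions 1. (\<Sum>j<1. c j * pderivs [d, Inr j] phase z \<theta>) = 0) \<longrightarrow> (\<forall>j<1. c j = 0))"
      unfolding p'(1) by simp
  qed
  moreover have "((Y_coord y, \<eta>), (x, \<xi>)) \<in> radon_canonical_relation \<alpha>" if "phase_crit Y_coord 1 ?G phase y x \<theta> \<eta> \<xi>" for y x \<theta> \<eta> \<xi>
    using that UY unfolding phase_crit_iff[OF GY] mem_C by (auto simp: Y_coord_def split_beta mem_phase_space0_1)
  \<comment> \<open>The amplitude order is -1/2 + (4 - 2)/4 = 0, from four base variables and one
    phase variable.\<close>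
  moreover have "symbol_class ?U 1 (amplitude_order (DIM(real \<times> real) + DIM(real^2)) (- 1 / 2) 1) (\<lambda>z \<theta>. amp z)"
    using symbol_class_0[OF oU smooth_open_mono[OF amp_smooth UY]] by (simp add: amplitude_order_def)
  moreover have "\<exists>S. S \<subseteq> ?G \<and> conic 1 S \<and> closedin (top_of_set ?G) S \<and> (\<forall>(z, \<theta>) \<in> ?G - S. amp z = 0)"
    by (intro exI[of _ ?G] conjI conic_phase_space0) auto
  ultimately show ?thesis
    unfolding fio_term_def prod.case using open_cone_full[OF oU order_refl] by (intro conjI) auto
qed

end

text \<open>Brings the integration over \<open>L\<close> inside the one over the angle and the
  point, since the limit of the truncated kernels is taken in \<open>L\<close> with the other two
  fixed.\<close>

lemma integral_reorder:
  fixes N :: "('a::euclidean_space \<times> 'b::euclidean_space) \<times> 'c::euclidean_space \<Rightarrow> complex"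
  assumes m [measurable]: "N \<in> borel_measurable borel" and S: "bounded S" and C: "\<And>z. norm (N z) \<le> C" "\<And>z. z \<notin> S \<Longrightarrow> N z = 0"
  shows "(\<integral>z. N z \<partial>lborel) = (\<integral>p. (\<integral>y. N ((fst p, y), snd p) \<partial>lborel) \<partial>lborel)"
    "integrable lborel (\<lambda>p. \<integral>y. N ((fst p, y), snd p) \<partial>lborel)"
proof -
  let ?P = "\<lambda>p. \<integral>y. N ((fst p, y), snd p) \<partial>lborel"
  have "integrable lborel N" by (rule bounded_integrable[OF m S C])
  then have "integrable (lborel \<Otimes>\<^sub>M lborel) (\<lambda>(y, x). N (y, x))" unfolding lborel_prod by simp
  from lborel_pair.integral_snd[OF this]
  have 1: "(\<integral>z. N z \<partial>lborel) = (\<integral>x. \<integral>y. N (y, x) \<partial>lborel \<partial>lborel)" unfolding lborel_prod by simp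
  have 2: "(\<integral>y. N (y, x) \<partial>lborel) = (\<integral>s. ?P (s, x) \<partial>lborel)" for x
  proof -
    have "integrable lborel (\<lambda>y. N (y, x))"
      by (rule bounded_integrable[OF _ bounded_fst[OF S] C(1)]) (measurable, rule C(2), force)
    then have "integrable (lborel \<Otimes>\<^sub>M lborel) (\<lambda>y. N (y, x))" unfolding lborel_prod .
    from lborel_pair.integral_fst'[OF this] show ?thesis unfolding lborel_prod by simp
  qed
  have "integrable lborel (\<lambda>q. N ((fst (fst q), snd q), snd (fst q)))"
  proof (rule bounded_integrable[OF _ _ C(1)])
    show "bounded ((fst ` fst ` S \<times> snd ` S) \<times> snd ` fst ` S)" by (intro bounded_Times bounded_fst bounded_snd S)
    show "N ((fst (fst q), snd q), snd (fst q)) = 0" if "q \<notin> (fst ` fst ` S \<times> snd ` S) \<times> snd ` fst ` S" for q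
      by (rule C(2)) (use that in \<open>force simp: mem_Times_iff\<close>)
  qed measurable
  then have "integrable (lborel \<Otimes>\<^sub>M lborel) (\<lambda>q. N ((fst (fst q), snd q), snd (fst q)))" unfolding lborel_prod .
  from lborel_pair.integrable_fst'[OF this] show 3: "integrable lborel ?P" by simp
  then have "integrable (lborel \<Otimes>\<^sub>M lborel) (\<lambda>(s, x). ?P (s, x))" unfolding lborel_prod split_beta prod.collapse .
  from lborel_pair.integral_snd[OF this]
  have "(\<integral>p. ?P p \<partial>lborel) = (\<integral>x. \<integral>s. ?P (s, x) \<partial>lborel \<partial>lborel)"
    unfolding lborel_prod split_beta prod.collapse by simp
  then show "(\<integral>z. N z \<partial>lborel) = (\<integral>p. ?P p \<partial>lborel)" unfolding 1 2 by simp
qed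

text \<open>For vector-valued integrands the period is changed through measures: Lebesgue measure on
  either period is pushed forward by reduction modulo 2\<pi>, and the two images agree by
  \<open>nn_integral_period\<close>.\<close>

lemma integral_period:
  fixes F :: "real \<Rightarrow> 'b::{banach, second_countable_topology}"
  assumes F [measurable]: "F \<in> borel_measurable borel" and per: "\<And>s t. circ s = circ t \<Longrightarrow> F s = F t"
  shows "(\<integral>s. indicator {c..<c + 2 * pi} s *\<^sub>R F s \<partial>lborel) = (\<integral>s. indicator {d..<d + 2 * pi} s *\<^sub>R F s \<partial>lborel)"
proof -
  define r where "r s = s - 2 * pi * of_int \<lfloor>s / (2 * pi)\<rfloor>" for s :: real
  have rm [measurable]: "r \<in> borel_measurable borel" unfolding r_def[abs_def] by measurable
  have r2: "r (s + 2 * pi) = r s" for s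
  proof -
    have "(s + 2 * pi) / (2 * pi) = s / (2 * pi) + 1" by (simp add: add_divide_distrib)
    then have "\<lfloor>(s + 2 * pi) / (2 * pi)\<rfloor> = \<lfloor>s / (2 * pi)\<rfloor> + 1" by simp
    then show ?thesis by (simp add: r_def algebra_simps)
  qed
  have Fr: "F (r s) = F s" for s
    by (rule per) (auto simp: r_def circ_eq_iff intro!: exI[of _ "- \<lfloor>s / (2 * pi)\<rfloor>"])
  define \<mu> where "\<mu> c = distr (density lborel (\<lambda>s. indicator {c..<c + 2 * pi} s)) borel r" for c :: real
  have "emeasure (\<mu> c) A = emeasure (\<mu> d) A" if A: "A \<in> sets borel" for A
  proof -
    have e: "emeasure (\<mu> c) A = (\<integral>\<^sup>+s. indicator {c..<c + 2 * pi} (s \<bullet> 1) * indicator A (r s) \<partial>lborel)" for c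
      unfolding \<mu>_def using A
      by (subst emeasure_distr; (subst emeasure_density)?) (auto simp: space_density measurable_sets_borel[OF rm A] intro!: nn_integral_cong split: split_indicator)
    show ?thesis unfolding e
      by (rule nn_integral_period) (use A in \<open>auto simp: r2\<close>)
  qed
  then have \<mu>: "\<mu> c = \<mu> d" by (intro measure_eqI) (auto simp: \<mu>_def)
  have "(\<integral>s. indicator {c..<c + 2 * pi} s *\<^sub>R F s \<partial>lborel) = (\<integral>s. F s \<partial>\<mu> c)" for c
    unfolding \<mu>_def by (subst integral_distr; (subst integral_density[where g = "\<lambda>s. indicator {c..<c + 2 * pi} s", simplified ennreal_indicator])?) (auto simp: Fr)
  then show ?thesis using \<mu> by simp
qed

section \<open>Localization to a box and the limit of the truncated integrals\<close>

context elliptic_radon begin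

text \<open>Length 2 in \<open>s\<close> is less than \<pi>, so \<open>Y_coord\<close> is injective
  on the box and the box lies inside a window, where the inverse chart is available.\<close>

definition Box :: "real \<Rightarrow> (real \<times> real) set" where "Box s0 = {s0 - 1<..<s0 + 1} \<times> {2 * a<..}"

text \<open>In the coordinates a test function on the circle becomes periodic. \<open>ext\<close>
  keeps only the copy in the box, which has compact support for test functions on the box.\<close>

definition ext where "ext s0 g y = (if y \<in> Box s0 then (g :: (real^2) \<times> real \<Rightarrow> complex) (Y_coord y) else 0)"

lemma open_Box: "open (Box s0)" by (simp add: Box_def open_Times)

lemma Box_VD: "Box s0 \<subseteq> VD" by (auto simp: Box_def)

lemma Box_inj: "inj_on Y_coord (Box s0)"
proof (rule inj_onI)
  fix y z assume yz: "y \<in> Box s0" "z \<in> Box s0" "Y_coord y = Y_coord z"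
  have "\<bar>fst y - fst z\<bar> < 2 * pi" using yz(1,2) pi_gt3 by (auto simp: Box_def mem_Times_iff)
  then show "y = z" using yz(3) circ_eq_close[of "fst y" "fst z"] by (auto simp: Y_coord_def split_beta prod_eq_iff)
qed

text \<open>The inverse chart carries the compact support of \<open>g\<close> to a compact subset of
  the open box, so the extension by 0 is smooth across the boundary of the box.\<close>

lemma ext_smooth:
  assumes g: "g \<in> test_functions Y_coord (Box s0)"
  shows "\<exists>Kc. compact Kc \<and> Kc \<subseteq> Box s0 \<and> (\<forall>y. y \<notin> Kc \<longrightarrow> ext s0 g y = 0) \<and> smooth_open UNIV (ext s0 g) \<and> g \<in> borel_measurable borel \<and>
    (\<forall>y. g y \<noteq> 0 \<longrightarrow> y \<in> Y_coord ` Box s0)"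
proof -
  obtain KK where KK: "smooth_open (Box s0) (g \<circ> Y_coord)" "compact KK" "KK \<subseteq> Y_coord ` Box s0" "\<And>p. p \<notin> KK \<Longrightarrow> g p = 0"
    using g by (auto simp: test_functions_def)
  interpret circle_param Y_coord VD "(1, 0)" UNIV fst "\<lambda>p. (fst p, snd (snd p))" by (rule Y_param) simp
  let ?w = "window (s0, 2 * a + 1)"
  obtain h where h: "diffeo ?w (Y_coord ` ?w) Y_coord h"
    using chart_window[of "(s0, 2 * a + 1)"] unfolding chart_def by (elim conjE exE)
  have Bw: "Box s0 \<subseteq> ?w" using pi_gt3 by (auto simp: Box_def window_def abs_if)
  have hi: "h (Y_coord y) = y" if "y \<in> Box s0" for y using h Bw that by (auto simp: diffeo_def)
  have "smooth_map_on (Y_coord ` ?w) h" using h by (simp add: diffeo_def)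
  then have "continuous_on (Y_coord ` ?w) h" by (rule smooth_map_on_continuous_on)
  then have hc: "continuous_on KK h" by (rule continuous_on_subset) (use KK(3) Bw in blast)
  define Kc where "Kc = h ` KK"
  have 1: "compact Kc" unfolding Kc_def by (rule compact_continuous_image[OF hc KK(2)])
  have 2: "Kc \<subseteq> Box s0" using KK(3) hi by (force simp: Kc_def)
  have 3: "ext s0 g y = 0" if "y \<notin> Kc" for y
  proof (cases "y \<in> Box s0")
    case True
    have "Y_coord y \<notin> KK" using that hi[OF True] by (force simp: Kc_def)
    then show ?thesis using KK(4) by (simp add: ext_def)
  qed (simp add: ext_def)
  have 4: "smooth_open UNIV (ext s0 g)"
  proof (rule smooth_open_locally)
    fix y show "\<exists>U. open U \<and> y \<in> U \<and> smooth_open U (ext s0 g)"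
    proof (cases "y \<in> Box s0")
      case True
      have "smooth_open (Box s0) (ext s0 g)" by (rule smooth_open_cong[OF open_Box _ KK(1)]) (simp add: ext_def)
      then show ?thesis using True open_Box by blast
    next
      case False
      have o: "open (- Kc)" using compact_imp_closed[OF 1] by (simp add: open_Compl)
      have "smooth_open (- Kc) (ext s0 g)" by (rule smooth_open_cong[OF o _ smooth_open_const[of _ 0]]) (simp add: 3)
      then show ?thesis using False 2 o by blast
    qed
  qed
  have "g = (\<lambda>m. if m \<in> KK then ext s0 g (h m) else 0)"
  proof
    fix m show "g m = (if m \<in> KK then ext s0 g (h m) else 0)"
    proof (cases "m \<in> KK")
      case True
      then obtain y where "y \<in> Box s0" "m = Y_coord y" using KK(3) by blast
      then show ?thesis using True hi by (simp add: ext_def)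
    qed (simp add: KK(4))
  qed
  moreover have "(\<lambda>m. if m \<in> KK then ext s0 g (h m) else 0) \<in> borel_measurable borel"
    by (intro borel_measurable_continuous_on_if borel_compact KK(2) continuous_on_compose2[OF smooth_open_continuous_on[OF 4] hc] continuous_on_const) auto
  ultimately have 5: "g \<in> borel_measurable borel" by simp
  have 6: "y \<in> Y_coord ` Box s0" if "g y \<noteq> 0" for y using KK(3,4) that by blast
  show ?thesis using 1 2 3 4 5 6 by (intro exI[of _ Kc] conjI allI impI)
qed

text \<open>The constants of the bump are independent of \<open>s\<close> because the support in
  \<open>(s, L)\<close> is compact.\<close>

lemma ext_bump:
  assumes g: "g \<in> test_functions Y_coord (Box s0)"
  shows "\<exists>D1 D2 R M. \<forall>s. C2_bump (\<lambda>L. ext s0 g (s, L)) (\<lambda>L. D1 (s, L)) (\<lambda>L. D2 (s, L)) R M"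
proof -
  obtain Kc where Kc0: "compact Kc" "Kc \<subseteq> Box s0" "\<forall>y. y \<notin> Kc \<longrightarrow> ext s0 g y = 0" "smooth_open UNIV (ext s0 g)"
    using ext_smooth[OF g] by (elim exE conjE)
  have zero0: "ext s0 g y = 0" if "y \<notin> Kc" for y by (rule mp[OF spec[OF Kc0(3)] that])
  note Kc = Kc0(1) zero0 Kc0(4)
  define D1 where "D1 y = frechet_derivative (ext s0 g) (at y) (0, 1)" for y
  define D2 where "D2 y = frechet_derivative D1 (at y) (0, 1)" for y
  have s1: "smooth_open UNIV D1" unfolding D1_def[abs_def] by (rule smooth_open_deriv[OF Kc(3)])
  have s2: "smooth_open UNIV D2" unfolding D2_def[abs_def] by (rule smooth_open_deriv[OF s1])
  have o: "open (- Kc)" using compact_imp_closed[OF Kc(1)] by (simp add: open_Compl)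
  have zero: "frechet_derivative E (at y) v = 0" if "smooth_open UNIV E" "\<And>y. y \<notin> Kc \<Longrightarrow> E y = 0" "y \<notin> Kc" for E :: "real \<times> real \<Rightarrow> complex" and y v
  proof -
    have "frechet_derivative E (at y) = frechet_derivative (\<lambda>_. 0) (at y)"
      by (rule frechet_derivative_cong_open[OF o _ _ differentiableI[OF smooth_open_has_derivative[OF that(1)]]]) (use that in auto)
    then show ?thesis by (simp add: frechet_derivative_const)
  qed
  have z1: "D1 y = 0" if "y \<notin> Kc" for y unfolding D1_def by (rule zero[OF Kc(3,2) that])
  have z2: "D2 y = 0" if "y \<notin> Kc" for y unfolding D2_def by (rule zero[OF s1 z1 that])
  obtain r where r: "\<forall>y\<in>Kc. norm y \<le> r" using compact_imp_bounded[OF Kc(1)] unfolding bounded_iff by (elim exE)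
  have out: "(s, L) \<notin> Kc" if "\<bar>r\<bar> + 1 \<le> \<bar>L\<bar>" for s L
  proof
    assume "(s, L) \<in> Kc"
    then have "norm (s, L) \<le> r" using r by blast
    moreover have "\<bar>L\<bar> \<le> norm (s, L)" by (metis norm_snd_le real_norm_def)
    ultimately show False using that by linarith
  qed
  have bd: "\<exists>M. \<forall>y. norm (E y) \<le> M" if "smooth_open UNIV E" "\<And>y. y \<notin> Kc \<Longrightarrow> E y = 0" for E :: "real \<times> real \<Rightarrow> complex"
  proof -
    have "continuous_on Kc E" by (rule continuous_on_subset[OF smooth_open_continuous_on[OF that(1)]]) simp
    then have "bounded (E ` Kc)" by (intro compact_imp_bounded compact_continuous_image Kc)
    then obtain M where "\<forall>x\<in>E ` Kc. norm x \<le> M" unfolding bounded_iff by (elim exE)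
    then have "norm (E y) \<le> max M 0" for y using that(2)[of y] by (cases "y \<in> Kc") (auto simp: le_max_iff_disj)
    then show ?thesis by blast
  qed
  have "\<exists>M. \<forall>y. norm (ext s0 g y) \<le> M" by (rule bd[OF Kc(3)]) (rule Kc(2))
  then obtain M0 where M0: "\<forall>y. norm (ext s0 g y) \<le> M0" by (elim exE)
  have "\<exists>M. \<forall>y. norm (D2 y) \<le> M" by (rule bd[OF s2]) (rule z2)
  then obtain M2 where M2: "\<forall>y. norm (D2 y) \<le> M2" by (elim exE)
  have dv: "((\<lambda>L. E (s, L)) has_vector_derivative frechet_derivative E (at (s, t)) (0, 1)) (at t)" if E: "smooth_open UNIV E" for E :: "real \<times> real \<Rightarrow> complex" and s t
  proof -
    have d: "(E has_derivative frechet_derivative E (at (s, t))) (at (s, t))" by (rule smooth_open_has_derivative[OF E]) simp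
    interpret bounded_linear "frechet_derivative E (at (s, t))" by (rule has_derivative_bounded_linear[OF d])
    have "((\<lambda>L. E (s, L)) has_derivative (\<lambda>h. frechet_derivative E (at (s, t)) (0, h))) (at t)"
      by (rule has_derivative_compose[of "\<lambda>L. (s, L)" "\<lambda>h. (0, h)"]) (use d in \<open>auto intro!: derivative_eq_intros\<close>)
    moreover have "(\<lambda>h. frechet_derivative E (at (s, t)) (0, h)) = (\<lambda>h. h *\<^sub>R frechet_derivative E (at (s, t)) (0, 1))"
      by (rule ext, subst scale[symmetric]) simp
    ultimately show ?thesis unfolding has_vector_derivative_def by (simp only:)
  qed
  have "C2_bump (\<lambda>L. ext s0 g (s, L)) (\<lambda>L. D1 (s, L)) (\<lambda>L. D2 (s, L)) (\<bar>r\<bar> + 1) (max M0 M2)" for s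
  proof
    show "((\<lambda>L. ext s0 g (s, L)) has_vector_derivative D1 (s, t)) (at t)" for t unfolding D1_def by (rule dv[OF Kc(3)])
    show "((\<lambda>L. D1 (s, L)) has_vector_derivative D2 (s, t)) (at t)" for t unfolding D2_def by (rule dv[OF s1])
    show "continuous_on UNIV (\<lambda>L. D2 (s, L))"
      by (rule continuous_on_compose2[OF smooth_open_continuous_on[OF s2]]) (auto intro!: continuous_intros)
    show "norm (ext s0 g (s, t)) \<le> max M0 M2" "norm (D2 (s, t)) \<le> max M0 M2" for t using M0 M2 by (simp_all add: le_max_iff_disj)
    show "0 \<le> \<bar>r\<bar> + 1" by simp
    fix t assume "\<bar>r\<bar> + 1 \<le> \<bar>t\<bar>"
    from out[OF this] show "ext s0 g (s, t) = 0" "D1 (s, t) = 0" "D2 (s, t) = 0" by (auto intro: Kc(2) z1 z2)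
  qed
  then show ?thesis by (intro exI allI)
qed

text \<open>The box lies over the period centred at \<open>s0\<close>, which contains each point of
  the circle once. So the integral over the line is an integral of the periodic integrand over that
  period, and periods are interchangeable.\<close>

lemma ext_backprojection:
  assumes g: "g \<in> test_functions Y_coord (Box s0)"
  shows "(\<integral>s. wt s x *\<^sub>R ext s0 g (s, phi (circ s) x) \<partial>lborel) = backprojection \<alpha> wt g x"
proof (cases "x \<in> disc \<alpha>")
  case False then show ?thesis by (simp add: wt_def backprojection_def)
next
  case True
  have gm [measurable]: "g \<in> borel_measurable borel" and supp0: "\<forall>y. g y \<noteq> 0 \<longrightarrow> y \<in> Y_coord ` Box s0"
    using ext_smooth[OF g] by auto
  note supp = mp[OF spec[OF supp0]]
  let ?F = "\<lambda>s. wt s x *\<^sub>R g (Y_coord (s, phi (circ s) x))"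
  have e: "wt s x *\<^sub>R ext s0 g (s, phi (circ s) x) = indicator {s0 - pi..<s0 - pi + 2 * pi} s *\<^sub>R ?F s" for s
  proof -
    let ?y = "(s, phi (circ s) x)"
    have L: "2 * a < phi (circ s) x" by (rule phi_gt[OF norm_circ True])
    show ?thesis
    proof (cases "g (Y_coord ?y) = 0")
      case False
      obtain z where z: "z \<in> Box s0" "Y_coord ?y = Y_coord z" using supp[OF False] by blast
      show ?thesis
      proof (cases "s \<in> {s0 - pi..<s0 - pi + 2 * pi}")
        case True
        have "\<bar>s - fst z\<bar> < 2 * pi" using True z(1) pi_gt3 by (auto simp: Box_def mem_Times_iff)
        then have "s = fst z" using z(2) circ_eq_close[of s "fst z"] by (simp add: Y_coord_def split_beta)
        then have "?y = z" using z(2) by (simp add: Y_coord_def split_beta prod_eq_iff)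
        then show ?thesis using True z(1) by (simp add: ext_def)
      next
        case s: False
        then have "?y \<notin> Box s0" using pi_gt3 by (auto simp: Box_def)
        then show ?thesis using s by (simp add: ext_def)
      qed
    qed (simp add: ext_def)
  qed
  have Fm: "?F \<in> borel_measurable borel" by measurable
  have per: "?F s = ?F t" if "circ s = circ t" for s t using that by (simp add: wt_def Y_coord_def)
  have "(\<integral>s. wt s x *\<^sub>R ext s0 g (s, phi (circ s) x) \<partial>lborel) = (\<integral>s. indicator {0..<0 + 2 * pi} s *\<^sub>R ?F s \<partial>lborel)"
    unfolding e by (rule integral_period[OF Fm per])
  also have "\<dots> = backprojection \<alpha> wt g x"
    unfolding backprojection_def set_lebesgue_integral_def focal_sum_eq
  proof (rule integral_cong_AE)
    have "AE s in lborel. s \<noteq> 2 * pi" by (rule AE_lborel_singleton)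
    then show "AE s in lborel. indicator {0..<0 + 2 * pi} s *\<^sub>R ?F s = indicator {0..2 * pi} s *\<^sub>R ?F s"
      by eventually_elim (auto simp: indicator_def)
  qed (use Fm in measurable)
  finally show ?thesis .
qed

lemma psi_measurable [measurable]: "psi \<in> borel_measurable borel"
  unfolding psi_def[abs_def] by measurable

lemma amp_measurable [measurable]: "amp \<in> borel_measurable borel"
proof -
  have "(\<lambda>z. wt (fst (fst z)) (snd z)) \<in> borel_measurable (borel :: ((real \<times> real) \<times> (real^2)) measure)"
    by (rule wt_measurable[OF measurable_compose[OF borel_measurable_fst borel_measurable_fst] borel_measurable_snd])
  then show ?thesis unfolding amp_def[abs_def]
    by (rule measurable_compose[where g = "\<lambda>r. complex_of_real (r / (2 * pi))"]) (intro borel_measurable_continuous_onI continuous_intros, simp)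
qed

lemma norm_amp_le: "norm (amp z) \<le> 1"
proof -
  have "wt (fst (fst z)) (snd z) \<le> 2 * pi" using wt_bounds(2)[of "fst (fst z)" "snd z"] pi_gt3 by linarith
  then show ?thesis unfolding amp_def norm_of_real using wt_bounds(1) by simp
qed

text \<open>The \<open>\<theta>\<close>-integral gives \<open>cut_kernel\<close> at
  \<open>psi\<close>, the \<open>L\<close>-integral then tends to 2\<pi> times the value of
  \<open>ext\<close> at \<open>L = phi (circ s) x\<close>, and the factor 2\<pi> cancels against
  \<open>amp\<close>. What remains over \<open>(s, x)\<close> is the backprojection paired with
  \<open>f\<close>.\<close>

lemma has_osc_integral_phase:
  assumes f: "f \<in> test_functions (\<lambda>x. x) (disc \<alpha>)" and g: "g \<in> test_functions Y_coord (Box s0)"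
  shows "has_osc_integral 1 phase (\<lambda>z \<theta>. amp z) (\<lambda>(y, x). if y \<in> Box s0 then g (Y_coord y) * f x else 0) (radon_dist \<alpha> wt (dist_of_fun f) g)"
  unfolding has_osc_integral_def
proof (intro allI impI)
  fix cutf :: "real \<Rightarrow> real"
  assume cutf: "smooth_open UNIV cutf \<and> (\<exists>\<delta>>0. \<forall>t. \<bar>t\<bar> < \<delta> \<longrightarrow> cutf t = 1) \<and> (\<exists>b. \<forall>t. \<bar>t\<bar> > b \<longrightarrow> cutf t = 0)"
  then obtain \<delta> bb where \<delta>: "\<delta> > 0" "\<And>t. \<bar>t\<bar> < \<delta> \<Longrightarrow> cutf t = 1" and bb: "\<And>t. \<bar>t\<bar> > bb \<Longrightarrow> cutf t = 0" by auto
  have cc: "continuous_on UNIV cutf" using cutf by (intro smooth_open_continuous_on) simp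
  then have cm [measurable]: "cutf \<in> borel_measurable borel" by (rule borel_measurable_continuous_onI)
  have "bounded (cutf ` {-bb..bb})"
    by (intro compact_imp_bounded compact_continuous_image continuous_on_subset[OF cc]) auto
  then obtain B0 where "\<forall>x\<in>cutf ` {-bb..bb}. norm x \<le> B0" unfolding bounded_iff by (elim exE)
  then have "\<bar>cutf t\<bar> \<le> max B0 0" for t using bb[of t] by (cases "\<bar>t\<bar> \<le> bb") (auto simp: le_max_iff_disj abs_le_iff)
  then obtain B where B: "\<And>t. \<bar>cutf t\<bar> \<le> B" by blast
  have B0: "0 \<le> B" by (rule order_trans[OF abs_ge_zero B[of 0]])
  obtain D1 D2 R M where bump0: "\<forall>s. C2_bump (\<lambda>L. ext s0 g (s, L)) (\<lambda>L. D1 (s, L)) (\<lambda>L. D2 (s, L)) R M"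
    using ext_bump[OF g] by (elim exE)
  have bump: "C2_bump (\<lambda>L. ext s0 g (s, L)) (\<lambda>L. D1 (s, L)) (\<lambda>L. D2 (s, L)) R M" for s using bump0 by simp
  obtain Kc where Kc: "compact Kc" "\<forall>y. y \<notin> Kc \<longrightarrow> ext s0 g y = 0" "smooth_open UNIV (ext s0 g)"
    using ext_smooth[OF g] by (elim exE conjE)
  have em [measurable]: "ext s0 g \<in> borel_measurable borel"
    by (rule borel_measurable_continuous_onI[OF smooth_open_continuous_on[OF Kc(3)]])
  have eM: "norm (ext s0 g y) \<le> M" for y using C2_bump.MG(1)[OF bump[of "fst y"], of "snd y"] by simp
  note Fb = Cc_functions_bounded_measurable[OF test_functions_disc[OF f] disc_sets]
  note [measurable] = Fb(1)
  obtain Cf where Cf: "\<And>x. norm (f x) \<le> Cf" using Fb(2) by blast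
  have Cf0: "0 \<le> Cf" by (rule order_trans[OF norm_ge_zero Cf[of 0]])
  have M0: "0 \<le> M" by (rule order_trans[OF norm_ge_zero eM[of 0]])
  obtain Kf where Kf: "compact Kf" "\<And>x. x \<notin> Kf \<Longrightarrow> f x = 0" using f by (auto simp: test_functions_def)
  define u where "u z = ext s0 g (fst z) * f (snd z)" for z :: "(real \<times> real) \<times> (real^2)"
  have u_eq: "(\<lambda>(y, x). if y \<in> Box s0 then g (Y_coord y) * f x else 0) = u"
    by (auto simp: u_def ext_def)
  have um [measurable]: "u \<in> borel_measurable borel" unfolding u_def[abs_def] by measurable
  have uC: "norm (amp z * u z) \<le> M * Cf" for z
  proof -
    have "norm (amp z * u z) \<le> 1 * (M * Cf)" unfolding norm_mult u_def
      by (intro mult_mono norm_amp_le eM Cf M0 Cf0 mult_nonneg_nonneg) auto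
    then show ?thesis by simp
  qed
  have u0: "u z = 0" if "z \<notin> Kc \<times> Kf" for z
    using that Kc(2)[rule_format, of "fst z"] Kf(2)[of "snd z"] by (auto simp: u_def mem_Times_iff)
  have bS: "bounded (Kc \<times> Kf)" by (intro bounded_Times compact_imp_bounded Kc Kf)
  \<comment> \<open>The integrand after the \<open>\<theta>\<close>-integration; \<open>I\<close>
    below is the original truncated integral.\<close>
  define N where "N \<epsilon> z = cut_kernel cutf \<epsilon> (psi z) * (amp z * u z)" for \<epsilon> z
  define I where "I \<epsilon> = (\<integral>(z, \<theta>). complex_of_real (cutf (\<epsilon> * phase_norm 1 \<theta>)) * exp (\<i> * complex_of_real (phase z \<theta>)) * amp z * u z
        \<partial>(lborel \<Otimes>\<^sub>M Pi\<^sub>M {..<1} (\<lambda>_. lborel)))" for \<epsilon>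
  have Nint: "I \<epsilon> = (\<integral>p. (\<integral>L. N \<epsilon> ((fst p, L), snd p) \<partial>lborel) \<partial>lborel)"
    "integrable lborel (\<lambda>p. \<integral>L. N \<epsilon> ((fst p, L), snd p) \<partial>lborel)" if e: "0 < \<epsilon>" for \<epsilon>
  proof -
    let ?H = "\<lambda>q. complex_of_real (cutf (\<epsilon> * \<bar>snd q\<bar>)) * exp (\<i> * complex_of_real (snd q * psi (fst q))) * (amp (fst q) * u (fst q))"
    let ?b = "\<bar>bb\<bar> / \<epsilon>"
    have expm [measurable]: "(exp :: complex \<Rightarrow> complex) \<in> borel_measurable borel"
      by (intro borel_measurable_continuous_onI continuous_intros)
    have c0: "cutf (\<epsilon> * \<bar>t\<bar>) = 0" if "t \<notin> {- ?b..?b}" for t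
    proof (rule bb)
      have "?b < \<bar>t\<bar>" using that by auto
      then have "\<bar>bb\<bar> < \<epsilon> * \<bar>t\<bar>" using e by (simp add: field_simps)
      then show "bb < \<bar>\<epsilon> * \<bar>t\<bar>\<bar>" using e by (simp add: abs_mult)
    qed
    have Hm: "?H \<in> borel_measurable borel" by measurable
    have nH: "norm (?H q) = \<bar>cutf (\<epsilon> * \<bar>snd q\<bar>)\<bar> * norm (amp (fst q) * u (fst q))" for q
      by (simp add: norm_mult C2_bump.norm_iexp[OF bump])
    have "I \<epsilon> = (\<integral>p. complex_of_real (cutf (\<epsilon> * phase_norm 1 (\<lambda>i\<in>{..<1}. snd p))) * exp (\<i> * complex_of_real (phase (fst p) (\<lambda>i\<in>{..<1}. snd p))) * amp (fst p) * u (fst p) \<partial>lborel)"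
      unfolding I_def
    proof (rule integral_PiM_1)
      show "(\<lambda>p. complex_of_real (cutf (\<epsilon> * phase_norm 1 (\<lambda>i\<in>{..<1}. snd p))) * exp (\<i> * complex_of_real (phase (fst p) (\<lambda>i\<in>{..<1}. snd p))) * amp (fst p) * u (fst p)) \<in> borel_measurable borel"
        using Hm by (simp add: phase_norm_1 phase_def mult.assoc)
      have t [measurable]: "(\<lambda>p. snd p 0) \<in> borel_measurable ((lborel :: ((real \<times> real) \<times> (real^2)) measure) \<Otimes>\<^sub>M Pi\<^sub>M {..<1::nat} (\<lambda>_. lborel :: real measure))"
      proof -
        have "(\<lambda>p. snd p 0) \<in> measurable ((lborel :: ((real \<times> real) \<times> (real^2)) measure) \<Otimes>\<^sub>M Pi\<^sub>M {..<1::nat} (\<lambda>_. lborel :: real measure)) (lborel :: real measure)"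
          by (rule measurable_compose[OF measurable_snd measurable_component_singleton]) (simp add: zero_less_one)
        then show ?thesis by simp
      qed
      have [measurable]: "fst \<in> measurable ((lborel :: ((real \<times> real) \<times> (real^2)) measure) \<Otimes>\<^sub>M Pi\<^sub>M {..<1} (\<lambda>_. lborel :: real measure)) borel"
        using measurable_fst[of lborel "Pi\<^sub>M {..<1} (\<lambda>_. lborel)"] by simp
      show "(\<lambda>(z, \<theta>). complex_of_real (cutf (\<epsilon> * phase_norm 1 \<theta>)) * exp (\<i> * complex_of_real (phase z \<theta>)) * amp z * u z)
         \<in> borel_measurable (lborel \<Otimes>\<^sub>M Pi\<^sub>M {..<1} (\<lambda>_. lborel))"
        unfolding phase_norm_1 phase_def split_beta by measurable
    qed
    also have "\<dots> = (\<integral>q. ?H q \<partial>lborel)" by (simp add: phase_norm_1 phase_def mult.assoc)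
    also have "\<dots> = (\<integral>z. N \<epsilon> z \<partial>lborel)"
    proof -
      have "integrable lborel ?H"
      proof (rule bounded_integrable[OF Hm])
        show "bounded ((Kc \<times> Kf) \<times> {- ?b..?b})" by (intro bounded_Times bS) auto
        show "norm (?H q) \<le> B * (M * Cf)" for q unfolding nH by (intro mult_mono B uC B0) auto
        show "?H q = 0" if "q \<notin> (Kc \<times> Kf) \<times> {- ?b..?b}" for q
          using that u0[of "fst q"] c0[of "snd q"] unfolding mem_Times_iff[of q] by (metis mult_zero_left mult_zero_right of_real_0)
      qed
      then have "integrable (lborel \<Otimes>\<^sub>M lborel) ?H" unfolding lborel_prod .
      from lborel_pair.integral_fst'[OF this] have "(\<integral>q. ?H q \<partial>lborel) = (\<integral>z. \<integral>\<theta>. ?H (z, \<theta>) \<partial>lborel \<partial>lborel)" unfolding lborel_prod by simp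
      then show ?thesis by (simp add: N_def cut_kernel_def)
    qed
    finally have I: "I \<epsilon> = (\<integral>z. N \<epsilon> z \<partial>lborel)" .
    have ci: "integrable lborel (\<lambda>t. cutf (\<epsilon> * \<bar>t\<bar>))"
      by (rule bounded_integrable[where S = "{- ?b..?b}" and C = B]) (use B c0 in auto)
    have ckb: "norm (cut_kernel cutf \<epsilon> \<tau>) \<le> (\<integral>t. \<bar>cutf (\<epsilon> * \<bar>t\<bar>)\<bar> \<partial>lborel)" for \<tau>
      unfolding cut_kernel_def
      by (rule order_trans[OF integral_norm_bound]) (simp add: norm_mult C2_bump.norm_iexp[OF bump])
    have Nm: "N \<epsilon> \<in> borel_measurable borel"
    proof -
      have "(\<lambda>\<tau>. cut_kernel cutf \<epsilon> \<tau>) \<in> borel_measurable borel"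
        unfolding cut_kernel_def by (rule borel_measurable_integral_borel) measurable
      then show ?thesis unfolding N_def[abs_def] by measurable
    qed
    have NC: "norm (N \<epsilon> z) \<le> (\<integral>t. \<bar>cutf (\<epsilon> * \<bar>t\<bar>)\<bar> \<partial>lborel) * (M * Cf)" for z
      unfolding N_def norm_mult[of "cut_kernel cutf \<epsilon> (psi z)"] by (intro mult_mono ckb uC integral_nonneg) auto
    have N0: "N \<epsilon> z = 0" if "z \<notin> Kc \<times> Kf" for z using u0[OF that] by (simp add: N_def)
    show "I \<epsilon> = (\<integral>p. (\<integral>L. N \<epsilon> ((fst p, L), snd p) \<partial>lborel) \<partial>lborel)"
      "integrable lborel (\<lambda>p. \<integral>L. N \<epsilon> ((fst p, L), snd p) \<partial>lborel)"
      unfolding I by (rule integral_reorder[OF Nm bS NC N0]; assumption)+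
  qed
  have inner: "(\<integral>L. N \<epsilon> ((s, L), x) \<partial>lborel) = (complex_of_real (wt s x / (2 * pi)) * f x) * (\<integral>L. ext s0 g (s, L) * cut_kernel cutf \<epsilon> (L - phi (circ s) x) \<partial>lborel)" for \<epsilon> s x
  proof -
    have "N \<epsilon> ((s, L), x) = (complex_of_real (wt s x / (2 * pi)) * f x) * (ext s0 g (s, L) * cut_kernel cutf \<epsilon> (L - phi (circ s) x))" for L
      by (simp add: N_def amp_def psi_def u_def)
    then show ?thesis by simp
  qed
  \<comment> \<open>The pointwise limit of the \<open>L\<close>-integrals, as a function of the
    angle and the point.\<close>
  define Lm where "Lm p = (complex_of_real (wt (fst p) (snd p)) * f (snd p)) * ext s0 g (fst p, phi (circ (fst p)) (snd p))" for p
  have Lm_m: "Lm \<in> borel_measurable borel" unfolding Lm_def[abs_def] by measurable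
  have bS2: "bounded (fst ` Kc \<times> Kf)" by (intro bounded_Times bounded_fst compact_imp_bounded Kc Kf)
  have out: "(\<forall>L. ext s0 g (fst p, L) = 0) \<or> f (snd p) = 0" if "p \<notin> fst ` Kc \<times> Kf" for p
  proof (cases "snd p \<in> Kf")
    case True
    then have "fst p \<notin> fst ` Kc" using that by (simp add: mem_Times_iff)
    then have "(fst p, L) \<notin> Kc" for L by force
    then show ?thesis using Kc(2) by blast
  qed (simp add: Kf(2))
  have wt_norm: "norm (complex_of_real (wt s x)) \<le> 2" for s x using wt_bounds(1,2)[of s x] by simp
  have Lm_int: "integrable lborel Lm"
  proof (rule bounded_integrable[OF Lm_m bS2])
    show "norm (Lm p) \<le> (2 * Cf) * M" for p unfolding Lm_def norm_mult
      by (intro mult_mono wt_norm Cf eM Cf0 mult_nonneg_nonneg) auto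
    show "Lm p = 0" if "p \<notin> fst ` Kc \<times> Kf" for p using out[OF that] by (auto simp: Lm_def)
  qed
  have lim: "(\<integral>p. Lm p \<partial>lborel) = radon_dist \<alpha> wt (dist_of_fun f) g"
  proof -
    have "integrable (lborel \<Otimes>\<^sub>M lborel) (\<lambda>(s, x). Lm (s, x))" unfolding lborel_prod using Lm_int by simp
    from lborel_pair.integral_snd[OF this] have "(\<integral>p. Lm p \<partial>lborel) = (\<integral>x. \<integral>s. Lm (s, x) \<partial>lborel \<partial>lborel)" unfolding lborel_prod by simp
    also have "\<dots> = (\<integral>x. f x * backprojection \<alpha> wt g x \<partial>lborel)"
    proof (intro Bochner_Integration.integral_cong refl)
      fix x
      have "(\<integral>s. Lm (s, x) \<partial>lborel) = (\<integral>s. f x * (wt s x *\<^sub>R ext s0 g (s, phi (circ s) x)) \<partial>lborel)"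
        by (intro Bochner_Integration.integral_cong refl) (simp add: Lm_def scaleR_conv_of_real)
      also have "\<dots> = f x * backprojection \<alpha> wt g x" unfolding integral_mult_right_zero ext_backprojection[OF g] ..
      finally show "(\<integral>s. Lm (s, x) \<partial>lborel) = f x * backprojection \<alpha> wt g x" .
    qed
    finally show ?thesis by (simp add: radon_dist_def dist_of_fun_def)
  qed
  have "(I \<longlongrightarrow> radon_dist \<alpha> wt (dist_of_fun f) g) (at_right 0)"
    \<comment> \<open>Dominated convergence and \<open>cut_kernel_limit\<close> are about sequences,
      so the limit at 0 is tested along arbitrary ones.\<close>
    unfolding tendsto_at_iff_sequentially
  proof (intro allI impI)
    fix X :: "nat \<Rightarrow> real" assume X0: "\<forall>i. X i \<in> {0<..} - {0}" and X1: "X \<longlonglongrightarrow> 0"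
    have X0: "0 < X n" for n using X0 by simp
    note ckl = C2_bump.cut_kernel_limit[OF bump cc B \<delta> bb X0 X1]
    let ?C = "B * (4 * R * M * (\<integral>\<theta>. inverse (1 + \<theta>\<^sup>2) \<partial>lborel))"
    have C0: "0 \<le> ?C" by (rule order_trans[OF norm_ge_zero ckl(2)])
    obtain r where r: "fst ` Kc \<times> Kf \<subseteq> cball 0 r" using bS2 unfolding bounded_iff by (auto simp: subset_iff)
    \<comment> \<open>\<open>?C\<close> depends neither on \<open>n\<close> nor on the angle and the
      point, so a constant on a ball containing the common support dominates.\<close>
    let ?w = "\<lambda>p. indicator (cball 0 r) p * (Cf * ?C)"
    have "(\<lambda>n. \<integral>p. (\<integral>L. N (X n) ((fst p, L), snd p) \<partial>lborel) \<partial>lborel) \<longlonglongrightarrow> (\<integral>p. Lm p \<partial>lborel)"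
    proof (rule integral_dominated_convergence[where w = ?w])
      show "Lm \<in> borel_measurable lborel" using Lm_m by simp
      show "(\<lambda>p. \<integral>L. N (X n) ((fst p, L), snd p) \<partial>lborel) \<in> borel_measurable lborel" for n
        using Nint(2)[OF X0] by (rule borel_measurable_integrable)
      show "integrable lborel ?w"
        by (intro integrable_mult_left integrable_real_indicator emeasure_bounded_finite) auto
      show "AE p in lborel. (\<lambda>n. \<integral>L. N (X n) ((fst p, L), snd p) \<partial>lborel) \<longlonglongrightarrow> Lm p"
      proof (rule AE_I2)
        fix p :: "real \<times> (real^2)"
        have "(\<lambda>n. \<integral>L. N (X n) ((fst p, L), snd p) \<partial>lborel) \<longlonglongrightarrow> (complex_of_real (wt (fst p) (snd p) / (2 * pi)) * f (snd p)) * (complex_of_real (2 * pi) * ext s0 g (fst p, phi (circ (fst p)) (snd p)))"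
          unfolding inner by (intro tendsto_mult tendsto_const ckl(1))
        then show "(\<lambda>n. \<integral>L. N (X n) ((fst p, L), snd p) \<partial>lborel) \<longlonglongrightarrow> Lm p" by (simp add: Lm_def mult.assoc)
      qed
      show "AE p in lborel. norm (\<integral>L. N (X n) ((fst p, L), snd p) \<partial>lborel) \<le> ?w p" for n
      proof (rule AE_I2)
        fix p :: "real \<times> (real^2)"
        show "norm (\<integral>L. N (X n) ((fst p, L), snd p) \<partial>lborel) \<le> ?w p"
        proof (cases "p \<in> cball 0 r")
          case True
          have "norm (complex_of_real (wt (fst p) (snd p) / (2 * pi))) \<le> 1" using norm_amp_le[of "((fst p, 0), snd p)"] by (simp add: amp_def)
          then have "norm (\<integral>L. N (X n) ((fst p, L), snd p) \<partial>lborel) \<le> (1 * Cf) * ?C"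
            unfolding inner norm_mult by (intro mult_mono Cf ckl(2) Cf0 mult_nonneg_nonneg) auto
          then show ?thesis using True by simp
        next
          case False
          then have "p \<notin> fst ` Kc \<times> Kf" using r by blast
          then show ?thesis using out[of p] False unfolding inner by auto
        qed
      qed
    qed
    then show "(I \<circ> X) \<longlonglongrightarrow> radon_dist \<alpha> wt (dist_of_fun f) g" unfolding lim o_def Nint(1)[OF X0] .
  qed
  then show "((\<lambda>\<epsilon>. \<integral>(z, \<theta>). complex_of_real (cutf (\<epsilon> * phase_norm 1 \<theta>)) * exp (\<i> * complex_of_real (phase z \<theta>)) * amp z *
       (case z of (y, x) \<Rightarrow> if y \<in> Box s0 then g (Y_coord y) * f x else 0) \<partial>(lborel \<Otimes>\<^sub>M Pi\<^sub>M {..<1} (\<lambda>_. lborel)))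
       \<longlongrightarrow> radon_dist \<alpha> wt (dist_of_fun f) g) (at_right 0)"
    unfolding u_eq[THEN fun_cong] I_def[abs_def] .
qed

definition osc where "osc s0 = (1 :: nat, (Box s0 \<times> disc \<alpha>) \<times> phase_space0 1, phase, \<lambda>z (\<theta> :: nat \<Rightarrow> real). amp z)"

lemma local_representation_osc:
  assumes y: "y \<in> coord_domain \<alpha>" and x: "x \<in> disc \<alpha>"
  shows "local_representation Y_coord (coord_domain \<alpha>) (disc \<alpha>) (radon_canonical_relation \<alpha>) (- 1 / 2) (radon_dist \<alpha> wt) y x
    (Box (fst y)) (disc \<alpha>) [osc (fst y)]"
proof -
  have "local_kernel Y_coord (radon_dist \<alpha> wt) (Box (fst y)) (disc \<alpha>) [osc (fst y)]"
    unfolding local_kernel_def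
  \<comment> \<open>The kernel is exactly the oscillatory integral, hence the smooth remainder is
    0.\<close>
  proof (rule exI[of _ "\<lambda>_. 0"], intro conjI ballI smooth_open_const)
    fix f g assume fg: "f \<in> test_functions (\<lambda>x. x) (disc \<alpha>)" "g \<in> test_functions Y_coord (Box (fst y))"
    show "\<exists>J. (\<forall>i<length [osc (fst y)]. case [osc (fst y)] ! i of (N, G, \<phi>, p) \<Rightarrow>
           has_osc_integral N \<phi> p (\<lambda>(y', x). if y' \<in> Box (fst y) then g (Y_coord y') * f x else 0) (J i)) \<and>
        radon_dist \<alpha> wt (dist_of_fun f) g = (\<Sum>i<length [osc (fst y)]. J i) +
           (LINT z:Box (fst y) \<times> disc \<alpha>|lborel. 0 * g (Y_coord (fst z)) * f (snd z))"
      using has_osc_integral_phase[OF fg]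
      by (intro exI[of _ "\<lambda>_. radon_dist \<alpha> wt (dist_of_fun f) g"]) (simp add: osc_def set_lebesgue_integral_def One_nat_def[symmetric])
  qed
  moreover have "y \<in> Box (fst y)" using y by (simp add: Box_def coord_domain_eq mem_Times_iff)
  ultimately show ?thesis
    unfolding local_representation_def
    using open_Box Box_VD Box_inj open_disc x fio_term_phase[OF open_Box open_disc order_refl]
    by (simp add: coord_domain_eq osc_def)
qed

section \<open>The Radon transform as an elliptic Fourier integral operator\<close>

lemma radon_fio:
  "fourier_integral_operator Y_coord (coord_domain \<alpha>) (Yset \<alpha>) (disc \<alpha>) (radon_canonical_relation \<alpha>) (- 1 / 2) (radon_dist \<alpha> wt)"
  unfolding fourier_integral_operator_def
proof (intro conjI ballI allI impI)
  show "canonical_relation (DIM(real \<times> real) + DIM(real^2)) (Yset \<alpha>) (disc \<alpha>) (radon_canonical_relation \<alpha>)"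
  proof -
    have "DIM(real \<times> real) + DIM(real^2) = 4" by (simp add: One_nat_def)
    then show ?thesis using canonical_relation_C by (simp only:)
  qed
  show "radon_dist \<alpha> wt u \<in> distributions Y_coord (coord_domain \<alpha>)" if "u \<in> compact_distributions (disc \<alpha>)" for u
    by (rule radon_dist_distribution[OF that])
  show "\<exists>B W ts. local_representation Y_coord (coord_domain \<alpha>) (disc \<alpha>) (radon_canonical_relation \<alpha>) (- 1 / 2) (radon_dist \<alpha> wt) y x B W ts"
    if "y \<in> coord_domain \<alpha>" "x \<in> disc \<alpha>" for y x
    using local_representation_osc[OF that] by (intro exI)
  fix U and u :: "((real^2) \<Rightarrow> complex) \<Rightarrow> complex" and g
  assume U: "(\<forall>n::nat. U n \<in> compact_distributions (disc \<alpha>)) \<and> u \<in> compact_distributions (disc \<alpha>) \<and>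
        (\<forall>f. smooth_open (disc \<alpha>) f \<longrightarrow> (\<lambda>n. U n f) \<longlonglongrightarrow> u f)" and g: "g \<in> test_functions Y_coord (coord_domain \<alpha>)"
  show "(\<lambda>n. radon_dist \<alpha> wt (U n) g) \<longlonglongrightarrow> radon_dist \<alpha> wt u g"
    unfolding radon_dist_def using U backprojection_smooth[OF test_smooth[OF g]] by simp
qed (simp_all add: open_disc etale radon_dist_def)

lemma radon_elliptic_fio:
  "elliptic_fourier_integral_operator Y_coord (coord_domain \<alpha>) (Yset \<alpha>) (disc \<alpha>) (radon_canonical_relation \<alpha>) (- 1 / 2) (radon_dist \<alpha> wt)"
  unfolding elliptic_fourier_integral_operator_def
proof (intro conjI ballI allI impI radon_fio)
  fix y \<eta> x \<xi> assume y: "y \<in> coord_domain \<alpha>" and C: "((Y_coord y, \<eta>), (x, \<xi>)) \<in> radon_canonical_relation \<alpha>"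
  let ?U = "Box (fst y) \<times> disc \<alpha>" let ?G = "?U \<times> phase_space0 1"
  define \<theta>0 where "\<theta>0 = (\<lambda>i\<in>{..<1::nat}. snd \<eta>)"
  have c: "x \<in> disc \<alpha>" "snd y = phi (circ (fst y)) x" "fst \<eta> = - (snd \<eta> * phis (circ (fst y)) x) *\<^sub>R rot (circ (fst y))"
    "\<xi> = snd \<eta> *\<^sub>R grad (circ (fst y)) x" "snd \<eta> \<noteq> 0"
    using C unfolding mem_C by (simp_all add: Y_coord_def split_beta)
  have GY: "?G \<subseteq> YX \<times> UNIV" by auto
  have UY: "?U \<subseteq> YX" by auto
  have yB: "y \<in> Box (fst y)" using y by (simp add: Box_def coord_domain_eq mem_Times_iff)
  have t0: "\<theta>0 \<in> phase_space0 1" "\<theta>0 0 = snd \<eta>" using c(5) by (simp_all add: \<theta>0_def mem_phase_space0_1 phase_space_def)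
  have crit: "phase_crit Y_coord 1 ?G phase y x \<theta>0 \<eta> \<xi>"
    unfolding phase_crit_iff[OF GY] using c t0 yB by (simp add: prod_eq_iff)
  \<comment> \<open>The phase variable is read off as the \<open>L\<close>-component of
    \<open>\<eta>\<close>, so there is exactly one critical point above the given covectors.\<close>
  have uniq: "\<theta>1 = \<theta>0" if "phase_crit Y_coord 1 ?G phase y x \<theta>1 \<eta> \<xi>" for \<theta>1
  proof
    fix i
    have 1: "\<theta>1 \<in> phase_space 1" "\<theta>1 0 = snd \<eta>" using that unfolding phase_crit_iff[OF GY] by (simp_all add: mem_phase_space0_1 prod_eq_iff)
    show "\<theta>1 i = \<theta>0 i" using 1 by (cases "i = 0") (auto simp: \<theta>0_def phase_space_def PiE_def extensional_def)
  qed
  \<comment> \<open>Half the modulus of the amplitude at the point is a lower bound on a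
    neighbourhood by continuity. The amplitude does not depend on the phase variable, so the full
    cone over this neighbourhood witnesses ellipticity.\<close>
  define k where "k = norm (amp (y, x)) / 2"
  have k: "0 < k" "k < norm (amp (y, x))" using wt_bounds(3)[OF c(1), of "fst y"] by (simp_all add: k_def amp_def)
  define V where "V = ?U \<inter> {z. k < norm (amp z)}"
  have "continuous_on ?U (\<lambda>z. norm (amp z))"
    by (intro continuous_on_norm continuous_on_subset[OF smooth_open_continuous_on[OF amp_smooth] UY])
  then have "open (?U \<inter> (\<lambda>z. norm (amp z)) -` {k<..})"
    by (rule continuous_open_preimage) (auto intro!: open_Times open_Box open_disc)
  moreover have "V = ?U \<inter> (\<lambda>z. norm (amp z)) -` {k<..}" by (auto simp: V_def)
  ultimately have oV: "open V" by simp
  have VU: "V \<subseteq> ?U" by (simp add: V_def)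
  have oc: "open_cone 1 ?U (V \<times> phase_space0 1)" by (rule open_cone_full[OF oV VU])
  have inH: "((y, x), \<theta>0) \<in> V \<times> phase_space0 1" using yB c(1) k(2) t0(1) by (simp add: V_def)
  have ell: "norm (amp z) \<ge> k * (1 + phase_norm 1 \<theta>) powr amplitude_order (DIM(real \<times> real) + DIM(real^2)) (- 1 / 2) 1" if "(z, \<theta>) \<in> V \<times> phase_space0 1" for z \<theta>
    using that k(1) by (auto simp: V_def amplitude_order_def phase_norm_1 add_nonneg_eq_0_iff)
  show "\<exists>B W ts i \<theta>0. local_representation Y_coord (coord_domain \<alpha>) (disc \<alpha>) (radon_canonical_relation \<alpha>) (- 1 / 2) (radon_dist \<alpha> wt) y x B W ts \<and> i < length ts \<and>
       (case ts ! i of (N, G, \<phi>, p) \<Rightarrow> phase_crit Y_coord N G \<phi> y x \<theta>0 \<eta> \<xi> \<and>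
          (\<exists>H c r. open_cone N (B \<times> W) H \<and> ((y, x), \<theta>0) \<in> H \<and> c > 0 \<and>
             (\<forall>(z, \<theta>) \<in> H. phase_norm N \<theta> \<ge> r \<longrightarrow>
                norm (p z \<theta>) \<ge> c * (1 + phase_norm N \<theta>) powr amplitude_order (DIM(real \<times> real) + DIM(real^2)) (- 1 / 2) N))) \<and>
       (\<forall>j<length ts. case ts ! j of (N, G, \<phi>, p) \<Rightarrow>
          (\<forall>\<theta>1. phase_crit Y_coord N G \<phi> y x \<theta>1 \<eta> \<xi> \<and> (j, \<theta>1) \<noteq> (i, \<theta>0) \<longrightarrow>
             (\<exists>H. open_cone N (B \<times> W) H \<and> ((y, x), \<theta>1) \<in> H \<and> (\<forall>(z, \<theta>) \<in> H. p z \<theta> = 0))))"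
  proof (rule exI[of _ "Box (fst y)"], rule exI[of _ "disc \<alpha>"], rule exI[of _ "[osc (fst y)]"], rule exI[of _ 0], rule exI[of _ \<theta>0], intro conjI)
    show "local_representation Y_coord (coord_domain \<alpha>) (disc \<alpha>) (radon_canonical_relation \<alpha>) (- 1 / 2) (radon_dist \<alpha> wt) y x (Box (fst y)) (disc \<alpha>) [osc (fst y)]"
      by (rule local_representation_osc[OF y c(1)])
    show "case [osc (fst y)] ! 0 of (N, G, \<phi>, p) \<Rightarrow> phase_crit Y_coord N G \<phi> y x \<theta>0 \<eta> \<xi> \<and>
          (\<exists>H c r. open_cone N ?U H \<and> ((y, x), \<theta>0) \<in> H \<and> c > 0 \<and>
             (\<forall>(z, \<theta>) \<in> H. phase_norm N \<theta> \<ge> r \<longrightarrow>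
                norm (p z \<theta>) \<ge> c * (1 + phase_norm N \<theta>) powr amplitude_order (DIM(real \<times> real) + DIM(real^2)) (- 1 / 2) N))"
      unfolding osc_def nth_Cons_0 prod.case
    proof (rule conjI[OF crit], rule exI[of _ "V \<times> phase_space0 1"], rule exI[of _ k], rule exI[of _ 0], intro conjI oc inH k(1) ballI)
      fix q assume "q \<in> V \<times> phase_space0 1"
      then show "case q of (z, \<theta>) \<Rightarrow> 0 \<le> phase_norm 1 \<theta> \<longrightarrow> k * (1 + phase_norm 1 \<theta>) powr amplitude_order (DIM(real \<times> real) + DIM(real^2)) (- 1 / 2) 1 \<le> norm (amp z)"
        using ell[of "fst q" "snd q"] unfolding split_beta prod.collapse by simp
    qed
    show "\<forall>j<length [osc (fst y)]. case [osc (fst y)] ! j of (N, G, \<phi>, p) \<Rightarrow>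
          (\<forall>\<theta>1. phase_crit Y_coord N G \<phi> y x \<theta>1 \<eta> \<xi> \<and> (j, \<theta>1) \<noteq> (0, \<theta>0) \<longrightarrow>
             (\<exists>H. open_cone N ?U H \<and> ((y, x), \<theta>1) \<in> H \<and> (\<forall>(z, \<theta>) \<in> H. p z \<theta> = 0)))"
      using uniq by (auto simp: osc_def)
  qed simp
qed

end

theorem theorem3p1:
  fixes \<alpha> :: real
  assumes "0 < \<alpha>" and "\<alpha> < pi / 2"
  shows "\<exists>w. L2_adjoint_weight \<alpha> w \<and>
    (df_manifolds (disc \<alpha>) (Yset \<alpha>) (Zset \<alpha>) \<and>
     df_measures (disc \<alpha>) (Yset \<alpha>) (Zset \<alpha>) (radon \<alpha>) (backprojection \<alpha> w) \<and>
     double_fibration (disc \<alpha>) (Y_meeting \<alpha>) (Zset \<alpha>) (radon \<alpha>) (backprojection \<alpha> w)) \<and>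
    elliptic_fourier_integral_operator Y_coord (coord_domain \<alpha>) (Yset \<alpha>) (disc \<alpha>)
      (radon_canonical_relation \<alpha>) (- 1 / 2) (radon_dist \<alpha> w) \<and>
    bolker_assumption (Yset \<alpha>) (radon_canonical_relation \<alpha>)"
proof -
  interpret elliptic_radon \<alpha> by unfold_locales fact+
  show ?thesis
    by (intro exI[of _ wt] conjI L2_adjoint df_manifolds_all(1) df_measures_all(1) double_fibration_meeting radon_elliptic_fio bolker)
qed

end
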